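(* Let $n\ge i\ge 1$, $r-1\ge1$, and let $s=s_+\in\mathcal{A}$ be an irreducible factor of $t^{n-i}q^{r-1}a^*b^*-1$. Let $$S=\{\lambda\in\mathbb{Z}^n;\ \lambda_i^+>r-1,\ \text{or } \lambda_i^+=r-1 \text{ and } \sigma(\lambda)_{|w_\lambda^+(i)|}=+1\}$$ and $V=\mathrm{span}_{\mathbb{K}_s}\{E_\lambda|_{s=0};\lambda\in S\}\subset P_n^s$. Then $$V=\{f\in P_n^{s};\ \chi_\mu^*(f)|_{s=0}=0\ \text{ for any } \mu\in\mathbb{Z}^n\setminus S\}.$$
   Context: $n\ge 2$; $\mathcal{A}=\mathbb{C}[q^{\pm1/2},t^{\pm1/2},t_n^{\pm1/2},t_0^{\pm1/2},u_n^{\pm1/2},u_0^{\pm1/2}]$, $\mathbb{K}=\mathrm{Frac}(\mathcal{A})$, $P_n=\mathbb{K}[x_1^{\pm1},\dots,x_n^{\pm1}]$. Put $a=t_n^{1/2}u_n^{1/2}$, $b=-t_n^{1/2}u_n^{-1/2}$, $c=q^{1/2}t_0^{1/2}u_0^{1/2}$, $d=-q^{1/2}t_0^{1/2}u_0^{-1/2}$, $a^*=t_n^{1/2}t_0^{1/2}$, $b^*=-t_n^{1/2}t_0^{-1/2}$. On Laurent polynomials, $s_i$ ($1\le i\le n-1$) exchanges $x_i,x_{i+1}$, $s_n$ sends $x_n\mapsto x_n^{-1}$, $s_0$ sends $x_1\mapsto qx_1^{-1}$. Define $\widehat T_0=t_0^{1/2}+t_0^{-1/2}\frac{(1-cx_1^{-1})(1-dx_1^{-1})}{1-qx_1^{-2}}(s_0-1)$,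 $\widehat T_i=t^{1/2}+t^{-1/2}\frac{1-tx_ix_{i+1}^{-1}}{1-x_ix_{i+1}^{-1}}(s_i-1)$ ($1\le i\le n-1$), $\widehat T_n=t_n^{1/2}+t_n^{-1/2}\frac{(1-ax_n)(1-bx_n)}{1-x_n^2}(s_n-1)$, $\widehat Y_i=\widehat T_i\cdots\widehat T_{n-1}\widehat T_n\widehat T_{n-1}\cdots\widehat T_1\widehat T_0\widehat T_1^{-1}\cdots\widehat T_{i-1}^{-1}$ (mutually commuting). $W_0$ is the group of signed permutations acting on $\mathbb{Z}^n$; for $w\in W_0$ write $w\epsilon_i=\pm\epsilon_{|w(i)|}$. For $\lambda\in\mathbb{Z}^n$, $\lambda^+$ is the dominant element of $W_0\lambda$ (a partition), $w_\lambda^+\in W_0$ the shortest element with $w_\lambda^+\lambda^+=\lambda$, $\rho(\lambda)=w_\lambda^+(n-1,\dots,1,0)$, $\sigma(\lambda)_i=\mathrm{sgn}(\lambda_i)$ with $\mathrm{sgn}(0)=+1$. $\lambda\ge\mu$ means $\lambda-\mu$ is a $\mathbb{Z}_{\ge0}$-combination of $\epsilon_1-\epsilon_2,\dots,\epsilon_{n-1}-\epsilon_n,\epsilon_n$; $\lambda\succeq\mu$ means $\lambda^+>\mu^+$, or $\lambda^+=\mu^+$ and $\lambda\ge\mu$. $y(\lambda)_i=q^{\lambda_i}t^{\rho(\lambda)_i}(a^* )^{\sigma(\lambda)_i}$, $y^*(\lambda)_i=q^{\lambda_i}t^{\rho(\lambda)_i}a^{\sigma(\lambda)_i}$. The non-symmetric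 Koornwinder polynomial $E_\lambda\in P_n$ is the unique element with $\widehat Y_iE_\lambda=y(\lambda)_iE_\lambda$ for all $i$ and $E_\lambda\in x^\lambda+\sum_{\mu\prec\lambda}\mathbb{K}x^\mu$. For an irreducible $s\in\mathcal{A}$, $\mathbb{K}_s=\mathrm{Frac}(\mathcal{A}/s\mathcal{A})$, $P_n^s=\mathbb{K}_s[x_1^{\pm1},\dots,x_n^{\pm1}]$, and $|_{s=0}$ denotes (coefficientwise) reduction to $\mathbb{K}_s$ of elements with non-negative $s$-adic valuation (for the present $s$, every $E_\lambda$ has this property). For $f\in P_n^s$, $\chi_\mu^*(f)|_{s=0}=f(y^*(\mu)_1^{-1}|_{s=0},\dots,y^*(\mu)_n^{-1}|_{s=0})$. *)

theory Defs
  imports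
    Complex_Main
    "HOL-Library.Poly_Mapping"
    "HOL-Library.FuncSet"
    "HOL-Computational_Algebra.Fraction_Field"
    "HOL-Combinatorics.Permutations"
    "HOL-Algebra.QuotRing"
    "HOL-Algebra.Algebraic_Closure_Type"
begin

section \<open>The coefficient rings\<close>

text \<open>The constructors stand for the square roots of the six parameters.\<close>

datatype param = Root_q | Root_t | Root_tn | Root_t0 | Root_un | Root_u0

text \<open>
  The linear order on \<open>param\<close> is a technical device: through the order instance of
  \<open>\<Rightarrow>\<^sub>0\<close> it makes the group algebra of the exponent group an integral domain.
\<close>

instantiation param :: linorder
begin

fun param_index :: "param \<Rightarrow> nat" where
  "param_index Root_q = 0"
| "param_index Root_t = 1"
| "param_index Root_tn = 2"
| "param_index Root_t0 = 3"
| "param_index Root_un = 4"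
| "param_index Root_u0 = 5"

definition less_eq_param :: "param \<Rightarrow> param \<Rightarrow> bool" where
  "less_eq_param x y \<longleftrightarrow> param_index x \<le> param_index y"

definition less_param :: "param \<Rightarrow> param \<Rightarrow> bool" where
  "less_param x y \<longleftrightarrow> param_index x < param_index y"

instance
proof
  fix x y :: param
  assume "x \<le> y" and "y \<le> x"
  then show "x = y"
    by (cases x; cases y) (simp_all add: less_eq_param_def)
qed (auto simp: less_eq_param_def less_param_def)

end

text \<open>
  \<open>\<A>\<close>, the Laurent polynomial ring over the complex numbers in six variables, is the group
  algebra of the group of exponents \<open>param \<Rightarrow>\<^sub>0 int\<close>.
\<close>

type_synonym alg = "(param \<Rightarrow>\<^sub>0 int) \<Rightarrow>\<^sub>0 complex"

type_synonym kfield = "alg fract"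

definition gen :: "param \<Rightarrow> int \<Rightarrow> alg" where
  "gen p k = Poly_Mapping.single (Poly_Mapping.single p k) 1"

definition par_q :: alg where "par_q = gen Root_q 2"
definition par_t :: alg where "par_t = gen Root_t 2"

definition par_a :: alg where "par_a = gen Root_tn 1 * gen Root_un 1"
definition par_b :: alg where "par_b = - (gen Root_tn 1 * gen Root_un (-1))"
definition par_c :: alg where "par_c = gen Root_q 1 * gen Root_t0 1 * gen Root_u0 1"
definition par_d :: alg where "par_d = - (gen Root_q 1 * gen Root_t0 1 * gen Root_u0 (-1))"
definition par_a_star :: alg where "par_a_star = gen Root_tn 1 * gen Root_t0 1"
definition par_b_star :: alg where "par_b_star = - (gen Root_tn 1 * gen Root_t0 (-1))"

definition emb :: "alg \<Rightarrow> kfield" where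
  "emb x = Fraction_Field.Fract x 1"

section \<open>Signed permutations and weights\<close>

text \<open>
  Elements of \<open>\<int>\<^sup>n\<close>, which are also the exponents of Laurent monomials in
  \<open>x\<^sub>1, \<dots>, x\<^sub>n\<close>, are finitely supported functions with support in \<open>{1..n}\<close>.
\<close>

definition weights :: "nat \<Rightarrow> (nat \<Rightarrow>\<^sub>0 int) set" where
  "weights n = {m. Poly_Mapping.keys m \<subseteq> {1..n}}"

text \<open>
  A signed permutation is an odd permutation function of \<open>{-n..n}\<close> (so that it fixes 0);
  it sends \<open>\<epsilon>\<^sub>i\<close> to \<open>sgn (w i) \<epsilon>\<^bsub>\<bar>w i\<bar>\<^esub>\<close>.
\<close>

definition signed_perms :: "nat \<Rightarrow> (int \<Rightarrow> int) set" where
  "signed_perms n = {w. w permutes {- int n..int n} \<and> (\<forall>k. w (- k) = - w k)}"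

definition act :: "nat \<Rightarrow> (int \<Rightarrow> int) \<Rightarrow> (nat \<Rightarrow>\<^sub>0 int) \<Rightarrow> (nat \<Rightarrow>\<^sub>0 int)" where
  "act n w m =
    (\<Sum>i=1..n. Poly_Mapping.single (nat \<bar>w (int i)\<bar>) (sgn (w (int i)) * Poly_Mapping.lookup m i))"

definition simple_refl :: "nat \<Rightarrow> nat \<Rightarrow> int \<Rightarrow> int" where
  "simple_refl n i =
    (if i < n
     then Transposition.transpose (int i) (int i + 1) \<circ> Transposition.transpose (- int i) (- int i - 1)
     else Transposition.transpose (int n) (- int n))"

definition perm_length :: "nat \<Rightarrow> (int \<Rightarrow> int) \<Rightarrow> nat" where
  "perm_length n w =
    (LEAST k. \<exists>js. length js = k \<and> set js \<subseteq> {1..n} \<and> w = foldr (\<circ>) (map (simple_refl n) js) id)"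

definition dominant :: "nat \<Rightarrow> (nat \<Rightarrow>\<^sub>0 int) \<Rightarrow> bool" where
  "dominant n m \<longleftrightarrow> m \<in> weights n \<and>
    (\<forall>i\<in>{1..<n}. Poly_Mapping.lookup m (Suc i) \<le> Poly_Mapping.lookup m i) \<and>
    0 \<le> Poly_Mapping.lookup m n"

definition dom_rep :: "nat \<Rightarrow> (nat \<Rightarrow>\<^sub>0 int) \<Rightarrow> (nat \<Rightarrow>\<^sub>0 int)" where
  "dom_rep n l = (THE m. dominant n m \<and> (\<exists>w\<in>signed_perms n. m = act n w l))"

definition wplus :: "nat \<Rightarrow> (nat \<Rightarrow>\<^sub>0 int) \<Rightarrow> int \<Rightarrow> int" where
  "wplus n l = (ARG_MIN (perm_length n) w. w \<in> signed_perms n \<and> act n w (dom_rep n l) = l)"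

definition rho :: "nat \<Rightarrow> (nat \<Rightarrow>\<^sub>0 int) \<Rightarrow> (nat \<Rightarrow>\<^sub>0 int)" where
  "rho n l = act n (wplus n l) (\<Sum>i=1..n. Poly_Mapping.single i (int n - int i))"

definition sgn_vec :: "(nat \<Rightarrow>\<^sub>0 int) \<Rightarrow> nat \<Rightarrow> int" where
  "sgn_vec l i = (if Poly_Mapping.lookup l i < 0 then -1 else 1)"

definition dominance_ge :: "nat \<Rightarrow> (nat \<Rightarrow>\<^sub>0 int) \<Rightarrow> (nat \<Rightarrow>\<^sub>0 int) \<Rightarrow> bool" where
  "dominance_ge n l m \<longleftrightarrow> (\<exists>k :: nat \<Rightarrow> nat.
     l - m = (\<Sum>i\<in>{1..<n}. Poly_Mapping.single i (int (k i)) - Poly_Mapping.single (Suc i) (int (k i)))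
       + Poly_Mapping.single n (int (k n)))"

definition weight_ge :: "nat \<Rightarrow> (nat \<Rightarrow>\<^sub>0 int) \<Rightarrow> (nat \<Rightarrow>\<^sub>0 int) \<Rightarrow> bool" where
  "weight_ge n l m \<longleftrightarrow>
     (dominance_ge n (dom_rep n l) (dom_rep n m) \<and> dom_rep n l \<noteq> dom_rep n m) \<or>
     (dom_rep n l = dom_rep n m \<and> dominance_ge n l m)"

definition y_val :: "nat \<Rightarrow> (nat \<Rightarrow>\<^sub>0 int) \<Rightarrow> nat \<Rightarrow> kfield" where
  "y_val n l i = emb par_q powi Poly_Mapping.lookup l i *
     emb par_t powi Poly_Mapping.lookup (rho n l) i * emb par_a_star powi sgn_vec l i"

definition y_star :: "nat \<Rightarrow> (nat \<Rightarrow>\<^sub>0 int) \<Rightarrow> nat \<Rightarrow> kfield" where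
  "y_star n l i = emb par_q powi Poly_Mapping.lookup l i *
     emb par_t powi Poly_Mapping.lookup (rho n l) i * emb par_a powi sgn_vec l i"

section \<open>Demazure-Lusztig operators and non-symmetric Koornwinder polynomials\<close>

type_synonym laurent = "(nat \<Rightarrow>\<^sub>0 int) \<Rightarrow>\<^sub>0 kfield"

definition laurent_polys :: "nat \<Rightarrow> laurent set" where
  "laurent_polys n = {f. Poly_Mapping.keys f \<subseteq> weights n}"

definition const :: "kfield \<Rightarrow> laurent" where
  "const k = Poly_Mapping.single 0 k"

definition mon :: "(nat \<Rightarrow>\<^sub>0 int) \<Rightarrow> laurent" where
  "mon m = Poly_Mapping.single m 1"

definition var :: "nat \<Rightarrow> int \<Rightarrow> laurent" where
  "var i k = mon (Poly_Mapping.single i k)"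

text \<open>
  \<open>x\<^sup>m\<close> goes to \<open>x\<^bsup>refl_exp n i m\<^esup>\<close>, times \<open>q\<^bsup>m\<^sub>1\<^esup>\<close> if \<open>i = 0\<close>.
\<close>

definition refl_exp :: "nat \<Rightarrow> nat \<Rightarrow> (nat \<Rightarrow>\<^sub>0 int) \<Rightarrow> (nat \<Rightarrow>\<^sub>0 int)" where
  "refl_exp n i m =
    (if i = 0 then m - Poly_Mapping.single 1 (2 * Poly_Mapping.lookup m 1)
     else if i < n then Poly_Mapping.map_key (Transposition.transpose i (Suc i)) m
     else m - Poly_Mapping.single n (2 * Poly_Mapping.lookup m n))"

definition refl_op :: "nat \<Rightarrow> nat \<Rightarrow> laurent \<Rightarrow> laurent" where
  "refl_op n i f = (\<Sum>m\<in>Poly_Mapping.keys f.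
     const (Poly_Mapping.lookup f m * (if i = 0 then emb par_q powi Poly_Mapping.lookup m 1 else 1))
       * mon (refl_exp n i m))"

text \<open>
  The quotients in the operators below are exact: the denominators divide
  \<open>refl_op n i f - f\<close> in the (integral) ring of Laurent polynomials.
\<close>

definition exact_div :: "laurent \<Rightarrow> laurent \<Rightarrow> laurent" where
  "exact_div f g = (THE h. h * g = f)"

definition That :: "nat \<Rightarrow> nat \<Rightarrow> laurent \<Rightarrow> laurent" where
  "That n i f =
    (if i = 0 then
       const (emb (gen Root_t0 1)) * f + const (emb (gen Root_t0 (-1))) *
         exact_div ((1 - const (emb par_c) * var 1 (-1)) * (1 - const (emb par_d) * var 1 (-1))
                      * (refl_op n 0 f - f))
                   (1 - const (emb par_q) * var 1 (-2))
     else if i < n then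
       const (emb (gen Root_t 1)) * f + const (emb (gen Root_t (-1))) *
         exact_div ((1 - const (emb par_t) * var i 1 * var (Suc i) (-1)) * (refl_op n i f - f))
                   (1 - var i 1 * var (Suc i) (-1))
     else
       const (emb (gen Root_tn 1)) * f + const (emb (gen Root_tn (-1))) *
         exact_div ((1 - const (emb par_a) * var n 1) * (1 - const (emb par_b) * var n 1)
                      * (refl_op n n f - f))
                   (1 - var n 2))"

definition Yhat :: "nat \<Rightarrow> nat \<Rightarrow> laurent \<Rightarrow> laurent" where
  "Yhat n i =
    foldr (\<circ>) (map (That n) ([i..<n] @ [n] @ rev [1..<n] @ [0])
               @ map (\<lambda>j. inv_into (laurent_polys n) (That n j)) [1..<i]) id"

definition koornwinder :: "nat \<Rightarrow> (nat \<Rightarrow>\<^sub>0 int) \<Rightarrow> laurent" where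
  "koornwinder n l = (THE f. f \<in> laurent_polys n \<and>
     (\<forall>i\<in>{1..n}. Yhat n i f = const (y_val n l i) * f) \<and>
     Poly_Mapping.keys (f - mon l) \<subseteq> {m \<in> weights n. weight_ge n l m \<and> m \<noteq> l})"

section \<open>Fraction field of a domain\<close>

definition frac_rel :: "('a, 'm) ring_scheme \<Rightarrow> (('a \<times> 'a) \<times> ('a \<times> 'a)) set" where
  "frac_rel R = {((a, b), (c, d)). a \<in> carrier R \<and> b \<in> carrier R - {\<zero>\<^bsub>R\<^esub>} \<and>
     c \<in> carrier R \<and> d \<in> carrier R - {\<zero>\<^bsub>R\<^esub>} \<and> a \<otimes>\<^bsub>R\<^esub> d = c \<otimes>\<^bsub>R\<^esub> b}"

definition frac_class :: "('a, 'm) ring_scheme \<Rightarrow> 'a \<Rightarrow> 'a \<Rightarrow> ('a \<times> 'a) set" where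
  "frac_class R a b = frac_rel R `` {(a, b)}"

definition frac_field :: "('a, 'm) ring_scheme \<Rightarrow> ('a \<times> 'a) set ring" where
  "frac_field R =
    \<lparr>carrier = (carrier R \<times> (carrier R - {\<zero>\<^bsub>R\<^esub>})) // frac_rel R,
     monoid.mult = (\<lambda>x y. \<Union>{frac_class R (a \<otimes>\<^bsub>R\<^esub> c) (b \<otimes>\<^bsub>R\<^esub> d) | a b c d. (a, b) \<in> x \<and> (c, d) \<in> y}),
     one = frac_class R \<one>\<^bsub>R\<^esub> \<one>\<^bsub>R\<^esub>,
     ring.zero = frac_class R \<zero>\<^bsub>R\<^esub> \<one>\<^bsub>R\<^esub>,
     add = (\<lambda>x y. \<Union>{frac_class R (a \<otimes>\<^bsub>R\<^esub> d \<oplus>\<^bsub>R\<^esub> c \<otimes>\<^bsub>R\<^esub> b) (b \<otimes>\<^bsub>R\<^esub> d) | a b c d.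
              (a, b) \<in> x \<and> (c, d) \<in> y})\<rparr>"

context domain
begin

lemma frac_rel_equiv: "equiv (carrier R \<times> (carrier R - {\<zero>})) (frac_rel R)"
proof (rule equivI)
  show "frac_rel R \<subseteq> (carrier R \<times> (carrier R - {\<zero>})) \<times> (carrier R \<times> (carrier R - {\<zero>}))"
    by (auto simp: frac_rel_def)
  show "refl_on (carrier R \<times> (carrier R - {\<zero>})) (frac_rel R)"
    by (auto simp: frac_rel_def refl_on_def)
  show "sym (frac_rel R)"
    by (auto simp: frac_rel_def sym_def)
  show "trans (frac_rel R)"
  proof (rule transI)
    fix x y z
    assume xy: "(x, y) \<in> frac_rel R" and yz: "(y, z) \<in> frac_rel R"
    obtain a b c d e f where eqs: "x = (a, b)" "y = (c, d)" "z = (e, f)"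
      by (metis surj_pair)
    have car: "a \<in> carrier R" "b \<in> carrier R" "c \<in> carrier R" "d \<in> carrier R" "e \<in> carrier R"
        "f \<in> carrier R" "b \<noteq> \<zero>" "d \<noteq> \<zero>" "f \<noteq> \<zero>"
      and ad: "a \<otimes> d = c \<otimes> b" and cf: "c \<otimes> f = e \<otimes> d"
      using xy yz by (auto simp: eqs frac_rel_def)
    have "d \<otimes> (a \<otimes> f) = (a \<otimes> d) \<otimes> f"
      using car by (simp add: m_ac)
    also have "\<dots> = (c \<otimes> f) \<otimes> b"
      using car by (simp add: ad m_ac)
    also have "\<dots> = d \<otimes> (e \<otimes> b)"
      using car by (simp add: cf m_ac)
    finally have "a \<otimes> f = e \<otimes> b"
      using car by (simp add: m_lcancel)
    then show "(x, z) \<in> frac_rel R"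
      using car by (simp add: eqs frac_rel_def)
  qed
qed

lemma frac_class_eq_iff:
  assumes "a \<in> carrier R" "b \<in> carrier R - {\<zero>}" "c \<in> carrier R" "d \<in> carrier R - {\<zero>}"
  shows "frac_class R a b = frac_class R c d \<longleftrightarrow> a \<otimes> d = c \<otimes> b"
proof -
  have "frac_class R a b = frac_class R c d \<longleftrightarrow> ((a, b), (c, d)) \<in> frac_rel R"
    unfolding frac_class_def by (rule eq_equiv_class_iff[OF frac_rel_equiv]) (use assms in auto)
  then show ?thesis
    using assms by (auto simp: frac_rel_def)
qed

lemma mem_frac_class_iff:
  assumes "a \<in> carrier R" "b \<in> carrier R - {\<zero>}"
  shows "(c, d) \<in> frac_class R a b \<longleftrightarrow>
    c \<in> carrier R \<and> d \<in> carrier R - {\<zero>} \<and> a \<otimes> d = c \<otimes> b"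
  using assms by (auto simp: frac_class_def frac_rel_def)

lemma frac_class_closed:
  "a \<in> carrier R \<Longrightarrow> b \<in> carrier R - {\<zero>} \<Longrightarrow> frac_class R a b \<in> carrier (frac_field R)"
  by (auto simp: frac_field_def frac_class_def intro!: quotientI)

lemma frac_field_cases:
  assumes "x \<in> carrier (frac_field R)"
  obtains a b where "a \<in> carrier R" "b \<in> carrier R" "b \<noteq> \<zero>" "x = frac_class R a b"
  using assms by (auto simp: frac_field_def frac_class_def elim!: quotientE)

lemma frac_field_mult:
  assumes "a \<in> carrier R" "b \<in> carrier R - {\<zero>}" "c \<in> carrier R" "d \<in> carrier R - {\<zero>}"
  shows "frac_class R a b \<otimes>\<^bsub>frac_field R\<^esub> frac_class R c d = frac_class R (a \<otimes> c) (b \<otimes> d)"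
proof -
  have *: "frac_class R (a' \<otimes> c') (b' \<otimes> d') = frac_class R (a \<otimes> c) (b \<otimes> d)"
    if "(a', b') \<in> frac_class R a b" "(c', d') \<in> frac_class R c d" for a' b' c' d'
  proof -
    have car: "a' \<in> carrier R" "b' \<in> carrier R - {\<zero>}" "c' \<in> carrier R" "d' \<in> carrier R - {\<zero>}"
      and eqs: "a \<otimes> b' = a' \<otimes> b" "c \<otimes> d' = c' \<otimes> d"
      using that assms by (simp_all add: mem_frac_class_iff)
    have "(a' \<otimes> c') \<otimes> (b \<otimes> d) = (a' \<otimes> b) \<otimes> (c' \<otimes> d)"
      using car assms by (simp add: m_ac)
    also have "\<dots> = (a \<otimes> b') \<otimes> (c \<otimes> d')"
      by (simp add: eqs)
    also have "\<dots> = (a \<otimes> c) \<otimes> (b' \<otimes> d')"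
      using car assms by (simp add: m_ac)
    finally show ?thesis
      using car assms by (subst frac_class_eq_iff) (auto simp: integral_iff)
  qed
  have mem: "(a, b) \<in> frac_class R a b" "(c, d) \<in> frac_class R c d"
    using assms by (auto simp: mem_frac_class_iff)
  have "{frac_class R (a' \<otimes> c') (b' \<otimes> d') | a' b' c' d'.
          (a', b') \<in> frac_class R a b \<and> (c', d') \<in> frac_class R c d} =
        {frac_class R (a \<otimes> c) (b \<otimes> d)}" (is "?S = ?T")
  proof (rule equalityI)
    show "?S \<subseteq> ?T" using * by blast
    show "?T \<subseteq> ?S" using mem by blast
  qed
  then show ?thesis
    by (simp add: frac_field_def)
qed

lemma frac_field_add:
  assumes "a \<in> carrier R" "b \<in> carrier R - {\<zero>}" "c \<in> carrier R" "d \<in> carrier R - {\<zero>}"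
  shows "frac_class R a b \<oplus>\<^bsub>frac_field R\<^esub> frac_class R c d =
    frac_class R (a \<otimes> d \<oplus> c \<otimes> b) (b \<otimes> d)"
proof -
  have *: "frac_class R (a' \<otimes> d' \<oplus> c' \<otimes> b') (b' \<otimes> d') =
      frac_class R (a \<otimes> d \<oplus> c \<otimes> b) (b \<otimes> d)"
    if "(a', b') \<in> frac_class R a b" "(c', d') \<in> frac_class R c d" for a' b' c' d'
  proof -
    have car: "a' \<in> carrier R" "b' \<in> carrier R - {\<zero>}" "c' \<in> carrier R" "d' \<in> carrier R - {\<zero>}"
      and eqs: "a \<otimes> b' = a' \<otimes> b" "c \<otimes> d' = c' \<otimes> d"
      using that assms by (simp_all add: mem_frac_class_iff)
    have "(a' \<otimes> d' \<oplus> c' \<otimes> b') \<otimes> (b \<otimes> d) = (a' \<otimes> b) \<otimes> (d \<otimes> d') \<oplus> (c' \<otimes> d) \<otimes> (b \<otimes> b')"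
      using car assms by (simp add: l_distr r_distr m_ac)
    also have "\<dots> = (a \<otimes> b') \<otimes> (d \<otimes> d') \<oplus> (c \<otimes> d') \<otimes> (b \<otimes> b')"
      by (simp add: eqs)
    also have "\<dots> = (a \<otimes> d \<oplus> c \<otimes> b) \<otimes> (b' \<otimes> d')"
      using car assms by (simp add: l_distr r_distr m_ac)
    finally show ?thesis
      using car assms by (subst frac_class_eq_iff) (auto simp: integral_iff)
  qed
  have mem: "(a, b) \<in> frac_class R a b" "(c, d) \<in> frac_class R c d"
    using assms by (auto simp: mem_frac_class_iff)
  have "{frac_class R (a' \<otimes> d' \<oplus> c' \<otimes> b') (b' \<otimes> d') | a' b' c' d'.
          (a', b') \<in> frac_class R a b \<and> (c', d') \<in> frac_class R c d} =
        {frac_class R (a \<otimes> d \<oplus> c \<otimes> b) (b \<otimes> d)}" (is "?S = ?T")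
  proof (rule equalityI)
    show "?S \<subseteq> ?T" using * by blast
    show "?T \<subseteq> ?S" using mem by blast
  qed
  then show ?thesis
    by (simp add: frac_field_def)
qed

lemma frac_field_is_field: "field (frac_field R)"
proof -
  have one: "\<one>\<^bsub>frac_field R\<^esub> = frac_class R \<one> \<one>" and zero: "\<zero>\<^bsub>frac_field R\<^esub> = frac_class R \<zero> \<one>"
    by (simp_all add: frac_field_def)
  note ops = one zero frac_field_mult frac_field_add frac_class_closed frac_class_eq_iff
    integral_iff
  have "cring (frac_field R)"
  proof (rule cringI)
    show "abelian_group (frac_field R)"
    proof (rule abelian_groupI)
      fix x assume x: "x \<in> carrier (frac_field R)"
      then obtain a b where ab: "a \<in> carrier R" "b \<in> carrier R" "b \<noteq> \<zero>" "x = frac_class R a b"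
        by (rule frac_field_cases)
      then have "frac_class R (\<ominus> a) b \<oplus>\<^bsub>frac_field R\<^esub> x = \<zero>\<^bsub>frac_field R\<^esub>"
        by (simp add: ops l_minus l_neg)
      then show "\<exists>y\<in>carrier (frac_field R). y \<oplus>\<^bsub>frac_field R\<^esub> x = \<zero>\<^bsub>frac_field R\<^esub>"
        using ab by (intro bexI[of _ "frac_class R (\<ominus> a) b"]) (auto simp: frac_class_closed)
    next
      fix x y z
      assume "x \<in> carrier (frac_field R)" "y \<in> carrier (frac_field R)" "z \<in> carrier (frac_field R)"
      then show "x \<oplus>\<^bsub>frac_field R\<^esub> y \<oplus>\<^bsub>frac_field R\<^esub> z =
          x \<oplus>\<^bsub>frac_field R\<^esub> (y \<oplus>\<^bsub>frac_field R\<^esub> z)"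
        by (elim frac_field_cases) (simp add: ops l_distr r_distr m_ac a_ac)
    qed (auto elim!: frac_field_cases simp: ops m_ac a_ac)
    show "comm_monoid (frac_field R)"
      by (rule comm_monoidI) (auto elim!: frac_field_cases simp: ops m_ac)
    fix x y z
    assume "x \<in> carrier (frac_field R)" "y \<in> carrier (frac_field R)" "z \<in> carrier (frac_field R)"
    then show "(x \<oplus>\<^bsub>frac_field R\<^esub> y) \<otimes>\<^bsub>frac_field R\<^esub> z =
        x \<otimes>\<^bsub>frac_field R\<^esub> z \<oplus>\<^bsub>frac_field R\<^esub> y \<otimes>\<^bsub>frac_field R\<^esub> z"
      by (elim frac_field_cases) (simp add: ops l_distr r_distr m_ac a_ac)
  qed
  then interpret F: cring "frac_field R" .
  show ?thesis
  proof (rule F.cring_fieldI2)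
    show "\<zero>\<^bsub>frac_field R\<^esub> \<noteq> \<one>\<^bsub>frac_field R\<^esub>"
      by (simp add: ops)
    fix x assume x: "x \<in> carrier (frac_field R)" "x \<noteq> \<zero>\<^bsub>frac_field R\<^esub>"
    then obtain a b where ab: "a \<in> carrier R" "b \<in> carrier R" "b \<noteq> \<zero>" "x = frac_class R a b"
      by (elim frac_field_cases)
    with x have "a \<noteq> \<zero>"
      by (auto simp: ops)
    with ab show "\<exists>y\<in>carrier (frac_field R). x \<otimes>\<^bsub>frac_field R\<^esub> y = \<one>\<^bsub>frac_field R\<^esub>"
      by (intro bexI[of _ "frac_class R b a"]) (simp_all add: ops m_comm)
  qed
qed

end

section \<open>Specialization at an irreducible element\<close>

definition alg_ring :: "alg ring" where
  "alg_ring = ring_of_type_algebra"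

definition quot_ring :: "alg \<Rightarrow> alg set ring" where
  "quot_ring s = alg_ring Quot (PIdl\<^bsub>alg_ring\<^esub> s)"

type_synonym sfield = "(alg set \<times> alg set) set"

definition spec_field :: "alg \<Rightarrow> sfield ring" where
  "spec_field s = frac_field (quot_ring s)"

definition residue :: "alg \<Rightarrow> alg \<Rightarrow> alg set" where
  "residue s x = (PIdl\<^bsub>alg_ring\<^esub> s) +>\<^bsub>alg_ring\<^esub> x"

text \<open>
  An element of the fraction field has non-negative \<open>s\<close>-adic valuation iff it can be written
  with a denominator not divisible by \<open>s\<close>; on the other elements \<open>spec\<close> is unspecified.
\<close>

definition spec :: "alg \<Rightarrow> kfield \<Rightarrow> sfield" where
  "spec s x = (THE z. \<exists>a b. \<not> s dvd b \<and> x = Fraction_Field.Fract a b \<and>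
                 z = frac_class (quot_ring s) (residue s a) (residue s b))"

definition spec_poly :: "alg \<Rightarrow> laurent \<Rightarrow> (nat \<Rightarrow>\<^sub>0 int) \<Rightarrow> sfield" where
  "spec_poly s f m = spec s (Poly_Mapping.lookup f m)"

text \<open>
  Since \<open>spec_field s\<close> is a ring with a carrier set and not a type, Laurent polynomials over it
  are represented by their coefficient functions.
\<close>

definition spec_laurent_polys :: "alg \<Rightarrow> nat \<Rightarrow> ((nat \<Rightarrow>\<^sub>0 int) \<Rightarrow> sfield) set" where
  "spec_laurent_polys s n =
    {f. (\<forall>m. f m \<in> carrier (spec_field s)) \<and>
        finite {m. f m \<noteq> \<zero>\<^bsub>spec_field s\<^esub>} \<and>
        {m. f m \<noteq> \<zero>\<^bsub>spec_field s\<^esub>} \<subseteq> weights n}"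

definition spec_eval ::
    "alg \<Rightarrow> nat \<Rightarrow> ((nat \<Rightarrow>\<^sub>0 int) \<Rightarrow> sfield) \<Rightarrow> (nat \<Rightarrow> sfield) \<Rightarrow> sfield" where
  "spec_eval s n f v =
    (\<Oplus>\<^bsub>spec_field s\<^esub> m\<in>{m. f m \<noteq> \<zero>\<^bsub>spec_field s\<^esub>}.
       f m \<otimes>\<^bsub>spec_field s\<^esub>
       (\<Otimes>\<^bsub>spec_field s\<^esub> i\<in>{1..n}. v i [^]\<^bsub>spec_field s\<^esub> Poly_Mapping.lookup m i))"

definition chi_star :: "alg \<Rightarrow> nat \<Rightarrow> (nat \<Rightarrow>\<^sub>0 int) \<Rightarrow> ((nat \<Rightarrow>\<^sub>0 int) \<Rightarrow> sfield) \<Rightarrow> sfield" where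
  "chi_star s n m f = spec_eval s n f (\<lambda>i. spec s (inverse (y_star n m i)))"

definition spec_span ::
    "alg \<Rightarrow> ((nat \<Rightarrow>\<^sub>0 int) \<Rightarrow> sfield) set \<Rightarrow> ((nat \<Rightarrow>\<^sub>0 int) \<Rightarrow> sfield) set" where
  "spec_span s B =
    {(\<lambda>m. \<Oplus>\<^bsub>spec_field s\<^esub> b\<in>F. c b \<otimes>\<^bsub>spec_field s\<^esub> b m) | F c.
       finite F \<and> F \<subseteq> B \<and> c \<in> F \<rightarrow> carrier (spec_field s)}"

definition index_set :: "nat \<Rightarrow> nat \<Rightarrow> nat \<Rightarrow> (nat \<Rightarrow>\<^sub>0 int) set" where
  "index_set n i r = {l \<in> weights n.
     Poly_Mapping.lookup (dom_rep n l) i > int (r - 1) \<or>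
     (Poly_Mapping.lookup (dom_rep n l) i = int (r - 1) \<and>
      sgn_vec l (nat \<bar>wplus n l (int i)\<bar>) = 1)}"

end

(*
  Modulo s one may substitute t_n^(1/2) = c q^(-(r-1)/2) t^(-(n-i)/2) with c^2 = -1, so the residue
  field of s sits inside the fraction field again, and the Noumi representation makes sense over both.

  The polynomials E_l are built from E_0 = 1 by affine intertwiners T_i + kappa (for i = 0, one uses
  x_1^(-1) T_0 + kappa), along steps that increase a Bruhat-like order. The denominators of kappa are
  differences of joint eigenvalues, which stay distinct modulo s; so the E_l specialize to joint
  eigenvectors with distinct eigenvalues.

  Evaluating the intertwiner recursion at the base point chi_0^* multiplies the value by a nonzero scalar,
  except where T_n + kappa crosses from the complement of S into S; hence chi_0^*(E_l) = 0 iff l lies in S.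
  The span V of the E_l with l in S is therefore stable under all T_i, and the action of T_i on values at
  spectral points propagates the vanishing of chi_0^* on V to chi_m^* for all m outside S. Conversely, the
  right-hand side is stable under all T_i, so it contains each eigencomponent of its elements, and
  an E_l with l outside S has chi_0^*(E_l) nonzero.
*)

theory Submission
  imports Defs
begin

section \<open>Laurent polynomials and their evaluation\<close>

text \<open>Write \<open>k = r - 1\<close> and \<open>m = n - i\<close>. Up to a unit
  \<open>s\<close> is one of the two primes \<open>t_n^(1/2) - c q^(-k/2) t^(-m/2)\<close>: since
  \<open>a^* b^* = - t_n\<close>, the given element is a unit times a sum of two squares, and -1 is
  a square in the complex numbers. Each prime is linear in \<open>t_n^(1/2)\<close>, hence the
  kernel of a substitution of the coefficient ring into itself; so generic and special parameters
  are two instances of one development over a field type. The image of the residue field is a proper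
  subfield, so expansion coefficients are tracked in a subring. The substitution leaves
  \<open>t_0^(1/2)\<close> and \<open>u_n^(1/2)\<close> free, so \<open>q\<close>, \<open>t\<close>,
  \<open>a^*\<close> stay multiplicatively independent and spectra stay simple. What changes is that
  \<open>b^*\<close> becomes the eigenvalue \<open>q^(-k) t^(-m) / a^*\<close>, and dually for
  \<open>b\<close>: this is where \<open>S\<close> is entered. Operator identities are checked on
  values, because \<open>T_i f\<close> at \<open>v\<close> only involves \<open>f\<close> at
  \<open>v\<close> and at \<open>s_i v\<close>. Triangularity is carried by a Bruhat order refining
  the order of the statement, since its lifting property makes the relevant lower sets stable under
  reflections.\<close>

type_synonym 'a lpoly = "(nat \<Rightarrow>\<^sub>0 int) \<Rightarrow>\<^sub>0 'a"

text \<open>Polymorphic in the exponents, so that it serves Laurent polynomials and the coefficient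
  ring \<open>alg\<close> alike; a term with coefficient 0 covers the zero element.\<close>

lemma lpoly_induct [case_names single add]:
  fixes f :: "'b \<Rightarrow>\<^sub>0 'a::ab_group_add"
  assumes single: "\<And>m c. P (Poly_Mapping.single m c)" and add: "\<And>f g. P f \<Longrightarrow> P g \<Longrightarrow> P (f + g)"
  shows "P f"
proof -
  have "P (\<Sum>m\<in>A. Poly_Mapping.single m (Poly_Mapping.lookup f m))" if "finite A" for A
    using that
  proof induction
    case empty
    show ?case using single[of undefined 0] by simp
  qed (auto intro: assms)
  moreover have "(\<Sum>m\<in>Poly_Mapping.keys f. Poly_Mapping.single m (Poly_Mapping.lookup f m)) = f"
    by (rule poly_mapping_eqI) (auto simp: lookup_sum lookup_single when_def in_keys_iff sum.delta)
  ultimately show ?thesis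
    by (metis finite_keys)
qed

definition pw :: "(nat \<Rightarrow> 'a::field) \<Rightarrow> (nat \<Rightarrow>\<^sub>0 int) \<Rightarrow> 'a" where
  "pw v m = (\<Prod>i\<in>Poly_Mapping.keys m. v i powi Poly_Mapping.lookup m i)"

lemma pw_superset:
  assumes "finite A" "Poly_Mapping.keys m \<subseteq> A"
  shows "pw v m = (\<Prod>i\<in>A. v i powi Poly_Mapping.lookup m i)"
  unfolding pw_def using assms by (intro prod.mono_neutral_left) (auto simp: in_keys_iff)

lemma pw_zero [simp]: "pw v 0 = 1"
  by (simp add: pw_def)

lemma pw_single [simp]: "pw v (Poly_Mapping.single i k) = v i powi k"
  by (cases "k = 0") (simp_all add: pw_def)

lemma pw_add:
  assumes "\<And>i. v i \<noteq> 0"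
  shows "pw v (m + m') = pw v m * pw v m'"
proof -
  let ?A = "Poly_Mapping.keys m \<union> Poly_Mapping.keys m'"
  have "pw v (m + m') = (\<Prod>i\<in>?A. v i powi Poly_Mapping.lookup (m + m') i)"
    by (rule pw_superset) (use keys_add[of m m'] in auto)
  also have "\<dots> = pw v m * pw v m'"
    by (subst (1 2) pw_superset[of ?A]) (auto simp: lookup_add power_int_add assms prod.distrib)
  finally show ?thesis .
qed

lemma prod_powi:
  fixes g :: "'b \<Rightarrow> 'a::field"
  assumes "finite A"
  shows "(\<Prod>i\<in>A. g i powi k) = (\<Prod>i\<in>A. g i) powi k"
  using assms by induction (auto simp: power_int_mult_distrib)

lemma pw_frag_cmul: "pw v (frag_cmul k m) = pw v m powi k"
proof -
  have "pw v (frag_cmul k m) = (\<Prod>i\<in>Poly_Mapping.keys m. v i powi (k * Poly_Mapping.lookup m i))"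
    by (subst pw_superset[of "Poly_Mapping.keys m"]) (auto)
  also have "\<dots> = (\<Prod>i\<in>Poly_Mapping.keys m. (v i powi Poly_Mapping.lookup m i) powi k)"
    by (simp add: power_int_mult[symmetric] mult.commute)
  also have "\<dots> = pw v m powi k"
    unfolding pw_def by (rule prod_powi) simp
  finally show ?thesis .
qed

lemma pw_mult: "pw (\<lambda>i. v i * w i) m = pw v m * pw w m"
  by (simp add: pw_def power_int_mult_distrib prod.distrib)

definition ev :: "(nat \<Rightarrow> 'a::field) \<Rightarrow> 'a lpoly \<Rightarrow> 'a" where
  "ev v f = (\<Sum>m\<in>Poly_Mapping.keys f. Poly_Mapping.lookup f m * pw v m)"

lemma ev_superset:
  assumes "finite A" "Poly_Mapping.keys f \<subseteq> A"
  shows "ev v f = (\<Sum>m\<in>A. Poly_Mapping.lookup f m * pw v m)"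
  unfolding ev_def using assms by (intro sum.mono_neutral_left) (auto simp: in_keys_iff)

lemma ev_zero [simp]: "ev v 0 = 0"
  by (simp add: ev_def)

lemma ev_single [simp]: "ev v (Poly_Mapping.single m c) = c * pw v m"
  by (cases "c = 0") (simp_all add: ev_def)

lemma ev_one [simp]: "ev v 1 = 1"
  by (simp flip: single_one)

lemma ev_add [simp]: "ev v (f + g) = ev v f + ev v g"
proof -
  let ?A = "Poly_Mapping.keys f \<union> Poly_Mapping.keys g"
  have "ev v (f + g) = (\<Sum>m\<in>?A. Poly_Mapping.lookup (f + g) m * pw v m)"
    by (rule ev_superset) (use keys_add[of f g] in auto)
  then show ?thesis
    by (subst (1 2) ev_superset[of ?A]) (auto simp: lookup_add sum.distrib ring_distribs)
qed

lemma ev_uminus [simp]: "ev v (- f) = - ev v f"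
  by (simp add: ev_def sum_negf)

lemma ev_diff [simp]: "ev v (f - g) = ev v f - ev v g"
  using ev_add[of v f "- g"] by simp

lemma ev_sum: "ev v (\<Sum>x\<in>A. f x) = (\<Sum>x\<in>A. ev v (f x))"
  by (induction A rule: infinite_finite_induct) auto

lemma ev_mult [simp]:
  assumes "\<And>i. v i \<noteq> 0"
  shows "ev v (f * g) = ev v f * ev v g"
proof (induction f rule: lpoly_induct)
  case (single m c)
  show ?case
    by (induction g rule: lpoly_induct) (auto simp: mult_single pw_add assms ring_distribs)
qed (simp add: ring_distribs)

lemma exists_powi_neq_1:
  assumes "infinite (UNIV :: 'a::field set)" "k \<noteq> (0::int)"
  shows "\<exists>z::'a. z \<noteq> 0 \<and> z powi k \<noteq> 1"
proof -
  define d where "d = nat \<bar>k\<bar>"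
  have d: "d > 0" using assms by (simp add: d_def)
  define p :: "'a poly" where "p = Polynomial.monom 1 d + [:-1:]"
  have "Polynomial.coeff p d \<noteq> 0"
    using d by (simp add: p_def coeff_pCons split: nat.split)
  then have "p \<noteq> 0" by auto
  then have "finite ({z. poly p z = 0} \<union> {0})"
    using poly_roots_finite by blast
  then obtain z where z: "z \<notin> {z. poly p z = 0} \<union> {0}"
    using assms(1) by (metis UNIV_eq_I)
  then have "z ^ d \<noteq> 1" by (auto simp: p_def poly_monom)
  then have "z powi k \<noteq> 1"
    by (cases "k \<ge> 0") (auto simp: power_int_def d_def field_simps)
  with z show ?thesis by auto
qed

text \<open>Linear independence of the characters \<open>pw _ m\<close>.\<close>

lemma ev_eq_0_imp_eq_0:
  fixes f :: "'a::field lpoly"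
  assumes inf: "infinite (UNIV :: 'a set)" and 0: "\<And>v. (\<And>i. v i \<noteq> 0) \<Longrightarrow> ev v f = 0"
  shows "f = 0"
  using 0
proof (induction "card (Poly_Mapping.keys f)" arbitrary: f rule: less_induct)
  case less
  show ?case
  proof (rule ccontr)
    assume "f \<noteq> 0"
    then obtain m0 where m0: "m0 \<in> Poly_Mapping.keys f"
      by (metis all_not_in_conv keys_eq_empty)
    show False
    proof (cases "Poly_Mapping.keys f = {m0}")
      case True
      then show False
        using less.prems[of "\<lambda>_. 1"] m0 by (auto simp: ev_def pw_def in_keys_iff)
    next
      case False
      then obtain m1 where m1: "m1 \<in> Poly_Mapping.keys f" "m1 \<noteq> m0"
        using m0 by blast
      then obtain j where j: "Poly_Mapping.lookup m1 j \<noteq> Poly_Mapping.lookup m0 j"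
        by (metis poly_mapping_eqI)
      then obtain z :: 'a where z: "z \<noteq> 0" "z powi (Poly_Mapping.lookup m1 j - Poly_Mapping.lookup m0 j) \<noteq> 1"
        using exists_powi_neq_1[OF inf] by (metis right_minus_eq)
      define w where "w = (\<lambda>i::nat. if i = j then z else 1)"
      have w0: "w i \<noteq> 0" for i using z by (simp add: w_def)
      have pww: "pw w m = z powi Poly_Mapping.lookup m j" for m
      proof -
        have "pw w m = (\<Prod>i\<in>insert j (Poly_Mapping.keys m). w i powi Poly_Mapping.lookup m i)"
          by (rule pw_superset) auto
        also have "\<dots> = w j powi Poly_Mapping.lookup m j"
          by (subst prod.remove[of _ j]) (auto simp: w_def intro!: prod.neutral)
        finally show ?thesis by (simp add: w_def)
      qed
      have w1: "pw w m1 \<noteq> pw w m0"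
        using z by (auto simp: pww power_int_diff)
      \<comment> \<open>Artin's argument: \<open>g\<close> evaluates at \<open>v\<close> to
        \<open>f(v w) - w^m0 f(v)\<close>, hence vanishes everywhere; the term \<open>m0\<close>
        drops out while \<open>m1\<close> survives, so \<open>g\<close> has fewer terms and is not
        zero.\<close>
      define g where "g = Poly_Mapping.mapp (\<lambda>m c. (pw w m - pw w m0) * c) f"
      have lg: "Poly_Mapping.lookup g m = (pw w m - pw w m0) * Poly_Mapping.lookup f m" for m
        by (auto simp: g_def lookup_mapp when_def in_keys_iff)
      have kg: "Poly_Mapping.keys g \<subset> Poly_Mapping.keys f"
        using m0 by (auto simp: in_keys_iff lg)
      have "ev v g = 0" if v: "\<And>i. v i \<noteq> 0" for v
      proof -
        have "ev v g = (\<Sum>m\<in>Poly_Mapping.keys f. Poly_Mapping.lookup g m * pw v m)"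
          by (rule ev_superset) (use kg in auto)
        also have "\<dots> = ev (\<lambda>i. v i * w i) f - pw w m0 * ev v f"
          by (simp add: ev_def lg pw_mult sum_distrib_left algebra_simps sum_subtractf)
        also have "\<dots> = 0"
          using less.prems[of v] less.prems[of "\<lambda>i. v i * w i"] v w0 by simp
        finally show ?thesis .
      qed
      then have "g = 0"
        using less.hyps[of g] psubset_card_mono[OF _ kg] by simp
      then have "Poly_Mapping.lookup g m1 = 0" by simp
      then show False using w1 m1 by (simp add: lg in_keys_iff)
    qed
  qed
qed

text \<open>\<open>(f - g) * p\<close> vanishes at every point with nonzero coordinates, and Laurent
  polynomials form a domain. Rational identities may thus be tested where their denominators do not
  vanish.\<close>

lemma ev_eq_imp_eq:
  fixes f g p :: "'a::field lpoly"
  assumes inf: "infinite (UNIV :: 'a set)" and p: "p \<noteq> 0"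
    and eq: "\<And>v. (\<And>i. v i \<noteq> 0) \<Longrightarrow> ev v p \<noteq> 0 \<Longrightarrow> ev v f = ev v g"
  shows "f = g"
proof -
  have "(f - g) * p = 0"
    by (rule ev_eq_0_imp_eq_0[OF inf]) (use eq in force)
  with p show ?thesis by simp
qed

section \<open>Divided differences\<close>

definition lext :: "((nat \<Rightarrow>\<^sub>0 int) \<Rightarrow> 'a::field lpoly) \<Rightarrow> 'a lpoly \<Rightarrow> 'a lpoly" where
  "lext \<phi> f = (\<Sum>m\<in>Poly_Mapping.keys f. Poly_Mapping.single 0 (Poly_Mapping.lookup f m) * \<phi> m)"

lemma lext_superset:
  assumes "finite A" "Poly_Mapping.keys f \<subseteq> A"
  shows "lext \<phi> f = (\<Sum>m\<in>A. Poly_Mapping.single 0 (Poly_Mapping.lookup f m) * \<phi> m)"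
  unfolding lext_def using assms by (intro sum.mono_neutral_left) (auto simp: in_keys_iff)

lemma lext_single [simp]: "lext \<phi> (Poly_Mapping.single m c) = Poly_Mapping.single 0 c * \<phi> m"
  by (cases "c = 0") (simp_all add: lext_def)

lemma lext_add: "lext \<phi> (f + g) = lext \<phi> f + lext \<phi> g"
proof -
  let ?A = "Poly_Mapping.keys f \<union> Poly_Mapping.keys g"
  have "lext \<phi> (f + g) = (\<Sum>m\<in>?A. Poly_Mapping.single 0 (Poly_Mapping.lookup (f + g) m) * \<phi> m)"
    by (rule lext_superset) (use keys_add[of f g] in auto)
  then show ?thesis
    by (subst (1 2) lext_superset[of ?A]) (auto simp: lookup_add single_add sum.distrib ring_distribs)
qed

lemma lext_cmul: "lext \<phi> (Poly_Mapping.single 0 c * f) = Poly_Mapping.single 0 c * lext \<phi> f"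
  by (induction f rule: lpoly_induct) (auto simp: lext_add ring_distribs mult_single simp flip: mult.assoc)

lemma lookup_cmul [simp]:
  fixes f :: "'a::field lpoly"
  shows "Poly_Mapping.lookup (Poly_Mapping.single 0 c * f) m = c * Poly_Mapping.lookup f m"
  by (induction f rule: lpoly_induct)
     (auto simp: mult_single lookup_single when_def lookup_add ring_distribs)

text \<open>
  A root direction is given by a monomial \<open>z = c x\<^sup>\<beta>\<close> and a linear form \<open>e\<close>; the
  reflection is \<open>x\<^sup>m \<mapsto> x\<^sup>m z\<^bsup>-e(m)\<^esup>\<close>, and the divided difference is
  \<open>(s f - f) / (1 - z)\<close>.
\<close>

definition zmon :: "'a::field \<Rightarrow> (nat \<Rightarrow>\<^sub>0 int) \<Rightarrow> int \<Rightarrow> 'a lpoly" where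
  "zmon c \<beta> k = Poly_Mapping.single (frag_cmul k \<beta>) (c powi k)"

text \<open>Exponents of the finite geometric sum for \<open>(z^(-e) - 1) / (1 - z)\<close>; for
  negative \<open>e\<close> the sum carries a minus sign, supplied by \<open>sgn\<close> in
  \<open>dd\<close>.\<close>

definition dd_exps :: "int \<Rightarrow> int set" where
  "dd_exps e = (if e > 0 then {-e..<0} else {0..<-e})"

definition dd :: "'a::field \<Rightarrow> (nat \<Rightarrow>\<^sub>0 int) \<Rightarrow> ((nat \<Rightarrow>\<^sub>0 int) \<Rightarrow> int) \<Rightarrow> 'a lpoly \<Rightarrow> 'a lpoly" where
  "dd c \<beta> e = lext (\<lambda>m. of_int (sgn (e m)) * (\<Sum>k\<in>dd_exps (e m). Poly_Mapping.single m 1 * zmon c \<beta> k))"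

definition rf :: "'a::field \<Rightarrow> (nat \<Rightarrow>\<^sub>0 int) \<Rightarrow> ((nat \<Rightarrow>\<^sub>0 int) \<Rightarrow> int) \<Rightarrow> 'a lpoly \<Rightarrow> 'a lpoly" where
  "rf c \<beta> e = lext (\<lambda>m. Poly_Mapping.single m 1 * zmon c \<beta> (- e m))"

lemma zmon_mult: "c \<noteq> 0 \<Longrightarrow> zmon c \<beta> k * zmon c \<beta> l = zmon c \<beta> (k + l)"
  by (simp add: zmon_def mult_single frag_cmul_distrib power_int_add)

lemma zmon_0 [simp]: "zmon c \<beta> 0 = 1"
  by (simp add: zmon_def)

lemma geometric_telescope:
  assumes "c \<noteq> (0::'a::field)" "a \<le> b"
  shows "(\<Sum>k\<in>{a..<b}. zmon c \<beta> k) * (1 - zmon c \<beta> 1) = zmon c \<beta> a - zmon c \<beta> b"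
  using assms(2)
proof (induction b rule: int_ge_induct)
  case (step i)
  have "{a..<i + 1} = insert i {a..<i}" using step by auto
  then show ?case
    using step by (simp add: ring_distribs zmon_mult[OF assms(1)])
qed simp

lemma dd_add: "dd c \<beta> e (f + g) = dd c \<beta> e f + dd c \<beta> e g"
  by (simp add: dd_def lext_add)

lemma rf_add: "rf c \<beta> e (f + g) = rf c \<beta> e f + rf c \<beta> e g"
  by (simp add: rf_def lext_add)

text \<open>Telescoping of the geometric sum; in this sense \<open>dd\<close> is a quotient,
  although no division takes place.\<close>

lemma dd_times:
  assumes "c \<noteq> (0::'a::field)"
  shows "dd c \<beta> e f * (1 - zmon c \<beta> 1) = rf c \<beta> e f - f"
proof (induction f rule: lpoly_induct)
  case (single m d)
  have *: "of_int (sgn (e m)) * (\<Sum>k\<in>dd_exps (e m). zmon c \<beta> k) * (1 - zmon c \<beta> 1) = zmon c \<beta> (- e m) - 1"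
    using geometric_telescope[OF assms, of "- e m" 0 \<beta>] geometric_telescope[OF assms, of 0 "- e m" \<beta>]
    by (cases "e m" "0 :: int" rule: linorder_cases) (auto simp: dd_exps_def mult.assoc)
  have "dd c \<beta> e (Poly_Mapping.single m d) * (1 - zmon c \<beta> 1) =
    Poly_Mapping.single 0 d * Poly_Mapping.single m 1 * (of_int (sgn (e m)) * (\<Sum>k\<in>dd_exps (e m). zmon c \<beta> k) * (1 - zmon c \<beta> 1))"
    by (simp add: dd_def sum_distrib_left[symmetric] mult_ac)
  then show ?case
    unfolding * by (simp add: rf_def ring_distribs mult_single flip: mult.assoc)
next
  case (add f g)
  have "dd c \<beta> e (f + g) * (1 - zmon c \<beta> 1) = dd c \<beta> e f * (1 - zmon c \<beta> 1) + dd c \<beta> e g * (1 - zmon c \<beta> 1)"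
    by (simp only: dd_add distrib_right)
  then show ?case using add by (simp add: rf_add)
qed

lemma ev_rf:
  assumes v: "\<And>i. v i \<noteq> 0" and "c \<noteq> 0"
    and w: "\<And>m. pw w m = pw v m * (c * pw v \<beta>) powi (- e m)"
  shows "ev v (rf c \<beta> e f) = ev w f"
  by (induction f rule: lpoly_induct)
    (auto simp: rf_def lext_add zmon_def pw_frag_cmul w power_int_mult_distrib v)

text \<open>One shape for \<open>T_0\<close>, \<open>T_i\<close> and \<open>T_n\<close>:
  \<open>tau + tau^(-1) N (s - 1) / (1 - z)\<close> with numerator \<open>N\<close> and root
  monomial \<open>z\<close>.\<close>

definition dl :: "'a::field \<Rightarrow> 'a lpoly \<Rightarrow> 'a \<Rightarrow> (nat \<Rightarrow>\<^sub>0 int) \<Rightarrow> ((nat \<Rightarrow>\<^sub>0 int) \<Rightarrow> int) \<Rightarrow> 'a lpoly \<Rightarrow> 'a lpoly" where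
  "dl \<tau> N c \<beta> e f = Poly_Mapping.single 0 \<tau> * f + Poly_Mapping.single 0 (inverse \<tau>) * (N * dd c \<beta> e f)"

lemma dl_add: "dl \<tau> N c \<beta> e (f + g) = dl \<tau> N c \<beta> e f + dl \<tau> N c \<beta> e g"
  by (simp add: dl_def dd_def lext_add ring_distribs)

lemma dl_cmul: "dl \<tau> N c \<beta> e (Poly_Mapping.single 0 k * f) = Poly_Mapping.single 0 k * dl \<tau> N c \<beta> e f"
  unfolding dl_def dd_def lext_cmul ring_distribs by (simp only: mult_ac)

lemma ev_dl:
  assumes v: "\<And>i. v i \<noteq> 0" and c: "c \<noteq> 0"
    and w: "\<And>m. pw w m = pw v m * (c * pw v \<beta>) powi (- e m)"
    and z: "c * pw v \<beta> \<noteq> 1"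
  shows "ev v (dl \<tau> N c \<beta> e f) = \<tau> * ev v f + inverse \<tau> * ev v N / (1 - c * pw v \<beta>) * (ev w f - ev v f)"
proof -
  have "ev v (dd c \<beta> e f * (1 - zmon c \<beta> 1)) = ev w f - ev v f"
    by (simp only: dd_times[OF c]) (simp add: ev_rf[OF v c w])
  then have "ev v (dd c \<beta> e f) * (1 - c * pw v \<beta>) = ev w f - ev v f"
    by (simp add: v zmon_def)
  then have "ev v (dd c \<beta> e f) = (ev w f - ev v f) / (1 - c * pw v \<beta>)"
    using z by (simp add: field_simps)
  then show ?thesis
    by (simp add: dl_def v)
qed

section \<open>Demazure--Lusztig operators over a field\<close>

lemma pw_upd:
  assumes "v j \<noteq> 0"
  shows "pw (v(j := x)) m = pw v m * (x / v j) powi Poly_Mapping.lookup m j"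
proof -
  let ?A = "insert j (Poly_Mapping.keys m)"
  have "pw (v(j := x)) m = (\<Prod>i\<in>?A. (v(j := x)) i powi Poly_Mapping.lookup m i)"
    by (rule pw_superset) auto
  also have "\<dots> = (\<Prod>i\<in>?A. v i powi Poly_Mapping.lookup m i * (if i = j then (x / v j) powi Poly_Mapping.lookup m j else 1))"
    by (intro prod.cong) (auto simp: assms simp flip: power_int_mult_distrib)
  also have "\<dots> = pw v m * (x / v j) powi Poly_Mapping.lookup m j"
    by (subst pw_superset[of ?A m v]) (auto simp: prod.distrib prod.delta)
  finally show ?thesis .
qed

abbreviation Cst :: "'a::field \<Rightarrow> 'a lpoly" where
  "Cst c \<equiv> Poly_Mapping.single 0 c"

abbreviation Xp :: "nat \<Rightarrow> int \<Rightarrow> 'a::field lpoly" where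
  "Xp i k \<equiv> Poly_Mapping.single (Poly_Mapping.single i k) 1"

text \<open>\<open>hq\<close>, \<open>ht\<close>, \<open>hn\<close>, \<open>h0\<close>,
  \<open>un\<close>, \<open>u0\<close> are the square roots of the six parameters, with no relation
  imposed, so that generic and specialized parameters are both instances. Infinity of the field lets
  polynomials be recovered from their values.\<close>

locale koornwinder_field =
  fixes n :: nat and hq ht hn h0 un u0 :: "'a::field"
  assumes n2: "2 \<le> n" and inf: "infinite (UNIV :: 'a set)"
    and nz [simp]: "hq \<noteq> 0" "ht \<noteq> 0" "hn \<noteq> 0" "h0 \<noteq> 0" "un \<noteq> 0" "u0 \<noteq> 0"
begin

definition tau :: "nat \<Rightarrow> 'a" where
  "tau i = (if i = 0 then h0 else if i < n then ht else hn)"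

definition del :: "nat \<Rightarrow> 'a" where
  "del i = tau i - inverse (tau i)"

definition Num :: "nat \<Rightarrow> 'a lpoly" where
  "Num i = (if i = 0 then (1 - Cst (hq * h0 * u0) * Xp 1 (-1)) * (1 - Cst (- (hq * h0 * inverse u0)) * Xp 1 (-1))
     else if i < n then 1 - Cst (ht\<^sup>2) * Xp i 1 * Xp (Suc i) (-1)
     else (1 - Cst (hn * un) * Xp n 1) * (1 - Cst (- (hn * inverse un)) * Xp n 1))"

definition zc :: "nat \<Rightarrow> 'a" where
  "zc i = (if i = 0 then hq\<^sup>2 else 1)"

definition beta :: "nat \<Rightarrow> (nat \<Rightarrow>\<^sub>0 int)" where
  "beta i = (if i = 0 then Poly_Mapping.single 1 (-2)
     else if i < n then Poly_Mapping.single i 1 + Poly_Mapping.single (Suc i) (-1)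
     else Poly_Mapping.single n 2)"

text \<open>The sign at \<open>i = 0\<close> comes from \<open>z = q x_1^(-2)\<close>: the
  reflection multiplies \<open>x^m\<close> by \<open>z^(m_1)\<close>, and \<open>rf\<close> uses the
  exponent \<open>- lf\<close>.\<close>

definition lf :: "nat \<Rightarrow> (nat \<Rightarrow>\<^sub>0 int) \<Rightarrow> int" where
  "lf i m = (if i = 0 then - Poly_Mapping.lookup m 1
     else if i < n then Poly_Mapping.lookup m i - Poly_Mapping.lookup m (Suc i)
     else Poly_Mapping.lookup m n)"

definition T :: "nat \<Rightarrow> 'a lpoly \<Rightarrow> 'a lpoly" where
  "T i = dl (tau i) (Num i) (zc i) (beta i) (lf i)"

definition pact :: "nat \<Rightarrow> (nat \<Rightarrow> 'a) \<Rightarrow> nat \<Rightarrow> 'a" where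
  "pact i v = (if i = 0 then v(1 := hq\<^sup>2 / v 1)
     else if i < n then v(i := v (Suc i), Suc i := v i)
     else v(n := inverse (v n)))"

definition gd :: "nat \<Rightarrow> (nat \<Rightarrow> 'a) \<Rightarrow> bool" where
  "gd i v \<longleftrightarrow> (if i = 0 then (v 1)\<^sup>2 \<noteq> hq\<^sup>2 else if i < n then v i \<noteq> v (Suc i) else (v n)\<^sup>2 \<noteq> 1)"

text \<open>Coefficient of \<open>f(v)\<close> in the value of \<open>T i f\<close> at
  \<open>v\<close>: it equals \<open>tau i - N / (tau i (1 - z))\<close> with \<open>N\<close> and
  \<open>z\<close> evaluated at \<open>v\<close>, as shown inside \<open>ev_T\<close>.\<close>

definition al :: "nat \<Rightarrow> (nat \<Rightarrow> 'a) \<Rightarrow> 'a" where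
  "al i v = (if i = 0 then (del 0 * (v 1)\<^sup>2 + (u0 - inverse u0) * hq * v 1) / ((v 1)\<^sup>2 - hq\<^sup>2)
     else if i < n then del i * v (Suc i) / (v (Suc i) - v i)
     else (del n + (un - inverse un) * v n) / (1 - (v n)\<^sup>2))"

lemma tau_nz [simp]: "tau i \<noteq> 0"
  by (simp add: tau_def)

lemma pact_nz: "(\<And>j. v j \<noteq> 0) \<Longrightarrow> pact i v j \<noteq> 0"
  by (simp add: pact_def)

lemma zc_pw: "zc i * pw v (beta i) = (if i = 0 then (hq / v 1)\<^sup>2 else if i < n then v i / v (Suc i) else (v n)\<^sup>2)"
  if "\<And>j. v j \<noteq> 0"
  using that by (simp add: zc_def beta_def pw_add power_int_minus power_divide field_simps)

lemma gd_iff: "(\<And>j. v j \<noteq> 0) \<Longrightarrow> gd i v \<longleftrightarrow> zc i * pw v (beta i) \<noteq> 1"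
  by (subst zc_pw) (auto simp: gd_def field_simps)

lemma pw_pact:
  assumes v: "\<And>j. v j \<noteq> 0"
  shows "pw (pact i v) m = pw v m * (zc i * pw v (beta i)) powi (- lf i m)"
proof -
  consider "i = 0" | "i \<noteq> 0" "i < n" | "i \<noteq> 0" "i \<ge> n" by linarith
  then show ?thesis
  proof cases
    case 1
    then show ?thesis
      by (simp add: pact_def zc_pw[OF v] pw_upd v lf_def power2_eq_square)
  next
    case 2
    then show ?thesis
      unfolding zc_pw[OF v]
      by (simp add: pact_def pw_upd v lf_def power_int_diff power_int_divide_distrib)
  next
    case 3
    then show ?thesis
      by (simp add: pact_def zc_pw[OF v] pw_upd v lf_def power2_eq_square power_int_minus power_int_mult_distrib
          field_simps power_int_divide_distrib)
  qed
qed

text \<open>Off the mirror of the reflection the value of \<open>T i f\<close> involves only two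
  values of \<open>f\<close>. The basic operator relations are thereby reduced to identities between
  coefficients along orbits of points.\<close>

lemma ev_T:
  assumes v: "\<And>j. v j \<noteq> 0" and g: "gd i v"
  shows "ev v (T i f) = al i v * ev v f + (tau i - al i v) * ev (pact i v) f"
proof -
  have ne: "zc i * pw v (beta i) \<noteq> 1"
    using g v by (simp add: gd_iff)
  have zc0: "zc i \<noteq> 0" by (simp add: zc_def)
  have *: "inverse (tau i) * ev v (Num i) / (1 - zc i * pw v (beta i)) = tau i - al i v"
  proof -
    consider "i = 0" | "i \<noteq> 0" "i < n" | "i \<noteq> 0" "i \<ge> n" by linarith
    then show ?thesis
    proof cases
      case 1
      define x where "x = v 1"
      have x: "x \<noteq> 0" "x\<^sup>2 - hq\<^sup>2 \<noteq> 0" using v g 1 by (auto simp: x_def gd_def)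
      have "1 - (hq / x)\<^sup>2 = (x\<^sup>2 - hq\<^sup>2) / x\<^sup>2" using x by (simp add: field_simps)
      then have "inverse h0 * ((1 - hq * h0 * u0 * inverse x) * (1 - (- (hq * h0 * inverse u0)) * inverse x)) / (1 - (hq / x)\<^sup>2)
          = h0 - ((h0 - inverse h0) * x\<^sup>2 + (u0 - inverse u0) * hq * x) / (x\<^sup>2 - hq\<^sup>2)"
        using x by (simp add: divide_simps) (simp add: algebra_simps power2_eq_square)
      then show ?thesis
        using 1 v by (simp add: zc_pw[OF v] tau_def al_def Num_def del_def x_def power_int_minus)
    next
      case 2
      define x y where "x = v i" and "y = v (Suc i)"
      have x: "x \<noteq> 0" "y \<noteq> 0" "y - x \<noteq> 0" using v g 2 by (auto simp: x_def y_def gd_def)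
      have "1 - x / y = (y - x) / y" using x by (simp add: field_simps)
      then have "inverse ht * (1 - ht\<^sup>2 * x * inverse y) / (1 - x / y) = ht - (ht - inverse ht) * y / (y - x)"
        using x by (simp add: divide_simps) (simp add: algebra_simps power2_eq_square)
      then show ?thesis
        using 2 v by (simp add: zc_pw[OF v] tau_def al_def Num_def del_def x_def y_def power_int_minus)
    next
      case 3
      define x where "x = v n"
      have x: "x \<noteq> 0" "1 - x\<^sup>2 \<noteq> 0" using v g 3 by (auto simp: x_def gd_def)
      then have "inverse hn * ((1 - hn * un * x) * (1 - (- (hn * inverse un)) * x)) / (1 - x\<^sup>2)
          = hn - ((hn - inverse hn) + (un - inverse un) * x) / (1 - x\<^sup>2)"
        by (simp add: divide_simps) (simp add: algebra_simps power2_eq_square)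
      then show ?thesis
        using 3 v n2 by (simp add: zc_pw[OF v] tau_def al_def Num_def del_def x_def power_int_minus)
    qed
  qed
  show ?thesis
    unfolding T_def ev_dl[OF v zc0 pw_pact[OF v] ne] * by (simp add: algebra_simps)
qed

lemma T_add: "T i (f + g) = T i f + T i g"
  by (simp add: T_def dl_add)

lemma T_cmul: "T i (Cst c * f) = Cst c * T i f"
  by (simp add: T_def dl_cmul)

lemma T_uminus: "T i (- f) = - T i f"
  using T_cmul[of i "-1" f] by (simp add: single_uminus)

lemma T_diff: "T i (f - g) = T i f - T i g"
  using T_add[of i f "- g"] by (simp add: T_uminus)

text \<open>Points at which every evaluation formula needed for the relations applies.\<close>

definition generic :: "(nat \<Rightarrow> 'a) \<Rightarrow> bool" where
  "generic v \<longleftrightarrow> (\<forall>i. v i \<noteq> 0) \<and> (\<forall>i\<le>n. \<forall>j\<le>n. (i \<noteq> j \<longrightarrow> v i \<noteq> v j) \<and> v i * v j \<noteq> 1)"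

lemma generic_eqI:
  assumes "\<And>v. generic v \<Longrightarrow> (v 1)\<^sup>2 \<noteq> hq\<^sup>2 \<Longrightarrow> ev v f = ev v g"
  shows "f = g"
proof (rule ev_eq_imp_eq[OF inf])
  \<comment> \<open>The excluded points are the zeros of a single nonzero Laurent polynomial; a
    diagonal pair contributes only the factor for \<open>v i * v j = 1\<close>.\<close>
  let ?P = "\<lambda>i j. (if i = j then 1 else Xp i 1 - Xp j 1) * (Xp i 1 * Xp j 1 - 1) :: 'a lpoly"
  let ?p = "(Xp 1 2 - Cst (hq\<^sup>2)) * (\<Prod>i\<le>n. \<Prod>j\<le>n. ?P i j) :: 'a lpoly"
  have neq: "Poly_Mapping.single m (1::'a) - Poly_Mapping.single m' c \<noteq> 0" if "m \<noteq> m'" for m m' :: "nat \<Rightarrow>\<^sub>0 int" and c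
  proof
    assume "Poly_Mapping.single m (1::'a) - Poly_Mapping.single m' c = 0"
    then have "Poly_Mapping.lookup (Poly_Mapping.single m (1::'a) - Poly_Mapping.single m' c) m = 0" by simp
    then show False using that by (simp add: lookup_minus lookup_single)
  qed
  have s0: "Poly_Mapping.single i (1::int) \<noteq> Poly_Mapping.single j 1" if "i \<noteq> j" for i j :: nat
    using that by (metis lookup_single_eq lookup_single_not_eq zero_neq_one)
  have s1: "Poly_Mapping.single i (1::int) + Poly_Mapping.single j 1 \<noteq> 0" for i j :: nat
  proof
    assume "Poly_Mapping.single i (1::int) + Poly_Mapping.single j 1 = 0"
    then have "Poly_Mapping.lookup (Poly_Mapping.single i (1::int) + Poly_Mapping.single j 1) i = 0" by simp
    then show False by (simp add: lookup_add lookup_single when_def split: if_splits)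
  qed
  have s2: "Poly_Mapping.single 1 (2::int) \<noteq> (0 :: nat \<Rightarrow>\<^sub>0 int)"
    by (metis lookup_single_eq lookup_zero zero_neq_numeral)
  have P1: "(if i = j then 1 else Xp i 1 - Xp j 1 :: 'a lpoly) \<noteq> 0" for i j
    using neq[OF s0, of i j 1] by simp
  have P2: "Xp i 1 * Xp j 1 - 1 \<noteq> (0 :: 'a lpoly)" for i j
    using neq[OF s1, of i j 1] by (simp add: mult_single)
  have P0: "?P i j \<noteq> 0" for i j
    by (rule no_zero_divisors[OF P1 P2])
  show "?p \<noteq> 0"
    using P0 neq[OF s2] by (simp del: mult_eq_0_iff add: no_zero_divisors)
  fix v :: "nat \<Rightarrow> 'a" assume v: "\<And>i. v i \<noteq> 0" and p: "ev v ?p \<noteq> 0"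
  have ep: "ev v (prod F A) = (\<Prod>x\<in>A. ev v (F x))" for F :: "nat \<Rightarrow> 'a lpoly" and A
    by (induction A rule: infinite_finite_induct) (auto simp: v)
  have "\<forall>i\<le>n. \<forall>j\<le>n. ev v (?P i j) \<noteq> 0" "(v 1)\<^sup>2 \<noteq> hq\<^sup>2"
    using p by (auto simp: v ep)
  then show "ev v f = ev v g"
    using v by (intro assms) (auto simp: generic_def split: if_splits)
qed

lemma generic_nz: "generic v \<Longrightarrow> v i \<noteq> 0"
  by (simp add: generic_def)

lemma generic_gd: "generic v \<Longrightarrow> i \<noteq> 0 \<Longrightarrow> i \<le> n \<Longrightarrow> gd i v"
  by (auto simp: generic_def gd_def power2_eq_square)

text \<open>Stability under \<open>s_1, ..., s_n\<close> lets \<open>ev_T\<close> be iterated along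
  words in these reflections; \<open>s_0\<close> breaks it, so relations with \<open>T 0\<close>
  rely on the extra condition \<open>(v 1)^2 \<noteq> hq^2\<close>.\<close>

lemma generic_pact:
  assumes "generic v" "i \<noteq> 0" "i \<le> n"
  shows "generic (pact i v)"
  using assms unfolding generic_def pact_def
  by (auto simp: inverse_eq_divide field_simps)

lemma ev_T_generic:
  assumes "generic v" "i \<noteq> 0" "i \<le> n"
  shows "ev v (T i f) = al i v * ev v f + (tau i - al i v) * ev (pact i v) f"
  using assms by (intro ev_T generic_gd) (auto simp: generic_nz)

text \<open>The coefficients at a point and at its mirror image add up to \<open>del i\<close>; this
  is the quadratic relation in numerical form.\<close>

lemma al_pact:
  assumes v: "\<And>j. v j \<noteq> 0" and g: "gd i v" and i: "i \<le> n"
  shows "al i (pact i v) = del i - al i v" "gd i (pact i v)" "pact i (pact i v) = v"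
proof -
  consider "i = 0" | "i \<noteq> 0" "i < n" | "i \<noteq> 0" "i = n" using i by linarith
  then show "al i (pact i v) = del i - al i v"
  proof cases
    case 1
    then have "(v 1)\<^sup>2 - hq\<^sup>2 \<noteq> 0" "hq\<^sup>2 - (v 1)\<^sup>2 \<noteq> 0" using g by (auto simp: gd_def)
    moreover have "(hq\<^sup>2 / v 1)\<^sup>2 - hq\<^sup>2 = hq\<^sup>2 * (hq\<^sup>2 - (v 1)\<^sup>2) / (v 1)\<^sup>2"
      using v by (simp add: field_simps power2_eq_square)
    ultimately show ?thesis
      using 1 v by (simp add: al_def pact_def) (simp add: divide_simps, simp add: algebra_simps power2_eq_square)
  next
    case 2
    then show ?thesis using g v by (simp add: al_def pact_def gd_def field_simps)
  next
    case 3
    then have "1 - (v n)\<^sup>2 \<noteq> 0" "(v n)\<^sup>2 - 1 \<noteq> 0" using g n2 by (auto simp: gd_def)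
    moreover have "1 - (inverse (v n))\<^sup>2 = ((v n)\<^sup>2 - 1) / (v n)\<^sup>2"
      using v by (simp add: field_simps power2_eq_square)
    ultimately show ?thesis
      using 3 v by (simp add: al_def pact_def) (simp add: divide_simps, simp add: algebra_simps power2_eq_square)
  qed
  show "gd i (pact i v)" "pact i (pact i v) = v"
    using g v by (auto simp: gd_def pact_def fun_eq_iff power2_eq_square field_simps)
qed

section \<open>Quadratic, commutation and braid relations\<close>

lemma ev_T2:
  assumes v: "\<And>j. v j \<noteq> 0" and g: "gd i v" and i: "i \<le> n"
  shows "ev v (T i (T i f)) = del i * ev v (T i f) + ev v f"
proof -
  note p = al_pact[OF v g i]
  have A: "ev (pact i v) (T i f) = (del i - al i v) * ev (pact i v) f + (tau i - (del i - al i v)) * ev v f"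
    using ev_T[of "pact i v" i f] pact_nz[OF v] p by simp
  show ?thesis
    unfolding ev_T[OF v g] A using tau_nz[of i] by (simp add: del_def algebra_simps)
qed

text \<open>Equivalent to \<open>(T - tau) (T + tau^(-1)) = 0\<close>; in particular
  \<open>T\<close> is invertible with inverse \<open>T - del\<close>.\<close>

lemma T_quadratic:
  assumes "i \<le> n"
  shows "T i (T i f) = Cst (del i) * T i f + f"
proof (rule generic_eqI)
  fix v assume v: "generic v" "(v 1)\<^sup>2 \<noteq> hq\<^sup>2"
  then have "gd i v" using assms generic_gd[of v i] by (cases "i = 0") (auto simp: gd_def)
  then show "ev v (T i (T i f)) = ev v (Cst (del i) * T i f + f)"
    using v assms by (simp add: ev_T2 generic_nz)
qed

lemma T_commute:
  assumes "Suc i < j" "j \<le> n"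
  shows "T i (T j f) = T j (T i f)"
proof (rule generic_eqI)
  fix v assume v: "generic v" "(v 1)\<^sup>2 \<noteq> hq\<^sup>2"
  have gi: "gd i v" using v assms generic_gd[of v i] by (cases "i = 0") (auto simp: gd_def)
  have gj: "gd j v" using v assms generic_gd[of v j] by auto
  have nzv: "v k \<noteq> 0" for k using v generic_nz by blast
  have g2: "gd i (pact j v)" "gd j (pact i v)" and a: "al i (pact j v) = al i v" "al j (pact i v) = al j v"
    and c: "pact i (pact j v) = pact j (pact i v)"
    using gi gj assms by (auto simp: gd_def pact_def al_def fun_eq_iff)
  show "ev v (T i (T j f)) = ev v (T j (T i f))"
    using nzv gi gj g2 a c by (simp add: ev_T pact_nz algebra_simps)
qed

lemma T_mult_invariant:
  assumes "i \<le> n" "\<And>v. (\<And>j. v j \<noteq> 0) \<Longrightarrow> ev (pact i v) g = ev v g"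
  shows "T i (f * g) = T i f * g"
proof (rule generic_eqI)
  fix v assume v: "generic v" "(v 1)\<^sup>2 \<noteq> hq\<^sup>2"
  then have "gd i v" using assms generic_gd[of v i] by (cases "i = 0") (auto simp: gd_def)
  then show "ev v (T i (f * g)) = ev v (T i f * g)"
    using v assms by (simp add: ev_T generic_nz pact_nz algebra_simps)
qed

text \<open>Both sides are expanded over the six points of an orbit. Their difference is a
  combination of the values of \<open>f\<close> at \<open>v\<close>, \<open>s_i v\<close> and
  \<open>s_(i+1) v\<close>, times one scalar that vanishes by the three-term identity
  \<open>rel\<close>; \<open>c\<close> belongs to the root \<open>x_i / x_(i+2)\<close>.\<close>

lemma T_braid3:
  assumes "0 < i" "Suc i < n"
  shows "T i (T (Suc i) (T i f)) = T (Suc i) (T i (T (Suc i) f))"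
proof (rule generic_eqI)
  fix v assume v: "generic v"
  let ?j = "Suc i"
  define x y z where xyz: "x = v i" "y = v (Suc i)" "z = v (Suc (Suc i))"
  have ne: "x \<noteq> y" "y \<noteq> z" "x \<noteq> z" using v assms by (auto simp: generic_def xyz)
  define a b c where abc: "a = del i * y / (y - x)" "b = del i * z / (z - y)" "c = del i * z / (z - x)"
  have dj: "del ?j = del i" "tau ?j = tau i" using assms by (simp_all add: del_def tau_def)
  have rel: "a * b = c * (a + b - del i)"
    using ne by (simp add: abc divide_simps) (simp add: algebra_simps)
  have swap: "del i * x / (x - y) = del i - a" "del i * y / (y - z) = del i - b" "del i * x / (x - z) = del i - c"
    using ne by (auto simp: abc divide_simps algebra_simps)
  have g: "generic (pact i v)" "generic (pact ?j v)" "generic (pact ?j (pact i v))" "generic (pact i (pact ?j v))"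
    using v assms by (auto intro!: generic_pact)
  have al: "al i v = a" "al ?j v = b" "al i (pact i v) = del i - a" "al ?j (pact i v) = c"
    "al i (pact ?j v) = c" "al ?j (pact ?j v) = del i - b"
    "al i (pact ?j (pact i v)) = b" "al ?j (pact i (pact ?j v)) = a"
    using assms swap by (simp_all add: al_def pact_def dj abc flip: xyz)
  have pp: "pact i (pact i v) = v" "pact ?j (pact ?j v) = v"
    "pact i (pact ?j (pact i v)) = pact ?j (pact i (pact ?j v))"
    using assms by (auto simp: pact_def fun_eq_iff)
  have "ev v (T i (T ?j (T i f))) - ev v (T ?j (T i (T ?j f))) =
    ((a - b) * ev v f + (tau i - a) * ev (pact i v) f - (tau i - b) * ev (pact ?j v) f) * (a * b - c * (a + b - del i))"
    using assms by (simp add: ev_T_generic v g al pp dj) (simp add: algebra_simps)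
  with rel show "ev v (T i (T ?j (T i f))) = ev v (T ?j (T i (T ?j f)))"
    by simp
qed

text \<open>Same method on an orbit of eight points: \<open>r\<close> is the coefficient for the
  root \<open>x_m x_n\<close>, and \<open>rel\<close> is the one scalar identity to which the
  difference of the two sides is proportional.\<close>

lemma T_braid4:
  assumes m: "Suc m = n"
  shows "T m (T n (T m (T n f))) = T n (T m (T n (T m f)))"
proof (rule generic_eqI)
  fix v assume v: "generic v"
  have i: "m \<noteq> 0" "m < n" "m \<noteq> n" "Suc m = n" using n2 m by auto
  define x y where xy: "x = v m" "y = v n"
  have ne: "x \<noteq> y" "x * y \<noteq> 1" "x\<^sup>2 \<noteq> 1" "y\<^sup>2 \<noteq> 1" "x \<noteq> 0" "y \<noteq> 0"
    using v i by (auto simp: generic_def xy power2_eq_square)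
  define g where "g = un - inverse un"
  define d e where de: "d = del m" "e = del n"
  define a r b c where abc: "a = d * y / (y - x)" "r = d / (1 - x * y)"
    "b = (e + g * y) / (1 - y\<^sup>2)" "c = (e + g * x) / (1 - x\<^sup>2)"
  have rel: "a * b - a * c - r * c - r * b + d * c + e * r = 0"
  proof -
    have "1 - y\<^sup>2 \<noteq> 0" "1 - x\<^sup>2 \<noteq> 0" "y - x \<noteq> 0" "1 - x * y \<noteq> 0" using ne by auto
    then show ?thesis
      unfolding abc by (simp add: divide_simps) (simp add: algebra_simps power2_eq_square power3_eq_cube)
  qed
  have swap: "d * x / (x - y) = d - a" "d * inverse y / (inverse y - x) = r" "d * inverse x / (inverse x - y) = r"
    "d * x / (x - inverse y) = d - r" "d * y / (y - inverse x) = d - r"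
    "(e + g * inverse y) / (1 - (inverse y)\<^sup>2) = e - b" "(e + g * inverse x) / (1 - (inverse x)\<^sup>2) = e - c"
    "d * inverse y / (inverse y - inverse x) = d - a" "d * inverse x / (inverse x - inverse y) = a"
  proof -
    have nn: "1 - y\<^sup>2 \<noteq> 0" "1 - x\<^sup>2 \<noteq> 0" "y - x \<noteq> 0" "x - y \<noteq> 0" "1 - x * y \<noteq> 0" "x * y - 1 \<noteq> 0"
      "y\<^sup>2 - 1 \<noteq> 0" "x\<^sup>2 - 1 \<noteq> 0" using ne by auto
    have dn: "inverse y - x = (1 - x * y) / y" "inverse x - y = (1 - x * y) / x"
      "x - inverse y = (x * y - 1) / y" "y - inverse x = (x * y - 1) / x"
      "1 - (inverse y)\<^sup>2 = (y\<^sup>2 - 1) / y\<^sup>2" "1 - (inverse x)\<^sup>2 = (x\<^sup>2 - 1) / x\<^sup>2"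
      "inverse y - inverse x = (x - y) / (x * y)" "inverse x - inverse y = (y - x) / (x * y)"
      using ne by (simp_all add: field_simps power2_eq_square)
    show "d * x / (x - y) = d - a" "d * inverse y / (inverse y - x) = r" "d * inverse x / (inverse x - y) = r"
      "d * x / (x - inverse y) = d - r" "d * y / (y - inverse x) = d - r"
      "(e + g * inverse y) / (1 - (inverse y)\<^sup>2) = e - b" "(e + g * inverse x) / (1 - (inverse x)\<^sup>2) = e - c"
      "d * inverse y / (inverse y - inverse x) = d - a" "d * inverse x / (inverse x - inverse y) = a"
      unfolding dn abc using nn ne by (simp_all add: divide_simps) (simp_all add: algebra_simps power2_eq_square)
  qed
  have gn: "generic (pact m v)" "generic (pact n v)" "generic (pact n (pact m v))" "generic (pact m (pact n v))"
    "generic (pact m (pact n (pact m v)))" "generic (pact n (pact m (pact n v)))"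
    using v i n2 by (simp_all add: generic_pact)
  have p_i: "pact m v = v(m := v n, n := v m)" for v using i by (simp add: pact_def)
  have p_n: "pact n v = v(n := inverse (v n))" for v using i n2 by (simp add: pact_def)
  have al_i: "al m v = d * v n / (v n - v m)" for v using i by (simp add: al_def de)
  have al_n: "al n v = (e + g * v n) / (1 - (v n)\<^sup>2)" for v using i n2 by (simp add: al_def de g_def)
  have al: "al m v = a" "al n v = b"
    "al m (pact m v) = d - a" "al n (pact m v) = c"
    "al m (pact n v) = r" "al n (pact n v) = e - b"
    "al m (pact n (pact m v)) = r" "al n (pact n (pact m v)) = e - c"
    "al m (pact m (pact n v)) = d - r" "al n (pact m (pact n v)) = c"
    "al n (pact m (pact n (pact m v))) = b" "al m (pact m (pact n (pact m v))) = d - r"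
    "al m (pact n (pact m (pact n v))) = a" "al n (pact n (pact m (pact n v))) = e - c"
    using i swap by (simp_all add: p_i p_n al_i al_n flip: xy) (simp_all add: abc)
  have pp: "pact m (pact m v) = v" "pact n (pact n v) = v" for v
    using i by (auto simp: p_i p_n fun_eq_iff)
  have pp4: "pact m (pact n (pact m (pact n v))) = pact n (pact m (pact n (pact m v)))"
    using i by (auto simp: p_i p_n fun_eq_iff)
  have "ev v (T m (T n (T m (T n f)))) - ev v (T n (T m (T n (T m f)))) =
    ((tau m - a) * (c - b) * ev (pact m v) f + (tau n - b) * (a - r) * ev (pact n v) f
     + (tau m - a) * (tau n - c) * ev (pact n (pact m v)) f - (tau n - b) * (tau m - r) * ev (pact m (pact n v)) f)
    * (a * b - a * c - r * c - r * b + d * c + e * r)"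
    using i n2 by (simp add: ev_T_generic v gn al pp pp4) (simp add: algebra_simps)
  with rel show "ev v (T m (T n (T m (T n f)))) = ev v (T n (T m (T n (T m f))))"
    by simp
qed

end

section \<open>Inverses, and relations with multiplication by the variables\<close>

definition commuting :: "('b \<Rightarrow> 'b) \<Rightarrow> ('b \<Rightarrow> 'b) \<Rightarrow> bool" where
  "commuting A B \<longleftrightarrow> (\<forall>f. A (B f) = B (A f))"

lemma commuting_sym: "commuting A B \<Longrightarrow> commuting B A"
  by (simp add: commuting_def)

lemma commuting_inverse:
  assumes "commuting A B" "\<And>f. B (B' f) = f" "\<And>f. B' (B f) = f"
  shows "commuting A B'"
  using assms by (metis commuting_def)

context koornwinder_field
begin

text \<open>The inverse of \<open>T i\<close>, in the form that the quadratic relation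
  gives.\<close>

definition Ti :: "nat \<Rightarrow> 'a lpoly \<Rightarrow> 'a lpoly" where
  "Ti i f = T i f - Cst (del i) * f"

lemma T_Ti: "i \<le> n \<Longrightarrow> T i (Ti i f) = f"
  by (simp add: Ti_def T_diff T_cmul T_quadratic)

lemma Ti_T: "i \<le> n \<Longrightarrow> Ti i (T i f) = f"
  by (simp add: Ti_def T_quadratic)

lemma T_eq_Ti: "T i f = Ti i f + Cst (del i) * f"
  by (simp add: Ti_def)

lemma commuting_Ti: "i \<le> n \<Longrightarrow> commuting A (T i) \<Longrightarrow> commuting A (Ti i)"
  by (rule commuting_inverse[of A "T i"]) (auto simp: T_Ti Ti_T)

lemma commuting_T_T: "i \<le> n \<Longrightarrow> j \<le> n \<Longrightarrow> Suc i < j \<or> Suc j < i \<Longrightarrow> commuting (T i) (T j)"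
  using T_commute by (auto simp: commuting_def)

text \<open>Cross relation of the double affine Hecke algebra. The mixed terms cancel by
  \<open>a'\<close>, and what remains is the quadratic relation in the form
  \<open>q\<close>.\<close>

lemma T_X:
  assumes i: "0 < i" "i < n"
  shows "T i (Xp (Suc i) (-1) * T i f) = Xp i (-1) * f"
proof (rule generic_eqI)
  fix v assume v: "generic v"
  have nv: "v j \<noteq> 0" for j using v by (rule generic_nz)
  have g: "gd i v" using v i by (intro generic_gd) auto
  note p = al_pact[OF nv g]
  define x y d where xyd: "x = v i" "y = v (Suc i)" "d = del i"
  have ne: "x \<noteq> 0" "y \<noteq> 0" "y - x \<noteq> 0" using nv g i by (auto simp: xyd gd_def)
  define a where "a = al i v"
  have a: "a * (y - x) = d * y" using ne i by (simp add: a_def al_def flip: xyd)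
  have a': "a * inverse y + (d - a) * inverse x = 0" 
    using a ne by (simp add: field_simps)
  have pv: "pact i v (Suc i) = x" using i by (simp add: pact_def xyd)
  have dt: "d = tau i - inverse (tau i)" by (simp add: xyd del_def)
  have q: "(tau i - a) * (tau i - d + a) = 1 + a * (d - a)"
    unfolding dt using tau_nz[of i] by (simp add: field_simps)
  have "ev v (T i (Xp (Suc i) (-1) * T i f)) = inverse x * ev v f
     + ((tau i - a) * ev (pact i v) f + a * ev v f) * (a * inverse y + (d - a) * inverse x)
     + inverse x * ((tau i - a) * (tau i - d + a) - (1 + a * (d - a))) * ev v f"
    using ev_T[OF nv g] ev_T[of "pact i v" i] pact_nz[OF nv] p i nv
    by (simp add: power_int_minus pv flip: xyd a_def) (simp add: algebra_simps)
  then show "ev v (T i (Xp (Suc i) (-1) * T i f)) = ev v (Xp i (-1) * f)"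
    using nv by (simp add: a' q power_int_minus flip: xyd)
qed

lemma X_Ti: "0 < i \<Longrightarrow> i < n \<Longrightarrow> T i (Xp (Suc i) (-1) * f) = Xp i (-1) * Ti i f"
  using T_X[of i "Ti i f"] by (simp add: T_Ti)

lemma T_mult_X1: "2 \<le> i \<Longrightarrow> i \<le> n \<Longrightarrow> T i (Xp 1 k * f) = Xp 1 k * T i f"
  using T_mult_invariant[of i "Xp 1 k" f] by (simp add: pact_def mult.commute)

lemma T0_mult_X2: "T 0 (Xp 2 k * f) = Xp 2 k * T 0 f"
  using T_mult_invariant[of 0 "Xp 2 k" f] by (simp add: pact_def mult.commute)

text \<open>Says that \<open>x_n^(-1) T_n^(-1)\<close> satisfies the Hecke relation with parameter
  \<open>un\<close> in place of \<open>hn\<close>; it starts the induction of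
  \<open>U_quadratic\<close>.\<close>

lemma Xn_Tn: "Xp n 1 * T n (Xp n 1 * f) = Ti n f - Cst (un - inverse un) * (Xp n 1 * f)"
proof (rule generic_eqI)
  fix v assume v: "generic v"
  have nv: "v j \<noteq> 0" for j using v by (rule generic_nz)
  have g: "gd n v" using v n2 by (intro generic_gd) auto
  define x where "x = v n"
  define a where "a = al n v"
  have x: "x \<noteq> 0" "1 - x\<^sup>2 \<noteq> 0" using nv g n2 by (auto simp: x_def gd_def)
  have a: "a * x\<^sup>2 = a - del n - (un - inverse un) * x"
    using x n2 by (simp add: a_def al_def field_simps flip: x_def)
  have pv: "pact n v n = inverse x" using n2 by (simp add: pact_def x_def)
  have E: "ev v (Xp n 1 * T n (Xp n 1 * f)) = a * x\<^sup>2 * ev v f + (tau n - a) * ev (pact n v) f"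
    using ev_T[OF nv g, of "Xp n 1 * f"] pact_nz[OF nv] nv x
    by (simp add: pv flip: a_def x_def) (simp add: field_simps power2_eq_square)
  then show "ev v (Xp n 1 * T n (Xp n 1 * f)) = ev v (Ti n f - Cst (un - inverse un) * (Xp n 1 * f))"
  proof -
    have "ev v (Ti n f) = a * ev v f + (tau n - a) * ev (pact n v) f - del n * ev v f"
      using ev_T[OF nv g, of f] nv by (simp add: Ti_def a_def)
    moreover have "ev v (Cst (un - inverse un) * (Xp n 1 * f)) = (un - inverse un) * x * ev v f"
      using nv by (simp add: x_def)
    ultimately show ?thesis
      by (simp only: E ev_diff a) (simp add: algebra_simps)
  qed
qed

text \<open>Says that the inverse of \<open>hq x_1^(-1) T_0\<close> satisfies the Hecke relation
  with parameter \<open>u0\<close>. Later it also sharpens the bound on the support of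
  \<open>x_1^(-1) T_0\<close>.\<close>

lemma X1_T0: "Cst (hq\<^sup>2) * (Xp 1 (-1) * T 0 (Xp 1 (-1) * f)) = Ti 0 f - Cst (hq * (u0 - inverse u0)) * (Xp 1 (-1) * f)"
proof (rule generic_eqI)
  fix v assume v: "generic v" "(v 1)\<^sup>2 \<noteq> hq\<^sup>2"
  have nv: "v j \<noteq> 0" for j using v(1) by (rule generic_nz)
  have g: "gd 0 v" using v n2 by (simp add: gd_def)
  define x where "x = v (Suc 0)"
  define a where "a = al 0 v"
  have x: "x \<noteq> 0" "x\<^sup>2 - hq\<^sup>2 \<noteq> 0" using nv g n2 by (auto simp: x_def gd_def)
  have "a * (x\<^sup>2 - hq\<^sup>2) = del 0 * x\<^sup>2 + (u0 - inverse u0) * hq * x"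
    using x n2 unfolding a_def al_def x_def by simp
  then have a: "hq\<^sup>2 * a / x\<^sup>2 = a - del 0 - hq * (u0 - inverse u0) * inverse x"
  proof -
    assume "a * (x\<^sup>2 - hq\<^sup>2) = del 0 * x\<^sup>2 + (u0 - inverse u0) * hq * x"
    then have "hq\<^sup>2 * a = a * x\<^sup>2 - del 0 * x\<^sup>2 - hq * (u0 - inverse u0) * x"
      by (simp add: algebra_simps)
    also have "\<dots> = (a - del 0 - hq * (u0 - inverse u0) * inverse x) * x\<^sup>2"
    proof -
      have "inverse x * x\<^sup>2 = x" using x by (simp add: power2_eq_square)
      then show ?thesis by (simp add: left_diff_distrib mult.assoc)
    qed
    finally show ?thesis using x by simp
  qed
  have pv: "pact 0 v 1 = hq\<^sup>2 / x" using n2 by (simp add: pact_def x_def)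
  have E: "ev v (Cst (hq\<^sup>2) * (Xp 1 (-1) * T 0 (Xp 1 (-1) * f))) = hq\<^sup>2 * a / x\<^sup>2 * ev v f + (tau 0 - a) * ev (pact 0 v) f"
    using ev_T[OF nv g, of "Xp 1 (-1) * f"] pact_nz[OF nv] nv x pv
    by (simp add: power_int_minus flip: a_def x_def) (simp add: field_simps power2_eq_square)
  then show "ev v (Cst (hq\<^sup>2) * (Xp 1 (-1) * T 0 (Xp 1 (-1) * f))) = ev v (Ti 0 f - Cst (hq * (u0 - inverse u0)) * (Xp 1 (-1) * f))"
  proof -
    have "ev v (Ti 0 f) = a * ev v f + (tau 0 - a) * ev (pact 0 v) f - del 0 * ev v f"
      using ev_T[OF nv g, of f] nv by (simp add: Ti_def a_def)
    moreover have "ev v (Cst (hq * (u0 - inverse u0)) * (Xp 1 (-1) * f)) = hq * (u0 - inverse u0) * inverse x * ev v f"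
      using nv by (simp add: x_def power_int_minus)
    ultimately show ?thesis
      by (simp only: E ev_diff a) (simp add: algebra_simps)
  qed
qed

section \<open>The Cherednik operators\<close>

text \<open>Indexed by the distance from \<open>n\<close>, which makes the recursion for
  \<open>T_i ... T_n ... T_i\<close> structural.\<close>

fun zz :: "nat \<Rightarrow> 'a lpoly \<Rightarrow> 'a lpoly" where
  "zz 0 f = T n f"
| "zz (Suc k) f = T (n - Suc k) (zz k (T (n - Suc k) f))"

fun zi :: "nat \<Rightarrow> 'a lpoly \<Rightarrow> 'a lpoly" where
  "zi 0 f = Ti n f"
| "zi (Suc k) f = Ti (n - Suc k) (zi k (Ti (n - Suc k) f))"

fun gg :: "nat \<Rightarrow> 'a lpoly \<Rightarrow> 'a lpoly" where
  "gg 0 f = T 0 f"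
| "gg (Suc k) f = T (Suc k) (gg k (Ti (Suc k) f))"

definition Zd :: "nat \<Rightarrow> 'a lpoly \<Rightarrow> 'a lpoly" where "Zd i = zz (n - i)"
definition Zi :: "nat \<Rightarrow> 'a lpoly \<Rightarrow> 'a lpoly" where "Zi i = zi (n - i)"
definition G :: "nat \<Rightarrow> 'a lpoly \<Rightarrow> 'a lpoly" where "G i = gg (i - 1)"
text \<open>\<open>Y_i\<close> is grouped as \<open>(T_i ... T_n ... T_i) (T_(i-1) ... T_1 T_0
  T_1^(-1) ... T_(i-1)^(-1))\<close>: a lift of a finite reflection times a conjugate of
  \<open>T_0\<close>.\<close>

definition Y :: "nat \<Rightarrow> 'a lpoly \<Rightarrow> 'a lpoly" where "Y i f = Zd i (G i f)"
text \<open>A conjugate of \<open>x_n^(-1) T_n^(-1)\<close> by \<open>U_step\<close>, and chosen so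
  that \<open>U 1\<close> after \<open>Y 1\<close> is \<open>x_1^(-1) T_0\<close>.\<close>

definition U :: "nat \<Rightarrow> 'a lpoly \<Rightarrow> 'a lpoly" where "U i f = Xp i (-1) * Zi i f"

lemma Zd_n: "Zd n f = T n f"
  by (simp add: Zd_def)

lemma Zi_n: "Zi n f = Ti n f"
  by (simp add: Zi_def)

lemma Zd_step: "i < n \<Longrightarrow> Zd i f = T i (Zd (Suc i) (T i f))"
  unfolding Zd_def by (simp add: Suc_diff_Suc[symmetric])

lemma Zi_step: "i < n \<Longrightarrow> Zi i f = Ti i (Zi (Suc i) (Ti i f))"
  unfolding Zi_def by (simp add: Suc_diff_Suc[symmetric])

lemma G_1: "G (Suc 0) f = T 0 f"
  by (simp add: G_def)

lemma G_step: "0 < i \<Longrightarrow> G (Suc i) f = T i (G i (Ti i f))"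
  by (cases i) (simp_all add: G_def)

lemma zz_zi: "k \<le> n \<Longrightarrow> zz k (zi k f) = f \<and> zi k (zz k f) = f"
  by (induction k arbitrary: f) (auto simp: T_Ti Ti_T)

lemma Zd_Zi: "Zd i (Zi i f) = f" and Zi_Zd: "Zi i (Zd i f) = f"
  using zz_zi[of "n - i"] by (auto simp: Zd_def Zi_def)

lemma commuting_Zd:
  assumes "\<And>j. i \<le> j \<Longrightarrow> j \<le> n \<Longrightarrow> commuting A (T j)" "i \<le> n"
  shows "commuting A (Zd i)"
  using assms(2,1)
proof (induction i rule: inc_induct)
  case base
  then show ?case by (simp add: commuting_def Zd_n)
next
  case (step i)
  then have "commuting A (T i)" "commuting A (Zd (Suc i))" by auto
  then show ?case using step by (simp add: commuting_def Zd_step)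
qed

lemma commuting_Zi: "commuting A (Zd i) \<Longrightarrow> commuting A (Zi i)"
  by (rule commuting_inverse[of A "Zd i"]) (auto simp: Zi_Zd Zd_Zi)

lemma commuting_T_Zd_low: "Suc j < i \<Longrightarrow> i \<le> n \<Longrightarrow> commuting (T j) (Zd i)"
  by (rule commuting_Zd) (auto intro: commuting_T_T)

text \<open>\<open>Zd i\<close> lifts the reflection \<open>x_i \<mapsto> x_i^(-1)\<close>, which
  commutes with \<open>s_j\<close> for \<open>j > i\<close>. The case to work out is
  \<open>j = i + 1\<close>: the braid relation of length four if \<open>j = n\<close>, of length
  three otherwise.\<close>

lemma commuting_T_Zd:
  assumes "0 < i" "i < j" "j \<le> n"
  shows "commuting (T j) (Zd i)"
proof -
  have "i \<le> n" using assms by simp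
  then show ?thesis using assms
  proof (induction i rule: inc_induct)
    case (step i)
    show ?case
    proof (cases "j = Suc i")
      case False
      then have "commuting (T j) (T i)" "commuting (T j) (Zd (Suc i))"
        using step by (auto intro: commuting_T_T)
      then show ?thesis using step by (simp add: commuting_def Zd_step)
    next
      case j: True
      show ?thesis
      proof (cases "j = n")
        case True
        then show ?thesis
          using T_braid4[of i] j step.hyps by (simp add: commuting_def Zd_step Zd_n)
      next
        case False
        then have lt: "j < n" using step.prems by simp
        have c: "T i (Zd (Suc j) f) = Zd (Suc j) (T i f)" for f
          using commuting_T_Zd_low[of i "Suc j"] lt j by (simp add: commuting_def)
        have b: "T i (T j (T i f)) = T j (T i (T j f))" for f
          using T_braid3[of i] step j lt by simp
        have Z: "Zd i f = T i (T j (Zd (Suc j) (T j (T i f))))" for f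
          using step j lt by (simp add: Zd_step)
        show ?thesis
          unfolding commuting_def Z by (metis b c)
      qed
    qed
  qed simp
qed

lemma Y_Suc:
  assumes "0 < i" "i < n"
  shows "Y (Suc i) f = Ti i (Y i (Ti i f))"
  using assms by (simp add: Y_def Zd_step G_step Ti_T)

lemma commuting_T_Y1:
  assumes "2 \<le> j" "j \<le> n"
  shows "commuting (T j) (Y 1)"
  using commuting_T_Zd[of 1 j] commuting_T_T[of j 0] assms by (simp add: commuting_def Y_def G_1)

text \<open>Induction through \<open>Y_(i+1) = T_i^(-1) Y_i T_i^(-1)\<close>. In the inductive step
  the braid relation enters for \<open>j = i - 2\<close>: \<open>T_j\<close> is carried through
  \<open>T_k^(-1) T_j^(-1)\<close> and comes out as \<open>T_k\<close>, which commutes with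
  \<open>Y_j\<close>.\<close>

lemma commuting_T_Y:
  assumes "0 < j" "j \<le> n" "0 < i" "i \<le> n" "j \<noteq> i" "Suc j \<noteq> i"
  shows "commuting (T j) (Y i)"
  using assms
proof (induction i arbitrary: j rule: less_induct)
  case (less i j)
  show ?case
  proof (cases "i = 1")
    case True
    then show ?thesis using less.prems commuting_T_Y1[of j] by simp
  next
    case False
    then obtain k where k: "i = Suc k" "0 < k" using less.prems by (metis One_nat_def Suc_pred' neq0_conv)
    have Yi: "Y i f = Ti k (Y k (Ti k f))" for f
      using Y_Suc[of k f] k less.prems by simp
    show ?thesis
    proof (cases "Suc j = k")
      case False
      then have "commuting (T j) (T k)" "commuting (T j) (Y k)"
        using k less.prems less.IH[of k j] commuting_T_T[of j k] by (cases "k < j"; force)+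
      moreover from this have "commuting (T j) (Ti k)"
        using k less.prems by (intro commuting_Ti) auto
      ultimately show ?thesis
        by (simp add: commuting_def Yi)
    next
      case True
      then have j: "0 < j" "Suc j < n" using less.prems k by auto
      have b: "T j (T k (T j f)) = T k (T j (T k f))" for f
        using T_braid3[of j f] True j by simp
      have Yk: "Y k f = Ti j (Y j (Ti j f))" for f
        using Y_Suc[of j f] True j by simp
      have c: "T k (Y j f) = Y j (T k f)" for f
        using less.IH[of j k] k True less.prems by (simp add: commuting_def)
      have e: "T j (Ti k (Ti j f)) = Ti k (Ti j (T k f))" for f
      proof -
        have "T j (T k (T j (Ti k (Ti j f)))) = T k f"
          using b[of "Ti k (Ti j f)"] j True by (simp add: T_Ti)
        then show ?thesis
          by (metis True Ti_T j less_imp_le Suc_lessD)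
      qed
      have e': "Ti j (Ti k (T j f)) = T k (Ti j (Ti k f))" for f
        using b[of "Ti j (Ti k f)"] j True
        by (metis Suc_lessD T_Ti Ti_T less_imp_le)
      show ?thesis
        unfolding commuting_def
      proof
        fix f
        have "T j (Y i f) = T j (Ti k (Ti j (Y j (Ti j (Ti k f)))))"
          by (simp add: Yi Yk)
        also have "\<dots> = Ti k (Ti j (T k (Y j (Ti j (Ti k f)))))"
          by (simp add: e)
        also have "\<dots> = Ti k (Ti j (Y j (Ti j (Ti k (T j f)))))"
          by (simp add: c e')
        also have "\<dots> = Y i (T j f)"
          by (simp add: Yi Yk)
        finally show "T j (Y i f) = Y i (T j f)" .
      qed
    qed
  qed
qed

definition linear_op :: "('a lpoly \<Rightarrow> 'a lpoly) \<Rightarrow> bool" where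
  "linear_op A \<longleftrightarrow> (\<forall>f g. A (f + g) = A f + A g) \<and> (\<forall>c f. A (Cst c * f) = Cst c * A f)"

lemma linear_opD:
  assumes "linear_op A"
  shows "A (f + g) = A f + A g" "A (Cst c * f) = Cst c * A f" "A (f - g) = A f - A g"
proof -
  show a: "A (f + g) = A f + A g" and c: "A (Cst c * f) = Cst c * A f" for f g c
    using assms by (auto simp: linear_op_def)
  have "A (f - g) = A (f + Cst (-1) * g)" by (simp add: single_uminus)
  then show "A (f - g) = A f - A g" by (simp only: a c) (simp add: single_uminus)
qed

lemma linear_T: "linear_op (T i)"
  by (simp add: linear_op_def T_add T_cmul)

lemma linear_Ti: "linear_op (Ti i)"
  by (simp add: linear_op_def Ti_def T_add T_cmul ring_distribs mult.left_commute)

lemma linear_zz: "linear_op (zz k)" and linear_zi: "linear_op (zi k)" and linear_gg: "linear_op (gg k)"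
proof -
  show "linear_op (zz k)"
    using linear_T by (induction k) (auto simp: linear_op_def)
  show "linear_op (zi k)"
    using linear_Ti by (induction k) (auto simp: linear_op_def)
  show "linear_op (gg k)"
    using linear_T linear_Ti by (induction k) (auto simp: linear_op_def)
qed

lemma linear_Zd: "linear_op (Zd i)" and linear_Zi: "linear_op (Zi i)" and linear_G: "linear_op (G i)"
  by (simp_all add: Zd_def Zi_def G_def linear_zz linear_zi linear_gg)

lemma linear_Y: "linear_op (Y i)"
  using linear_Zd[of i] linear_G[of i] by (simp add: linear_op_def Y_def)

lemma linear_U: "linear_op (U i)"
  using linear_Zi[of i] by (simp add: linear_op_def U_def ring_distribs mult_ac)

lemma G_quadratic:
  assumes "0 < i" "i \<le> n"
  shows "G i (G i f) = Cst (del 0) * G i f + f"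
proof -
  have "0 < i \<Longrightarrow> i \<le> n \<Longrightarrow> G i (G i f) = Cst (del 0) * G i f + f" for f
  proof (induction i arbitrary: f)
    case (Suc i)
    show ?case
    proof (cases "i = 0")
      case True
      then show ?thesis by (simp add: G_1 T_quadratic)
    next
      case False
      then show ?thesis
        using Suc by (simp add: G_step Ti_T T_Ti T_add T_cmul)
    qed
  qed simp
  then show ?thesis using assms .
qed

lemma Tn_Yn: "Y n f = T n (G n f)"
  by (simp add: Y_def Zd_n)

lemma U_step:
  assumes "0 < i" "i < n"
  shows "U i f = T i (U (Suc i) (Ti i f))"
  using assms by (simp add: U_def X_Ti Zi_step)

lemma U_quadratic:
  assumes "0 < i" "i \<le> n"
  shows "U i (U i f) = Cst (un - inverse un) * U i f + f"
proof -
  have "U i (U i f) = Cst (un - inverse un) * U i f + f" for f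
    using assms(2,1)
  proof (induction i arbitrary: f rule: inc_induct)
    case base
    let ?g = "Cst (un - inverse un)"
    have X: "Xp n (-1) * (Xp n 1 * f) = f" "Xp n 1 * (Xp n (-1) * f) = f" for f :: "'a lpoly"
      by (simp_all add: mult_single flip: mult.assoc single_add)
    have TX: "Ti n (Xp n (-1) * Ti n f) = Xp n 1 * f + ?g * Ti n f" for f
    proof -
      have "Xp n (-1) * Ti n h = T n (Xp n 1 * h) + ?g * h" for h
        using arg_cong[OF Xn_Tn[of h], of "\<lambda>u. Xp n (-1) * u"]
        by (simp add: X right_diff_distrib mult.left_commute[of "Xp n (-1)" ?g])
      then have "Ti n (Xp n (-1) * Ti n f) = Ti n (T n (Xp n 1 * f) + ?g * f)" by simp
      also have "\<dots> = Xp n 1 * f + ?g * Ti n f"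
        by (simp add: linear_opD[OF linear_Ti] Ti_T)
      finally show ?thesis .
    qed
    show ?case
      by (simp add: U_def Zi_n TX ring_distribs X mult_ac(3))
  next
    case (step i)
    then show ?case by (simp add: U_step Ti_T T_add T_cmul T_Ti)
  qed
  then show ?thesis .
qed

definition R :: "'a lpoly \<Rightarrow> 'a lpoly" where
  "R f = Xp 1 (-1) * T 0 f"

lemma U_Y1: "U 1 (Y 1 f) = R f"
  by (simp add: U_def Y_def R_def Zi_Zd G_1)

lemma R_quadratic: "Cst (hq\<^sup>2) * R (R f) = f - Cst (hq * (u0 - inverse u0)) * R f"
  using X1_T0[of "T 0 f"] by (simp add: R_def Ti_T)

lemma commuting_X1_T: "2 \<le> j \<Longrightarrow> j \<le> n \<Longrightarrow> commuting (\<lambda>f. Xp 1 (-1) * f) (T j)"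
  using T_mult_X1[of j "-1"] by (simp add: commuting_def)

lemma commuting_U_T:
  assumes "2 \<le> j" "j \<le> n"
  shows "commuting (T j) (U 1)"
proof -
  have "commuting (T j) (Zi 1)"
    using assms by (intro commuting_Zi commuting_T_Zd) auto
  then show ?thesis
    using commuting_sym[OF commuting_X1_T[OF assms]] by (simp add: commuting_def U_def)
qed

text \<open>The common factor \<open>Zd 2\<close> is moved out on both sides; the rest is
  \<open>key\<close>, where \<open>x_1^(-1) T_1^(-1) = T_1 x_2^(-1)\<close> and \<open>T_0\<close>
  commutes with \<open>x_2\<close>.\<close>

lemma commuting_U_Y2: "commuting (U 1) (Y 2)"
  unfolding commuting_def
proof
  fix f
  have n1: "1 < n" "1 \<le> n" using n2 by auto
  let ?X = "\<lambda>f. Xp 1 (-1) * f"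
  have ZZ: "commuting (Zd 1) (Zd 2)"
    by (rule commuting_Zd, rule commuting_sym, rule commuting_T_Zd) (use n2 in auto)
  have c1: "Zi 1 (Zd 2 g) = Zd 2 (Zi 1 g)" for g
    using commuting_Zi[of "Zd 2" 1] ZZ by (auto simp: commuting_def)
  have c2: "Zi 2 (T 0 g) = T 0 (Zi 2 g)" for g
    using commuting_Zi[of "T 0" 2] commuting_T_Zd_low[of 0 2] n2 by (simp add: commuting_def)
  have c3: "?X (Zd 2 g) = Zd 2 (?X g)" for g
    using commuting_Zd[of 2 ?X] commuting_X1_T n2 by (simp add: commuting_def)
  have Y2: "Y 2 g = Zd 2 (T 1 (T 0 (Ti 1 g)))" for g
    using G_step[of 1 g] by (simp add: Y_def G_1 numeral_2_eq_2)
  have Zi1: "Zi 1 g = Ti 1 (Zi 2 (Ti 1 g))" for g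
    using Zi_step[of 1 g] n1 by (simp add: numeral_2_eq_2)
  have key: "?X (Ti 1 (T 0 g)) = T 1 (T 0 (Ti 1 (?X (Ti 1 g))))" for g
  proof -
    have X: "?X (Ti 1 h) = T 1 (Xp 2 (-1) * h)" for h
      using X_Ti[of 1 h] n1 by (simp add: numeral_2_eq_2)
    show ?thesis
      unfolding X using n1 by (simp add: Ti_T T0_mult_X2)
  qed
  have "U 1 (Y 2 f) = ?X (Zi 1 (Zd 2 (T 1 (T 0 (Ti 1 f)))))"
    by (simp add: U_def Y2)
  also have "\<dots> = Zd 2 (?X (Zi 1 (T 1 (T 0 (Ti 1 f)))))"
    unfolding c1 c3 ..
  also have "\<dots> = Zd 2 (?X (Ti 1 (T 0 (Zi 2 (Ti 1 f)))))"
    unfolding Zi1 using n1 by (simp add: Ti_T c2)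
  also have "\<dots> = Zd 2 (T 1 (T 0 (Ti 1 (?X (Zi 1 f)))))"
    unfolding key Zi1 ..
  finally show "U 1 (Y 2 f) = Y 2 (U 1 f)"
    by (simp add: U_def Y2)
qed

lemma commuting_U_Y:
  assumes "2 \<le> i" "i \<le> n"
  shows "commuting (U 1) (Y i)"
  using assms
proof (induction i rule: dec_induct)
  case base
  show ?case by (rule commuting_U_Y2)
next
  case (step i)
  then have "commuting (U 1) (Ti i)"
    by (intro commuting_Ti commuting_sym[OF commuting_U_T]) auto
  then show ?case
    using step by (simp add: commuting_def Y_Suc)
qed

end

section \<open>Intertwiners\<close>

context koornwinder_field
begin

definition eig :: "(nat \<Rightarrow> 'a) \<Rightarrow> 'a lpoly \<Rightarrow> bool" where
  "eig y f \<longleftrightarrow> (\<forall>i\<in>{1..n}. Y i f = Cst (y i) * f)"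

definition yact :: "nat \<Rightarrow> (nat \<Rightarrow> 'a) \<Rightarrow> nat \<Rightarrow> 'a" where
  "yact i y = (if i = 0 then y(1 := inverse (hq\<^sup>2 * y 1))
     else if i < n then y(i := y (Suc i), Suc i := y i)
     else y(n := inverse (y n)))"

definition kden :: "nat \<Rightarrow> (nat \<Rightarrow> 'a) \<Rightarrow> 'a" where
  "kden i y = (if i = 0 then hq\<^sup>2 * (y 1)\<^sup>2 - 1
     else if i < n then y (Suc i) - y i else 1 - (y n)\<^sup>2)"

text \<open>On the span of \<open>f\<close> and its image under the generator, the relevant
  \<open>Y\<close> is triangular; \<open>kap\<close> is the constant that produces its second
  eigenvector. For \<open>i = 0\<close> the Hecke relations of \<open>R\<close> and
  \<open>U 1\<close>, with parameters \<open>u0\<close> and \<open>un\<close>, play the part of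
  those with \<open>hn\<close> and \<open>h0\<close>.\<close>

definition kap :: "nat \<Rightarrow> (nat \<Rightarrow> 'a) \<Rightarrow> 'a" where
  "kap i y = (if i = 0 then hq * (u0 - inverse u0) * y 1 + (un - inverse un)
     else if i < n then del i * y i
     else y n * (y n * del n + del 0)) / kden i y"

text \<open>On eigenvectors \<open>y_1^(-1) R\<close> agrees with \<open>U 1\<close>
  (\<open>sop_0\<close>), which commutes with \<open>Y_2, ..., Y_n\<close>; but \<open>R\<close>
  involves the first variable only, so its support is easy to bound.\<close>

definition sop :: "nat \<Rightarrow> (nat \<Rightarrow> 'a) \<Rightarrow> 'a lpoly \<Rightarrow> 'a lpoly" where
  "sop i y f = (if i = 0 then Cst (inverse (y 1)) * R f else T i f)"

definition step :: "nat \<Rightarrow> (nat \<Rightarrow> 'a) \<Rightarrow> 'a lpoly \<Rightarrow> 'a lpoly" where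
  "step i y f = sop i y f + Cst (kap i y) * f"

lemma eigD: "eig y f \<Longrightarrow> 0 < i \<Longrightarrow> i \<le> n \<Longrightarrow> Y i f = Cst (y i) * f"
  by (auto simp: eig_def)

lemma R_cmul: "R (Cst c * f) = Cst c * R f"
  by (simp add: R_def T_cmul mult.left_commute)

lemma cmul_eqI:
  fixes f g :: "'a lpoly"
  assumes "\<And>m. Poly_Mapping.lookup f m = Poly_Mapping.lookup g m"
  shows "f = g"
  using assms by (rule poly_mapping_eqI)

lemma Cst_Cst: "Cst a * (Cst b * f) = Cst (a * b) * (f :: 'a lpoly)"
  by (simp add: mult_single flip: mult.assoc)

lemma eig_step_mid:
  assumes e: "eig y f" and i: "0 < i" "i < n" and d: "kden i y \<noteq> 0"
  shows "eig (yact i y) (step i y f)"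
  unfolding eig_def
proof
  fix j assume "j \<in> {1..n}"
  then have j: "0 < j" "j \<le> n" by auto
  have ii: "i \<le> n" "0 < Suc i" "Suc i \<le> n" using i by auto
  have d': "y (Suc i) - y i \<noteq> 0" using d i by (simp add: kden_def)
  have k: "kap i y * (y (Suc i) - y i) = del i * y i" using d' i by (simp add: kap_def kden_def)
  have st: "step i y f = T i f + Cst (kap i y) * f" using i by (simp add: step_def sop_def)
  note lin = linear_opD[OF linear_Y] linear_opD[OF linear_T] linear_opD[OF linear_Ti]
  have Y1: "Y (Suc i) (T i f) = Cst (y i) * (T i f - Cst (del i) * f)"
    using i ii by (simp add: Y_Suc Ti_T eigD[OF e i(1) ii(1)] lin) (simp add: Ti_def)
  have YT: "Y i g = T i (Y (Suc i) (T i g))" for g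
    using i ii by (simp add: Y_Suc Ti_T T_Ti)
  \<comment> \<open>Since \<open>Y_i = T_i Y_(i+1) T_i\<close>, the quadratic relation of
    \<open>T_i\<close> expresses the result through \<open>f\<close> and \<open>T_i f\<close>
    alone.\<close>
  have Y0: "Y i (T i f) = Cst (del i * y i) * f + Cst (y (Suc i)) * T i f"
  proof -
    have "Y i (T i f) = Cst (del i) * T i (Y (Suc i) (T i f)) + T i (Y (Suc i) f)"
      using ii by (simp add: YT[of "T i f"] T_quadratic lin)
    also have "T i (Y (Suc i) (T i f)) = Cst (y i) * f"
      using YT[of f] eigD[OF e i(1) ii(1)] by simp
    finally show ?thesis
      using eigD[OF e ii(2,3)] by (simp add: lin Cst_Cst)
  qed
  consider "j = i" | "j = Suc i" | "j \<noteq> i" "j \<noteq> Suc i" by blast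
  then show "Y j (step i y f) = Cst (yact i y j) * step i y f"
  proof cases
    case 1
    have "Y i (step i y f) = Cst (y (Suc i)) * step i y f"
      unfolding st lin Y0 eigD[OF e i(1) ii(1)]
    proof (rule cmul_eqI)
      fix m
      have "del i * y i = kap i y * y (Suc i) - kap i y * y i" using k by (simp add: algebra_simps)
      then show "Poly_Mapping.lookup (Cst (del i * y i) * f + Cst (y (Suc i)) * T i f + Cst (kap i y) * (Cst (y i) * f)) m =
         Poly_Mapping.lookup (Cst (y (Suc i)) * (T i f + Cst (kap i y) * f)) m"
        by (simp add: lookup_add) (simp add: algebra_simps)
    qed
    then show ?thesis using 1 i by (simp add: yact_def)
  next
    case 2
    have "Y (Suc i) (step i y f) = Cst (y i) * step i y f"
      unfolding st lin Y1 eigD[OF e ii(2,3)]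
    proof (rule cmul_eqI)
      fix m
      have k': "y i * del i = kap i y * y (Suc i) - kap i y * y i" using k by (simp add: algebra_simps)
      show "Poly_Mapping.lookup (Cst (y i) * (T i f - Cst (del i) * f) + Cst (kap i y) * (Cst (y (Suc i)) * f)) m =
         Poly_Mapping.lookup (Cst (y i) * (T i f + Cst (kap i y) * f)) m"
        using arg_cong[OF k', of "\<lambda>c. c * Poly_Mapping.lookup f m"]
        by (simp only: lookup_add lookup_minus lookup_cmul) (simp add: algebra_simps)
    qed
    then show ?thesis using 2 i by (simp add: yact_def)
  next
    case 3
    then have "Y j (T i f) = T i (Y j f)"
      using commuting_T_Y[of i j] i j by (simp add: commuting_def)
    then have "Y j (step i y f) = Cst (y j) * step i y f"
      unfolding st lin eigD[OF e j] by (simp add: lin ring_distribs mult.left_commute)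
    then show ?thesis using 3 i by (simp add: yact_def)
  qed
qed

text \<open>\<open>Y_n = T_n G_n\<close>, where the factors satisfy Hecke relations with parameters
  \<open>hn\<close> and \<open>h0\<close>; so the span of \<open>f\<close> and \<open>T_n f\<close>
  is stable and a rank-one computation remains.\<close>

lemma eig_step_n:
  assumes e: "eig y f" and d: "kden n y \<noteq> 0" and y0: "y n \<noteq> 0"
  shows "eig (yact n y) (step n y f)"
  unfolding eig_def
proof
  fix j assume "j \<in> {1..n}"
  then have j: "0 < j" "j \<le> n" by auto
  have n: "0 < n" "n \<noteq> 0" using n2 by auto
  have k: "kap n y * (1 - (y n)\<^sup>2) = y n * (y n * del n + del 0)" using d n by (simp add: kap_def kden_def)
  have st: "step n y f = T n f + Cst (kap n y) * f" using n by (simp add: step_def sop_def)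
  note lin = linear_opD[OF linear_Y] linear_opD[OF linear_T] linear_opD[OF linear_Ti] linear_opD[OF linear_G]
  note ef = eigD[OF e n(1) order_refl]
  show "Y j (step n y f) = Cst (yact n y j) * step n y f"
  proof (cases "j = n")
    case True
    have Gf: "G n f = Cst (y n) * Ti n f"
      using arg_cong[OF ef, of "Ti n"] n by (simp add: Tn_Yn Ti_T lin)
    have GG: "Cst (y n) * G n (Ti n f) = Cst (del 0) * (Cst (y n) * Ti n f) + f"
      using G_quadratic[of n f] n by (simp add: Gf lin)
    have GT: "G n (Ti n f) = Cst (del 0) * Ti n f + Cst (inverse (y n)) * f"
    proof (rule cmul_eqI)
      fix m
      have "y n * Poly_Mapping.lookup (G n (Ti n f)) m
          = del 0 * (y n * Poly_Mapping.lookup (Ti n f) m) + Poly_Mapping.lookup f m"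
        using arg_cong[OF GG, of "\<lambda>h. Poly_Mapping.lookup h m"] by (simp add: lookup_add)
      then show "Poly_Mapping.lookup (G n (Ti n f)) m = Poly_Mapping.lookup (Cst (del 0) * Ti n f + Cst (inverse (y n)) * f) m"
        using y0 by (simp only: lookup_add lookup_cmul) (simp add: field_simps)
    qed
    have "G n (T n f) = G n (Ti n f + Cst (del n) * f)"
      by (simp add: T_eq_Ti)
    also have "\<dots> = Cst (del 0) * Ti n f + Cst (inverse (y n)) * f + Cst (del n) * (Cst (y n) * Ti n f)"
      by (simp add: lin GT Gf)
    finally have "Y n (T n f) = Cst (del 0) * f + Cst (inverse (y n)) * T n f + Cst (del n) * (Cst (y n) * f)"
      by (simp add: Tn_Yn lin T_Ti)
    then have "Y n (step n y f) = Cst (inverse (y n)) * step n y f"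
      unfolding st lin ef
    proof (intro cmul_eqI)
      fix m
      assume a: "Y n (T n f) = Cst (del 0) * f + Cst (inverse (y n)) * T n f + Cst (del n) * (Cst (y n) * f)"
      have "inverse (y n) * kap n y = inverse (y n) * (kap n y * (1 - (y n)\<^sup>2)) + kap n y * y n"
        using y0 by (simp add: field_simps power2_eq_square)
      also have "inverse (y n) * (kap n y * (1 - (y n)\<^sup>2)) = y n * del n + del 0"
        unfolding k using y0 by simp
      finally have k': "inverse (y n) * kap n y = y n * del n + del 0 + kap n y * y n" .
      show "Poly_Mapping.lookup (Y n (T n f) + Cst (kap n y) * (Cst (y n) * f)) m =
        Poly_Mapping.lookup (Cst (inverse (y n)) * (T n f + Cst (kap n y) * f)) m"
        using arg_cong[OF k', of "\<lambda>c. c * Poly_Mapping.lookup f m"]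
        by (simp only: lookup_add a lookup_cmul) (simp add: algebra_simps)
    qed
    then show ?thesis using True n by (simp add: yact_def)
  next
    case False
    then have "Y j (T n f) = T n (Y j f)"
      using commuting_T_Y[of n j] n j by (simp add: commuting_def)
    then have "Y j (step n y f) = Cst (y j) * step n y f"
      unfolding st lin eigD[OF e j] by (simp add: lin ring_distribs mult.left_commute)
    then show ?thesis using False n by (simp add: yact_def)
  qed
qed

lemma sop_0: "eig y f \<Longrightarrow> y 1 \<noteq> 0 \<Longrightarrow> sop 0 y f = U 1 f"
proof -
  assume e: "eig y f" and y0: "y 1 \<noteq> 0"
  have "R f = Cst (y 1) * U 1 f"
    using U_Y1[of f] eigD[OF e, of 1] n2 by (simp add: linear_opD[OF linear_U])
  then show "sop 0 y f = U 1 f"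
    using y0 by (simp add: sop_def Cst_Cst)
qed

text \<open>The same rank-one computation for \<open>R = U_1 Y_1\<close>: the quadratic relations of
  \<open>R\<close> and \<open>U_1\<close> determine \<open>Y_1\<close> on the span of
  \<open>f\<close> and \<open>U_1 f\<close>, and \<open>U_1\<close> commutes with the other
  \<open>Y_j\<close>.\<close>

lemma eig_step_0:
  assumes e: "eig y f" and d: "kden 0 y \<noteq> 0" and y0: "y 1 \<noteq> 0"
  shows "eig (yact 0 y) (step 0 y f)"
  unfolding eig_def
proof
  fix j assume "j \<in> {1..n}"
  then have j: "0 < j" "j \<le> n" by auto
  have n: "0 < (1::nat)" "1 \<le> n" using n2 by auto
  have k: "kap 0 y * (hq\<^sup>2 * (y 1)\<^sup>2 - 1) = hq * (u0 - inverse u0) * y 1 + (un - inverse un)"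
    using d by (simp add: kap_def kden_def)
  define u where "u = U 1 f"
  have st: "step 0 y f = u + Cst (kap 0 y) * f"
    using sop_0[OF e y0] by (simp add: step_def u_def)
  note lin = linear_opD[OF linear_Y] linear_opD[OF linear_U]
  note ef = eigD[OF e n]
  show "Y j (step 0 y f) = Cst (yact 0 y j) * step 0 y f"
  proof (cases "j = 1")
    case True
    define g where "g = un - inverse un"
    define v where "v = hq * (u0 - inverse u0)"
    have Rf: "R f = Cst (y 1) * u"
      using U_Y1[of f] ef by (simp add: lin u_def)
    have RR: "Cst (hq\<^sup>2) * R (R f) = Cst (hq\<^sup>2 * y 1) * U 1 (Y 1 u)"
      using U_Y1[of u] by (simp add: Rf Cst_Cst R_cmul)
    have Uu: "U 1 u = Cst g * u + f"
      unfolding u_def g_def using n by (intro U_quadratic) auto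
    have UY: "Cst (hq\<^sup>2 * y 1) * U 1 (Y 1 u) = f - Cst v * (Cst (y 1) * u)"
      using R_quadratic[of f] unfolding RR by (simp add: Rf v_def)
    \<comment> \<open>Applying \<open>U 1\<close> once more lets its own quadratic relation isolate
      \<open>Y 1 u\<close>.\<close>
    have "Cst (hq\<^sup>2 * y 1) * U 1 (U 1 (Y 1 u)) = u - Cst v * (Cst (y 1) * (Cst g * u + f))"
      using arg_cong[OF UY, of "U 1"] unfolding lin Uu by (simp add: u_def)
    moreover have "U 1 (U 1 (Y 1 u)) = Cst g * U 1 (Y 1 u) + Y 1 u"
      unfolding g_def using n by (intro U_quadratic) auto
    ultimately have E: "Cst (hq\<^sup>2 * y 1) * (Cst g * U 1 (Y 1 u) + Y 1 u) = u - Cst v * (Cst (y 1) * (Cst g * u + f))"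
      by simp
    have main: "hq\<^sup>2 * y 1 * Poly_Mapping.lookup (Y 1 u) m =
       Poly_Mapping.lookup u m - (v * y 1 + g) * Poly_Mapping.lookup f m" for m
    proof -
      define F u' w W where d: "F = Poly_Mapping.lookup f m" "u' = Poly_Mapping.lookup u m"
        "w = Poly_Mapping.lookup (Y 1 u) m" "W = Poly_Mapping.lookup (U 1 (Y 1 u)) m"
      have 1: "hq\<^sup>2 * y 1 * W = F - v * (y 1 * u')"
        using arg_cong[OF UY, of "\<lambda>h. Poly_Mapping.lookup h m"] unfolding d by (simp only: lookup_minus lookup_cmul)
      have "hq\<^sup>2 * y 1 * (g * W + w) = u' - v * (y 1 * (g * u' + F))"
        using arg_cong[OF E, of "\<lambda>h. Poly_Mapping.lookup h m"] unfolding d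
        by (simp only: lookup_add lookup_minus lookup_cmul)
      then have "hq\<^sup>2 * y 1 * w = u' - v * (y 1 * (g * u' + F)) - g * (hq\<^sup>2 * y 1 * W)"
        by (simp add: algebra_simps)
      then show ?thesis
        unfolding 1 by (simp add: algebra_simps d)
    qed
    have "Y 1 (step 0 y f) = Cst (inverse (hq\<^sup>2 * y 1)) * step 0 y f"
      unfolding st lin ef
    proof (rule cmul_eqI)
      fix m
      define F u' w where "F = Poly_Mapping.lookup f m" "u' = Poly_Mapping.lookup u m" "w = Poly_Mapping.lookup (Y 1 u) m"
      have q0: "hq\<^sup>2 * y 1 \<noteq> 0" using y0 by simp
      have "hq\<^sup>2 * y 1 * w = u' - (v * y 1 + g) * F" using main[of m] by (simp add: F_u'_w_def)
      moreover have "v * y 1 + g = kap 0 y * (hq\<^sup>2 * (y 1)\<^sup>2 - 1)" using k by (simp add: v_def g_def)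
      ultimately have "hq\<^sup>2 * y 1 * w = u' - kap 0 y * (hq\<^sup>2 * (y 1)\<^sup>2 - 1) * F"
        by simp
      then have "hq\<^sup>2 * y 1 * (w + kap 0 y * (y 1 * F)) = u' + kap 0 y * F"
        by (simp add: algebra_simps power2_eq_square)
      then have "w + kap 0 y * (y 1 * F) = inverse (hq\<^sup>2 * y 1) * (u' + kap 0 y * F)"
        using q0 by (metis mult.assoc left_inverse mult.left_neutral)
      then show "Poly_Mapping.lookup (Y 1 u + Cst (kap 0 y) * (Cst (y 1) * f)) m =
        Poly_Mapping.lookup (Cst (inverse (hq\<^sup>2 * y 1)) * (u + Cst (kap 0 y) * f)) m"
        by (simp only: lookup_add lookup_cmul F_u'_w_def)
    qed
    then show ?thesis using True by (simp add: yact_def)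
  next
    case False
    then have "Y j u = U 1 (Y j f)"
      using commuting_U_Y[of j] j by (simp add: commuting_def u_def)
    then have "Y j (step 0 y f) = Cst (y j) * step 0 y f"
      unfolding st lin eigD[OF e j] by (simp add: lin ring_distribs mult.left_commute u_def)
    then show ?thesis using False by (simp add: yact_def)
  qed
qed

lemma eig_step:
  assumes "eig y f" "kden i y \<noteq> 0" "\<And>j. y j \<noteq> 0" "i \<le> n"
  shows "eig (yact i y) (step i y f)"
proof -
  consider "i = 0" | "0 < i" "i < n" | "i = n" using assms(4) by linarith
  then show ?thesis
    by cases (use assms eig_step_0 eig_step_mid eig_step_n in auto)
qed

section \<open>The constant eigenfunction and evaluation at the base point\<close>

lemma T_one: "T i 1 = Cst (tau i)"
proof -
  have "dd (zc i) (beta i) (lf i) 1 = 0"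
    by (simp add: dd_def lf_def dd_exps_def flip: single_one)
  then show ?thesis by (simp add: T_def dl_def)
qed

lemma Ti_one: "Ti i 1 = Cst (inverse (tau i))"
  by (simp add: Ti_def T_one del_def single_diff)

lemma T_Cst: "T i (Cst c) = Cst (tau i * c)"
  using T_cmul[of i c 1] by (simp add: T_one mult_single mult.commute)

lemma Ti_Cst: "Ti i (Cst c) = Cst (inverse (tau i) * c)"
  using linear_opD(2)[OF linear_Ti, of i c 1] by (simp add: Ti_one mult_single mult.commute)

lemma Y_one:
  assumes "0 < i" "i \<le> n"
  shows "Y i 1 = Cst (ht ^ (2 * (n - i)) * hn * h0)"
proof -
  have "gg k (Cst c) = Cst (h0 * c)" if "k < n" for k c
    using that by (induction k arbitrary: c) (auto simp: T_Cst Ti_Cst tau_def field_simps)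
  then have G: "G i 1 = Cst h0"
    using assms by (simp add: G_def flip: single_one)
  have "zz k (Cst c) = Cst (ht ^ (2 * k) * hn * c)" if "k < n" for k c
    using that n2 by (induction k arbitrary: c) (auto simp: T_Cst tau_def power2_eq_square algebra_simps)
  then show ?thesis
    unfolding Y_def G Zd_def using assms by simp
qed

text \<open>Evaluation at a common fixed character of \<open>T\<^sub>1, \<dots>, T\<^sub>n\<close> and \<open>U\<close>.\<close>

definition base_pt :: "nat \<Rightarrow> 'a" where
  "base_pt i = (if i \<in> {1..n} then inverse (ht ^ (2 * (n - i)) * hn * un) else 1)"

lemma base_pt_nz: "base_pt i \<noteq> 0"
  by (simp add: base_pt_def)

text \<open>At \<open>base_pt\<close> the numerators of the operators vanish: neighbouring
  coordinates have ratio \<open>ht^2\<close>, and the last one is \<open>1 / (hn un)\<close>. Hence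
  the reflected value gets coefficient 0. The hypotheses keep the point off the mirrors.\<close>

lemma ev_T_base:
  assumes i: "0 < i" "i \<le> n" and ht: "ht\<^sup>2 \<noteq> 1" and a: "(hn * un)\<^sup>2 \<noteq> 1"
  shows "ev base_pt (T i f) = tau i * ev base_pt f"
proof (cases "i < n")
  case True
  have r: "base_pt (Suc i) = ht\<^sup>2 * base_pt i"
  proof -
    have "2 * (n - i) = 2 + 2 * (n - Suc i)" using True by simp
    then have "ht ^ (2 * (n - i)) = ht\<^sup>2 * ht ^ (2 * (n - Suc i))" by (metis power_add)
    then show ?thesis using True i by (simp add: base_pt_def)
  qed
  have g: "gd i base_pt" using True i ht base_pt_nz[of i] by (simp add: gd_def r)
  have d: "base_pt (Suc i) - base_pt i = (ht\<^sup>2 - 1) * base_pt i" by (simp add: r algebra_simps)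
  have "al i base_pt = del i * ht\<^sup>2 / (ht\<^sup>2 - 1)"
    using True i ht base_pt_nz[of i] by (simp add: al_def d) (simp add: r)
  also have "\<dots> = tau i"
    using True i ht by (simp add: del_def tau_def field_simps power2_eq_square)
  finally show ?thesis
    using ev_T[OF base_pt_nz g] by simp
next
  case False
  then have i: "i = n" using i by simp
  have b: "base_pt n = inverse (hn * un)" using n2 by (simp add: base_pt_def)
  have "(base_pt n)\<^sup>2 * (hn * un)\<^sup>2 = 1"
    by (simp add: b del: power_mult_distrib inverse_mult_distrib flip: power_mult_distrib)
  then have g: "gd n base_pt" using n2 a by (auto simp: gd_def)
  have d: "1 - (base_pt n)\<^sup>2 = ((hn * un)\<^sup>2 - 1) / (hn * un)\<^sup>2"
    by (simp add: b field_simps)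
  have "del n + (un - inverse un) * base_pt n = hn * ((hn * un)\<^sup>2 - 1) / (hn * un)\<^sup>2"
    using n2 by (simp add: b del_def tau_def field_simps power2_eq_square)
  then have "al n base_pt = tau n"
    using n2 a by (simp add: al_def d tau_def)
  then show ?thesis
    using ev_T[OF base_pt_nz g] i by simp
qed

lemma ev_Ti_base:
  assumes i: "0 < i" "i \<le> n" and ht: "ht\<^sup>2 \<noteq> 1" and a: "(hn * un)\<^sup>2 \<noteq> 1"
  shows "ev base_pt (Ti i f) = inverse (tau i) * ev base_pt f"
  using ev_T_base[OF assms, of f] by (simp add: Ti_def base_pt_nz del_def algebra_simps)

text \<open>The scalars by which the inverse operators in \<open>Zi 1\<close> act cancel against the
  value of \<open>x_1^(-1)\<close> at \<open>base_pt\<close>, leaving \<open>un\<close>.\<close>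

lemma ev_U_base:
  assumes ht: "ht\<^sup>2 \<noteq> 1" and a: "(hn * un)\<^sup>2 \<noteq> 1"
  shows "ev base_pt (U 1 f) = un * ev base_pt f"
proof -
  have "ev base_pt (zi k f) = inverse (ht ^ (2 * k) * hn) * ev base_pt f" if "k < n" for k f
    using that n2 by (induction k arbitrary: f)
      (auto simp: ev_Ti_base[OF _ _ ht a] tau_def power2_eq_square)
  then have "ev base_pt (Zi 1 f) = inverse (ht ^ (2 * (n - 1)) * hn) * ev base_pt f"
    using n2 by (simp add: Zi_def)
  then show ?thesis
    using n2 by (simp add: U_def base_pt_nz power_int_minus) (simp add: base_pt_def field_simps)
qed

lemma ev_step_base:
  assumes "eig y f" "y 1 \<noteq> 0" "i \<le> n" and ht: "ht\<^sup>2 \<noteq> 1" and a: "(hn * un)\<^sup>2 \<noteq> 1"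
  shows "ev base_pt (step i y f) = ((if i = 0 then un else tau i) + kap i y) * ev base_pt f"
  using assms sop_0[OF assms(1,2)] ev_U_base[OF ht a, of f]
  by (cases "i = 0") (auto simp: step_def ev_T_base base_pt_nz sop_def[of i] ring_distribs)

end

section \<open>Signed permutations and the weights \<open>\<rho>(\<lambda>)\<close>\<close>

lemma signed_permsD:
  assumes "w \<in> signed_perms n"
  shows "w (- k) = - w k" "w 0 = 0" "inj w" "surj w" "\<bar>k\<bar> \<le> int n \<Longrightarrow> \<bar>w k\<bar> \<le> int n"
    "\<not> \<bar>k\<bar> \<le> int n \<Longrightarrow> w k = k" "w k = 0 \<longleftrightarrow> k = 0"
proof -
  have p: "w permutes {- int n..int n}" and o: "\<And>k. w (- k) = - w k"
    using assms by (auto simp: signed_perms_def)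
  show "w (- k) = - w k" by (rule o)
  show w0: "w 0 = 0" using o[of 0] by simp
  show i: "inj w" "surj w" using p permutes_inj permutes_surj by blast+
  show "\<bar>k\<bar> \<le> int n \<Longrightarrow> \<bar>w k\<bar> \<le> int n" using permutes_in_image[OF p, of k] by auto
  show "\<not> \<bar>k\<bar> \<le> int n \<Longrightarrow> w k = k" by (rule permutes_not_in[OF p]) (auto simp: abs_le_iff)
  show "w k = 0 \<longleftrightarrow> k = 0" using w0 i by (metis injD)
qed

lemma bij_betw_obtain: "bij_betw p A A \<Longrightarrow> j \<in> A \<Longrightarrow> \<exists>i\<in>A. j = p i"
  unfolding bij_betw_def by blast

lemma signed_perms_comp: "w \<in> signed_perms n \<Longrightarrow> u \<in> signed_perms n \<Longrightarrow> w \<circ> u \<in> signed_perms n"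
  by (auto simp: signed_perms_def intro: permutes_compose)

lemma signed_perms_inv:
  assumes "w \<in> signed_perms n"
  shows "inv_into UNIV w \<in> signed_perms n"
proof -
  have p: "w permutes {- int n..int n}" using assms by (simp add: signed_perms_def)
  have "inv_into UNIV w (- k) = - inv_into UNIV w k" for k
    by (rule inv_f_eq[OF signed_permsD(3)[OF assms]])
       (simp add: signed_permsD(1)[OF assms] permutes_inverses[OF p])
  then show ?thesis using permutes_inv[OF p] by (simp add: signed_perms_def)
qed

lemma abs_perm_bij:
  assumes "w \<in> signed_perms n"
  shows "bij_betw (\<lambda>i. nat \<bar>w (int i)\<bar>) {1..n} {1..n}"
proof -
  have inj: "inj_on (\<lambda>i. nat \<bar>w (int i)\<bar>) {1..n}"
  proof (rule inj_onI)
    fix i j :: nat assume ij: "i \<in> {1..n}" "j \<in> {1..n}" "nat \<bar>w (int i)\<bar> = nat \<bar>w (int j)\<bar>"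
    then have "\<bar>w (int i)\<bar> = \<bar>w (int j)\<bar>" by simp
    then have "w (int i) = w (int j) \<or> w (int i) = w (- int j)"
      unfolding signed_permsD(1)[OF assms, of "int j"] by (simp add: abs_eq_iff)
    then have "int i = int j \<or> int i = - int j"
      using injD[OF signed_permsD(3)[OF assms]] by blast
    with ij show "i = j" by auto
  qed
  have sub: "(\<lambda>i. nat \<bar>w (int i)\<bar>) ` {1..n} \<subseteq> {1..n}"
  proof
    fix j assume "j \<in> (\<lambda>i. nat \<bar>w (int i)\<bar>) ` {1..n}"
    then obtain i where i: "i \<in> {1..n}" "j = nat \<bar>w (int i)\<bar>" by auto
    then show "j \<in> {1..n}"
      using signed_permsD(5)[OF assms, of "int i"] signed_permsD(7)[OF assms, of "int i"] by auto
  qed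
  then show ?thesis
    using inj by (simp add: bij_betw_def endo_inj_surj)
qed

lemma lookup_act:
  assumes w: "w \<in> signed_perms n" and i: "i \<in> {1..n}"
  shows "Poly_Mapping.lookup (act n w m) (nat \<bar>w (int i)\<bar>) = sgn (w (int i)) * Poly_Mapping.lookup m i"
proof -
  have inj: "inj_on (\<lambda>i. nat \<bar>w (int i)\<bar>) {1..n}"
    using abs_perm_bij[OF w] by (simp add: bij_betw_def)
  have "Poly_Mapping.lookup (act n w m) (nat \<bar>w (int i)\<bar>) =
    (\<Sum>k=1..n. if k = i then sgn (w (int k)) * Poly_Mapping.lookup m k else 0)"
    unfolding act_def lookup_sum
  proof (rule sum.cong)
    fix k assume k: "k \<in> {1..n}"
    show "Poly_Mapping.lookup (Poly_Mapping.single (nat \<bar>w (int k)\<bar>) (sgn (w (int k)) * Poly_Mapping.lookup m k)) (nat \<bar>w (int i)\<bar>)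
      = (if k = i then sgn (w (int k)) * Poly_Mapping.lookup m k else 0)"
    proof (cases "k = i")
      case False
      then have "nat \<bar>w (int k)\<bar> \<noteq> nat \<bar>w (int i)\<bar>" using inj_onD[OF inj _ k i] by blast
      then show ?thesis using False by (simp only: lookup_single when_def if_False)
    qed simp
  qed simp
  also have "\<dots> = sgn (w (int i)) * Poly_Mapping.lookup m i"
    using i by (simp add: sum.delta')
  finally show ?thesis .
qed

lemma act_weights: "w \<in> signed_perms n \<Longrightarrow> act n w m \<in> weights n"
proof -
  assume w: "w \<in> signed_perms n"
  have "j \<notin> Poly_Mapping.keys (act n w m)" if "j \<notin> {1..n}" for j
    unfolding act_def lookup_sum in_keys_iff not_not
    by (rule sum.neutral) (use that abs_perm_bij[OF w] in \<open>auto simp: lookup_single when_def bij_betw_def\<close>)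
  then show ?thesis unfolding weights_def by blast
qed

lemma weights_lookup: "m \<in> weights n \<Longrightarrow> j \<notin> {1..n} \<Longrightarrow> Poly_Mapping.lookup m j = 0"
  by (auto simp: weights_def in_keys_iff)

lemma weights_eqI:
  assumes "m \<in> weights n" "m' \<in> weights n" "\<And>j. j \<in> {1..n} \<Longrightarrow> Poly_Mapping.lookup m j = Poly_Mapping.lookup m' j"
  shows "m = m'"
  by (rule poly_mapping_eqI) (metis assms weights_lookup)

lemma act_comp:
  assumes w: "w \<in> signed_perms n" and u: "u \<in> signed_perms n"
  shows "act n w (act n u m) = act n (w \<circ> u) m"
proof (rule weights_eqI)
  show "act n w (act n u m) \<in> weights n" "act n (w \<circ> u) m \<in> weights n"
    using w u by (simp_all add: act_weights signed_perms_comp)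
  fix j assume "j \<in> {1..n}"
  then obtain i where i: "i \<in> {1..n}" "j = nat \<bar>(w \<circ> u) (int i)\<bar>"
    using bij_betw_obtain[OF abs_perm_bij[OF signed_perms_comp[OF w u]]] by blast
  let ?k = "nat \<bar>u (int i)\<bar>"
  have k: "?k \<in> {1..n}" using abs_perm_bij[OF u] i by (auto simp: bij_betw_def)
  have wk: "w (int ?k) = sgn (u (int i)) * w (u (int i))"
    using signed_permsD(1)[OF w, of "u (int i)"] signed_permsD(2)[OF w] by (cases "u (int i)" "0 :: int" rule: linorder_cases) auto
  have u0: "u (int i) \<noteq> 0" using signed_permsD(7)[OF u] i by auto
  have j: "j = nat \<bar>w (int ?k)\<bar>"
    unfolding wk using i u0 by (simp add: abs_mult)
  have "Poly_Mapping.lookup (act n w (act n u m)) j = sgn (w (int ?k)) * (sgn (u (int i)) * Poly_Mapping.lookup m i)"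
    unfolding j lookup_act[OF w k] lookup_act[OF u i(1)] ..
  also have "\<dots> = sgn (w (u (int i))) * Poly_Mapping.lookup m i"
    unfolding wk using u0 by (auto simp: sgn_mult sgn_if)
  finally show "Poly_Mapping.lookup (act n w (act n u m)) j = Poly_Mapping.lookup (act n (w \<circ> u) m) j"
    unfolding i(2) lookup_act[OF signed_perms_comp[OF w u] i(1)] by simp
qed

lemma act_id: "m \<in> weights n \<Longrightarrow> act n id m = m"
proof (rule weights_eqI[of _ n])
  have "id \<in> signed_perms n" by (simp add: signed_perms_def permutes_id)
  then show "act n id m \<in> weights n" by (rule act_weights)
  fix j assume "j \<in> {1..n}"
  then show "Poly_Mapping.lookup (act n id m) j = Poly_Mapping.lookup m j"
    using lookup_act[OF \<open>id \<in> signed_perms n\<close>, of j m] by simp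
qed

text \<open>\<open>gval\<close> enumerates the integers in the order \<open>0, -1, 1, -2, 2, \<dots>\<close>.\<close>

definition gval :: "int \<Rightarrow> int" where
  "gval v = (if v \<ge> 0 then 2 * v else - 2 * v - 1)"

lemma gval_inj: "gval v = gval v' \<longleftrightarrow> v = v'"
  by (cases "v \<ge> 0"; cases "v' \<ge> 0"; simp add: gval_def; presburger)

text \<open>The order in which \<open>w\<^sub>\<lambda>\<^sup>+\<close> lists the coordinates of \<open>\<lambda>\<close>.\<close>

definition above :: "(nat \<Rightarrow>\<^sub>0 int) \<Rightarrow> nat \<Rightarrow> nat \<Rightarrow> bool" where
  "above l j k \<longleftrightarrow> gval (Poly_Mapping.lookup l j) > gval (Poly_Mapping.lookup l k) \<or>
    (Poly_Mapping.lookup l j = Poly_Mapping.lookup l k \<and> (if Poly_Mapping.lookup l j \<ge> 0 then j < k else k < j))"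

text \<open>By \<open>rho_eq\<close> this is the absolute value of the \<open>j\<close>-th
  coordinate of \<open>rho(l)\<close>, obtained by counting instead of by words of minimal
  length.\<close>

definition rk :: "nat \<Rightarrow> (nat \<Rightarrow>\<^sub>0 int) \<Rightarrow> nat \<Rightarrow> nat" where
  "rk n l j = card {k\<in>{1..n}. above l j k}"

lemma above_irrefl: "\<not> above l j j"
  by (simp add: above_def)

lemma above_trans: "above l i j \<Longrightarrow> above l j k \<Longrightarrow> above l i k"
  by (auto simp: above_def split: if_splits)

lemma above_total: "j \<noteq> k \<Longrightarrow> above l j k \<or> above l k j"
proof (cases "gval (Poly_Mapping.lookup l j)" "gval (Poly_Mapping.lookup l k)" rule: linorder_cases)
  case equal
  assume "j \<noteq> k"
  then show ?thesis using equal by (auto simp: above_def gval_inj)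
qed (auto simp: above_def)

lemma above_asym: "above l j k \<Longrightarrow> \<not> above l k j"
  using above_trans above_irrefl by blast

lemma rk_mono:
  assumes "above l j k" "k \<in> {1..n}"
  shows "rk n l k < rk n l j"
  unfolding rk_def
proof (rule psubset_card_mono)
  show "{i \<in> {1..n}. above l k i} \<subset> {i \<in> {1..n}. above l j i}"
    using assms above_trans above_irrefl by blast
qed simp

lemma rk_less_iff: "j \<in> {1..n} \<Longrightarrow> k \<in> {1..n} \<Longrightarrow> rk n l k < rk n l j \<longleftrightarrow> above l j k"
  using rk_mono above_total by (metis less_asym less_irrefl)

lemma rk_bound: "j \<in> {1..n} \<Longrightarrow> rk n l j < n"
proof -
  assume j: "j \<in> {1..n}"
  have "{k \<in> {1..n}. above l j k} \<subset> {1..n}" using above_irrefl j by blast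
  then have "card {k \<in> {1..n}. above l j k} < card {1..n}" by (intro psubset_card_mono) auto
  then show ?thesis by (simp add: rk_def)
qed

lemma rk_inj: "inj_on (rk n l) {1..n}"
proof (rule inj_onI)
  fix j k assume jk: "j \<in> {1..n}" "k \<in> {1..n}" "rk n l j = rk n l k"
  show "j = k"
  proof (rule ccontr)
    assume "j \<noteq> k"
    then show False using above_total[of j k l] rk_mono[of l j k n] rk_mono[of l k j n] jk by auto
  qed
qed

lemma rk_bij: "bij_betw (\<lambda>j. n - rk n l j) {1..n} {1..n}"
proof -
  have "inj_on (\<lambda>j. n - rk n l j) {1..n}"
  proof (rule inj_onI)
    fix j k assume jk: "j \<in> {1..n}" "k \<in> {1..n}" "n - rk n l j = n - rk n l k"
    then have "rk n l j = rk n l k" using rk_bound[OF jk(1), of l] rk_bound[OF jk(2), of l] by linarith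
    then show "j = k" using inj_onD[OF rk_inj _ jk(1,2)] by blast
  qed
  moreover have "(\<lambda>j. n - rk n l j) ` {1..n} \<subseteq> {1..n}"
  proof (rule image_subsetI)
    fix j assume "j \<in> {1..n}"
    then show "n - rk n l j \<in> {1..n}" using rk_bound[of j n l] by auto
  qed
  ultimately show ?thesis by (simp add: bij_betw_def endo_inj_surj)
qed

section \<open>Dominant representatives of orbits\<close>

definition sort_perm :: "nat \<Rightarrow> (nat \<Rightarrow>\<^sub>0 int) \<Rightarrow> int \<Rightarrow> int" where
  "sort_perm n l x = (if x \<noteq> 0 \<and> \<bar>x\<bar> \<le> int n
     then sgn x * sgn_vec l (nat \<bar>x\<bar>) * int (n - rk n l (nat \<bar>x\<bar>)) else x)"

lemma sort_perm_signed: "sort_perm n l \<in> signed_perms n"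
proof -
  let ?w = "sort_perm n l"
  have odd: "?w (- k) = - ?w k" for k by (auto simp: sort_perm_def)
  have ab: "\<bar>?w x\<bar> = int (n - rk n l (nat \<bar>x\<bar>))" "sgn (?w x) = sgn x * sgn_vec l (nat \<bar>x\<bar>)" if "x \<noteq> 0" "\<bar>x\<bar> \<le> int n" for x
  proof -
    have "nat \<bar>x\<bar> \<in> {1..n}" using that by auto
    then have "rk n l (nat \<bar>x\<bar>) < n" by (rule rk_bound)
    then show "\<bar>?w x\<bar> = int (n - rk n l (nat \<bar>x\<bar>))" "sgn (?w x) = sgn x * sgn_vec l (nat \<bar>x\<bar>)"
      using that by (auto simp: sort_perm_def abs_mult sgn_vec_def sgn_mult sgn_if)
  qed
  have im: "?w ` {- int n..int n} \<subseteq> {- int n..int n}"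
  proof (rule image_subsetI)
    fix x assume "x \<in> {- int n..int n}"
    then have "\<bar>?w x\<bar> \<le> int n" using ab[of x] by (cases "x = 0") (auto simp: sort_perm_def)
    then show "?w x \<in> {- int n..int n}" by auto
  qed
  have "inj_on ?w {- int n..int n}"
  proof (rule inj_onI)
    fix x y assume xy: "x \<in> {- int n..int n}" "y \<in> {- int n..int n}" "?w x = ?w y"
    have z: "?w u = 0 \<longleftrightarrow> u = 0" if "\<bar>u\<bar> \<le> int n" for u
    proof (cases "u = 0")
      case False
      then have "nat \<bar>u\<bar> \<in> {1..n}" using that by auto
      then have "rk n l (nat \<bar>u\<bar>) < n" by (rule rk_bound)
      then show ?thesis using ab(1)[OF False that] False by auto
    qed (simp add: sort_perm_def)
    have bx: "\<bar>x\<bar> \<le> int n" and b_y: "\<bar>y\<bar> \<le> int n" using xy by auto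
    show "x = y"
    proof (cases "x = 0")
      case True
      then show ?thesis using z[OF bx] z[OF b_y] xy(3) by simp
    next
      case False
      then have y: "y \<noteq> 0" using z[OF bx] z[OF b_y] xy(3) by simp
      have "n - rk n l (nat \<bar>x\<bar>) = n - rk n l (nat \<bar>y\<bar>)"
        using ab(1)[OF False bx] ab(1)[OF y b_y] xy(3) by simp
      then have e: "nat \<bar>x\<bar> = nat \<bar>y\<bar>"
      proof (rule inj_onD[OF bij_betw_imp_inj_on[OF rk_bij]])
        show "nat \<bar>x\<bar> \<in> {1..n}" "nat \<bar>y\<bar> \<in> {1..n}" using bx b_y False y by auto
      qed
      have "sgn x * sgn_vec l (nat \<bar>x\<bar>) = sgn y * sgn_vec l (nat \<bar>x\<bar>)"
        using ab(2)[OF False bx] ab(2)[OF y b_y] xy(3) e by metis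
      moreover have "sgn_vec l (nat \<bar>x\<bar>) \<noteq> 0" by (simp add: sgn_vec_def)
      ultimately have "sgn x = sgn y" by simp
      with e show ?thesis by (metis abs_mult_sgn abs_ge_zero eq_nat_nat_iff mult.commute)
    qed
  qed
  then have "bij_betw ?w {- int n..int n} {- int n..int n}"
    using im by (simp add: bij_betw_def endo_inj_surj)
  then have "?w permutes {- int n..int n}"
    by (rule bij_imp_permutes) (auto simp: sort_perm_def)
  then show ?thesis using odd by (simp add: signed_perms_def)
qed

lemma gval_abs: "gval v > gval v' \<Longrightarrow> \<bar>v\<bar> \<ge> \<bar>v'\<bar>"
  by (auto simp: gval_def split: if_splits)

lemma above_abs: "above l j k \<Longrightarrow> \<bar>Poly_Mapping.lookup l j\<bar> \<ge> \<bar>Poly_Mapping.lookup l k\<bar>"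
  using gval_abs by (auto simp: above_def)

text \<open>\<open>sort_perm\<close> lists the coordinates in the order \<open>above\<close>, along
  which absolute values do not increase, and makes them nonnegative. It is the witness that every
  orbit contains a dominant weight.\<close>

lemma sort_dominant:
  assumes "n \<ge> 1"
  shows "dominant n (act n (sort_perm n l) l)"
proof -
  let ?w = "sort_perm n l"
  have v: "Poly_Mapping.lookup (act n ?w l) (n - rk n l j) = \<bar>Poly_Mapping.lookup l j\<bar>" if "j \<in> {1..n}" for j
  proof -
    have "?w (int j) = sgn_vec l j * int (n - rk n l j)" using that by (simp add: sort_perm_def)
    moreover have "n - rk n l j > 0" using rk_bound[OF that, of l] by simp
    ultimately have "nat \<bar>?w (int j)\<bar> = n - rk n l j" "sgn (?w (int j)) = sgn_vec l j"
      by (auto simp: sgn_vec_def)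
    then show ?thesis using lookup_act[OF sort_perm_signed that, of l l] by (simp add: sgn_vec_def)
  qed
  have surj: "\<exists>j\<in>{1..n}. p = n - rk n l j" if "p \<in> {1..n}" for p
    using bij_betw_obtain[OF rk_bij that] .
  show ?thesis
    unfolding dominant_def
  proof (intro conjI ballI)
    show "act n ?w l \<in> weights n" by (rule act_weights[OF sort_perm_signed])
    show "0 \<le> Poly_Mapping.lookup (act n ?w l) n"
    proof -
      obtain j where "j \<in> {1..n}" "n = n - rk n l j" using surj[of n] assms by auto
      then show ?thesis using v[of j] by simp
    qed
    fix i assume i: "i \<in> {1..<n}"
    then obtain j k where jk: "j \<in> {1..n}" "i = n - rk n l j" "k \<in> {1..n}" "Suc i = n - rk n l k"
    proof -
      have "i \<in> {1..n}" "Suc i \<in> {1..n}" using i by auto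
      then show ?thesis using surj that by blast
    qed
    then have "rk n l k < rk n l j" using i by auto
    then have "above l j k" using jk rk_less_iff by blast
    then show "Poly_Mapping.lookup (act n ?w l) (Suc i) \<le> Poly_Mapping.lookup (act n ?w l) i"
      using v[OF jk(1)] v[OF jk(3)] jk above_abs by simp
  qed
qed

lemma dominant_antimono:
  assumes "dominant n m" "1 \<le> i" "i \<le> j" "j \<le> n"
  shows "Poly_Mapping.lookup m j \<le> Poly_Mapping.lookup m i"
  using assms(3,4,2)
proof (induction j rule: dec_induct)
  case (step j)
  then have "Poly_Mapping.lookup m (Suc j) \<le> Poly_Mapping.lookup m j"
    using assms(1) by (auto simp: dominant_def)
  then show ?case using step by simp
qed simp

lemma dominant_nonneg:
  assumes "dominant n m" "j \<in> {1..n}"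
  shows "0 \<le> Poly_Mapping.lookup m j"
  using dominant_antimono[OF assms(1), of j n] assms by (auto simp: dominant_def)

text \<open>An orbit invariant; for a dominant weight it is the conjugate partition, which
  determines the weight (\<open>dominant_unique\<close>).\<close>

definition cnt :: "nat \<Rightarrow> (nat \<Rightarrow>\<^sub>0 int) \<Rightarrow> int \<Rightarrow> nat" where
  "cnt n l c = card {j\<in>{1..n}. \<bar>Poly_Mapping.lookup l j\<bar> \<ge> c}"

lemma card_bij_Collect:
  assumes "bij_betw p A A"
  shows "card {j\<in>A. P j} = card {i\<in>A. P (p i)}"
proof -
  have im: "p ` {i\<in>A. P (p i)} = {j\<in>A. P j}"
  proof (intro equalityI subsetI)
    fix j assume "j \<in> p ` {i\<in>A. P (p i)}"
    then obtain i where "i \<in> A" "P (p i)" "j = p i" by blast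
    then show "j \<in> {j\<in>A. P j}" using bij_betw_apply[OF assms] by simp
  next
    fix j assume j: "j \<in> {j\<in>A. P j}"
    then obtain i where "i \<in> A" "j = p i" using bij_betw_obtain[OF assms] by blast
    then show "j \<in> p ` {i\<in>A. P (p i)}" using j by simp
  qed
  have inj: "inj_on p {i\<in>A. P (p i)}" by (rule inj_on_subset[OF bij_betw_imp_inj_on[OF assms]]) auto
  show ?thesis
    by (rule trans[OF arg_cong[OF im[symmetric], of card] card_image[OF inj]])
qed

lemma cnt_act:
  assumes "w \<in> signed_perms n"
  shows "cnt n (act n w l) c = cnt n l c"
proof -
  let ?p = "\<lambda>i. nat \<bar>w (int i)\<bar>"
  have b: "bij_betw ?p {1..n} {1..n}" by (rule abs_perm_bij[OF assms])
  have a: "\<bar>Poly_Mapping.lookup (act n w l) (?p i)\<bar> = \<bar>Poly_Mapping.lookup l i\<bar>" if "i \<in> {1..n}" for i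
    using lookup_act[OF assms that, of l] signed_permsD(7)[OF assms, of "int i"] that
    by (auto simp: abs_mult)
  have "cnt n (act n w l) c = card {i\<in>{1..n}. \<bar>Poly_Mapping.lookup (act n w l) (?p i)\<bar> \<ge> c}"
    unfolding cnt_def by (rule card_bij_Collect[OF b])
  also have "\<dots> = cnt n l c"
    unfolding cnt_def by (rule arg_cong[where f = card], rule Collect_cong) (use a in auto)
  finally show ?thesis .
qed

lemma dominant_cnt:
  assumes m: "dominant n m" and p: "p \<in> {1..n}"
  shows "Poly_Mapping.lookup m p \<ge> c \<longleftrightarrow> p \<le> cnt n m c"
proof
  assume c: "Poly_Mapping.lookup m p \<ge> c"
  have "{1..p} \<subseteq> {j\<in>{1..n}. \<bar>Poly_Mapping.lookup m j\<bar> \<ge> c}"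
  proof
    fix j assume j: "j \<in> {1..p}"
    then have "Poly_Mapping.lookup m p \<le> Poly_Mapping.lookup m j"
      using dominant_antimono[OF m, of j p] p by auto
    then show "j \<in> {j\<in>{1..n}. \<bar>Poly_Mapping.lookup m j\<bar> \<ge> c}" using c j p by auto
  qed
  then have "card {1..p} \<le> cnt n m c" unfolding cnt_def by (intro card_mono) auto
  then show "p \<le> cnt n m c" by simp
next
  assume le: "p \<le> cnt n m c"
  show "Poly_Mapping.lookup m p \<ge> c"
  proof (rule ccontr)
    assume n: "\<not> Poly_Mapping.lookup m p \<ge> c"
    have "{j\<in>{1..n}. \<bar>Poly_Mapping.lookup m j\<bar> \<ge> c} \<subseteq> {1..<p}"
    proof
      fix j assume j: "j \<in> {j\<in>{1..n}. \<bar>Poly_Mapping.lookup m j\<bar> \<ge> c}"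
      then have "Poly_Mapping.lookup m j \<ge> c" using dominant_nonneg[OF m, of j] by auto
      then have "\<not> p \<le> j" using dominant_antimono[OF m, of p j] p j n by auto
      then show "j \<in> {1..<p}" using j by auto
    qed
    then have "cnt n m c \<le> card {1..<p}" unfolding cnt_def by (intro card_mono) auto
    then show False using le p by auto
  qed
qed

lemma dominant_unique:
  assumes "dominant n m" "dominant n m'" "\<And>c. cnt n m c = cnt n m' c"
  shows "m = m'"
proof (rule weights_eqI[of _ n])
  show "m \<in> weights n" "m' \<in> weights n" using assms by (auto simp: dominant_def)
  fix j assume "j \<in> {1..n}"
  then have "Poly_Mapping.lookup m j \<ge> c \<longleftrightarrow> Poly_Mapping.lookup m' j \<ge> c" for c
    using dominant_cnt[OF assms(1)] dominant_cnt[OF assms(2)] assms(3) by simp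
  then show "Poly_Mapping.lookup m j = Poly_Mapping.lookup m' j" by (meson order_antisym order_refl)
qed

lemma dom_rep_props:
  assumes "n \<ge> 1"
  shows "dominant n (dom_rep n l)" "\<exists>w\<in>signed_perms n. dom_rep n l = act n w l"
proof -
  have "\<exists>!m. dominant n m \<and> (\<exists>w\<in>signed_perms n. m = act n w l)"
  proof (rule ex_ex1I)
    show "\<exists>m. dominant n m \<and> (\<exists>w\<in>signed_perms n. m = act n w l)"
      using sort_dominant[OF assms] sort_perm_signed by blast
    show "m = m'" if "dominant n m \<and> (\<exists>w\<in>signed_perms n. m = act n w l)"
      "dominant n m' \<and> (\<exists>w\<in>signed_perms n. m' = act n w l)" for m m'
      using that cnt_act by (auto intro!: dominant_unique)
  qed
  then have "dominant n (dom_rep n l) \<and> (\<exists>w\<in>signed_perms n. dom_rep n l = act n w l)"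
    unfolding dom_rep_def by (rule theI')
  then show "dominant n (dom_rep n l)" "\<exists>w\<in>signed_perms n. dom_rep n l = act n w l" by auto
qed

section \<open>Length and exchange for signed permutations\<close>

definition refl_p :: "nat \<Rightarrow> int" where "refl_p i = int i"
text \<open>The \<open>j\<close>-th simple reflection exchanges \<open>refl_p j\<close> with
  \<open>refl_q n j\<close>, and their negatives likewise; for \<open>j = n\<close> the two pairs
  coincide.\<close>

definition refl_q :: "nat \<Rightarrow> nat \<Rightarrow> int" where "refl_q n i = (if i < n then int i + 1 else - int n)"

text \<open>Position of a signed index in the sequence \<open>-1, \<dots>, -n, n, \<dots>, 1\<close>.\<close>

definition kpos :: "nat \<Rightarrow> int \<Rightarrow> int" where
  "kpos n x = (if x > 0 then int n + 1 - x else if x < 0 then - (int n + 1) - x else 0)"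

lemma simple_refl_eq:
  assumes "i \<in> {1..n}"
  shows "simple_refl n i x = (if x = refl_p i then refl_q n i else if x = refl_q n i then refl_p i
     else if x = - refl_p i then - refl_q n i else if x = - refl_q n i then - refl_p i else x)"
proof (cases "i < n")
  case True
  then show ?thesis
    using assms by (simp add: simple_refl_def refl_p_def refl_q_def transpose_def)
next
  case False
  then have "i = n" using assms by simp
  then show ?thesis
    using assms by (simp add: simple_refl_def refl_p_def refl_q_def transpose_def)
qed

lemma simple_refl_invol:
  assumes "i \<in> {1..n}"
  shows "simple_refl n i (simple_refl n i x) = x"
proof -
  have "refl_p i \<noteq> refl_q n i" "refl_p i \<noteq> - refl_p i" "refl_q n i \<noteq> - refl_q n i" "refl_q n i = - refl_p i \<or> refl_q n i \<noteq> - refl_p i"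
    using assms by (auto simp: refl_p_def refl_q_def)
  then show ?thesis
    unfolding simple_refl_eq[OF assms] by auto
qed

lemma simple_refl_signed:
  assumes "i \<in> {1..n}"
  shows "simple_refl n i \<in> signed_perms n"
proof -
  have fixd: "simple_refl n i x = x" if "x \<notin> {- int n..int n}" for x
    using that assms unfolding simple_refl_eq[OF assms] by (auto simp: refl_p_def refl_q_def)
  have "simple_refl n i permutes {- int n..int n}"
    unfolding permutes_def using fixd simple_refl_invol[OF assms] by metis
  moreover have "simple_refl n i (- k) = - simple_refl n i k" for k
    using assms unfolding simple_refl_eq[OF assms] by (auto simp: refl_p_def refl_q_def split: if_splits)
  ultimately show ?thesis by (simp add: signed_perms_def)
qed

lemma kpos_minus: "kpos n (- x) = - kpos n x"
  by (simp add: kpos_def)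

lemma kpos_inj: "\<bar>x\<bar> \<le> int n \<Longrightarrow> \<bar>y\<bar> \<le> int n \<Longrightarrow> kpos n x = kpos n y \<Longrightarrow> x = y"
  by (simp add: kpos_def split: if_splits)

lemma kpos_refl: "i \<in> {1..n} \<Longrightarrow> kpos n (refl_q n i) < kpos n (refl_p i)"
  by (simp add: kpos_def refl_p_def refl_q_def)

text \<open>In terms of positions a simple reflection swaps neighbours (\<open>sk\<close>), so it
  inverts only the pair belonging to its own root, up to sign.\<close>

lemma kpos_adjacent:
  assumes i: "i \<in> {1..n}" and a: "a \<noteq> 0" "\<bar>a\<bar> \<le> int n" and b: "b \<noteq> 0" "\<bar>b\<bar> \<le> int n"
    and lt: "kpos n b < kpos n a" and gt: "kpos n (simple_refl n i a) < kpos n (simple_refl n i b)"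
  shows "a = refl_p i \<and> b = refl_q n i \<or> a = - refl_q n i \<and> b = - refl_p i"
proof -
  define sk where "sk x = (if i < n then
      (if x = int n + 1 - int i then x - 1 else if x = int n - int i then x + 1
       else if x = - (int n + 1 - int i) then x + 1 else if x = - (int n - int i) then x - 1 else x)
     else (if x = 1 then - 1 else if x = - 1 then 1 else x))" for x
  have sk: "kpos n (simple_refl n i x) = sk (kpos n x)" if "x \<noteq> 0" "\<bar>x\<bar> \<le> int n" for x
  proof (cases "i < n")
    case True
    consider "x = int i" | "x = int i + 1" | "x = - int i" | "x = - int i - 1"
      | "x > 0" "x \<noteq> int i" "x \<noteq> int i + 1" | "x < 0" "x \<noteq> - int i" "x \<noteq> - int i - 1"
      using \<open>x \<noteq> 0\<close> by linarith
    then show ?thesis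
      using that i True by cases (simp_all add: sk_def kpos_def simple_refl_eq[OF i] refl_p_def refl_q_def)
  next
    case False
    then have n: "i = n" using i by simp
    consider "x = int n" | "x = - int n" | "x > 0" "x \<noteq> int n" | "x < 0" "x \<noteq> - int n"
      using \<open>x \<noteq> 0\<close> by linarith
    then show ?thesis
      using that i n by cases (simp_all add: sk_def kpos_def simple_refl_eq[OF i[unfolded n]] refl_p_def refl_q_def)
  qed
  have sk': "sk (kpos n a) < sk (kpos n b)" using gt sk a b by simp
  have nz: "kpos n a \<noteq> 0" "kpos n b \<noteq> 0" using a b by (auto simp: kpos_def)
  have "kpos n a = kpos n (refl_p i) \<and> kpos n b = kpos n (refl_q n i) \<or>
        kpos n a = kpos n (- refl_q n i) \<and> kpos n b = kpos n (- refl_p i)"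
  proof (cases "i < n")
    case True
    have k: "kpos n (refl_p i) = int n + 1 - int i" "kpos n (refl_q n i) = int n - int i"
      using i True by (simp_all add: kpos_def refl_p_def refl_q_def)
    show ?thesis
      unfolding kpos_minus k using sk' lt True by (simp add: sk_def split: if_splits)
  next
    case False
    have k: "kpos n (refl_p i) = 1" "kpos n (refl_q n i) = - 1"
      using i False by (simp_all add: kpos_def refl_p_def refl_q_def)
    show ?thesis
      unfolding kpos_minus k using sk' lt False nz by (simp add: sk_def split: if_splits)
  qed
  moreover have "\<bar>refl_p i\<bar> \<le> int n" "\<bar>refl_q n i\<bar> \<le> int n" "\<bar>- refl_p i\<bar> \<le> int n" "\<bar>- refl_q n i\<bar> \<le> int n"
    using i by (auto simp: refl_p_def refl_q_def)
  ultimately show ?thesis using kpos_inj a(2) b(2) by metis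
qed

definition wd :: "nat \<Rightarrow> nat list \<Rightarrow> int \<Rightarrow> int" where
  "wd n js = foldr (\<circ>) (map (simple_refl n) js) id"

lemma wd_Nil [simp]: "wd n [] = id" and wd_Cons [simp]: "wd n (i # js) = simple_refl n i \<circ> wd n js"
  by (simp_all add: wd_def)

lemma wd_snoc: "wd n (js @ [j]) = wd n js \<circ> simple_refl n j"
  by (induction js) auto

lemma wd_signed: "set js \<subseteq> {1..n} \<Longrightarrow> wd n js \<in> signed_perms n"
proof (induction js)
  case Nil
  show ?case unfolding wd_Nil signed_perms_def by (intro CollectI conjI permutes_id) simp
next
  case (Cons a js)
  then have a: "a \<in> {1..n}" "set js \<subseteq> {1..n}" by auto
  show ?case
    unfolding wd_Cons by (rule signed_perms_comp[OF simple_refl_signed[OF a(1)] Cons.IH[OF a(2)]])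
qed

text \<open>Exchange condition: along the word, read from the right, some letter reverses the order
  of the images of the pair of \<open>j\<close>; deleting that letter amounts to multiplying by the
  \<open>j\<close>-th reflection.\<close>

lemma exchange:
  assumes "set js \<subseteq> {1..n}" "j \<in> {1..n}" "kpos n (wd n js (refl_p j)) < kpos n (wd n js (refl_q n j))"
  shows "\<exists>js'. length js = Suc (length js') \<and> set js' \<subseteq> {1..n} \<and> wd n js' = wd n js \<circ> simple_refl n j"
  using assms(1,3)
proof (induction js)
  case Nil
  then show ?case using kpos_refl[OF assms(2)] by simp
next
  case (Cons i js)
  let ?u = "wd n js"
  have i: "i \<in> {1..n}" and js: "set js \<subseteq> {1..n}" using Cons.prems by auto
  have u: "?u \<in> signed_perms n" by (rule wd_signed[OF js])
  show ?case
  proof (cases "kpos n (?u (refl_p j)) < kpos n (?u (refl_q n j))")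
    case True
    then obtain js' where "length js = Suc (length js')" "set js' \<subseteq> {1..n}" "wd n js' = ?u \<circ> simple_refl n j"
      using Cons.IH js by blast
    then show ?thesis using i by (intro exI[of _ "i # js'"]) (simp add: comp_assoc)
  next
    case False
    have pq: "refl_p j \<noteq> 0" "refl_q n j \<noteq> 0" "refl_p j \<noteq> refl_q n j" "\<bar>refl_p j\<bar> \<le> int n" "\<bar>refl_q n j\<bar> \<le> int n"
      using assms(2) by (auto simp: refl_p_def refl_q_def)
    let ?a = "?u (refl_p j)" and ?b = "?u (refl_q n j)"
    have ab: "?a \<noteq> 0" "?b \<noteq> 0" "\<bar>?a\<bar> \<le> int n" "\<bar>?b\<bar> \<le> int n"
      using pq signed_permsD(5,7)[OF u] by auto
    have "?a \<noteq> ?b" using pq(3) injD[OF signed_permsD(3)[OF u]] by blast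
    then have "kpos n ?a \<noteq> kpos n ?b" using kpos_inj ab by blast
    then have lt: "kpos n ?b < kpos n ?a" using False by linarith
    have gt: "kpos n (simple_refl n i ?a) < kpos n (simple_refl n i ?b)" using Cons.prems(2) by simp
    have c: "?a = refl_p i \<and> ?b = refl_q n i \<or> ?a = - refl_q n i \<and> ?b = - refl_p i"
      by (rule kpos_adjacent[OF i ab(1,3,2,4) lt gt])
    have m: "?u (- refl_p j) = - ?a" "?u (- refl_q n j) = - ?b" by (rule signed_permsD(1)[OF u])+
    have com: "?u (simple_refl n j x) = simple_refl n i (?u x)" for x
    proof (cases "x \<in> {refl_p j, refl_q n j, - refl_p j, - refl_q n j}")
      case True
      have d: "refl_p i \<noteq> refl_q n i" "refl_p i \<noteq> - refl_p i" "refl_q n i \<noteq> - refl_q n i"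
        "refl_p j \<noteq> - refl_p j" "refl_q n j \<noteq> - refl_q n j"
        using i assms(2) by (auto simp: refl_p_def refl_q_def)
      have si: "simple_refl n i (refl_p i) = refl_q n i" "simple_refl n i (refl_q n i) = refl_p i"
        "simple_refl n i (- refl_p i) = - refl_q n i" "simple_refl n i (- refl_q n i) = - refl_p i"
        and sj: "simple_refl n j (refl_p j) = refl_q n j" "simple_refl n j (refl_q n j) = refl_p j"
        "simple_refl n j (- refl_p j) = - refl_q n j" "simple_refl n j (- refl_q n j) = - refl_p j"
        unfolding simple_refl_eq[OF i] simple_refl_eq[OF assms(2)] using d pq by auto
      show ?thesis using True c m si sj by auto
    next
      case False
      then have "?u x \<notin> {?a, ?b, - ?a, - ?b}"
        using injD[OF signed_permsD(3)[OF u]] m by (metis insertCI insertE singletonD)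
      then have "?u x \<notin> {refl_p i, refl_q n i, - refl_p i, - refl_q n i}" using c by auto
      then have "simple_refl n i (?u x) = ?u x" unfolding simple_refl_eq[OF i] by auto
      moreover have "simple_refl n j x = x" unfolding simple_refl_eq[OF assms(2)] using False by auto
      ultimately show ?thesis by simp
    qed
    have "?u = wd n (i # js) \<circ> simple_refl n j"
      by (rule ext) (simp add: com simple_refl_invol[OF i])
    then show ?thesis using js by (intro exI[of _ js] conjI) (simp, assumption+)
  qed
qed

lemma kpos_bound: "\<bar>x\<bar> \<le> int n \<Longrightarrow> \<bar>kpos n x\<bar> \<le> int n"
  by (simp add: kpos_def)

lemma generated:
  assumes "w \<in> signed_perms n"
  shows "\<exists>js. set js \<subseteq> {1..n} \<and> w = wd n js"
proof -
  \<comment> \<open>A rearrangement sum: removing a descent raises it strictly, it is at most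
    \<open>n^3\<close>, and a signed permutation without descents is the identity.\<close>
  define M where "M w = (\<Sum>x\<in>{1..n}. kpos n (int x) * kpos n (w (int x)))" for w
  have Mb: "M w \<le> int n * (int n * int n)" if "w \<in> signed_perms n" for w
  proof -
    have "M w \<le> (\<Sum>x\<in>{1..n}. int n * int n)"
      unfolding M_def
    proof (rule sum_mono)
      fix x assume "x \<in> {1..n}"
      then have "\<bar>kpos n (int x)\<bar> \<le> int n" "\<bar>kpos n (w (int x))\<bar> \<le> int n"
        using signed_permsD(5)[OF that] by (auto intro!: kpos_bound)
      then have "\<bar>kpos n (int x)\<bar> * \<bar>kpos n (w (int x))\<bar> \<le> int n * int n" by (intro mult_mono) auto
      then show "kpos n (int x) * kpos n (w (int x)) \<le> int n * int n"
        using abs_ge_self[of "kpos n (int x) * kpos n (w (int x))"] by (simp add: abs_mult)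
    qed
    then show ?thesis by simp
  qed
  show ?thesis
    using assms
  proof (induction "nat (int n * (int n * int n) - M w)" arbitrary: w rule: less_induct)
    case less
    note w = less.prems
    have kb: "\<bar>w (int x)\<bar> \<le> int n" "w (int x) \<noteq> 0" if "x \<in> {1..n}" for x
      using signed_permsD(5,7)[OF w, of "int x"] that by auto
    show ?case
    proof (cases "\<exists>j\<in>{1..n}. kpos n (w (refl_p j)) < kpos n (w (refl_q n j))")
      case True
      then obtain j where j: "j \<in> {1..n}" "kpos n (w (refl_p j)) < kpos n (w (refl_q n j))" by blast
      let ?w = "w \<circ> simple_refl n j"
      have w': "?w \<in> signed_perms n" by (rule signed_perms_comp[OF w simple_refl_signed[OF j(1)]])
      have "M w < M ?w"
      proof (cases "j < n")
        case True
        define g where "g x = kpos n (int x) * kpos n (w (int x))" for x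
        define g' where "g' x = kpos n (int x) * kpos n (?w (int x))" for x
        have "{1..n} = insert j (insert (Suc j) ({1..n} - {j, Suc j}))" using j True by auto
        then have split: "(\<Sum>x\<in>{1..n}. f x) = f j + f (Suc j) + (\<Sum>x\<in>{1..n} - {j, Suc j}. f x)" for f :: "nat \<Rightarrow> int"
          by (metis (no_types, lifting) Diff_iff add.assoc finite_Diff finite_atLeastAtMost finite_insert insertCI insertE n_not_Suc_n singletonD sum.insert)
        have "g' x = g x" if "x \<in> {1..n} - {j, Suc j}" for x
          using that True by (auto simp: g_def g'_def simple_refl_eq[OF j(1)] refl_p_def refl_q_def)
        then have "(\<Sum>x\<in>{1..n} - {j, Suc j}. g' x) = (\<Sum>x\<in>{1..n} - {j, Suc j}. g x)" by (intro sum.cong) auto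
        moreover have "simple_refl n j (int j) = int (Suc j)" "simple_refl n j (int (Suc j)) = int j"
          using True by (auto simp: simple_refl_eq[OF j(1)] refl_p_def refl_q_def)
        then have "g' j + g' (Suc j) = kpos n (int j) * kpos n (w (int (Suc j))) + kpos n (int (Suc j)) * kpos n (w (int j))"
          by (simp add: g'_def)
        moreover have "kpos n (int j) = kpos n (int (Suc j)) + 1" using j True by (simp add: kpos_def)
        moreover have "kpos n (w (int j)) < kpos n (w (int (Suc j)))"
          using j(2) True by (simp add: refl_p_def refl_q_def add.commute)
        ultimately have "(\<Sum>x\<in>{1..n}. g x) < (\<Sum>x\<in>{1..n}. g' x)"
          unfolding split[of g] split[of g'] by (simp add: g_def algebra_simps)
        then show ?thesis by (simp add: M_def g_def g'_def)
      next
        case False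
        then have jn: "j = n" using j by simp
        define g where "g x = kpos n (int x) * kpos n (w (int x))" for x
        define g' where "g' x = kpos n (int x) * kpos n (?w (int x))" for x
        have split: "(\<Sum>x\<in>{1..n}. f x) = f n + (\<Sum>x\<in>{1..n} - {n}. f x)" for f :: "nat \<Rightarrow> int"
          using j jn by (intro sum.remove) auto
        have "g' x = g x" if "x \<in> {1..n} - {n}" for x
          using that jn by (auto simp: g_def g'_def simple_refl_eq[OF j(1)[unfolded jn]] refl_p_def refl_q_def)
        then have "(\<Sum>x\<in>{1..n} - {n}. g' x) = (\<Sum>x\<in>{1..n} - {n}. g x)" by (intro sum.cong) auto
        moreover have "simple_refl n j (int n) = - int n"
          using jn by (auto simp: simple_refl_eq[OF j(1)[unfolded jn]] refl_p_def refl_q_def)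
        then have "g' n = - g n"
          using signed_permsD(1)[OF w, of "int n"] by (simp add: g'_def g_def kpos_minus)
        moreover have "g n < 0"
          using j(2) jn j(1) signed_permsD(1)[OF w, of "int n"]
          by (simp add: g_def refl_p_def refl_q_def kpos_minus) (simp add: kpos_def)
        ultimately have "(\<Sum>x\<in>{1..n}. g x) < (\<Sum>x\<in>{1..n}. g' x)"
          unfolding split[of g] split[of g'] by simp
        then show ?thesis by (simp add: M_def g_def g'_def)
      qed
      then have "nat (int n * (int n * int n) - M ?w) < nat (int n * (int n * int n) - M w)"
        using Mb[OF w'] by linarith
      then obtain js where js: "set js \<subseteq> {1..n}" "?w = wd n js" using less.hyps w' by blast
      have "w = wd n (js @ [j])"
        unfolding wd_snoc js(2)[symmetric] by (rule ext) (simp add: simple_refl_invol[OF j(1)])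
      then show ?thesis using js j by (intro exI[of _ "js @ [j]"]) auto
    next
      case False
      have step: "kpos n (w (int (Suc j))) < kpos n (w (int j))" if "1 \<le> j" "j < n" for j
      proof -
        have "\<not> kpos n (w (int j)) < kpos n (w (int (Suc j)))"
          using False that by (force simp: refl_p_def refl_q_def add.commute)
        moreover have "w (int j) \<noteq> w (int (Suc j))" using injD[OF signed_permsD(3)[OF w], of "int j" "int (Suc j)"] by auto
        then have "kpos n (w (int j)) \<noteq> kpos n (w (int (Suc j)))"
          using kpos_inj[of "w (int j)" n "w (int (Suc j))"] kb[of j] kb[of "Suc j"] that by auto
        ultimately show ?thesis by linarith
      qed
      \<comment> \<open>Without descents the positions of \<open>w 1, ..., w n\<close> decrease
        strictly from at most \<open>n\<close> to at least 1, which leaves only one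
        possibility.\<close>
      have id: "w (int j) = int j" if "j \<in> {1..n}" for j
      proof -
        have n1: "n \<in> {1..n}" using that by auto
        have "\<not> kpos n (w (int n)) < kpos n (w (- int n))"
          using False n1 by (force simp: refl_p_def refl_q_def)
        then have kn: "kpos n (w (int n)) \<ge> 1"
          using signed_permsD(1)[OF w, of "int n"] kb[OF n1] by (simp add: kpos_minus) (simp add: kpos_def split: if_splits)
        have low: "kpos n (w (int j)) \<ge> int n + 1 - int j" if "1 \<le> j" "j \<le> n" for j
          using that(2,1)
        proof (induction j rule: inc_induct)
          case base
          then show ?case using kn by simp
        next
          case (step k)
          then show ?case using \<open>\<And>j. 1 \<le> j \<Longrightarrow> j < n \<Longrightarrow> kpos n (w (int (Suc j))) < kpos n (w (int j))\<close>[of k] by simp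
        qed
        have up: "kpos n (w (int j)) \<le> int n + 1 - int j" if "1 \<le> j" "j \<le> n" for j
          using that
        proof (induction j rule: dec_induct)
          case base
          then show ?case using kpos_bound[of "w (int 1)" n] kb[of 1] by auto
        next
          case (step k)
          then show ?case using \<open>\<And>j. 1 \<le> j \<Longrightarrow> j < n \<Longrightarrow> kpos n (w (int (Suc j))) < kpos n (w (int j))\<close>[of k] by simp
        qed
        have "kpos n (w (int j)) = kpos n (int j)"
          using low[of j] up[of j] that by (simp add: kpos_def)
        then show ?thesis using kpos_inj[of "w (int j)" n "int j"] kb[OF that] that by auto
      qed
      have "w x = x" for x
      proof -
        consider "x = 0" | "\<not> \<bar>x\<bar> \<le> int n" | j where "j \<in> {1..n}" "x = int j" | j where "j \<in> {1..n}" "x = - int j"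
        proof (cases "x > 0")
          case True
          then have "x = int (nat x)" by simp
          then show ?thesis using that(2) that(3)[of "nat x"] True by fastforce
        next
          case False
          then have "x = - int (nat (- x))" by simp
          then show ?thesis using that(1,2) that(4)[of "nat (- x)"] False by fastforce
        qed
        then show ?thesis
          by cases (use signed_permsD(1,2,6)[OF w] id in auto)
      qed
      then have "w = wd n []" by auto
      then show ?thesis by (intro exI[of _ "[]"]) simp
    qed
  qed
qed

lemma perm_length_witness:
  assumes "w \<in> signed_perms n"
  shows "\<exists>js. length js = perm_length n w \<and> set js \<subseteq> {1..n} \<and> w = wd n js"
proof -
  have "\<exists>k js. length js = k \<and> set js \<subseteq> {1..n} \<and> w = wd n js" using generated[OF assms] by blast
  then show ?thesis unfolding perm_length_def wd_def by (rule LeastI_ex)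
qed

lemma perm_length_le: "set js \<subseteq> {1..n} \<Longrightarrow> perm_length n (wd n js) \<le> length js"
  unfolding perm_length_def wd_def by (rule Least_le) blast

lemma perm_length_descent:
  assumes w: "w \<in> signed_perms n" and j: "j \<in> {1..n}"
    and d: "kpos n (w (refl_p j)) < kpos n (w (refl_q n j))"
  shows "perm_length n (w \<circ> simple_refl n j) < perm_length n w"
proof -
  obtain js where js: "length js = perm_length n w" "set js \<subseteq> {1..n}" "w = wd n js"
    using perm_length_witness[OF w] by blast
  obtain js' where "length js = Suc (length js')" "set js' \<subseteq> {1..n}" "wd n js' = w \<circ> simple_refl n j"
    using exchange[OF js(2) j] d js(3) by blast
  then show ?thesis using perm_length_le[of js' n] js(1) by simp
qed

section \<open>The minimal representative and the vector rho\<close>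

lemma wplus_props:
  assumes n: "n \<ge> 1" and l: "l \<in> weights n"
  shows "wplus n l \<in> signed_perms n" "act n (wplus n l) (dom_rep n l) = l"
    "\<And>w. w \<in> signed_perms n \<Longrightarrow> act n w (dom_rep n l) = l \<Longrightarrow> perm_length n (wplus n l) \<le> perm_length n w"
proof -
  let ?P = "\<lambda>w. w \<in> signed_perms n \<and> act n w (dom_rep n l) = l"
  obtain w where w: "w \<in> signed_perms n" "dom_rep n l = act n w l" using dom_rep_props(2)[OF n] by blast
  have "inv_into UNIV w \<circ> w = id" using signed_permsD(3)[OF w(1)] by (rule inv_o_cancel)
  then have "act n (inv_into UNIV w) (dom_rep n l) = l"
    unfolding w(2) act_comp[OF signed_perms_inv[OF w(1)] w(1)] by (simp add: act_id[OF l])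
  then have P: "?P (inv_into UNIV w)" using signed_perms_inv[OF w(1)] by simp
  have *: "?P (wplus n l) \<and> (\<forall>w. ?P w \<longrightarrow> perm_length n (wplus n l) \<le> perm_length n w)"
    unfolding wplus_def by (rule arg_min_nat_lemma[of ?P, OF P])
  then show "wplus n l \<in> signed_perms n" "act n (wplus n l) (dom_rep n l) = l"
    "\<And>w. w \<in> signed_perms n \<Longrightarrow> act n w (dom_rep n l) = l \<Longrightarrow> perm_length n (wplus n l) \<le> perm_length n w"
    by auto
qed

lemma act_simple_refl_fixed:
  assumes D: "D \<in> weights n" and j: "j \<in> {1..n}"
    and e: "if j < n then Poly_Mapping.lookup D (Suc j) = Poly_Mapping.lookup D j else Poly_Mapping.lookup D n = 0"
  shows "act n (simple_refl n j) D = D"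
proof (rule weights_eqI[of _ n])
  note s = simple_refl_signed[OF j]
  show "act n (simple_refl n j) D \<in> weights n" "D \<in> weights n" using act_weights[OF s] D by auto
  fix k assume k: "k \<in> {1..n}"
  then obtain i where i: "i \<in> {1..n}" "k = nat \<bar>simple_refl n j (int i)\<bar>"
    using bij_betw_obtain[OF abs_perm_bij[OF s]] by blast
  have L: "Poly_Mapping.lookup (act n (simple_refl n j) D) k = sgn (simple_refl n j (int i)) * Poly_Mapping.lookup D i"
    unfolding i(2) by (rule lookup_act[OF s i(1)])
  show "Poly_Mapping.lookup (act n (simple_refl n j) D) k = Poly_Mapping.lookup D k"
  proof (cases "j < n")
    case True
    consider "i = j" | "i = Suc j" | "i \<noteq> j" "i \<noteq> Suc j" by blast
    then show ?thesis
    proof cases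
      case 1
      then have "simple_refl n j (int i) = int (Suc j)"
        unfolding simple_refl_eq[OF j] using True by (simp add: refl_p_def refl_q_def)
      moreover from this have "k = Suc j" using i(2) by (simp del: of_nat_Suc)
      ultimately show ?thesis using L e True 1 by (simp del: of_nat_Suc)
    next
      case 2
      then have "simple_refl n j (int i) = int j"
        unfolding simple_refl_eq[OF j] using True by (simp add: refl_p_def refl_q_def)
      then show ?thesis using L i(2) e True 2 j by simp
    next
      case 3
      then have "simple_refl n j (int i) = int i"
        unfolding simple_refl_eq[OF j] using True i by (simp add: refl_p_def refl_q_def)
      then show ?thesis using L i by simp
    qed
  next
    case False
    then have jn: "j = n" using j by simp
    show ?thesis
    proof (cases "i = n")
      case True
      then have "simple_refl n j (int i) = - int n"
        unfolding simple_refl_eq[OF j] using jn by (simp add: refl_p_def refl_q_def)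
      then show ?thesis using L i(2) e jn True by simp
    next
      case False
      then have "simple_refl n j (int i) = int i"
        unfolding simple_refl_eq[OF j] using jn i by (simp add: refl_p_def refl_q_def)
      then show ?thesis using L i by simp
    qed
  qed
qed

definition wpos :: "nat \<Rightarrow> (nat \<Rightarrow>\<^sub>0 int) \<Rightarrow> nat \<Rightarrow> nat" where
  "wpos n l p = nat \<bar>wplus n l (int p)\<bar>"

context
  fixes n :: nat and l :: "nat \<Rightarrow>\<^sub>0 int"
  assumes n: "n \<ge> 1" and l: "l \<in> weights n"
begin

lemma wpos_bij: "bij_betw (wpos n l) {1..n} {1..n}"
  using abs_perm_bij[OF wplus_props(1)[OF n l]] unfolding wpos_def .

lemma lookup_wpos: "p \<in> {1..n} \<Longrightarrow>
    Poly_Mapping.lookup l (wpos n l p) = sgn (wplus n l (int p)) * Poly_Mapping.lookup (dom_rep n l) p"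
  using lookup_act[OF wplus_props(1)[OF n l], of p "dom_rep n l"] unfolding wplus_props(2)[OF n l] wpos_def .

lemma wplus_nz: "p \<in> {1..n} \<Longrightarrow> wplus n l (int p) \<noteq> 0"
  using signed_permsD(7)[OF wplus_props(1)[OF n l], of "int p"] by simp

lemma dom_rep_wpos: "p \<in> {1..n} \<Longrightarrow> Poly_Mapping.lookup (dom_rep n l) p = \<bar>Poly_Mapping.lookup l (wpos n l p)\<bar>"
  using lookup_wpos[of p] wplus_nz[of p] dominant_nonneg[OF dom_rep_props(1)[OF n], of p l] by (simp add: abs_mult)

text \<open>If the \<open>j\<close>-th reflection fixes the dominant weight, then
  \<open>w s_j\<close> represents \<open>l\<close> as well; a descent at \<open>j\<close> would make
  it shorter, against minimality.\<close>

lemma wplus_kpos: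
  assumes j: "j \<in> {1..n}"
    and e: "if j < n then Poly_Mapping.lookup (dom_rep n l) (Suc j) = Poly_Mapping.lookup (dom_rep n l) j
      else Poly_Mapping.lookup (dom_rep n l) n = 0"
  shows "kpos n (wplus n l (refl_q n j)) < kpos n (wplus n l (refl_p j))"
proof (rule ccontr)
  let ?w = "wplus n l"
  note w = wplus_props(1)[OF n l]
  assume "\<not> ?thesis"
  moreover have "refl_p j \<noteq> refl_q n j" "\<bar>refl_p j\<bar> \<le> int n" "\<bar>refl_q n j\<bar> \<le> int n"
    using j by (auto simp: refl_p_def refl_q_def)
  then have "kpos n (?w (refl_q n j)) \<noteq> kpos n (?w (refl_p j))"
    using kpos_inj[OF signed_permsD(5)[OF w] signed_permsD(5)[OF w]] injD[OF signed_permsD(3)[OF w]] by metis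
  ultimately have d: "kpos n (?w (refl_p j)) < kpos n (?w (refl_q n j))" by linarith
  have D: "dom_rep n l \<in> weights n" using dom_rep_props(1)[OF n] by (simp add: dominant_def)
  have "act n (?w \<circ> simple_refl n j) (dom_rep n l) = l"
    unfolding act_comp[OF w simple_refl_signed[OF j], symmetric] act_simple_refl_fixed[OF D j e]
    by (rule wplus_props(2)[OF n l])
  then have "perm_length n ?w \<le> perm_length n (?w \<circ> simple_refl n j)"
    by (rule wplus_props(3)[OF n l signed_perms_comp[OF w simple_refl_signed[OF j]]])
  then show False using perm_length_descent[OF w j d] by simp
qed

lemma wplus_pos_if_zero:
  assumes "p \<in> {1..n}" "Poly_Mapping.lookup (dom_rep n l) p = 0"
  shows "wplus n l (int p) > 0"
proof -
  note D = dom_rep_props(1)[OF n, of l]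
  have "p \<le> n" "1 \<le> p" using assms by auto
  then have "Poly_Mapping.lookup (dom_rep n l) p = 0 \<Longrightarrow> kpos n (wplus n l (int p)) > 0"
  proof (induction p rule: inc_induct)
    case base
    then have "kpos n (wplus n l (- int n)) < kpos n (wplus n l (int n))"
      using wplus_kpos[of n] n by (simp add: refl_p_def refl_q_def)
    then show ?case
      using signed_permsD(1)[OF wplus_props(1)[OF n l], of "int n"] by (simp add: kpos_minus)
  next
    case (step q)
    have "0 \<le> Poly_Mapping.lookup (dom_rep n l) (Suc q)" "Poly_Mapping.lookup (dom_rep n l) (Suc q) \<le> Poly_Mapping.lookup (dom_rep n l) q"
      using dominant_nonneg[OF D, of "Suc q"] dominant_antimono[OF D, of q "Suc q"] step by auto
    then have z: "Poly_Mapping.lookup (dom_rep n l) (Suc q) = 0" using step by simp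
    then have "kpos n (wplus n l (int (Suc q))) < kpos n (wplus n l (int q))"
      using wplus_kpos[of q] step by (simp add: refl_p_def refl_q_def add.commute)
    then show ?case using step z by simp
  qed
  moreover have "\<bar>wplus n l (int p)\<bar> \<le> int n"
    using signed_permsD(5)[OF wplus_props(1)[OF n l]] assms by simp
  ultimately show ?thesis using assms(2) by (simp add: kpos_def split: if_splits)
qed

text \<open>For nonzero entries the sign is forced; for zero entries minimal length makes it
  positive, in agreement with the convention \<open>sgn(0) = 1\<close>.\<close>

lemma sgn_wplus:
  assumes p: "p \<in> {1..n}"
  shows "sgn (wplus n l (int p)) = sgn_vec l (wpos n l p)"
proof (cases "Poly_Mapping.lookup (dom_rep n l) p = 0")
  case True
  then show ?thesis using wplus_pos_if_zero[OF p] lookup_wpos[OF p] by (simp add: sgn_vec_def)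
next
  case False
  then have "Poly_Mapping.lookup (dom_rep n l) p > 0"
    using dominant_nonneg[OF dom_rep_props(1)[OF n] p] by (simp add: order_less_le)
  then show ?thesis
    using lookup_wpos[OF p] wplus_nz[OF p] by (auto simp: sgn_vec_def sgn_if split: if_splits)
qed

text \<open>Different dominant entries are ordered by absolute value. For equal ones the absence of
  a descent, read through \<open>kpos\<close>, is exactly the tie-break of \<open>above\<close>:
  positive before negative, then by index in the direction given by the sign.\<close>

lemma above_wpos_Suc:
  assumes p: "1 \<le> p" "p < n"
  shows "above l (wpos n l p) (wpos n l (Suc p))"
proof -
  note D = dom_rep_props(1)[OF n, of l]
  define d d' where dd: "d = Poly_Mapping.lookup (dom_rep n l) p" "d' = Poly_Mapping.lookup (dom_rep n l) (Suc p)"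
  define x x' where xx: "x = wplus n l (int p)" "x' = wplus n l (int (Suc p))"
  have pp: "p \<in> {1..n}" "Suc p \<in> {1..n}" using p by auto
  have le: "d' \<le> d" "0 \<le> d'" using dominant_antimono[OF D, of p "Suc p"] dominant_nonneg[OF D pp(2)] p by (auto simp: dd)
  have L: "Poly_Mapping.lookup l (wpos n l p) = sgn x * d" "Poly_Mapping.lookup l (wpos n l (Suc p)) = sgn x' * d'"
    using lookup_wpos pp by (auto simp: dd xx)
  have x0: "x \<noteq> 0" "x' \<noteq> 0" using wplus_nz[OF pp(1)] wplus_nz[OF pp(2)] unfolding xx by blast+
  have P: "wpos n l p = nat \<bar>x\<bar>" "wpos n l (Suc p) = nat \<bar>x'\<bar>" by (simp_all add: wpos_def xx)
  show ?thesis
  proof (cases "d' < d")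
    case True
    then show ?thesis
      unfolding above_def L using le x0 by (auto simp: gval_def sgn_if)
  next
    case False
    then have e: "d' = d" using le by simp
    have k: "kpos n x' < kpos n x"
      using wplus_kpos[of p] e p by (simp add: refl_p_def refl_q_def add.commute dd xx)
    have b: "\<bar>x\<bar> \<le> int n" "\<bar>x'\<bar> \<le> int n"
      using signed_permsD(5)[OF wplus_props(1)[OF n l]] pp by (auto simp: xx)
    show ?thesis
    proof (cases "d = 0")
      case True
      then have "x > 0" "x' > 0"
        using wplus_pos_if_zero[OF pp(1)] wplus_pos_if_zero[OF pp(2)] e unfolding dd xx by simp_all
      then show ?thesis unfolding above_def L unfolding P using k True e by (auto simp: kpos_def)
    next
      case False
      then have "d > 0" using le e by simp
      then show ?thesis
        unfolding above_def L e unfolding P using k b x0 by (auto simp: kpos_def gval_def sgn_if split: if_splits)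
    qed
  qed
qed

lemma above_wpos:
  assumes "1 \<le> p" "p < p'" "p' \<le> n"
  shows "above l (wpos n l p) (wpos n l p')"
proof -
  have "Suc p \<le> p'" using assms by simp
  then show ?thesis using assms(3)
  proof (induction p' rule: dec_induct)
    case base
    then show ?case using above_wpos_Suc assms by simp
  next
    case (step k)
    then have "above l (wpos n l k) (wpos n l (Suc k))" using above_wpos_Suc[of k] assms by simp
    then show ?case using step above_trans by (meson Suc_leD)
  qed
qed

lemma rk_wpos:
  assumes p: "p \<in> {1..n}"
  shows "rk n l (wpos n l p) = n - p"
proof -
  have "rk n l (wpos n l p) = card {k\<in>{1..n}. above l (wpos n l p) (wpos n l k)}"
    unfolding rk_def by (rule card_bij_Collect[OF wpos_bij])
  also have "{k\<in>{1..n}. above l (wpos n l p) (wpos n l k)} = {p<..n}"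
  proof (intro equalityI subsetI)
    fix k assume "k \<in> {k\<in>{1..n}. above l (wpos n l p) (wpos n l k)}"
    then have k: "k \<in> {1..n}" "above l (wpos n l p) (wpos n l k)" by auto
    have "\<not> k < p" using above_wpos[of k p] above_asym[OF k(2)] k p by auto
    moreover have "k \<noteq> p" using k(2) above_irrefl by auto
    ultimately show "k \<in> {p<..n}" using k by auto
  next
    fix k assume "k \<in> {p<..n}"
    then show "k \<in> {k\<in>{1..n}. above l (wpos n l p) (wpos n l k)}" using above_wpos[of p k] p by auto
  qed
  finally show ?thesis by simp
qed

text \<open>The entry at position \<open>p\<close> of the list carries \<open>n - p\<close>, and
  exactly \<open>n - p\<close> coordinates come after it.\<close>

lemma rho_eq:
  assumes j: "j \<in> {1..n}"
  shows "Poly_Mapping.lookup (rho n l) j = sgn_vec l j * int (rk n l j)"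
proof -
  obtain p where p: "p \<in> {1..n}" "j = wpos n l p" using bij_betw_obtain[OF wpos_bij j] by blast
  have "Poly_Mapping.lookup (\<Sum>i=1..n. Poly_Mapping.single i (int n - int i)) p = (\<Sum>i=1..n. if i = p then int n - int i else 0)"
    unfolding lookup_sum by (rule sum.cong) (auto simp: lookup_single when_def)
  also have "\<dots> = int n - int p" using p by (simp add: sum.delta')
  finally have "Poly_Mapping.lookup (rho n l) j = sgn (wplus n l (int p)) * (int n - int p)"
    unfolding rho_def p(2) wpos_def lookup_act[OF wplus_props(1)[OF n l] p(1)] by simp
  then show ?thesis
    using p sgn_wplus[OF p(1)] rk_wpos[OF p(1)] by (simp add: of_nat_diff)
qed

text \<open>The two alternatives together say that the \<open>i\<close>-th listed coordinate has
  \<open>gval\<close> at least \<open>gval c = 2 * c\<close>; for \<open>c > 0\<close> the entry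
  \<open>-c\<close>, of value \<open>2 * c - 1\<close>, is just excluded. As the list is decreasing,
  this is a count.\<close>

lemma dom_rep_ge_iff:
  assumes i: "i \<in> {1..n}" and c: "c \<ge> 0"
  shows "Poly_Mapping.lookup (dom_rep n l) i > c \<or> Poly_Mapping.lookup (dom_rep n l) i = c \<and> sgn_vec l (wpos n l i) = 1
    \<longleftrightarrow> card {k\<in>{1..n}. gval (Poly_Mapping.lookup l k) \<ge> 2 * c} \<ge> i"
proof -
  let ?B = "{k\<in>{1..n}. gval (Poly_Mapping.lookup l k) \<ge> 2 * c}"
  let ?j = "wpos n l i"
  have "Poly_Mapping.lookup (dom_rep n l) i > c \<or> Poly_Mapping.lookup (dom_rep n l) i = c \<and> sgn_vec l ?j = 1
    \<longleftrightarrow> gval (Poly_Mapping.lookup l ?j) \<ge> 2 * c"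
    unfolding dom_rep_wpos[OF i] using c by (auto simp: gval_def sgn_vec_def)
  also have "\<dots> \<longleftrightarrow> card ?B \<ge> i"
  proof -
    have cb: "card ?B = card {k\<in>{1..n}. gval (Poly_Mapping.lookup l (wpos n l k)) \<ge> 2 * c}"
      by (rule card_bij_Collect[OF wpos_bij])
    have mono: "gval (Poly_Mapping.lookup l (wpos n l k')) \<le> gval (Poly_Mapping.lookup l (wpos n l k))"
      if "1 \<le> k" "k \<le> k'" "k' \<le> n" for k k'
      using above_wpos[of k k'] that by (cases "k = k'") (auto simp: above_def)
    show ?thesis
    proof
      assume a: "gval (Poly_Mapping.lookup l ?j) \<ge> 2 * c"
      have "{1..i} \<subseteq> {k\<in>{1..n}. gval (Poly_Mapping.lookup l (wpos n l k)) \<ge> 2 * c}"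
        using a mono[of _ i] i by (auto intro: order_trans)
      then have "card {1..i} \<le> card ?B" unfolding cb by (intro card_mono) auto
      then show "card ?B \<ge> i" by simp
    next
      assume ge: "card ?B \<ge> i"
      show "gval (Poly_Mapping.lookup l ?j) \<ge> 2 * c"
      proof (rule ccontr)
        assume a: "\<not> ?thesis"
        have "{k\<in>{1..n}. gval (Poly_Mapping.lookup l (wpos n l k)) \<ge> 2 * c} \<subseteq> {1..<i}"
        proof
          fix k assume k: "k \<in> {k\<in>{1..n}. gval (Poly_Mapping.lookup l (wpos n l k)) \<ge> 2 * c}"
          then have "\<not> i \<le> k" using mono[of i k] i a by force
          then show "k \<in> {1..<i}" using k by auto
        qed
        then have "card ?B \<le> card {1..<i}" unfolding cb by (intro card_mono) auto
        then show False using ge i by auto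
      qed
    qed
  qed
  finally show ?thesis .
qed

end

lemma index_set_iff:
  assumes "n \<ge> 1" "i \<in> {1..n}" "l \<in> weights n"
  shows "l \<in> index_set n i r \<longleftrightarrow> card {k\<in>{1..n}. gval (Poly_Mapping.lookup l k) \<ge> 2 * int (r - 1)} \<ge> i"
  using dom_rep_ge_iff[OF assms(1,3,2), of "int (r - 1)"] assms(3) by (simp add: index_set_def wpos_def)

text \<open>The affine action on weights; \<open>i = 0\<close> is \<open>\<lambda>\<^sub>1 \<mapsto> -1 - \<lambda>\<^sub>1\<close>.\<close>

definition wact :: "nat \<Rightarrow> nat \<Rightarrow> (nat \<Rightarrow>\<^sub>0 int) \<Rightarrow> (nat \<Rightarrow>\<^sub>0 int)" where
  "wact n i m = (if i = 0 then Poly_Mapping.update 1 (- 1 - Poly_Mapping.lookup m 1) m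
     else if i < n then Poly_Mapping.update i (Poly_Mapping.lookup m (Suc i)) (Poly_Mapping.update (Suc i) (Poly_Mapping.lookup m i) m)
     else Poly_Mapping.update n (- Poly_Mapping.lookup m n) m)"

lemma lookup_wact:
  "Poly_Mapping.lookup (wact n i m) c = (if i = 0 then (if c = 1 then - 1 - Poly_Mapping.lookup m 1 else Poly_Mapping.lookup m c)
     else if i < n then (if c = i then Poly_Mapping.lookup m (Suc i) else if c = Suc i then Poly_Mapping.lookup m i else Poly_Mapping.lookup m c)
     else (if c = n then - Poly_Mapping.lookup m n else Poly_Mapping.lookup m c))"
  by (simp add: wact_def lookup_update)

lemma weightsI:
  assumes "\<And>c. c \<notin> {1..n} \<Longrightarrow> Poly_Mapping.lookup v c = 0"
  shows "v \<in> weights n"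
  unfolding weights_def using assms by (blast dest: lookup_not_eq_zero_eq_in_keys[THEN iffD2])

lemma wact_weights:
  assumes "m \<in> weights n" "i \<le> n" "n \<ge> 1"
  shows "wact n i m \<in> weights n"
proof -
  have "Poly_Mapping.lookup (wact n i m) c = 0" if "c \<notin> {1..n}" for c
    using that assms weights_lookup[OF assms(1), of c] weights_lookup[OF assms(1), of i]
    by (auto simp: lookup_wact)
  then show ?thesis by (rule weightsI)
qed

lemma wact_wact [simp]: "wact n i (wact n i m) = m"
  by (rule poly_mapping_eqI) (auto simp: lookup_wact)

lemma rk_mid:
  assumes i: "0 < i" "i < n" and ne: "Poly_Mapping.lookup l i \<noteq> Poly_Mapping.lookup l (Suc i)"
  shows "rk n (wact n i l) j = rk n l (Transposition.transpose i (Suc i) j)"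
proof -
  let ?p = "Transposition.transpose i (Suc i)"
  have L: "Poly_Mapping.lookup (wact n i l) c = Poly_Mapping.lookup l (?p c)" for c
    using i by (auto simp: lookup_wact transpose_def)
  have ord: "?p j < ?p k \<longleftrightarrow> j < k" if "Poly_Mapping.lookup l (?p j) = Poly_Mapping.lookup l (?p k)" for j k
    using that ne by (auto simp: transpose_def split: if_splits)
  have A: "above (wact n i l) j k \<longleftrightarrow> above l (?p j) (?p k)" for k
    unfolding above_def L using ord by metis
  have b: "bij_betw ?p {1..n} {1..n}"
    by (rule bij_betw_byWitness[of _ ?p]) (use i in \<open>auto simp: transpose_def\<close>)
  have "rk n l (?p j) = card {k\<in>{1..n}. above l (?p j) (?p k)}"
    unfolding rk_def by (rule card_bij_Collect[OF b])
  then show ?thesis unfolding rk_def A by simp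
qed

text \<open>Equal neighbours are consecutive in the order, with the tie-break turned round for
  negative entries; the signs make \<open>rho_i - rho_(i+1) = 1\<close> either way.\<close>

lemma rk_tie:
  assumes i: "0 < i" "i < n" and e: "Poly_Mapping.lookup l i = Poly_Mapping.lookup l (Suc i)"
  shows "sgn_vec l i * int (rk n l i) = sgn_vec l (Suc i) * int (rk n l (Suc i)) + 1"
proof (cases "Poly_Mapping.lookup l i \<ge> 0")
  case True
  have "{k\<in>{1..n}. above l i k} = insert (Suc i) {k\<in>{1..n}. above l (Suc i) k}"
    using i e True by (auto simp: above_def)
  moreover have "Suc i \<notin> {k\<in>{1..n}. above l (Suc i) k}" using above_irrefl by auto
  ultimately have "rk n l i = Suc (rk n l (Suc i))" unfolding rk_def by simp
  then show ?thesis using True e by (simp add: sgn_vec_def)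
next
  case False
  have "{k\<in>{1..n}. above l (Suc i) k} = insert i {k\<in>{1..n}. above l i k}"
    using i e False by (auto simp: above_def)
  moreover have "i \<notin> {k\<in>{1..n}. above l i k}" using above_irrefl by auto
  ultimately have "rk n l (Suc i) = Suc (rk n l i)" unfolding rk_def by simp
  then show ?thesis using False e by (simp add: sgn_vec_def)
qed

lemma rk_cong: "(\<And>k. k \<in> {1..n} \<Longrightarrow> above l j k \<longleftrightarrow> above l' j k) \<Longrightarrow> rk n l j = rk n l' j"
  unfolding rk_def by (metis (mono_tags, lifting) Collect_cong)

text \<open>For \<open>c > 0\<close> the entries \<open>c\<close> and \<open>-c\<close> have
  adjacent values \<open>2 c\<close> and \<open>2 c - 1\<close>; coordinate \<open>n\<close> loses
  ties among nonnegative entries and wins them among negative ones, so no comparison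
  changes.\<close>

lemma rk_n:
  assumes n: "n \<ge> 1" and ne: "Poly_Mapping.lookup l n \<noteq> 0" and j: "j \<in> {1..n}"
  shows "rk n (wact n n l) j = rk n l j"
proof (rule rk_cong)
  fix k assume k: "k \<in> {1..n}"
  have L: "Poly_Mapping.lookup (wact n n l) c = (if c = n then - Poly_Mapping.lookup l n else Poly_Mapping.lookup l c)" for c
    using n by (simp add: lookup_wact)
  show "above (wact n n l) j k \<longleftrightarrow> above l j k"
  proof (cases "j = n \<longleftrightarrow> k = n")
    case True
    then show ?thesis using j k by (cases "j = n") (auto simp: above_def L)
  next
    case False
    then consider "j = n" "k < n" | "k = n" "j < n" using j k by force
    then show ?thesis
      by cases (use ne in \<open>auto simp: above_def L gval_def split: if_splits\<close>)
  qed
qed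

lemma rk_n0:
  assumes "Poly_Mapping.lookup l n = 0"
  shows "rk n l n = 0"
proof -
  have "{k\<in>{1..n}. above l n k} = {}" using assms by (auto simp: above_def gval_def split: if_splits)
  then show ?thesis by (simp add: rk_def)
qed

text \<open>The mirror case: for \<open>v \<ge> 0\<close> the entries \<open>v\<close> and
  \<open>-1 - v\<close> have adjacent values \<open>2 v\<close> and \<open>2 v + 1\<close>, and
  coordinate 1 wins ties among nonnegative entries and loses them among negative ones.\<close>

lemma rk_0:
  assumes j: "j \<in> {1..n}"
  shows "rk n (wact n 0 l) j = rk n l j"
proof (rule rk_cong)
  fix k assume k: "k \<in> {1..n}"
  have L: "Poly_Mapping.lookup (wact n 0 l) c = (if c = 1 then - 1 - Poly_Mapping.lookup l 1 else Poly_Mapping.lookup l c)" for c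
    by (simp add: lookup_wact)
  show "above (wact n 0 l) j k \<longleftrightarrow> above l j k"
  proof (cases "j = 1 \<longleftrightarrow> k = 1")
    case True
    then show ?thesis using j k by (cases "j = 1") (auto simp: above_def L)
  next
    case False
    then consider "j = 1" "1 < k" | "k = 1" "1 < j" using j k by force
    then show ?thesis
      by cases (auto simp: above_def L gval_def split: if_splits, presburger+)
  qed
qed

text \<open>The entry \<open>-c\<close> at coordinate \<open>n\<close> has value
  \<open>2 c - 1\<close> and wins all ties, so the other coordinates that are not below it are those
  of value at least \<open>2 c\<close>.\<close>

lemma rk_cross:
  assumes n: "n \<ge> 1" and c: "Poly_Mapping.lookup l n = - c" "c > 0"
  shows "rk n l n + card {k\<in>{1..n}. gval (Poly_Mapping.lookup l k) \<ge> 2 * c} = n - 1"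
proof -
  have e: "{k\<in>{1..n}. gval (Poly_Mapping.lookup l k) \<ge> 2 * c} = {k\<in>{1..n}. k \<noteq> n \<and> \<not> above l n k}"
    using c by (auto simp: above_def gval_def split: if_splits)
  have "{k\<in>{1..n}. above l n k} \<union> {k\<in>{1..n}. k \<noteq> n \<and> \<not> above l n k} = {1..n} - {n}"
    using above_irrefl by auto
  moreover have "card ({k\<in>{1..n}. above l n k} \<union> {k\<in>{1..n}. k \<noteq> n \<and> \<not> above l n k})
    = rk n l n + card {k\<in>{1..n}. k \<noteq> n \<and> \<not> above l n k}"
    unfolding rk_def by (intro card_Un_disjoint) auto
  ultimately show ?thesis unfolding e using n by simp
qed

lemma rk_zero:
  assumes "j \<in> {1..n}"
  shows "rk n 0 j = n - j"
proof -
  have "{k\<in>{1..n}. above 0 j k} = {j<..n}" using assms by (auto simp: above_def)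
  then show ?thesis by (simp add: rk_def)
qed

section \<open>An order on weights compatible with the intertwiners\<close>

abbreviation lk :: "(nat \<Rightarrow>\<^sub>0 int) \<Rightarrow> nat \<Rightarrow> int" where "lk \<equiv> Poly_Mapping.lookup"

text \<open>The strict order \<open>gval d' < gval d\<close>, that is
  \<open>0, -1, 1, -2, 2, ...\<close> from the bottom.\<close>

definition dlow :: "int \<Rightarrow> int \<Rightarrow> bool" where
  "dlow d' d \<longleftrightarrow> \<bar>d'\<bar> < \<bar>d\<bar> \<or> d' = - d \<and> d' < 0"

text \<open>\<open>lowA\<close>, \<open>lowB\<close> and \<open>lowC\<close> are moves along
  \<open>e_a\<close>, \<open>e_a - e_b\<close> and \<open>e_a + e_b\<close>, compared through the
  corresponding linear form.\<close>

definition lowA :: "nat \<Rightarrow> (nat \<Rightarrow>\<^sub>0 int) \<Rightarrow> (nat \<Rightarrow>\<^sub>0 int) \<Rightarrow> bool" where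
  "lowA a v l \<longleftrightarrow> (\<forall>c. c \<noteq> a \<longrightarrow> lk v c = lk l c) \<and> dlow (lk v a) (lk l a)"

definition lowB :: "nat \<Rightarrow> nat \<Rightarrow> (nat \<Rightarrow>\<^sub>0 int) \<Rightarrow> (nat \<Rightarrow>\<^sub>0 int) \<Rightarrow> bool" where
  "lowB a b v l \<longleftrightarrow> (\<forall>c. c \<noteq> a \<and> c \<noteq> b \<longrightarrow> lk v c = lk l c) \<and> lk v a + lk v b = lk l a + lk l b \<and>
     dlow (lk v a - lk v b) (lk l a - lk l b)"

definition lowC :: "nat \<Rightarrow> nat \<Rightarrow> (nat \<Rightarrow>\<^sub>0 int) \<Rightarrow> (nat \<Rightarrow>\<^sub>0 int) \<Rightarrow> bool" where
  "lowC a b v l \<longleftrightarrow> (\<forall>c. c \<noteq> a \<and> c \<noteq> b \<longrightarrow> lk v c = lk l c) \<and> lk v a - lk v b = lk l a - lk l b \<and>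
     dlow (lk v a + lk v b) (lk l a + lk l b)"

text \<open>One step down along a root string, in the Bruhat order of the affine Weyl group that acts on
  weights through \<open>wact\<close>.\<close>

definition low1 :: "nat \<Rightarrow> (nat \<Rightarrow>\<^sub>0 int) \<Rightarrow> (nat \<Rightarrow>\<^sub>0 int) \<Rightarrow> bool" where
  "low1 n v l \<longleftrightarrow> v \<in> weights n \<and> l \<in> weights n \<and>
    ((\<exists>a\<in>{1..n}. lowA a v l) \<or> (\<exists>a\<in>{1..n}. \<exists>b\<in>{1..n}. a < b \<and> (lowB a b v l \<or> lowC a b v l)))"

definition low :: "nat \<Rightarrow> (nat \<Rightarrow>\<^sub>0 int) \<Rightarrow> (nat \<Rightarrow>\<^sub>0 int) \<Rightarrow> bool" where
  "low n = (low1 n)\<^sup>*\<^sup>*"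

lemma low1_cases:
  assumes "low1 n v l"
  obtains a where "a \<in> {1..n}" "lowA a v l"
    | a b where "a \<in> {1..n}" "b \<in> {1..n}" "a < b" "lowB a b v l"
    | a b where "a \<in> {1..n}" "b \<in> {1..n}" "a < b" "lowC a b v l"
  using assms unfolding low1_def by blast

lemma low1_weights: "low1 n v l \<Longrightarrow> v \<in> weights n \<and> l \<in> weights n"
  by (simp add: low1_def)

lemma low_refl: "low n l l"
  by (simp add: low_def)

lemma low_trans: "low n u v \<Longrightarrow> low n v l \<Longrightarrow> low n u l"
  unfolding low_def by (rule rtranclp_trans)

lemma low1_low: "low1 n v l \<Longrightarrow> low n v l"
  by (simp add: low_def)

lemma low_weights: "low n v l \<Longrightarrow> l \<in> weights n \<Longrightarrow> v \<in> weights n"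
  unfolding low_def by (induction rule: converse_rtranclp_induct) (auto simp: low1_weights)

lemma dlow_0: "dlow x' x \<Longrightarrow> - 1 - x' = x \<or> dlow (- 1 - x') x"
  unfolding dlow_def by arith

text \<open>\<open>d \<mapsto> -1 - d\<close> exchanges \<open>v\<close> and \<open>-1 - v\<close>,
  which are neighbours in the order and differ in parity; so comparisons between numbers of equal
  parity survive.\<close>

lemma dlow_shift: "dlow d' d \<Longrightarrow> even (d' - d) \<Longrightarrow> dlow (- 1 - d') (- 1 - d)"
  unfolding dlow_def by presburger

text \<open>Lifting property of the Bruhat order. A reflection carries a root string to a root
  string and preserves the comparison, unless the string belongs to its own root; \<open>s_0\<close>
  and \<open>s_n\<close> exchange the types \<open>lowB\<close> and \<open>lowC\<close> at their
  coordinate.\<close>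

lemma low1_lift:
  assumes lo: "low1 n v' v" and i: "i \<le> n" and n: "n \<ge> 2"
  shows "low1 n (wact n i v') (wact n i v) \<or> wact n i v' = v \<or> low1 n (wact n i v') v"
proof -
  let ?w = "wact n i"
  have W: "v' \<in> weights n" "v \<in> weights n" using lo low1_weights by auto
  then have W': "?w v' \<in> weights n" "?w v \<in> weights n" using wact_weights i n by auto
  have IA: "low1 n x y" if "a \<in> {1..n}" "lowA a x y" "x \<in> weights n" "y \<in> weights n" for a x y
    using that by (auto simp: low1_def)
  have IBC: "low1 n x y" if "a \<in> {1..n}" "b \<in> {1..n}" "a < b" "lowB a b x y \<or> lowC a b x y" "x \<in> weights n" "y \<in> weights n" for a b x y
    using that unfolding low1_def by blast
  consider (z) "i = 0" | (m) "0 < i" "i < n" | (n) "i = n" "0 < i" using i by linarith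
  then show ?thesis
  proof cases
    case z
    have L: "lk (?w x) c = (if c = 1 then - 1 - lk x 1 else lk x c)" for x c using z by (simp add: lookup_wact)
    have one: "1 \<in> {1..n}" using n by simp
    show ?thesis using lo
    proof (cases rule: low1_cases)
      case (1 a)
      show ?thesis
      proof (cases "a = 1")
        case True
        then consider "- 1 - lk v' 1 = lk v 1" | "dlow (- 1 - lk v' 1) (lk v 1)" using 1(2) dlow_0 unfolding lowA_def by blast
        then show ?thesis
        proof cases
          case 1
          have "?w v' = v" by (rule poly_mapping_eqI) (use 1 \<open>lowA a v' v\<close> True in \<open>auto simp: L lowA_def\<close>)
          then show ?thesis by blast
        next
          case 2
          have "lowA 1 (?w v') v" using 2 \<open>lowA a v' v\<close> True by (auto simp: L lowA_def)
          then show ?thesis using IA one W' W by blast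
        qed
      next
        case False
        then have "lowA a (?w v') (?w v)" using 1 by (auto simp: lowA_def L)
        then show ?thesis using IA 1 W' by blast
      qed
    next
      case (2 a b)
      show ?thesis
      proof (cases "a = 1")
        case True
        have "(lk v' a - lk v' b) - (lk v a - lk v b) = 2 * (lk v b - lk v' b)" using 2(4) by (simp add: lowB_def)
        then have p: "even ((lk v' a - lk v' b) - (lk v a - lk v b))" by (metis dvd_triv_left)
        have "dlow (- 1 - (lk v' a - lk v' b)) (- 1 - (lk v a - lk v b))"
          using dlow_shift[OF _ p] 2(4) by (simp add: lowB_def)
        then have "lowC a b (?w v') (?w v)"
          using 2 True by (auto simp: lowB_def lowC_def L algebra_simps)
        then show ?thesis using IBC 2 W' by blast
      next
        case False
        then have "lowB a b (?w v') (?w v)" using 2 by (auto simp: lowB_def L)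
        then show ?thesis using IBC 2 W' by blast
      qed
    next
      case (3 a b)
      show ?thesis
      proof (cases "a = 1")
        case True
        have "(lk v' a + lk v' b) - (lk v a + lk v b) = 2 * (lk v' b - lk v b)" using 3(4) by (simp add: lowC_def)
        then have p: "even ((lk v' a + lk v' b) - (lk v a + lk v b))" by (metis dvd_triv_left)
        have "dlow (- 1 - (lk v' a + lk v' b)) (- 1 - (lk v a + lk v b))"
          using dlow_shift[OF _ p] 3(4) by (simp add: lowC_def)
        then have "lowB a b (?w v') (?w v)"
          using 3 True by (auto simp: lowB_def lowC_def L algebra_simps)
        then show ?thesis using IBC 3 W' by blast
      next
        case False
        then have "lowC a b (?w v') (?w v)" using 3 by (auto simp: lowC_def L)
        then show ?thesis using IBC 3 W' by blast
      qed
    qed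
  next
    case m
    have L: "lk (?w x) c = lk x (Transposition.transpose i (Suc i) c)" for x c
      using m by (auto simp: lookup_wact transpose_def)
    let ?p = "Transposition.transpose i (Suc i)"
    have pi: "?p c \<in> {1..n}" if "c \<in> {1..n}" for c using that m by (auto simp: transpose_def)
    have pp: "?p (?p c) = c" for c by simp
    have pne: "c \<noteq> ?p a \<Longrightarrow> ?p c \<noteq> a" for a c by auto
    have plt: "?p a < ?p b" if "a < b" "\<not> (a = i \<and> b = Suc i)" for a b
      using that by (auto simp: transpose_def split: if_splits)
    show ?thesis using lo
    proof (cases rule: low1_cases)
      case (1 a)
      then have "lowA (?p a) (?w v') (?w v)" using pne by (auto simp: lowA_def L)
      then show ?thesis using IA pi 1 W' by blast
    next
      case (2 a b)
      show ?thesis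
      proof (cases "a = i \<and> b = Suc i")
        case False
        then have "lowB (?p a) (?p b) (?w v') (?w v)" using 2 pne by (auto simp: lowB_def L)
        then show ?thesis using IBC[OF pi pi plt] 2 W' False by blast
      next
        case True
        then consider "\<bar>lk v' i - lk v' (Suc i)\<bar> < \<bar>lk v i - lk v (Suc i)\<bar>" | "lk v' i - lk v' (Suc i) = - (lk v i - lk v (Suc i))"
          using 2(4) by (auto simp: lowB_def dlow_def)
        then show ?thesis
        proof cases
          case 1
          have "lowB a b (?w v') v"
            using 1 2(4) True by (auto simp: lowB_def dlow_def L transpose_def)
          then show ?thesis using IBC 2 W' W by blast
        next
          case 2
          have "lk v' i = lk v (Suc i)" "lk v' (Suc i) = lk v i"
            using 2 \<open>lowB a b v' v\<close> True by (auto simp: lowB_def)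
          then have "?w v' = v"
            using \<open>lowB a b v' v\<close> True by (intro poly_mapping_eqI) (auto simp: L lowB_def transpose_def)
          then show ?thesis by blast
        qed
      qed
    next
      case (3 a b)
      show ?thesis
      proof (cases "a = i \<and> b = Suc i")
        case False
        then have "lowC (?p a) (?p b) (?w v') (?w v)" using 3 pne by (auto simp: lowC_def L)
        then show ?thesis using IBC[OF pi pi plt] 3 W' False by blast
      next
        case True
        then have "lowC a b (?w v') (?w v)" using 3 by (auto simp: lowC_def L transpose_def add.commute)
        then show ?thesis using IBC 3 W' by blast
      qed
    qed
  next
    case n
    have L: "lk (?w x) c = (if c = n then - lk x n else lk x c)" for x c using n by (simp add: lookup_wact)
    show ?thesis using lo
    proof (cases rule: low1_cases)
      case (1 a)
      show ?thesis
      proof (cases "a = n")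
        case True
        then consider "\<bar>lk v' n\<bar> < \<bar>lk v n\<bar>" | "- lk v' n = lk v n" using 1(2) unfolding lowA_def dlow_def by auto
        then show ?thesis
        proof cases
          case 1
          have "lowA n (?w v') v" using 1 \<open>lowA a v' v\<close> True by (auto simp: L lowA_def dlow_def)
          then show ?thesis using IA \<open>a \<in> {1..n}\<close> True W' W by blast
        next
          case 2
          have "?w v' = v" by (rule poly_mapping_eqI) (use 2 \<open>lowA a v' v\<close> True in \<open>auto simp: L lowA_def\<close>)
          then show ?thesis by blast
        qed
      next
        case False
        then have "lowA a (?w v') (?w v)" using 1 by (auto simp: lowA_def L)
        then show ?thesis using IA 1 W' by blast
      qed
    next
      case (2 a b)
      then have "a \<noteq> n" by auto
      have "lowB a b (?w v') (?w v) \<or> lowC a b (?w v') (?w v)"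
        using 2(4) \<open>a \<noteq> n\<close> by (cases "b = n") (auto simp: lowB_def lowC_def L)
      then show ?thesis using IBC 2 W' by blast
    next
      case (3 a b)
      then have "a \<noteq> n" by auto
      have "lowB a b (?w v') (?w v) \<or> lowC a b (?w v') (?w v)"
        using 3(4) \<open>a \<noteq> n\<close> by (cases "b = n") (auto simp: lowB_def lowC_def L)
      then show ?thesis using IBC 3 W' by blast
    qed
  qed
qed

text \<open>The condition under which \<open>wact n i l\<close> lies strictly above \<open>l\<close>
  (\<open>asc_low1\<close>).\<close>

definition asc :: "nat \<Rightarrow> nat \<Rightarrow> (nat \<Rightarrow>\<^sub>0 int) \<Rightarrow> bool" where
  "asc n i l \<longleftrightarrow> (if i = 0 then lk l 1 \<ge> 0 else if i < n then lk l i < lk l (Suc i) else lk l n < 0)"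

lemma asc_low1:
  assumes "l \<in> weights n" "i \<le> n" "n \<ge> 2" "asc n i l"
  shows "low1 n l (wact n i l)"
proof -
  have W: "wact n i l \<in> weights n" using assms wact_weights by simp
  consider "i = 0" | "0 < i" "i < n" | "i = n" using assms by linarith
  then show ?thesis
  proof cases
    case 1
    then have "lowA 1 l (wact n i l)" using assms by (auto simp: lowA_def lookup_wact asc_def dlow_def)
    then show ?thesis unfolding low1_def using assms W by force
  next
    case 2
    then have "lowB i (Suc i) l (wact n i l)" using assms by (auto simp: lowB_def lookup_wact asc_def dlow_def)
    then show ?thesis unfolding low1_def using assms W 2 by force
  next
    case 3
    then have "lowA n l (wact n i l)" using assms by (auto simp: lowA_def lookup_wact asc_def dlow_def)
    then show ?thesis unfolding low1_def using assms W by force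
  qed
qed

text \<open>Iterates \<open>low1_lift\<close> along a chain below \<open>s l\<close>; the lower set
  of \<open>s l\<close> is thus stable under \<open>s\<close>.\<close>

lemma low_wact:
  assumes l: "l \<in> weights n" and i: "i \<le> n" and n: "n \<ge> 2" and a: "asc n i l" and v: "low n v (wact n i l)"
  shows "low n (wact n i v) (wact n i l)"
  using v unfolding low_def
proof (induction rule: converse_rtranclp_induct)
  case base
  show ?case using asc_low1[OF l i n a] by simp
next
  case (step v' v)
  have "low n (wact n i v') (wact n i v) \<or> wact n i v' = v \<or> low n (wact n i v') v"
    using low1_lift[OF step(1) i n] low1_low by blast
  moreover have "low n v (wact n i l)" "low n (wact n i v) (wact n i l)" using step by (simp_all add: low_def)
  ultimately have "low n (wact n i v') (wact n i l)" using low_trans by blast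
  then show ?case by (simp add: low_def)
qed

text \<open>The exponents that occur in the image of \<open>x\<^sup>m\<close> under an intertwiner.\<close>

definition seg :: "nat \<Rightarrow> nat \<Rightarrow> (nat \<Rightarrow>\<^sub>0 int) \<Rightarrow> (nat \<Rightarrow>\<^sub>0 int) set" where
  "seg n i m = {v. if i = 0 then (\<forall>c. c \<noteq> 1 \<longrightarrow> lk v c = lk m c) \<and> \<bar>2 * lk v 1 + 1\<bar> \<le> \<bar>2 * lk m 1 + 1\<bar>
     else if i < n then (\<forall>c. c \<noteq> i \<and> c \<noteq> Suc i \<longrightarrow> lk v c = lk m c) \<and> lk v i + lk v (Suc i) = lk m i + lk m (Suc i) \<and>
       \<bar>lk v i - lk v (Suc i)\<bar> \<le> \<bar>lk m i - lk m (Suc i)\<bar>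
     else (\<forall>c. c \<noteq> n \<longrightarrow> lk v c = lk m c) \<and> \<bar>lk v n\<bar> \<le> \<bar>lk m n\<bar>}"

lemma seg_cases:
  assumes m: "m \<in> weights n" and i: "i \<le> n" and n: "n \<ge> 2" and v: "v \<in> seg n i m"
  shows "v = m \<or> v = wact n i m \<or> low1 n v m"
proof -
  consider "i = 0" | "0 < i" "i < n" | "i = n" "0 < i" using i by linarith
  then show ?thesis
  proof cases
    case 1
    have v1: "\<And>c. c \<noteq> 1 \<Longrightarrow> lk v c = lk m c" "\<bar>2 * lk v 1 + 1\<bar> \<le> \<bar>2 * lk m 1 + 1\<bar>"
      using v 1 by (auto simp: seg_def)
    have "lk v c = 0" if "c \<notin> {1..n}" for c using weights_lookup[OF m that] v1(1)[of c] that n by fastforce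
    then have W: "v \<in> weights n" by (rule weightsI)
    have "lk v 1 = lk m 1 \<or> lk v 1 = - 1 - lk m 1 \<or> dlow (lk v 1) (lk m 1)"
      using v1(2) unfolding dlow_def by arith
    then consider "lk v 1 = lk m 1" | "lk v 1 = - 1 - lk m 1" | "dlow (lk v 1) (lk m 1)" by blast
    then show ?thesis
    proof cases
      assume "lk v 1 = lk m 1"
      then have "v = m" using v1(1) by (intro poly_mapping_eqI) metis
      then show ?thesis by blast
    next
      assume "lk v 1 = - 1 - lk m 1"
      then have "v = wact n i m" using v1(1) 1 by (intro poly_mapping_eqI) (auto simp: lookup_wact)
      then show ?thesis by blast
    next
      assume "dlow (lk v 1) (lk m 1)"
      then have "lowA 1 v m" using v1(1) by (simp add: lowA_def)
      then show ?thesis unfolding low1_def using W m n by force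
    qed
  next
    case 2
    have v1: "\<And>c. c \<noteq> i \<Longrightarrow> c \<noteq> Suc i \<Longrightarrow> lk v c = lk m c" "lk v i + lk v (Suc i) = lk m i + lk m (Suc i)"
      "\<bar>lk v i - lk v (Suc i)\<bar> \<le> \<bar>lk m i - lk m (Suc i)\<bar>"
      using v 2 by (auto simp: seg_def)
    have "lk v c = 0" if "c \<notin> {1..n}" for c using weights_lookup[OF m that] v1(1)[of c] that 2 by fastforce
    then have W: "v \<in> weights n" by (rule weightsI)
    have "lk v i = lk m i \<or> lk v i = lk m (Suc i) \<or> \<bar>lk v i - lk v (Suc i)\<bar> < \<bar>lk m i - lk m (Suc i)\<bar>"
      using v1(2,3) by arith
    then consider "lk v i = lk m i" | "lk v i = lk m (Suc i)" | "\<bar>lk v i - lk v (Suc i)\<bar> < \<bar>lk m i - lk m (Suc i)\<bar>" by blast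
    then show ?thesis
    proof cases
      assume "lk v i = lk m i"
      then have "v = m" using v1(1,2) by (intro poly_mapping_eqI) (metis add_left_cancel)
      then show ?thesis by blast
    next
      assume "lk v i = lk m (Suc i)"
      then have "v = wact n i m" using v1(1,2) 2 by (intro poly_mapping_eqI) (auto simp: lookup_wact)
      then show ?thesis by blast
    next
      assume "\<bar>lk v i - lk v (Suc i)\<bar> < \<bar>lk m i - lk m (Suc i)\<bar>"
      then have "lowB i (Suc i) v m" using v1(1,2) by (simp add: lowB_def dlow_def)
      then show ?thesis unfolding low1_def using W m 2 by force
    qed
  next
    case 3
    have v1: "\<And>c. c \<noteq> n \<Longrightarrow> lk v c = lk m c" "\<bar>lk v n\<bar> \<le> \<bar>lk m n\<bar>"
      using v 3 by (auto simp: seg_def)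
    have "lk v c = 0" if "c \<notin> {1..n}" for c using weights_lookup[OF m that] v1(1)[of c] that 3 by fastforce
    then have W: "v \<in> weights n" by (rule weightsI)
    have "lk v n = lk m n \<or> lk v n = - lk m n \<or> \<bar>lk v n\<bar> < \<bar>lk m n\<bar>" using v1(2) by arith
    then consider "lk v n = lk m n" | "lk v n = - lk m n" | "\<bar>lk v n\<bar> < \<bar>lk m n\<bar>" by blast
    then show ?thesis
    proof cases
      assume "lk v n = lk m n"
      then have "v = m" using v1(1) by (intro poly_mapping_eqI) metis
      then show ?thesis by blast
    next
      assume "lk v n = - lk m n"
      then have "v = wact n i m" using v1(1) 3 by (intro poly_mapping_eqI) (auto simp: lookup_wact)
      then show ?thesis by blast
    next
      assume "\<bar>lk v n\<bar> < \<bar>lk m n\<bar>"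
      then have "lowA n v m" using v1(1) by (simp add: lowA_def dlow_def)
      then show ?thesis unfolding low1_def using W m n by force
    qed
  qed
qed

text \<open>Combined with the support bounds for the generators, this preserves triangularity under
  an ascending intertwiner.\<close>

lemma seg_low:
  assumes l: "l \<in> weights n" and i: "i \<le> n" and n: "n \<ge> 2" and a: "asc n i l"
    and m: "low n m (wact n i l)" and v: "v \<in> seg n i m"
  shows "low n v (wact n i l)"
proof -
  have "m \<in> weights n" using low_weights[OF m] wact_weights l i n by simp
  then consider "v = m" | "v = wact n i m" | "low1 n v m" using seg_cases[OF _ i n v] by blast
  then show ?thesis
    using low_wact[OF l i n a m] m low1_low low_trans by cases blast+
qed

section \<open>Comparison with the order of the statement\<close>

definition psum :: "(nat \<Rightarrow>\<^sub>0 int) \<Rightarrow> nat \<Rightarrow> int" where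
  "psum l k = (\<Sum>j\<in>{1..k}. lk l j)"

definition sqs :: "nat \<Rightarrow> (nat \<Rightarrow>\<^sub>0 int) \<Rightarrow> int" where
  "sqs n l = (\<Sum>j\<in>{1..n}. (lk l j)\<^sup>2)"

text \<open>Partial sums are the coefficients with respect to
  \<open>e_1 - e_2, ..., e_(n-1) - e_n, e_n\<close>, so this yields \<open>dominance_ge\<close>
  (\<open>dominance_geI\<close>).\<close>

definition psum_le :: "nat \<Rightarrow> (nat \<Rightarrow>\<^sub>0 int) \<Rightarrow> (nat \<Rightarrow>\<^sub>0 int) \<Rightarrow> bool" where
  "psum_le n v l \<longleftrightarrow> (\<forall>k\<in>{1..n}. psum v k \<le> psum l k)"

definition height :: "nat \<Rightarrow> (nat \<Rightarrow>\<^sub>0 int) \<Rightarrow> int" where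
  "height n l = (\<Sum>k\<in>{1..n}. psum l k)"

lemma sum_two:
  fixes g :: "nat \<Rightarrow> int"
  assumes "finite A" "a \<noteq> b" "\<And>c. c \<noteq> a \<Longrightarrow> c \<noteq> b \<Longrightarrow> g c = 0"
  shows "sum g A = (if a \<in> A then g a else 0) + (if b \<in> A then g b else 0)"
proof -
  have "sum g A = sum g (A \<inter> {a, b})"
    using assms by (intro sum.mono_neutral_right) auto
  also have "\<dots> = (if a \<in> A then g a else 0) + (if b \<in> A then g b else 0)"
    using assms(2) by (cases "a \<in> A"; cases "b \<in> A") auto
  finally show ?thesis .
qed

lemma psum_two:
  assumes "a \<noteq> b" "\<And>c. c \<noteq> a \<Longrightarrow> c \<noteq> b \<Longrightarrow> lk v c = lk l c" "1 \<le> a" "1 \<le> b"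
  shows "psum v k - psum l k = (if a \<le> k then lk v a - lk l a else 0) + (if b \<le> k then lk v b - lk l b else 0)"
proof -
  have "psum v k - psum l k = (\<Sum>j\<in>{1..k}. lk v j - lk l j)" by (simp add: psum_def sum_subtractf)
  also have "\<dots> = (if a \<in> {1..k} then lk v a - lk l a else 0) + (if b \<in> {1..k} then lk v b - lk l b else 0)"
    by (rule sum_two) (use assms in auto)
  finally show ?thesis using assms by simp
qed

lemma sqs_two:
  assumes "a \<noteq> b" "\<And>c. c \<noteq> a \<Longrightarrow> c \<noteq> b \<Longrightarrow> lk v c = lk l c" "a \<in> {1..n}"
  shows "sqs n v - sqs n l = ((lk v a)\<^sup>2 - (lk l a)\<^sup>2) + (if b \<in> {1..n} then (lk v b)\<^sup>2 - (lk l b)\<^sup>2 else 0)"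
proof -
  have "sqs n v - sqs n l = (\<Sum>j\<in>{1..n}. (lk v j)\<^sup>2 - (lk l j)\<^sup>2)" by (simp add: sqs_def sum_subtractf)
  also have "\<dots> = (if a \<in> {1..n} then (lk v a)\<^sup>2 - (lk l a)\<^sup>2 else 0) + (if b \<in> {1..n} then (lk v b)\<^sup>2 - (lk l b)\<^sup>2 else 0)"
    by (rule sum_two) (use assms in auto)
  finally show ?thesis using assms(3) by simp
qed

lemma abs_less_square: "\<bar>x\<bar> < \<bar>y\<bar> \<Longrightarrow> x\<^sup>2 < (y::int)\<^sup>2"
  by (metis abs_le_square_iff not_le)

lemma half_less:
  fixes x y p q :: int
  assumes "2 * (x - y) = p - q" "p < q"
  shows "x < y"
  using assms by presburger

text \<open>A step into the interior of a root string shortens the weight; a step to the opposite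
  end is a reflection, which keeps the length and subtracts a positive multiple of a positive
  root.\<close>

lemma low1_psum:
  assumes "low1 n v l"
  shows "sqs n v < sqs n l \<or> sqs n v = sqs n l \<and> psum_le n v l"
  using assms
proof (cases rule: low1_cases)
  case (1 a)
  then have off: "lk v c = lk l c" if "c \<noteq> a" for c using that by (simp add: lowA_def)
  then have S: "sqs n v - sqs n l = (lk v a)\<^sup>2 - (lk l a)\<^sup>2"
    using sqs_two[of a "Suc a" v l n] 1 by auto
  have P: "psum v k - psum l k = (if a \<le> k then lk v a - lk l a else 0)" for k
    using psum_two[of a "Suc a" v l k] off 1 by auto
  from 1(2) consider "\<bar>lk v a\<bar> < \<bar>lk l a\<bar>" | "lk v a = - lk l a" "lk v a < 0" unfolding lowA_def dlow_def by blast
  then show ?thesis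
  proof cases
    assume "\<bar>lk v a\<bar> < \<bar>lk l a\<bar>"
    then show ?thesis using abs_less_square S by fastforce
  next
    assume e: "lk v a = - lk l a" "lk v a < 0"
    have "psum v k \<le> psum l k" for k using P[of k] e by (auto split: if_splits)
    then show ?thesis using S e by (simp add: psum_le_def)
  qed
next
  case (2 a b)
  then have off: "lk v c = lk l c" if "c \<noteq> a" "c \<noteq> b" for c using that by (simp add: lowB_def)
  have s: "lk v a + lk v b = lk l a + lk l b" using 2 by (simp add: lowB_def)
  have S: "2 * (sqs n v - sqs n l) = (lk v a - lk v b)\<^sup>2 - (lk l a - lk l b)\<^sup>2"
  proof -
    have "2 * (((lk v a)\<^sup>2 - (lk l a)\<^sup>2) + ((lk v b)\<^sup>2 - (lk l b)\<^sup>2)) =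
      (lk v a - lk v b)\<^sup>2 - (lk l a - lk l b)\<^sup>2 + ((lk v a + lk v b)\<^sup>2 - (lk l a + lk l b)\<^sup>2)"
      by (simp add: power2_eq_square algebra_simps)
    then show ?thesis using sqs_two[of a b v l n] off 2 s by simp
  qed
  have P: "psum v k - psum l k = (if a \<le> k then lk v a - lk l a else 0) + (if b \<le> k then lk v b - lk l b else 0)" for k
    using psum_two[of a b v l k] off 2 by auto
  from 2(4) consider "\<bar>lk v a - lk v b\<bar> < \<bar>lk l a - lk l b\<bar>"
    | "lk v a - lk v b = - (lk l a - lk l b)" "lk v a - lk v b < 0" unfolding lowB_def dlow_def by blast
  then show ?thesis
  proof cases
    assume "\<bar>lk v a - lk v b\<bar> < \<bar>lk l a - lk l b\<bar>"
    from abs_less_square[OF this] have "sqs n v < sqs n l" by (rule half_less[OF S])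
    then show ?thesis by simp
  next
    assume e: "lk v a - lk v b = - (lk l a - lk l b)" "lk v a - lk v b < 0"
    then have "(lk v a - lk v b)\<^sup>2 = (lk l a - lk l b)\<^sup>2" by (metis power2_minus)
    moreover have "psum v k \<le> psum l k" for k using P[of k] e s 2(3) by (auto split: if_splits)
    ultimately show ?thesis using S by (simp add: psum_le_def)
  qed
next
  case (3 a b)
  then have off: "lk v c = lk l c" if "c \<noteq> a" "c \<noteq> b" for c using that by (simp add: lowC_def)
  have s: "lk v a - lk v b = lk l a - lk l b" using 3 by (simp add: lowC_def)
  have S: "2 * (sqs n v - sqs n l) = (lk v a + lk v b)\<^sup>2 - (lk l a + lk l b)\<^sup>2"
  proof -
    have "2 * (((lk v a)\<^sup>2 - (lk l a)\<^sup>2) + ((lk v b)\<^sup>2 - (lk l b)\<^sup>2)) =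
      (lk v a - lk v b)\<^sup>2 - (lk l a - lk l b)\<^sup>2 + ((lk v a + lk v b)\<^sup>2 - (lk l a + lk l b)\<^sup>2)"
      by (simp add: power2_eq_square algebra_simps)
    then show ?thesis using sqs_two[of a b v l n] off 3 s by simp
  qed
  have P: "psum v k - psum l k = (if a \<le> k then lk v a - lk l a else 0) + (if b \<le> k then lk v b - lk l b else 0)" for k
    using psum_two[of a b v l k] off 3 by auto
  from 3(4) consider "\<bar>lk v a + lk v b\<bar> < \<bar>lk l a + lk l b\<bar>"
    | "lk v a + lk v b = - (lk l a + lk l b)" "lk v a + lk v b < 0" unfolding lowC_def dlow_def by blast
  then show ?thesis
  proof cases
    assume "\<bar>lk v a + lk v b\<bar> < \<bar>lk l a + lk l b\<bar>"
    from abs_less_square[OF this] have "sqs n v < sqs n l" by (rule half_less[OF S])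
    then show ?thesis by simp
  next
    assume e: "lk v a + lk v b = - (lk l a + lk l b)" "lk v a + lk v b < 0"
    then have "(lk v a + lk v b)\<^sup>2 = (lk l a + lk l b)\<^sup>2" by (metis power2_minus)
    moreover have "psum v k \<le> psum l k" for k using P[of k] e s 3(3) by (auto split: if_splits)
    ultimately show ?thesis using S by (simp add: psum_le_def)
  qed
qed

lemma low1_neq: "low1 n v l \<Longrightarrow> v \<noteq> l"
  by (auto elim!: low1_cases simp: lowA_def lowB_def lowC_def dlow_def)

lemma psum_inject:
  assumes "v \<in> weights n" "l \<in> weights n" "\<And>k. k \<in> {1..n} \<Longrightarrow> psum v k = psum l k"
  shows "v = l"
proof (rule weights_eqI[OF assms(1,2)])
  fix j assume j: "j \<in> {1..n}"
  have e: "psum x j = psum x (j - 1) + lk x j" for x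
    using j by (cases j) (simp_all add: psum_def)
  have "psum v (j - 1) = psum l (j - 1)"
  proof (cases "j = 1")
    case True
    then show ?thesis by (simp add: psum_def)
  next
    case False
    then have "j - 1 \<in> {1..n}" using j by auto
    then show ?thesis by (rule assms(3))
  qed
  then show "lk v j = lk l j" using e[of v] e[of l] assms(3)[OF j] by simp
qed

lemma height_less:
  assumes "v \<in> weights n" "l \<in> weights n" "psum_le n v l" "v \<noteq> l"
  shows "height n v < height n l"
  unfolding height_def
proof (rule sum_strict_mono_ex1)
  show "\<forall>k\<in>{1..n}. psum v k \<le> psum l k" using assms(3) by (simp add: psum_le_def)
  show "\<exists>k\<in>{1..n}. psum v k < psum l k"
    using psum_inject[OF assms(1,2)] assms(3,4) unfolding psum_le_def by force
qed simp

lemma abs_le_power2: "\<bar>x\<bar> \<le> (x::int)\<^sup>2"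
proof (cases "x = 0")
  case False
  then have "\<bar>x\<bar> * 1 \<le> \<bar>x\<bar> * \<bar>x\<bar>" by (intro mult_left_mono) linarith+
  then show ?thesis by (simp add: power2_eq_square)
qed simp

lemma height_bound: "\<bar>height n l\<bar> \<le> int n * sqs n l"
proof -
  have "\<bar>psum l k\<bar> \<le> sqs n l" if "k \<in> {1..n}" for k
  proof -
    have "\<bar>psum l k\<bar> \<le> (\<Sum>j\<in>{1..k}. \<bar>lk l j\<bar>)" unfolding psum_def by (rule sum_abs)
    also have "\<dots> \<le> (\<Sum>j\<in>{1..k}. (lk l j)\<^sup>2)"
    proof (rule sum_mono)
      fix j
      show "\<bar>lk l j\<bar> \<le> (lk l j)\<^sup>2" by (rule abs_le_power2)
    qed
    also have "\<dots> \<le> sqs n l"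
      unfolding sqs_def using that by (intro sum_mono2) auto
    finally show ?thesis .
  qed
  then have "(\<Sum>k\<in>{1..n}. \<bar>psum l k\<bar>) \<le> (\<Sum>k\<in>{1..n}. sqs n l)" by (intro sum_mono) auto
  moreover have "\<bar>height n l\<bar> \<le> (\<Sum>k\<in>{1..n}. \<bar>psum l k\<bar>)" unfolding height_def by (rule sum_abs)
  ultimately show ?thesis by simp
qed

lemma sqs_nonneg: "0 \<le> sqs n l"
  by (simp add: sqs_def sum_nonneg)

text \<open>\<open>hm\<close> encodes the lexicographic order on pairs \<open>(sqs, height)\<close> in a single natural number.\<close>

definition hm :: "nat \<Rightarrow> (nat \<Rightarrow>\<^sub>0 int) \<Rightarrow> nat" where
  "hm n l = nat ((2 * int n + 1) * (sqs n l)\<^sup>2 + height n l + int n * sqs n l)"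

lemma hm_less:
  assumes "low1 n v l"
  shows "hm n v < hm n l"
proof -
  define h where "h l = (2 * int n + 1) * (sqs n l)\<^sup>2 + height n l + int n * sqs n l" for l
  have h0: "0 \<le> h l" for l
  proof -
    have "0 \<le> (2 * int n + 1) * (sqs n l)\<^sup>2" by simp
    then show ?thesis using height_bound[of n l] unfolding h_def by linarith
  qed
  have "h v < h l"
  proof (cases "sqs n v < sqs n l")
    case False
    then have "sqs n v = sqs n l" "psum_le n v l" using low1_psum[OF assms] by auto
    moreover have "height n v < height n l"
      using height_less low1_neq low1_weights assms calculation by blast
    ultimately show ?thesis by (simp add: h_def)
  next
    case True
    have hv: "h v \<le> (2 * int n + 1) * (sqs n v)\<^sup>2 + 2 * int n * sqs n v"
      using height_bound[of n v] unfolding h_def by linarith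
    \<comment> \<open>\<open>height\<close> is bounded by \<open>n * sqs\<close> in absolute value,
      so the lower-order terms amount to at most \<open>2 n sqs\<close>, less than the gap
      \<open>(2 n + 1) (2 sqs + 1)\<close> between consecutive squares.\<close>
    have "(2 * int n + 1) * (sqs n v)\<^sup>2 + 2 * int n * sqs n v < (2 * int n + 1) * (sqs n v + 1)\<^sup>2"
      using sqs_nonneg[of n v] by (simp add: power2_eq_square algebra_simps add_pos_nonneg)
    also have "\<dots> \<le> (2 * int n + 1) * (sqs n l)\<^sup>2"
      using True sqs_nonneg[of n v] by (intro mult_left_mono power_mono) auto
    also have "\<dots> \<le> h l" using height_bound[of n l] unfolding h_def by linarith
    finally show ?thesis using hv by linarith
  qed
  moreover have "hm n x = nat (h x)" for x by (simp add: hm_def h_def)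
  ultimately show ?thesis using h0[of v] by (simp add: nat_less_eq_zless)
qed

lemma low_hm: "low n v l \<Longrightarrow> hm n v \<le> hm n l"
  unfolding low_def by (induction rule: rtranclp_induct) (auto dest: hm_less)

lemma low_hm_less: "low n v l \<Longrightarrow> v \<noteq> l \<Longrightarrow> hm n v < hm n l"
  unfolding low_def
proof (induction rule: converse_rtranclp_induct)
  case (step u v)
  then have "hm n v \<le> hm n l" using low_hm by (simp add: low_def)
  then show ?case using hm_less[OF step(1)] by simp
qed simp

lemma low_antisym: "low n v l \<Longrightarrow> low n l v \<Longrightarrow> v = l"
  using low_hm_less by (metis less_asym)

text \<open>If no reflection lowers \<open>l\<close>, then
  \<open>0 \<le> l_1 \<le> ... \<le> l_n \<le> 0\<close>.\<close>

lemma ascending_path: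
  assumes l: "l \<in> weights n" and n: "n \<ge> 2" and l0: "l \<noteq> 0"
  shows "\<exists>i\<le>n. asc n i (wact n i l)"
proof (rule ccontr)
  assume no: "\<not> ?thesis"
  have mid: "lk l i \<le> lk l (Suc i)" if "0 < i" "i < n" for i
  proof -
    have "\<not> asc n i (wact n i l)" using no that by auto
    then show ?thesis using that by (simp add: asc_def lookup_wact)
  qed
  have "\<not> asc n n (wact n n l)" "\<not> asc n 0 (wact n 0 l)" using no by auto
  then have last: "lk l n \<le> 0" and first: "lk l 1 \<ge> 0"
    using n by (auto simp: asc_def lookup_wact)
  have up: "lk l 1 \<le> lk l j" if "1 \<le> j" "j \<le> n" for j
    using that
  proof (induction j rule: dec_induct)
    case (step k)
    then show ?case using mid[of k] by simp
  qed simp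
  have dn: "lk l j \<le> lk l n" if "1 \<le> j" "j \<le> n" for j
    using that(2,1)
  proof (induction j rule: inc_induct)
    case (step k)
    then show ?case using mid[of k] by simp
  qed simp
  have "l = 0"
  proof (rule poly_mapping_eqI)
    fix j
    show "lk l j = lk 0 j"
      using up[of j] dn[of j] first last weights_lookup[OF l, of j] by (cases "j \<in> {1..n}") auto
  qed
  then show False using l0 by simp
qed

lemma weights_zero: "0 \<in> weights n"
  by (simp add: weights_def)

text \<open>Every weight is reached from 0 by ascending reflections, and \<open>hm\<close> decreases
  on the way back. The polynomials \<open>E\<close> are constructed and compared along such
  paths.\<close>

lemma weight_induct [consumes 2, case_names zero step]:
  assumes l: "l \<in> weights n" and n: "n \<ge> 2"
    and 0: "P 0" and step: "\<And>i v. v \<in> weights n \<Longrightarrow> i \<le> n \<Longrightarrow> asc n i v \<Longrightarrow> P v \<Longrightarrow> P (wact n i v)"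
  shows "P l"
  using l
proof (induction "hm n l" arbitrary: l rule: less_induct)
  case less
  show ?case
  proof (cases "l = 0")
    case True
    then show ?thesis using 0 by simp
  next
    case False
    then obtain i where i: "i \<le> n" "asc n i (wact n i l)" using ascending_path less.prems n by blast
    have W: "wact n i l \<in> weights n" using wact_weights less.prems i n by simp
    have "low1 n (wact n i l) l" using asc_low1[OF W i(1) n i(2)] by simp
    then have "P (wact n i l)" using less.hyps hm_less W by blast
    from step[OF W i this] show ?thesis by simp
  qed
qed

lemma dominance_geI:
  assumes "l \<in> weights n" "v \<in> weights n" "n \<ge> 1" "psum_le n v l"
  shows "dominance_ge n l v"
proof -
  define k where "k i = nat (psum l i - psum v i)" for i
  have k: "int (k i) = psum l i - psum v i" if "i \<in> {1..n}" for i
    using assms(4) that by (simp add: k_def psum_le_def)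
  have "l - v = (\<Sum>i\<in>{1..<n}. Poly_Mapping.single i (int (k i)) - Poly_Mapping.single (Suc i) (int (k i)))
       + Poly_Mapping.single n (int (k n))" (is "_ = ?r")
  proof (rule poly_mapping_eqI)
    fix j
    have A: "(\<Sum>i\<in>{1..<n}. lk (Poly_Mapping.single i (int (k i))) j) = (if j \<in> {1..<n} then int (k j) else 0)"
    proof -
      have "(\<Sum>i\<in>{1..<n}. lk (Poly_Mapping.single i (int (k i))) j) = (\<Sum>i\<in>{1..<n}. if i = j then int (k i) else 0)"
        by (rule sum.cong) (auto simp: lookup_single when_def)
      then show ?thesis by (simp add: sum.delta')
    qed
    have B: "(\<Sum>i\<in>{1..<n}. lk (Poly_Mapping.single (Suc i) (int (k i))) j) = (if j \<in> {2..n} then int (k (j - 1)) else 0)"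
    proof -
      have "(\<Sum>i\<in>{1..<n}. lk (Poly_Mapping.single (Suc i) (int (k i))) j) = (\<Sum>i\<in>{1..<n}. if i = j - 1 then (if j = 0 then 0 else int (k i)) else 0)"
        by (rule sum.cong) (auto simp: lookup_single when_def)
      also have "\<dots> = (if j - 1 \<in> {1..<n} then (if j = 0 then 0 else int (k (j - 1))) else 0)" by (simp add: sum.delta')
      also have "\<dots> = (if j \<in> {2..n} then int (k (j - 1)) else 0)" by auto
      finally show ?thesis .
    qed
    have r: "lk ?r j = (if j \<in> {1..<n} then int (k j) else 0) - (if j \<in> {2..n} then int (k (j - 1)) else 0)
        + (if j = n then int (k n) else 0)"
      unfolding lookup_add lookup_sum lookup_minus sum_subtractf A B by (simp add: lookup_single when_def)
    show "lk (l - v) j = lk ?r j"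
    proof (cases "j \<in> {1..n}")
      case False
      then have "lk ?r j = 0" unfolding r using assms(3) by auto
      then show ?thesis using weights_lookup[OF assms(1) False] weights_lookup[OF assms(2) False] by (simp add: lookup_minus)
    next
      case True
      have e: "psum x j = psum x (j - 1) + lk x j" for x
        using True by (cases j) (simp_all add: psum_def)
      have "lk ?r j = int (k j) - (if j \<in> {2..n} then int (k (j - 1)) else 0)"
        unfolding r using True assms(3) by auto
      also have "\<dots> = (psum l j - psum v j) - (psum l (j - 1) - psum v (j - 1))"
      proof (cases "j = 1")
        case True
        then show ?thesis using k[OF \<open>j \<in> {1..n}\<close>] by (simp add: psum_def)
      next
        case False
        then have "j \<in> {2..n}" "j - 1 \<in> {1..n}" using True by auto
        then show ?thesis using k[OF True] k[of "j - 1"] by simp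
      qed
      also have "\<dots> = lk l j - lk v j" using e[of l] e[of v] by simp
      finally show ?thesis by (simp add: lookup_minus)
    qed
  qed
  then show ?thesis unfolding dominance_ge_def by blast
qed

text \<open>An exchange argument: dominant entries beyond position \<open>k\<close> are at most the
  \<open>k\<close>-th one, those up to \<open>k\<close> are at least as large, and the two
  differences of sets have equal size.\<close>

lemma top_sum:
  assumes n: "n \<ge> 1" and l: "l \<in> weights n" and A: "A \<subseteq> {1..n}" and k: "card A = k"
  shows "(\<Sum>j\<in>A. \<bar>lk l j\<bar>) \<le> psum (dom_rep n l) k"
proof -
  note D = dom_rep_props(1)[OF n, of l]
  let ?D = "\<lambda>p. lk (dom_rep n l) p"
  define B where "B = {p\<in>{1..n}. wpos n l p \<in> A}"
  have b: "bij_betw (wpos n l) {1..n} {1..n}" by (rule wpos_bij[OF n l])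
  have im: "wpos n l ` B = A"
  proof (intro equalityI subsetI)
    fix j assume "j \<in> A"
    then obtain p where "p \<in> {1..n}" "j = wpos n l p" using bij_betw_obtain[OF b] A by blast
    then show "j \<in> wpos n l ` B" using \<open>j \<in> A\<close> by (simp add: B_def)
  qed (auto simp: B_def)
  have inj: "inj_on (wpos n l) B" by (rule inj_on_subset[OF bij_betw_imp_inj_on[OF b]]) (auto simp: B_def)
  have cB: "card B = k" using card_image[OF inj] im k by simp
  have fin: "finite B" by (simp add: B_def)
  have kn: "k \<le> n" using card_mono[OF _ A] k by simp
  have "(\<Sum>j\<in>A. \<bar>lk l j\<bar>) = (\<Sum>p\<in>B. \<bar>lk l (wpos n l p)\<bar>)"
    unfolding im[symmetric] by (rule sum.reindex[OF inj, unfolded comp_def])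
  also have "\<dots> = (\<Sum>p\<in>B. ?D p)"
    by (rule sum.cong) (auto simp: B_def dom_rep_wpos[OF n l])
  also have "\<dots> \<le> (\<Sum>p\<in>{1..k}. ?D p)"
  proof (cases "k = 0")
    case True
    then show ?thesis using cB fin by simp
  next
    case False
    have c: "card (B - {1..k}) = card ({1..k} - B)"
    proof -
      have "card B = card (B \<inter> {1..k}) + card (B - {1..k})" using fin by (metis card_Int_Diff)
      moreover have "card {1..k} = card ({1..k} \<inter> B) + card ({1..k} - B)" by (metis card_Int_Diff finite_atLeastAtMost)
      ultimately show ?thesis using cB by (simp add: Int_commute)
    qed
    have "(\<Sum>p\<in>B - {1..k}. ?D p) \<le> (\<Sum>p\<in>B - {1..k}. ?D k)"
      using dominant_antimono[OF D, of k] False by (intro sum_mono) (auto simp: B_def)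
    also have "\<dots> = (\<Sum>p\<in>{1..k} - B. ?D k)" using c by simp
    also have "\<dots> \<le> (\<Sum>p\<in>{1..k} - B. ?D p)"
      using dominant_antimono[OF D, of _ k] kn by (intro sum_mono) auto
    finally have "(\<Sum>p\<in>B - {1..k}. ?D p) \<le> (\<Sum>p\<in>{1..k} - B. ?D p)" .
    moreover have "(\<Sum>p\<in>B. ?D p) = (\<Sum>p\<in>B \<inter> {1..k}. ?D p) + (\<Sum>p\<in>B - {1..k}. ?D p)"
      using fin by (rule sum.Int_Diff)
    moreover have "(\<Sum>p\<in>{1..k}. ?D p) = (\<Sum>p\<in>{1..k} \<inter> B. ?D p) + (\<Sum>p\<in>{1..k} - B. ?D p)"
      by (rule sum.Int_Diff) simp
    ultimately show ?thesis by (simp add: Int_commute)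
  qed
  finally show ?thesis by (simp add: psum_def)
qed

lemma abs_pair_bound:
  fixes a b c d :: int
  assumes "a + b = c + d" "\<bar>a - b\<bar> \<le> \<bar>c - d\<bar>"
  shows "\<bar>a\<bar> + \<bar>b\<bar> \<le> \<bar>c\<bar> + \<bar>d\<bar>" "\<bar>a\<bar> \<le> \<bar>c\<bar> \<or> \<bar>a\<bar> \<le> \<bar>d\<bar>" "\<bar>b\<bar> \<le> \<bar>c\<bar> \<or> \<bar>b\<bar> \<le> \<bar>d\<bar>"
  using assms by linarith+

text \<open>A step alters at most two coordinates, does not raise the sum of their absolute values,
  and bounds each new one by an old one; so \<open>A\<close> itself or \<open>A\<close> with one
  coordinate exchanged will do.\<close>

lemma low1_top:
  assumes lo: "low1 n v l" and A: "A \<subseteq> {1..n}"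
  shows "\<exists>A'\<subseteq>{1..n}. card A' = card A \<and> (\<Sum>j\<in>A. \<bar>lk v j\<bar>) \<le> (\<Sum>j\<in>A'. \<bar>lk l j\<bar>)"
proof -
  have fin: "finite A" using A finite_subset by blast
  have two: ?thesis if ab: "a \<in> {1..n}" "b \<in> {1..n}" "a \<noteq> b" and off: "\<And>c. c \<noteq> a \<Longrightarrow> c \<noteq> b \<Longrightarrow> lk v c = lk l c"
    and m1: "\<bar>lk v a\<bar> + \<bar>lk v b\<bar> \<le> \<bar>lk l a\<bar> + \<bar>lk l b\<bar>"
    and m2: "\<bar>lk v a\<bar> \<le> \<bar>lk l a\<bar> \<or> \<bar>lk v a\<bar> \<le> \<bar>lk l b\<bar>" "\<bar>lk v b\<bar> \<le> \<bar>lk l a\<bar> \<or> \<bar>lk v b\<bar> \<le> \<bar>lk l b\<bar>" for a b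
  proof -
    have same: "(\<Sum>j\<in>A. \<bar>lk v j\<bar>) - (\<Sum>j\<in>A. \<bar>lk l j\<bar>) =
      (if a \<in> A then \<bar>lk v a\<bar> - \<bar>lk l a\<bar> else 0) + (if b \<in> A then \<bar>lk v b\<bar> - \<bar>lk l b\<bar> else 0)"
      unfolding sum_subtractf[symmetric] using fin ab(3) off by (intro sum_two) auto
    have sw: "\<exists>A'\<subseteq>{1..n}. card A' = card A \<and> (\<Sum>j\<in>A. \<bar>lk v j\<bar>) \<le> (\<Sum>j\<in>A'. \<bar>lk l j\<bar>)"
      if xy: "x \<in> A" "y \<notin> A" "y \<in> {1..n}" "\<bar>lk v x\<bar> \<le> \<bar>lk l y\<bar>" "\<And>c. c \<in> A \<Longrightarrow> c \<noteq> x \<Longrightarrow> lk v c = lk l c" for x y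
    proof (intro exI conjI)
      show "insert y (A - {x}) \<subseteq> {1..n}" using A xy by auto
      show "card (insert y (A - {x})) = card A" using fin xy card_Suc_Diff1[OF fin xy(1)] by simp
      have "(\<Sum>j\<in>A. \<bar>lk v j\<bar>) = \<bar>lk v x\<bar> + (\<Sum>j\<in>A - {x}. \<bar>lk v j\<bar>)" using fin xy(1) by (rule sum.remove)
      also have "(\<Sum>j\<in>A - {x}. \<bar>lk v j\<bar>) = (\<Sum>j\<in>A - {x}. \<bar>lk l j\<bar>)" using xy(5) by (intro sum.cong) auto
      finally show "(\<Sum>j\<in>A. \<bar>lk v j\<bar>) \<le> (\<Sum>j\<in>insert y (A - {x}). \<bar>lk l j\<bar>)"
        using fin xy by simp
    qed
    show ?thesis
    proof (cases "(\<Sum>j\<in>A. \<bar>lk v j\<bar>) \<le> (\<Sum>j\<in>A. \<bar>lk l j\<bar>)")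
      case True
      then show ?thesis using A by blast
    next
      case False
      then consider "a \<in> A" "b \<notin> A" "\<bar>lk v a\<bar> > \<bar>lk l a\<bar>" | "b \<in> A" "a \<notin> A" "\<bar>lk v b\<bar> > \<bar>lk l b\<bar>"
        using same m1 by (auto split: if_splits)
      then show ?thesis
      proof cases
        case 1
        have "lk v c = lk l c" if "c \<in> A" "c \<noteq> a" for c using off[of c] that 1(2) by metis
        then show ?thesis using m2 ab 1 by (intro sw[of a b]) auto
      next
        case 2
        have "lk v c = lk l c" if "c \<in> A" "c \<noteq> b" for c using off[of c] that 2(2) by metis
        then show ?thesis using m2 ab 2 by (intro sw[of b a]) auto
      qed
    qed
  qed
  show ?thesis using lo
  proof (cases rule: low1_cases)
    case (1 a)
    have "(\<Sum>j\<in>A. \<bar>lk v j\<bar>) \<le> (\<Sum>j\<in>A. \<bar>lk l j\<bar>)"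
    proof (rule sum_mono)
      fix j
      show "\<bar>lk v j\<bar> \<le> \<bar>lk l j\<bar>" using 1(2) by (cases "j = a") (auto simp: lowA_def dlow_def)
    qed
    then show ?thesis using A by blast
  next
    case (2 a b)
    have "lk v a + lk v b = lk l a + lk l b" "\<bar>lk v a - lk v b\<bar> \<le> \<bar>lk l a - lk l b\<bar>"
      using 2(4) by (auto simp: lowB_def dlow_def)
    note m = abs_pair_bound[OF this]
    show ?thesis
      by (rule two[OF 2(1,2) less_imp_neq[OF 2(3)] _ m]) (use 2(4) in \<open>simp add: lowB_def\<close>)
  next
    case (3 a b)
    have "lk v a - lk v b = lk l a - lk l b" "\<bar>lk v a + lk v b\<bar> \<le> \<bar>lk l a + lk l b\<bar>"
      using 3(4) by (auto simp: lowC_def dlow_def)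
    then have "lk v a + (- lk v b) = lk l a + (- lk l b)" "\<bar>lk v a - (- lk v b)\<bar> \<le> \<bar>lk l a - (- lk l b)\<bar>" by auto
    note m = abs_pair_bound[OF this, unfolded abs_minus_cancel]
    show ?thesis
      by (rule two[OF 3(1,2) less_imp_neq[OF 3(3)] _ m]) (use 3(4) in \<open>simp add: lowC_def\<close>)
  qed
qed

lemma low1_dom:
  assumes lo: "low1 n v l" and n: "n \<ge> 1"
  shows "psum_le n (dom_rep n v) (dom_rep n l)"
  unfolding psum_le_def
proof
  fix k assume k: "k \<in> {1..n}"
  have W: "v \<in> weights n" "l \<in> weights n" using low1_weights[OF lo] by auto
  have b: "bij_betw (wpos n v) {1..n} {1..n}" by (rule wpos_bij[OF n W(1)])
  have inj: "inj_on (wpos n v) {1..k}" by (rule inj_on_subset[OF bij_betw_imp_inj_on[OF b]]) (use k in auto)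
  have sub: "wpos n v ` {1..k} \<subseteq> {1..n}"
  proof (rule image_subsetI)
    fix p assume "p \<in> {1..k}"
    then have "p \<in> {1..n}" using k by auto
    then show "wpos n v p \<in> {1..n}" by (rule bij_betw_apply[OF b])
  qed
  have "psum (dom_rep n v) k = (\<Sum>p\<in>{1..k}. \<bar>lk v (wpos n v p)\<bar>)"
    unfolding psum_def by (rule sum.cong) (use k dom_rep_wpos[OF n W(1)] in auto)
  also have "\<dots> = (\<Sum>j\<in>wpos n v ` {1..k}. \<bar>lk v j\<bar>)"
    by (rule sum.reindex[OF inj, unfolded comp_def, symmetric])
  finally have e: "psum (dom_rep n v) k = (\<Sum>j\<in>wpos n v ` {1..k}. \<bar>lk v j\<bar>)" .
  obtain A' where A': "A' \<subseteq> {1..n}" "card A' = card (wpos n v ` {1..k})"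
    "(\<Sum>j\<in>wpos n v ` {1..k}. \<bar>lk v j\<bar>) \<le> (\<Sum>j\<in>A'. \<bar>lk l j\<bar>)"
    using low1_top[OF lo sub] by blast
  have "card A' = k" using A'(2) card_image[OF inj] by simp
  then show "psum (dom_rep n v) k \<le> psum (dom_rep n l) k"
    using top_sum[OF n W(2) A'(1)] A'(3) e by simp
qed

lemma sqs_dom_rep:
  assumes "n \<ge> 1" "l \<in> weights n"
  shows "sqs n (dom_rep n l) = sqs n l"
proof -
  have "sqs n (dom_rep n l) = (\<Sum>p\<in>{1..n}. (lk l (wpos n l p))\<^sup>2)"
    unfolding sqs_def by (rule sum.cong) (auto simp: dom_rep_wpos[OF assms])
  also have "\<dots> = sqs n l"
    unfolding sqs_def by (rule sum.reindex_bij_betw[OF wpos_bij[OF assms]])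
  finally show ?thesis .
qed

definition pre_weight_ge :: "nat \<Rightarrow> (nat \<Rightarrow>\<^sub>0 int) \<Rightarrow> (nat \<Rightarrow>\<^sub>0 int) \<Rightarrow> bool" where
  "pre_weight_ge n l v \<longleftrightarrow> psum_le n (dom_rep n v) (dom_rep n l) \<and> (dom_rep n v = dom_rep n l \<longrightarrow> psum_le n v l)"

text \<open>If the two ends of a chain have equal dominant weights, antisymmetry of
  \<open>psum_le\<close> makes them equal all along; the norm is then constant and every step
  subtracts a positive combination.\<close>

lemma low_pre_weight_ge:
  assumes "low n v l" "n \<ge> 1"
  shows "pre_weight_ge n l v"
  using assms(1) unfolding low_def
proof (induction rule: rtranclp_induct)
  case base
  show ?case by (simp add: pre_weight_ge_def psum_le_def)
next
  case (step u l)
  have D: "dom_rep n x \<in> weights n" for x using dom_rep_props(1)[OF assms(2), of x] by (simp add: dominant_def)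
  have ul: "pre_weight_ge n l u"
  proof -
    have "dom_rep n u = dom_rep n l \<Longrightarrow> psum_le n u l"
      using low1_psum[OF step(2)] sqs_dom_rep[OF assms(2)] low1_weights[OF step(2)] by (metis less_irrefl)
    then show ?thesis using low1_dom[OF step(2) assms(2)] by (simp add: pre_weight_ge_def)
  qed
  have tr: "psum_le n x y \<Longrightarrow> psum_le n y z \<Longrightarrow> psum_le n x z" for x y z
    unfolding psum_le_def using order_trans by blast
  have anti: "x = y" if "psum_le n x y" "psum_le n y x" "x \<in> weights n" "y \<in> weights n" for x y
    using that psum_inject[OF that(3,4)] unfolding psum_le_def by (meson order_antisym)
  show ?case
    unfolding pre_weight_ge_def
  proof (intro conjI impI)
    show "psum_le n (dom_rep n v) (dom_rep n l)" using step.IH ul tr unfolding pre_weight_ge_def by blast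
    assume e: "dom_rep n v = dom_rep n l"
    then have "dom_rep n u = dom_rep n l"
      using anti[of "dom_rep n u" "dom_rep n l"] step.IH ul D unfolding pre_weight_ge_def by simp
    then show "psum_le n v l" using e step.IH ul tr unfolding pre_weight_ge_def by metis
  qed
qed

text \<open>The order of the construction refines the one in the statement, so triangularity for
  \<open>low\<close> gives the expansion that the definition of the polynomials requires.\<close>

lemma low_weight_ge:
  assumes "low n v l" "n \<ge> 1" "l \<in> weights n"
  shows "weight_ge n l v"
proof -
  have D: "dom_rep n x \<in> weights n" for x using dom_rep_props(1)[OF assms(2), of x] by (simp add: dominant_def)
  show ?thesis
    using low_pre_weight_ge[OF assms(1,2)] dominance_geI[OF D D assms(2)]
      dominance_geI[OF assms(3) low_weights[OF assms(1,3)] assms(2)]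
    unfolding weight_ge_def pre_weight_ge_def by metis
qed

section \<open>Construction of the eigenfunctions\<close>

abbreviation xmon :: "(nat \<Rightarrow>\<^sub>0 int) \<Rightarrow> 'a::field lpoly" where
  "xmon m \<equiv> Poly_Mapping.single m 1"

context koornwinder_field
begin

lemma linear_op_zero: "linear_op A \<Longrightarrow> A 0 = 0"
  using linear_opD(2)[of A 0 0] by simp

lemma linear_op_sum: "linear_op A \<Longrightarrow> A (\<Sum>x\<in>S. f x) = (\<Sum>x\<in>S. A (f x))"
  by (induction S rule: infinite_finite_induct) (auto simp: linear_opD linear_op_zero)

lemma mono_expand: "f = (\<Sum>m\<in>Poly_Mapping.keys f. Cst (Poly_Mapping.lookup f m) * xmon m)"
  by (rule poly_mapping_eqI) (auto simp: lookup_sum lookup_single when_def in_keys_iff mult_single sum.delta)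

lemma linear_expand:
  assumes "linear_op A"
  shows "A f = (\<Sum>m\<in>Poly_Mapping.keys f. Cst (Poly_Mapping.lookup f m) * A (xmon m))"
proof -
  have "A f = A (\<Sum>m\<in>Poly_Mapping.keys f. Cst (Poly_Mapping.lookup f m) * xmon m)" using mono_expand[of f] by simp
  then show ?thesis by (simp add: linear_op_sum[OF assms] linear_opD(2)[OF assms])
qed

lemma linear_lookup:
  assumes "linear_op A"
  shows "Poly_Mapping.lookup (A f) u = (\<Sum>m\<in>Poly_Mapping.keys f. Poly_Mapping.lookup f m * Poly_Mapping.lookup (A (xmon m)) u)"
  by (subst linear_expand[OF assms]) (simp add: lookup_sum)

lemma linear_keys:
  assumes "linear_op A" "u \<in> Poly_Mapping.keys (A f)"
  shows "\<exists>m\<in>Poly_Mapping.keys f. u \<in> Poly_Mapping.keys (A (xmon m))"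
proof (rule ccontr)
  assume "\<not> ?thesis"
  then have "Poly_Mapping.lookup (A f) u = 0"
    by (subst linear_lookup[OF assms(1)], intro sum.neutral) (auto simp: in_keys_iff)
  then show False using assms(2) by (simp add: in_keys_iff)
qed

text \<open>Exponent of the middle term of the expanded numerator; for \<open>i = 0\<close> and
  \<open>i = n\<close> it is half of \<open>beta i\<close>.\<close>

definition half :: "nat \<Rightarrow> (nat \<Rightarrow>\<^sub>0 int)" where
  "half i = (if i = 0 then Poly_Mapping.single 1 (-1) else if i < n then 0 else Poly_Mapping.single n 1)"

definition num1 :: "nat \<Rightarrow> 'a" where
  "num1 i = (if i = 0 then hq * h0 * inverse u0 - hq * h0 * u0 else if i < n then 0 else hn * inverse un - hn * un)"

definition num2 :: "nat \<Rightarrow> 'a" where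
  "num2 i = (if i = 0 then - hq\<^sup>2 * h0\<^sup>2 else if i < n then - ht\<^sup>2 else - hn\<^sup>2)"

lemma Num_eq: "Num i = 1 + Poly_Mapping.single (half i) (num1 i) + Poly_Mapping.single (beta i) (num2 i)"
proof -
  have A: "(1 - Cst a * Xp p k) * (1 - Cst (- b) * Xp p k) =
    1 + Poly_Mapping.single (Poly_Mapping.single p k) (b - a) + Poly_Mapping.single (Poly_Mapping.single p (2 * k)) (- (a * b))" for a b :: 'a and p k
    by (simp add: mult_single algebra_simps single_uminus single_diff flip: single_add)
  have e: "hq * h0 * u0 * (hq * h0 * inverse u0) = hq\<^sup>2 * h0\<^sup>2" "hn * un * (hn * inverse un) = hn\<^sup>2"
    by (simp_all add: power2_eq_square)
  consider "i = 0" | "i \<noteq> 0" "i < n" | "i \<noteq> 0" "i \<ge> n" by linarith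
  then show ?thesis
  proof cases
    case 1
    then show ?thesis unfolding Num_def half_def num1_def num2_def beta_def by (simp only: A if_True e) simp
  next
    case 2
    then show ?thesis by (simp add: Num_def half_def num1_def num2_def beta_def mult_single single_uminus)
  next
    case 3
    then have "\<not> i < n" by simp
    with 3 show ?thesis unfolding Num_def half_def num1_def num2_def beta_def by (simp only: A if_False e) simp
  qed
qed

lemma T_mono:
  "T i (xmon m) = Cst (tau i) * xmon m + Cst (inverse (tau i)) * (Num i * (of_int (sgn (lf i m)) *
     (\<Sum>k\<in>dd_exps (lf i m). Poly_Mapping.single (m + frag_cmul k (beta i)) (zc i powi k))))"
  by (simp add: T_def dl_def dd_def zmon_def mult_single)

lemma keys_cmul_sub: "Poly_Mapping.keys (Cst c * f) \<subseteq> Poly_Mapping.keys (f :: 'a lpoly)"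
  by (auto simp: in_keys_iff)

lemma keys_T_mono:
  assumes "u \<in> Poly_Mapping.keys (T i (xmon m))"
  shows "u = m \<or> (\<exists>k\<in>dd_exps (lf i m). \<exists>g\<in>{0, half i, beta i}. u = m + frag_cmul k (beta i) + g)"
proof -
  define S where "S = (\<Sum>k\<in>dd_exps (lf i m). Poly_Mapping.single (m + frag_cmul k (beta i)) (zc i powi k))"
  have S: "\<exists>k\<in>dd_exps (lf i m). v = m + frag_cmul k (beta i)" if "v \<in> Poly_Mapping.keys S" for v
  proof (rule ccontr)
    assume "\<not> ?thesis"
    then have "Poly_Mapping.lookup S v = 0"
      unfolding S_def lookup_sum by (intro sum.neutral) (auto simp: lookup_single when_def)
    then show False using that by (simp add: in_keys_iff)
  qed
  have "of_int x * g = Cst (of_int x) * g" for x and g :: "'a lpoly"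
    by (simp add: single_of_int)
  then have Tm: "T i (xmon m) = Cst (tau i) * xmon m + Cst (inverse (tau i)) * (Num i * (Cst (of_int (sgn (lf i m))) * S))"
    unfolding T_mono S_def by simp
  have "u \<in> Poly_Mapping.keys (xmon m :: 'a lpoly) \<or> u \<in> Poly_Mapping.keys (Num i * (Cst (of_int (sgn (lf i m))) * S))"
    using assms keys_add[of "Cst (tau i) * xmon m"] keys_cmul_sub unfolding Tm by blast
  then show ?thesis
  proof
    assume "u \<in> Poly_Mapping.keys (xmon m :: 'a lpoly)"
    then show ?thesis by simp
  next
    assume "u \<in> Poly_Mapping.keys (Num i * (Cst (of_int (sgn (lf i m))) * S))"
    then obtain g v where gv: "u = g + v" "g \<in> Poly_Mapping.keys (Num i)" "v \<in> Poly_Mapping.keys (Cst (of_int (sgn (lf i m))) * S)"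
      using keys_mult[of "Num i"] by blast
    have "Poly_Mapping.keys (Num i) \<subseteq> {0, half i, beta i}"
    proof
      fix x assume "x \<in> Poly_Mapping.keys (Num i)"
      then have "Poly_Mapping.lookup (Num i) x \<noteq> 0" by (simp add: in_keys_iff)
      then show "x \<in> {0, half i, beta i}" unfolding Num_eq by (auto simp: lookup_add lookup_single lookup_one when_def split: if_splits)
    qed
    then have "g \<in> {0, half i, beta i}" using gv by blast
    moreover obtain k where "k \<in> dd_exps (lf i m)" "v = m + frag_cmul k (beta i)" using S gv(3) keys_cmul_sub by blast
    ultimately show ?thesis using gv(1) by (metis add.commute)
  qed
qed

lemma lk_half: "lk (half i) c = (if i = 0 then (if c = 1 then - 1 else 0) else if i < n then 0 else if c = n then 1 else 0)"
  by (simp add: half_def lookup_single when_def)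

lemma lk_beta: "lk (beta i) c = (if i = 0 then (if c = 1 then - 2 else 0)
   else if i < n then (if c = i then 1 else if c = Suc i then - 1 else 0) else if c = n then 2 else 0)"
  by (auto simp: beta_def lookup_single lookup_add when_def)

lemma keys_T_seg:
  assumes "0 < i" "i \<le> n" "u \<in> Poly_Mapping.keys (T i (xmon m))"
  shows "u \<in> seg n i m"
  using keys_T_mono[OF assms(3)]
proof (elim disjE bexE)
  assume "u = m"
  then show ?thesis by (simp add: seg_def)
next
  fix k g assume k: "k \<in> dd_exps (lf i m)" and g: "g \<in> {0, half i, beta i}" and u: "u = m + frag_cmul k (beta i) + g"
  have L: "lk u c = lk m c + k * lk (beta i) c + lk g c" for c by (simp add: u lookup_add)
  show ?thesis
  proof (cases "i < n")
    case True
    have lg: "lk g c = 0 \<or> lk g c = lk (beta i) c" "lk g i = - lk g (Suc i)" for c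
      using g True assms(1) by (auto simp: lk_half lk_beta)
    have gi: "lk g i \<in> {0, 1}" using g True assms(1) by (auto simp: lk_half lk_beta)
    have e: "lk u i = lk m i + k + lk g i" "lk u (Suc i) = lk m (Suc i) - k - lk g i"
      using L lg(2) True assms(1) by (auto simp: lk_beta)
    have off: "lk u c = lk m c" if "c \<noteq> i" "c \<noteq> Suc i" for c
      using L[of c] lg(1)[of c] that True assms(1) by (auto simp: lk_beta)
    have "\<bar>lk u i - lk u (Suc i)\<bar> \<le> \<bar>lk m i - lk m (Suc i)\<bar>"
      using k gi e assms(1) True by (auto simp: dd_exps_def lf_def split: if_splits)
    then show ?thesis using off e True assms(1) by (simp add: seg_def)
  next
    case False
    then have i: "i = n" using assms by simp
    have off: "lk u c = lk m c" if "c \<noteq> n" for c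
      using L[of c] g that i assms(1) by (auto simp: lk_beta lk_half)
    have gn: "lk g n \<in> {0, 1, 2}" using g i assms(1) by (auto simp: lk_half lk_beta)
    have "lk u n = lk m n + 2 * k + lk g n" using L[of n] i assms(1) by (simp add: lk_beta)
    then have "\<bar>lk u n\<bar> \<le> \<bar>lk m n\<bar>"
      using k gn i assms(1) by (auto simp: dd_exps_def lf_def split: if_splits)
    then show ?thesis using off i assms(1) by (simp add: seg_def)
  qed
qed

lemma keys_T0:
  assumes "u \<in> Poly_Mapping.keys (T 0 (xmon m))"
  shows "(\<forall>c. c \<noteq> 1 \<longrightarrow> lk u c = lk m c) \<and> \<bar>lk u 1\<bar> \<le> \<bar>lk m 1\<bar>"
  using keys_T_mono[OF assms]
proof (elim disjE bexE)
  assume "u = m"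
  then show ?thesis by simp
next
  fix k g assume k: "k \<in> dd_exps (lf 0 m)" and g: "g \<in> {0, half 0, beta 0}" and u: "u = m + frag_cmul k (beta 0) + g"
  have L: "lk u c = lk m c + k * lk (beta 0) c + lk g c" for c by (simp add: u lookup_add)
  have off: "lk u c = lk m c" if "c \<noteq> 1" for c
    using L[of c] g that by (auto simp: lk_beta lk_half)
  have g1: "lk g 1 \<in> {0, - 1, - 2}" using g by (auto simp: lk_half lk_beta)
  have "lk u 1 = lk m 1 - 2 * k + lk g 1" using L[of 1] by (simp add: lk_beta)
  then have "\<bar>lk u 1\<bar> \<le> \<bar>lk m 1\<bar>"
    using k g1 by (auto simp: dd_exps_def lf_def split: if_splits)
  then show ?thesis using off by simp
qed

lemma keys_X_mult:
  assumes "u \<in> Poly_Mapping.keys (Xp 1 (-1) * (f :: 'a lpoly))"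
  shows "u + Poly_Mapping.single 1 1 \<in> Poly_Mapping.keys f"
proof -
  obtain g where "g \<in> Poly_Mapping.keys f" "u = Poly_Mapping.single 1 (-1) + g"
    using keys_mult[of "Xp 1 (-1)" f] assms by auto
  then show ?thesis by (simp add: algebra_simps flip: add.assoc single_add)
qed

lemma linear_R: "linear_op R"
  by (simp add: linear_op_def R_def T_add T_cmul ring_distribs mult.left_commute)

text \<open>For \<open>m_1 \<ge> 0\<close> the factor \<open>x_1^(-1)\<close> shifts the support of
  \<open>T_0 x^m\<close> into the segment. For \<open>m_1 < 0\<close> this bound is off by one
  exponent; writing \<open>x^m\<close> as \<open>x_1^(-1) x^m'\<close> and applying
  \<open>X1_T0\<close> gains it back.\<close>

lemma keys_R_seg:
  assumes u: "u \<in> Poly_Mapping.keys (R (xmon m))"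
  shows "u \<in> seg n 0 m"
proof (cases "lk m 1 \<ge> 0")
  case True
  have "u + Poly_Mapping.single 1 1 \<in> Poly_Mapping.keys (T 0 (xmon m))"
    using keys_X_mult u unfolding R_def by blast
  note k = keys_T0[OF this]
  have "lk u c = lk m c" if "c \<noteq> 1" for c using k that by (auto simp: lookup_add lookup_single when_def)
  moreover have "\<bar>lk u 1 + 1\<bar> \<le> \<bar>lk m 1\<bar>" using k by (auto simp: lookup_add)
  then have "\<bar>2 * lk u 1 + 1\<bar> \<le> \<bar>2 * lk m 1 + 1\<bar>" using True by linarith
  ultimately show ?thesis by (simp add: seg_def)
next
  case False
  define m' where "m' = m + Poly_Mapping.single 1 1"
  define g where "g = (xmon m' :: 'a lpoly)"
  have m': "lk m' c = (if c = 1 then lk m 1 + 1 else lk m c)" for c by (simp add: m'_def lookup_add lookup_single when_def)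
  have gm: "Xp 1 (-1) * g = xmon m" by (simp add: g_def m'_def mult_single algebra_simps flip: add.assoc single_add)
  have "Cst (hq\<^sup>2) * R (xmon m) = Ti 0 g - Cst (hq * (u0 - inverse u0)) * xmon m"
    using X1_T0[of g] unfolding gm by (simp add: R_def)
  moreover have "u \<in> Poly_Mapping.keys (Cst (hq\<^sup>2) * R (xmon m))" using u by (simp add: in_keys_iff)
  ultimately have "u \<in> Poly_Mapping.keys (T 0 g) \<or> u = m' \<or> u = m"
    unfolding Ti_def g_def
    by (auto simp: in_keys_iff lookup_minus lookup_single when_def split: if_splits)
  then show ?thesis
  proof (elim disjE)
    assume "u \<in> Poly_Mapping.keys (T 0 g)"
    note k = keys_T0[OF this[unfolded g_def]]
    then have "lk u c = lk m c" if "c \<noteq> 1" for c using that m' by simp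
    moreover have "\<bar>2 * lk u 1 + 1\<bar> \<le> \<bar>2 * lk m 1 + 1\<bar>" using k False m' by auto
    ultimately show ?thesis by (simp add: seg_def)
  qed (use False m' in \<open>auto simp: seg_def\<close>)
qed

text \<open>Only the last term of the geometric sum, times the \<open>beta\<close> term of the
  numerator, reaches the far end of the string; the \<open>half\<close> term misses it by parity
  (\<open>hf\<close>).\<close>

lemma T_mono_coeff:
  assumes e: "lf i m < 0" and i: "i \<le> n"
  shows "Poly_Mapping.lookup (T i (xmon m)) (m + frag_cmul (- lf i m) (beta i)) = - num2 i * inverse (tau i) * zc i powi (- lf i m - 1)"
proof -
  define K where "K = - lf i m"
  have K: "K > 0" using e by (simp add: K_def)
  define p where "p = (if i = 0 then 1 else i)"
  have bp: "lk (beta i) p \<noteq> 0" using i by (auto simp: p_def lk_beta)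
  have b0: "beta i \<noteq> 0" using bp by auto
  have inj: "frag_cmul k (beta i) = frag_cmul k' (beta i) \<longleftrightarrow> k = k'" for k k'
  proof
    assume "frag_cmul k (beta i) = frag_cmul k' (beta i)"
    then have "lk (frag_cmul k (beta i)) p = lk (frag_cmul k' (beta i)) p" by simp
    then show "k = k'" using bp by simp
  qed simp
  have hf: "num1 i = 0 \<or> m + frag_cmul k (beta i) + half i \<noteq> m + frag_cmul k' (beta i)" for k k'
  proof (cases "i \<noteq> 0 \<and> i < n")
    case True
    then show ?thesis by (simp add: num1_def)
  next
    case False
    have h: "2 * lk (half i) p = lk (beta i) p" "\<bar>lk (half i) p\<bar> = 1" using False i by (auto simp: p_def lk_beta lk_half)
    have "m + frag_cmul k (beta i) + half i \<noteq> m + frag_cmul k' (beta i)"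
    proof
      assume a: "m + frag_cmul k (beta i) + half i = m + frag_cmul k' (beta i)"
      have "k * lk (beta i) p + lk (half i) p = k' * lk (beta i) p"
        using arg_cong[OF a, of "\<lambda>x. lk x p"] by (simp add: lookup_add)
      then have "k * (2 * lk (half i) p) + lk (half i) p = k' * (2 * lk (half i) p)" using h by simp
      then have "(2 * k + 1 - 2 * k') * lk (half i) p = 0" by (simp add: algebra_simps)
      then show False using h(2) by simp presburger
    qed
    then show ?thesis by simp
  qed
  define S where "S = (\<Sum>k\<in>{0..<K}. Poly_Mapping.single (m + frag_cmul k (beta i)) (zc i powi k))"
  have Tm: "T i (xmon m) = Cst (tau i) * xmon m - Cst (inverse (tau i)) * (Num i * S)"
    using K unfolding T_mono S_def K_def by (simp add: dd_exps_def)
  have NS: "Num i * S = S + (\<Sum>k\<in>{0..<K}. Poly_Mapping.single (m + frag_cmul k (beta i) + half i) (num1 i * zc i powi k))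
     + (\<Sum>k\<in>{0..<K}. Poly_Mapping.single (m + frag_cmul (k + 1) (beta i)) (num2 i * zc i powi k))"
    unfolding Num_eq S_def by (simp add: ring_distribs sum_distrib_left mult_single frag_cmul_distrib add_ac sum.distrib)
  let ?u = "m + frag_cmul K (beta i)"
  have 1: "Poly_Mapping.lookup S ?u = 0"
    unfolding S_def lookup_sum by (intro sum.neutral) (auto simp: lookup_single inj b0 when_def)
  have 2: "Poly_Mapping.lookup (\<Sum>k\<in>{0..<K}. Poly_Mapping.single (m + frag_cmul k (beta i) + half i) (num1 i * zc i powi k)) ?u = 0"
    unfolding lookup_sum by (intro sum.neutral) (use hf in \<open>auto simp: lookup_single when_def\<close>)
  have "Poly_Mapping.lookup (\<Sum>k\<in>{0..<K}. Poly_Mapping.single (m + frag_cmul (k + 1) (beta i)) (num2 i * zc i powi k)) ?u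
    = (\<Sum>k\<in>{0..<K}. if k = K - 1 then num2 i * zc i powi k else 0)"
    unfolding lookup_sum by (rule sum.cong) (auto simp: lookup_single inj b0 when_def)
  also have "\<dots> = num2 i * zc i powi (K - 1)" using K by (simp add: sum.delta')
  finally have 3: "Poly_Mapping.lookup (\<Sum>k\<in>{0..<K}. Poly_Mapping.single (m + frag_cmul (k + 1) (beta i)) (num2 i * zc i powi k)) ?u = num2 i * zc i powi (K - 1)" .
  have 4: "Poly_Mapping.lookup (xmon m) ?u = 0"
    using b0 K by (auto simp: lookup_single when_def)
  have "Poly_Mapping.lookup (T i (xmon m)) ?u = - num2 i * inverse (tau i) * zc i powi (K - 1)"
    unfolding Tm NS using 1 2 3 4 by (simp add: lookup_minus lookup_add)
  then show ?thesis by (simp add: K_def)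
qed

lemma T_coeff:
  assumes i: "0 < i" "i \<le> n" and a: "asc n i m"
  shows "Poly_Mapping.lookup (T i (xmon m)) (wact n i m) = tau i"
proof -
  have e: "lf i m < 0" using a i by (auto simp: asc_def lf_def)
  have w: "wact n i m = m + frag_cmul (- lf i m) (beta i)"
    by (rule poly_mapping_eqI) (use i in \<open>auto simp: lookup_wact lookup_add lk_beta lf_def\<close>)
  show ?thesis
    unfolding w T_mono_coeff[OF e i(2)] using i by (auto simp: num2_def tau_def zc_def power2_eq_square)
qed

lemma R_coeff:
  assumes a: "lk m 1 \<ge> 0"
  shows "Poly_Mapping.lookup (R (xmon m)) (wact n 0 m) = h0 * hq powi (2 * lk m 1)"
proof -
  have w: "wact n 0 m = Poly_Mapping.single 1 (-1) + (m + frag_cmul (lk m 1) (beta 0))"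
    by (rule poly_mapping_eqI) (auto simp: lookup_wact lookup_add lk_beta lookup_single when_def)
  have s: "Poly_Mapping.lookup (Xp 1 (-1) * f) (Poly_Mapping.single 1 (-1) + u) = Poly_Mapping.lookup f u" for f :: "'a lpoly" and u
    by (induction f rule: lpoly_induct) (auto simp: mult_single lookup_single when_def lookup_add ring_distribs)
  have "Poly_Mapping.lookup (R (xmon m)) (wact n 0 m) = Poly_Mapping.lookup (T 0 (xmon m)) (m + frag_cmul (lk m 1) (beta 0))"
    unfolding R_def w s ..
  also have "\<dots> = h0 * hq powi (2 * lk m 1)"
  proof (cases "lk m 1 = 0")
    case True
    then show ?thesis by (simp add: T_mono lf_def dd_exps_def tau_def)
  next
    case False
    then have e: "lf 0 m < 0" using a by (simp add: lf_def)
    have "Poly_Mapping.lookup (T 0 (xmon m)) (m + frag_cmul (lk m 1) (beta 0)) = - num2 0 * inverse (tau 0) * zc 0 powi (lk m 1 - 1)"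
      using T_mono_coeff[OF e] by (simp add: lf_def)
    also have "\<dots> = h0 * (hq\<^sup>2 * (hq\<^sup>2) powi (lk m 1 - 1))"
      by (simp add: num2_def tau_def zc_def power2_eq_square)
    also have "hq\<^sup>2 * (hq\<^sup>2) powi (lk m 1 - 1) = (hq\<^sup>2) powi (lk m 1)"
      using power_int_add_1'[of "hq\<^sup>2" "lk m 1 - 1"] by simp
    also have "(hq\<^sup>2) powi (lk m 1) = hq powi (2 * lk m 1)"
      by (simp add: power_int_mult)
    finally show ?thesis .
  qed
  finally show ?thesis .
qed

section \<open>Spectral vectors and the recursion for the eigenfunctions\<close>

definition yv :: "(nat \<Rightarrow>\<^sub>0 int) \<Rightarrow> nat \<Rightarrow> 'a" where
  "yv l i = hq powi (2 * lk l i) * ht powi (2 * (sgn_vec l i * int (rk n l i))) * (hn * h0) powi sgn_vec l i"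

text \<open>Monomials in \<open>q\<close>, \<open>t\<close> and \<open>a^*\<close>. Eigenvalues and
  their products have this form, so questions about them become questions about integer
  exponents.\<close>

definition mon3 :: "int \<Rightarrow> int \<Rightarrow> int \<Rightarrow> 'a" where
  "mon3 A B C = hq powi (2 * A) * ht powi (2 * B) * (hn * h0) powi C"

lemma yv_mon3: "yv l i = mon3 (lk l i) (sgn_vec l i * int (rk n l i)) (sgn_vec l i)"
  by (simp add: yv_def mon3_def)

lemma mon3_nz [simp]: "mon3 A B C \<noteq> 0"
  by (simp add: mon3_def)

lemma mon3_mult: "mon3 A B C * mon3 A' B' C' = mon3 (A + A') (B + B') (C + C')"
  by (simp add: mon3_def power_int_add distrib_left)

lemma mon3_inverse: "inverse (mon3 A B C) = mon3 (- A) (- B) (- C)"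
  by (simp add: mon3_def power_int_minus)

lemma yv_nz [simp]: "yv l i \<noteq> 0"
  by (simp add: yv_mon3)

lemma yact_yv:
  assumes i: "i \<le> n" and a: "if i = 0 then True else if i < n then lk l i \<noteq> lk l (Suc i) else lk l n \<noteq> 0" and j: "j \<in> {1..n}"
  shows "yact i (yv l) j = yv (wact n i l) j"
proof -
  consider "i = 0" | "0 < i" "i < n" | "i = n" "0 < i" using i by linarith
  then show ?thesis
  proof cases
    case 1
    have s: "sgn_vec (wact n 0 l) c = (if c = 1 then - sgn_vec l 1 else sgn_vec l c)" for c
      by (auto simp: sgn_vec_def lookup_wact)
    show ?thesis
    proof (cases "j = 1")
      case True
      have "inverse (hq\<^sup>2 * yv l 1) = inverse (mon3 1 0 0 * mon3 (lk l 1) (sgn_vec l 1 * int (rk n l 1)) (sgn_vec l 1))"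
        by (simp add: yv_mon3 mon3_def)
      also have "\<dots> = yv (wact n 0 l) 1"
        unfolding mon3_mult mon3_inverse yv_mon3 s using j True by (simp add: rk_0 lookup_wact)
      finally show ?thesis using True 1 by (simp add: yact_def)
    next
      case False
      then show ?thesis using 1 j by (simp add: yact_def yv_def s rk_0 lookup_wact)
    qed
  next
    case 2
    then have ne: "lk l i \<noteq> lk l (Suc i)" using a by simp
    let ?p = "Transposition.transpose i (Suc i)"
    have L: "lk (wact n i l) c = lk l (?p c)" for c
      using 2 by (auto simp: lookup_wact transpose_def)
    have s: "sgn_vec (wact n i l) c = sgn_vec l (?p c)" for c
      by (simp add: sgn_vec_def L)
    have "yact i (yv l) j = yv l (?p j)" using 2 by (auto simp: yact_def transpose_def)
    then show ?thesis by (simp add: yv_def L s rk_mid[OF 2 ne])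
  next
    case 3
    then have ne: "lk l n \<noteq> 0" using a by simp
    have s: "sgn_vec (wact n n l) c = (if c = n then - sgn_vec l n else sgn_vec l c)" for c
      using ne 3 by (auto simp: sgn_vec_def lookup_wact)
    have n1: "n \<ge> 1" using 3 by simp
    show ?thesis
    proof (cases "j = n")
      case True
      then show ?thesis using 3 j by (simp add: yact_def yv_mon3 mon3_inverse s rk_n[OF n1 ne] lookup_wact)
    next
      case False
      then show ?thesis using 3 j by (simp add: yact_def yv_def s rk_n[OF n1 ne] lookup_wact)
    qed
  qed
qed

lemma asc_yact:
  assumes "i \<le> n" "asc n i l" "j \<in> {1..n}"
  shows "yact i (yv l) j = yv (wact n i l) j"
  using assms by (intro yact_yv) (auto simp: asc_def)

definition isE :: "(nat \<Rightarrow>\<^sub>0 int) \<Rightarrow> 'a lpoly \<Rightarrow> bool" where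
  "isE l f \<longleftrightarrow> eig (yv l) f \<and> (\<forall>v\<in>Poly_Mapping.keys f. low n v l) \<and> Poly_Mapping.lookup f l = 1"

definition lead :: "nat \<Rightarrow> (nat \<Rightarrow>\<^sub>0 int) \<Rightarrow> 'a" where
  "lead i l = (if i = 0 then inverse (yv l 1) * (h0 * hq powi (2 * lk l 1)) else tau i)"

lemma lead_nz: "lead i l \<noteq> 0"
  by (simp add: lead_def)

definition estep :: "nat \<Rightarrow> (nat \<Rightarrow>\<^sub>0 int) \<Rightarrow> 'a lpoly \<Rightarrow> 'a lpoly" where
  "estep i l f = Cst (inverse (lead i l)) * step i (yv l) f"

lemma linear_sop: "linear_op (sop i y)"
  using linear_R linear_T[of i] unfolding sop_def linear_op_def
  by (auto simp: ring_distribs mult.left_commute)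

lemma keys_sop_seg: "i \<le> n \<Longrightarrow> u \<in> Poly_Mapping.keys (sop i y (xmon m)) \<Longrightarrow> u \<in> seg n i m"
  using keys_R_seg keys_T_seg subsetD[OF keys_cmul_sub] by (cases "i = 0") (auto simp: sop_def)

lemma sop_coeff:
  assumes "i \<le> n" "asc n i m"
  shows "Poly_Mapping.lookup (sop i (yv m) (xmon m)) (wact n i m) = lead i m"
  using assms R_coeff[of m] T_coeff[of i m] by (auto simp: sop_def lead_def asc_def)

lemma eig_cong: "(\<And>j. j \<in> {1..n} \<Longrightarrow> y j = y' j) \<Longrightarrow> eig y f \<longleftrightarrow> eig y' f"
  by (simp add: eig_def)

lemma eig_cmul: "eig y f \<Longrightarrow> eig y (Cst c * f)"
  by (simp add: eig_def linear_opD[OF linear_Y] mult.left_commute)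

text \<open>The support stays below \<open>s l\<close> by \<open>seg_low\<close>. The coefficient at
  \<open>s l\<close> comes from \<open>x^l\<close> alone: another exponent \<open>m\<close> below
  \<open>l\<close> whose segment contains \<open>s l\<close> would put \<open>s l\<close> below
  \<open>l\<close>.\<close>

lemma isE_step:
  assumes E: "isE l f" and l: "l \<in> weights n" and i: "i \<le> n" and a: "asc n i l" and d: "kden i (yv l) \<noteq> 0"
  shows "isE (wact n i l) (estep i l f)"
  unfolding isE_def
proof (intro conjI ballI)
  have e: "eig (yv l) f" and sup: "\<And>v. v \<in> Poly_Mapping.keys f \<Longrightarrow> low n v l" and one: "Poly_Mapping.lookup f l = 1"
    using E by (auto simp: isE_def)
  have lw: "low n l (wact n i l)" and lw1: "low1 n l (wact n i l)" using asc_low1[OF l i n2 a] low1_low by auto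
  have "eig (yact i (yv l)) (step i (yv l) f)" by (rule eig_step[OF e d _ i]) simp
  then show "eig (yv (wact n i l)) (estep i l f)"
    unfolding estep_def using eig_cong[of "yact i (yv l)" "yv (wact n i l)"] asc_yact[OF i a] eig_cmul by blast
  have supw: "low n v (wact n i l)" if vk: "v \<in> Poly_Mapping.keys (sop i (yv l) f)" for v
  proof -
    obtain m where m: "m \<in> Poly_Mapping.keys f" "v \<in> Poly_Mapping.keys (sop i (yv l) (xmon m))"
      using linear_keys[OF linear_sop vk] by blast
    have "low n m (wact n i l)" using sup[OF m(1)] lw low_trans by blast
    then show ?thesis using seg_low[OF l i n2 a] keys_sop_seg[OF i m(2)] by blast
  qed
  show "low n v (wact n i l)" if "v \<in> Poly_Mapping.keys (estep i l f)" for v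
  proof -
    have "v \<in> Poly_Mapping.keys (sop i (yv l) f) \<or> v \<in> Poly_Mapping.keys f"
      using that unfolding estep_def step_def by (auto simp: in_keys_iff lookup_add)
    then show ?thesis using supw sup lw low_trans by blast
  qed
  have nl: "\<not> low n (wact n i l) l"
    using low_antisym[OF lw] low1_neq[OF lw1] by blast
  have z: "Poly_Mapping.lookup f (wact n i l) = 0"
    using sup[of "wact n i l"] nl by (auto simp: in_keys_iff)
  have lin_l: "l \<in> Poly_Mapping.keys f" using one by (simp add: in_keys_iff)
  have other: "Poly_Mapping.lookup (sop i (yv l) (xmon m)) (wact n i l) = 0" if m: "m \<in> Poly_Mapping.keys f" "m \<noteq> l" for m
  proof (rule ccontr)
    assume "\<not> ?thesis"
    then have sg: "wact n i l \<in> seg n i m" using keys_sop_seg[OF i] by (simp add: in_keys_iff)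
    have ml: "low n m l" by (rule sup[OF m(1)])
    have "m \<in> weights n" using low_weights[OF ml l] .
    then consider "wact n i l = m" | "wact n i l = wact n i m" | "low1 n (wact n i l) m"
      using seg_cases[OF _ i n2 sg] by blast
    then show False
    proof cases
      case 1
      then show ?thesis using ml nl by simp
    next
      case 2
      then have "wact n i (wact n i l) = wact n i (wact n i m)" by simp
      then show ?thesis using m(2) by simp
    next
      case 3
      then show ?thesis using low_trans[OF low1_low ml] nl by blast
    qed
  qed
  have "Poly_Mapping.lookup (sop i (yv l) f) (wact n i l) =
    (\<Sum>m\<in>Poly_Mapping.keys f. if m = l then lead i l else 0)"
    by (subst linear_lookup[OF linear_sop], rule sum.cong) (use other one sop_coeff[OF i a] in auto)
  also have "\<dots> = lead i l" using lin_l by (simp add: sum.delta')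
  finally show "Poly_Mapping.lookup (estep i l f) (wact n i l) = 1"
    using lead_nz[of i l] z by (simp add: estep_def step_def lookup_add)
qed

lemma isE_zero: "isE 0 1"
  unfolding isE_def eig_def
proof (intro conjI ballI)
  fix i assume i: "i \<in> {1..n}"
  have "yv 0 i = ht ^ (2 * (n - i)) * hn * h0"
  proof -
    have "2 * int (n - i) = int (2 * (n - i))" by simp
    then have "ht powi (2 * int (n - i)) = ht ^ (2 * (n - i))" by (metis power_int_of_nat)
    then show ?thesis using i by (simp add: yv_def sgn_vec_def rk_zero)
  qed
  then show "Y i 1 = Cst (yv 0 i) * 1" using Y_one[of i] i by simp
next
  fix v assume "v \<in> Poly_Mapping.keys (1 :: 'a lpoly)"
  then show "low n v 0" by (simp add: low_refl)
qed (simp add: lookup_one)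

end

section \<open>Eigenbasis\<close>

context koornwinder_field
begin

definition triangular :: "((nat \<Rightarrow>\<^sub>0 int) \<Rightarrow> 'a lpoly) \<Rightarrow> bool" where
  "triangular F \<longleftrightarrow> (\<forall>l\<in>weights n. (\<forall>v\<in>Poly_Mapping.keys (F l). low n v l) \<and> Poly_Mapping.lookup (F l) l = 1)"

definition lcomb :: "((nat \<Rightarrow>\<^sub>0 int) \<Rightarrow> 'a lpoly) \<Rightarrow> (nat \<Rightarrow>\<^sub>0 int) set \<Rightarrow> ((nat \<Rightarrow>\<^sub>0 int) \<Rightarrow> 'a) \<Rightarrow> 'a lpoly" where
  "lcomb F A c = (\<Sum>l\<in>A. Cst (c l) * F l)"

lemma lcomb_superset: "finite A \<Longrightarrow> B \<subseteq> A \<Longrightarrow> (\<And>l. l \<in> A \<Longrightarrow> l \<notin> B \<Longrightarrow> c l = 0) \<Longrightarrow> lcomb F A c = lcomb F B c"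
  unfolding lcomb_def by (intro sum.mono_neutral_right) auto

lemma lcomb_add:
  assumes "finite A" "finite B"
  shows "lcomb F A c + lcomb F B d = lcomb F (A \<union> B) (\<lambda>l. (if l \<in> A then c l else 0) + (if l \<in> B then d l else 0))"
proof -
  have 1: "lcomb F A c = lcomb F (A \<union> B) (\<lambda>l. if l \<in> A then c l else 0)"
    using assms unfolding lcomb_def by (intro sum.mono_neutral_cong_left) auto
  have 2: "lcomb F B d = lcomb F (A \<union> B) (\<lambda>l. if l \<in> B then d l else 0)"
    using assms unfolding lcomb_def by (intro sum.mono_neutral_cong_left) auto
  show ?thesis unfolding 1 2 unfolding lcomb_def by (simp add: sum.distrib ring_distribs single_add)
qed

lemma lcomb_cmul: "Cst k * lcomb F A c = lcomb F A (\<lambda>l. k * c l)"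
  by (simp add: lcomb_def sum_distrib_left mult_single flip: mult.assoc)

lemma lcomb_linear: "linear_op Z \<Longrightarrow> Z (lcomb F A c) = lcomb (\<lambda>l. Z (F l)) A c"
  by (simp add: lcomb_def linear_op_sum linear_opD)

text \<open>\<open>L\<close> is a subring containing the coefficients involved. Leading coefficients
  are 1, so a triangular family is inverted without division. With the image of the residue field as
  \<open>L\<close>, expansions descend to that field.\<close>

lemma triangular_expand:
  assumes F: "triangular F" and f: "Poly_Mapping.keys f \<subseteq> weights n"
    and L: "0 \<in> L" "\<And>a b. a \<in> L \<Longrightarrow> b \<in> L \<Longrightarrow> a + b \<in> L" "\<And>a b. a \<in> L \<Longrightarrow> b \<in> L \<Longrightarrow> a * b \<in> L"
      "\<And>a. a \<in> L \<Longrightarrow> - a \<in> L" "1 \<in> L"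
    and fL: "\<And>m. Poly_Mapping.lookup f m \<in> L" and FL: "\<And>l m. l \<in> weights n \<Longrightarrow> Poly_Mapping.lookup (F l) m \<in> L"
  shows "\<exists>A c. finite A \<and> A \<subseteq> weights n \<and> (\<forall>l. c l \<in> L) \<and> f = lcomb F A c"
proof -
  define SP where "SP = {f. \<exists>A c. finite A \<and> A \<subseteq> weights n \<and> (\<forall>l. c l \<in> L) \<and> f = lcomb F A c}"
  have SPD: "\<exists>A c. finite A \<and> A \<subseteq> weights n \<and> (\<forall>l. c l \<in> L) \<and> f = lcomb F A c" if "f \<in> SP" for f
    using that by (simp add: SP_def)
  have SP_add: "f + g \<in> SP" if fS: "f \<in> SP" and gS: "g \<in> SP" for f g
  proof -
    obtain A c where 1: "finite A" "A \<subseteq> weights n" "\<And>l. c l \<in> L" "f = lcomb F A c"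
      using SPD[OF fS] by metis
    obtain B d where 2: "finite B" "B \<subseteq> weights n" "\<And>l. d l \<in> L" "g = lcomb F B d"
      using SPD[OF gS] by metis
    define e where "e l = (if l \<in> A then c l else 0) + (if l \<in> B then d l else 0)" for l
    have eL: "e l \<in> L" for l
      unfolding e_def by (rule L(2)) (simp_all add: 1(3) 2(3) L(1))
    have fg: "f + g = lcomb F (A \<union> B) e"
      unfolding 1(4) 2(4) e_def by (rule lcomb_add[OF 1(1) 2(1)])
    show ?thesis unfolding SP_def
      by (intro CollectI exI[of _ "A \<union> B"] exI[of _ e] conjI allI) (use 1(1,2) 2(1,2) eL fg in auto)
  qed
  have SP_0: "0 \<in> SP" unfolding SP_def using L(1) by (auto simp: lcomb_def intro!: exI[of _ "{}"] exI[of _ "\<lambda>_. 0"])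
  have SP_cmul: "Cst k * f \<in> SP" if fS: "f \<in> SP" and kS: "k \<in> L" for f k
  proof -
    obtain A c where 1: "finite A" "A \<subseteq> weights n" "\<And>l. c l \<in> L" "f = lcomb F A c"
      using SPD[OF fS] by metis
    have kf: "Cst k * f = lcomb F A (\<lambda>l. k * c l)" unfolding 1(4) by (rule lcomb_cmul)
    have kL: "k * c l \<in> L" for l by (rule L(3)[OF kS 1(3)])
    show ?thesis unfolding SP_def
      by (intro CollectI exI[of _ A] exI[of _ "\<lambda>l. k * c l"] conjI allI) (use 1(1,2) kL kf in auto)
  qed
  have SP_sum: "(\<Sum>x\<in>Z. g x) \<in> SP" if "finite Z" "\<And>x. x \<in> Z \<Longrightarrow> g x \<in> SP" for Z :: "(nat \<Rightarrow>\<^sub>0 int) set" and g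
    using that
  proof induction
    case empty
    show ?case using SP_0 by simp
  next
    case (insert x Z)
    show ?case unfolding sum.insert[OF insert(1,2)]
      by (rule SP_add) (use insert in simp_all)
  qed
  have SP_F: "F l \<in> SP" if "l \<in> weights n" for l
  proof -
    have "F l = lcomb F {l} (\<lambda>_. 1)" by (simp add: lcomb_def)
    then show ?thesis unfolding SP_def
      by (intro CollectI exI[of _ "{l}"] exI[of _ "\<lambda>_. 1"] conjI allI) (use L(5) that in auto)
  qed
  have mono_SP: "xmon l \<in> SP" if "l \<in> weights n" for l
    using that
  proof (induction "hm n l" arbitrary: l rule: less_induct)
    case less
    let ?K = "Poly_Mapping.keys (F l) - {l}"
    have tr: "\<And>v. v \<in> Poly_Mapping.keys (F l) \<Longrightarrow> low n v l" "Poly_Mapping.lookup (F l) l = 1"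
      using F less.prems by (auto simp: triangular_def)
    have l: "l \<in> Poly_Mapping.keys (F l)" using tr(2) by (simp add: in_keys_iff)
    define S where "S = (\<Sum>m\<in>?K. Cst (Poly_Mapping.lookup (F l) m) * xmon m)"
    have "F l = (\<Sum>m\<in>Poly_Mapping.keys (F l). Cst (Poly_Mapping.lookup (F l) m) * xmon m)"
      by (rule mono_expand)
    also have "\<dots> = xmon l + S"
      unfolding S_def sum.remove[OF finite_keys l] tr(2) by simp
    finally have FS: "F l = xmon l + S" .
    have e: "xmon l = F l + (\<Sum>m\<in>?K. Cst (- Poly_Mapping.lookup (F l) m) * xmon m)"
      unfolding single_uminus mult_minus_left sum_negf S_def[symmetric] unfolding FS by simp
    have "Cst (- Poly_Mapping.lookup (F l) m) * xmon m \<in> SP" if m: "m \<in> ?K" for m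
    proof -
      have "low n m l" "m \<noteq> l" using tr(1) m by auto
      then have "hm n m < hm n l" "m \<in> weights n" using low_hm_less low_weights less.prems by auto
      then have "xmon m \<in> SP" using less.hyps by blast
      then show ?thesis using FL[OF less.prems] by (intro SP_cmul L(4))
    qed
    then have "(\<Sum>m\<in>?K. Cst (- Poly_Mapping.lookup (F l) m) * xmon m) \<in> SP" by (intro SP_sum) auto
    then show ?case unfolding e by (rule SP_add[OF SP_F[OF less.prems]])
  qed
  have "(\<Sum>m\<in>Poly_Mapping.keys f. Cst (Poly_Mapping.lookup f m) * xmon m) \<in> SP"
    using f fL by (intro SP_sum SP_cmul mono_SP) auto
  then have "f \<in> SP" using mono_expand[of f] by simp
  then show ?thesis unfolding SP_def by blast
qed

text \<open>In a vanishing combination, take an index of maximal \<open>hm\<close> with nonzero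
  coefficient: no other term contributes to its leading monomial.\<close>

lemma triangular_independent:
  assumes F: "triangular F" and A: "finite A" "A \<subseteq> weights n" and z: "lcomb F A c = 0" and l: "l \<in> A"
  shows "c l = 0"
proof (rule ccontr)
  assume nz: "c l \<noteq> 0"
  let ?B = "{l\<in>A. c l \<noteq> 0}"
  have B: "finite ?B" "?B \<noteq> {}" using A nz l by auto
  obtain m where m: "m \<in> ?B" "\<And>k. k \<in> ?B \<Longrightarrow> hm n k \<le> hm n m"
  proof -
    have "Max (hm n ` ?B) \<in> hm n ` ?B" using B by (intro Max_in) auto
    then obtain m where "m \<in> ?B" "hm n m = Max (hm n ` ?B)" by auto
    then show ?thesis using that B by auto
  qed
  have "Poly_Mapping.lookup (lcomb F A c) m = (\<Sum>k\<in>A. c k * Poly_Mapping.lookup (F k) m)"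
    by (simp add: lcomb_def lookup_sum)
  also have "\<dots> = (\<Sum>k\<in>A. if k = m then c m else 0)"
  proof (rule sum.cong)
    fix k assume k: "k \<in> A"
    show "c k * Poly_Mapping.lookup (F k) m = (if k = m then c m else 0)"
    proof (cases "k = m")
      case True
      then show ?thesis using F m A by (auto simp: triangular_def)
    next
      case False
      show ?thesis
      proof (cases "c k = 0 \<or> Poly_Mapping.lookup (F k) m = 0")
        case False': False
        then have "m \<in> Poly_Mapping.keys (F k)" by (simp add: in_keys_iff)
        then have "low n m k" using F k A by (auto simp: triangular_def)
        then have "hm n m < hm n k" using low_hm_less False by metis
        moreover have "hm n k \<le> hm n m" using m(2)[of k] k False' by simp
        ultimately show ?thesis by simp
      qed (use False in auto)
    qed
  qed simp
  also have "\<dots> = c m" using A m by (simp add: sum.delta')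
  finally show False using z m by simp
qed

end

text \<open>Multiplicative independence of \<open>q\<close>, \<open>t\<close> and
  \<open>a^*\<close>. It separates the joint eigenvalues and keeps the denominators of the
  intertwiners nonzero, and it holds generically as well as modulo \<open>s\<close>.\<close>

locale koornwinder_sep = koornwinder_field +
  assumes sep: "mon3 A B C = 1 \<Longrightarrow> A = 0 \<and> B = 0 \<and> C = 0"
begin

lemma mon3_eq_iff: "mon3 A B C = mon3 A' B' C' \<longleftrightarrow> A = A' \<and> B = B' \<and> C = C'"
proof
  assume "mon3 A B C = mon3 A' B' C'"
  then have "mon3 A B C * inverse (mon3 A' B' C') = 1" by simp
  then show "A = A' \<and> B = B' \<and> C = C'" unfolding mon3_inverse mon3_mult using sep by fastforce
qed simp

lemma sgn_vec_nz: "sgn_vec l i \<noteq> 0" "sgn_vec l i = 1 \<or> sgn_vec l i = - 1"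
  by (auto simp: sgn_vec_def)

lemma yv_tie:
  assumes i: "0 < i" "i < n" and e: "lk l i = lk l (Suc i)"
  shows "yv l i = ht\<^sup>2 * yv l (Suc i)"
proof -
  have "sgn_vec l i = sgn_vec l (Suc i)" using e by (simp add: sgn_vec_def)
  then have "yv l i = mon3 0 1 0 * yv l (Suc i)"
    unfolding yv_mon3 mon3_mult using rk_tie[OF i e] e by (simp add: add.commute)
  then show ?thesis by (simp add: mon3_def)
qed

lemma yv_ratio:
  assumes i: "0 < i" "i < n" and e: "yv l i = ht\<^sup>2 * yv l (Suc i)"
  shows "lk l i = lk l (Suc i)"
proof -
  have "yv l i = mon3 0 1 0 * yv l (Suc i)" using e by (simp add: mon3_def)
  then show ?thesis unfolding yv_mon3 mon3_mult mon3_eq_iff by simp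
qed

text \<open>For \<open>i = 0\<close> and \<open>i = n\<close> the exponent of \<open>a^*\<close> is
  2 or -2. In between, equal eigenvalues would force equal entries, and for those the eigenvalues
  differ by the factor \<open>t\<close>.\<close>

lemma kden_nz:
  assumes "i \<le> n"
  shows "kden i (yv l) \<noteq> 0"
proof -
  consider "i = 0" | "0 < i" "i < n" | "i = n" "0 < i" using assms by linarith
  then show ?thesis
  proof cases
    case 1
    have "hq\<^sup>2 * (yv l 1)\<^sup>2 = mon3 1 0 0 * yv l 1 * yv l 1" by (simp add: mon3_def power2_eq_square)
    also have "\<dots> \<noteq> 1"
      unfolding yv_mon3 mon3_mult using sep sgn_vec_nz(1)[of l 1] by fastforce
    finally show ?thesis using 1 by (simp add: kden_def)
  next
    case 2
    have "yv l (Suc i) \<noteq> yv l i"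
    proof
      assume e: "yv l (Suc i) = yv l i"
      then have "lk l (Suc i) = lk l i" unfolding yv_mon3 mon3_eq_iff by simp
      then have "mon3 0 1 0 * yv l i = 1 * yv l i" using yv_tie[OF 2, of l] e by (simp add: mon3_def)
      then have "mon3 0 1 0 = 1" by (simp only: mult_cancel_right yv_nz)  simp
      then show False using sep by fastforce
    qed
    then show ?thesis using 2 by (simp add: kden_def)
  next
    case 3
    have "(yv l n)\<^sup>2 = yv l n * yv l n" by (simp add: power2_eq_square)
    also have "\<dots> \<noteq> 1"
      unfolding yv_mon3 mon3_mult using sep sgn_vec_nz(1)[of l n] by fastforce
    finally show ?thesis using 3 by (simp add: kden_def)
  qed
qed

lemma exists_E: "l \<in> weights n \<Longrightarrow> \<exists>f. isE l f"
proof -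
  assume "l \<in> weights n"
  then show ?thesis
    using n2
  proof (induction rule: weight_induct)
    case zero
    show ?case using isE_zero by blast
  next
    case (step i v)
    then show ?case using isE_step kden_nz by blast
  qed
qed

definition E :: "(nat \<Rightarrow>\<^sub>0 int) \<Rightarrow> 'a lpoly" where
  "E l = (SOME f. isE l f)"

lemma isE_E: "l \<in> weights n \<Longrightarrow> isE l (E l)"
  unfolding E_def using exists_E by (rule someI_ex)

lemma triangular_E: "triangular E"
  unfolding triangular_def using isE_E by (simp add: isE_def)

lemma eig_E: "l \<in> weights n \<Longrightarrow> eig (yv l) (E l)"
  using isE_E by (simp add: isE_def)

lemma yv_inject:
  assumes "l \<in> weights n" "l' \<in> weights n" "\<And>j. j \<in> {1..n} \<Longrightarrow> yv l j = yv l' j"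
  shows "l = l'"
  using assms(1,2) by (rule weights_eqI) (use assms(3) in \<open>auto simp: yv_mon3 mon3_eq_iff\<close>)

lemma expand_E:
  assumes "Poly_Mapping.keys f \<subseteq> weights n"
  shows "\<exists>A c. finite A \<and> A \<subseteq> weights n \<and> f = lcomb E A c"
  using triangular_expand[OF triangular_E assms, of UNIV] by auto

lemma Y_lcomb_E:
  assumes "A \<subseteq> weights n" "j \<in> {1..n}"
  shows "Y j (lcomb E A c) = lcomb E A (\<lambda>l. yv l j * c l)"
  unfolding lcomb_linear[OF linear_Y] unfolding lcomb_def
proof (rule sum.cong)
  fix l assume "l \<in> A"
  then have "Y j (E l) = Cst (yv l j) * E l" using eig_E assms by (auto simp: eig_def)
  then show "Cst (c l) * Y j (E l) = Cst (yv l j * c l) * E l" by (simp only: Cst_Cst mult.commute[of "c l"])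
qed simp

lemma eigenvector_E:
  assumes f: "Poly_Mapping.keys f \<subseteq> weights n" and e: "eig y f" and nz: "f \<noteq> 0"
  shows "\<exists>l\<in>weights n. \<exists>c. f = Cst c * E l \<and> (\<forall>j\<in>{1..n}. y j = yv l j)"
proof -
  obtain A c where A: "finite A" "A \<subseteq> weights n" "f = lcomb E A c" using expand_E[OF f] by blast
  have c: "c l = 0 \<or> yv l j = y j" if "l \<in> A" "j \<in> {1..n}" for l j
  proof -
    have "Y j f = Cst (y j) * f" using e that by (auto simp: eig_def)
    then have "lcomb E A (\<lambda>l. yv l j * c l) + lcomb E A (\<lambda>l. (- y j) * c l) = 0"
      unfolding A(3) Y_lcomb_E[OF A(2) that(2)] lcomb_cmul[symmetric] by (simp add: single_uminus)
    then have "lcomb E A (\<lambda>l. (if l \<in> A then yv l j * c l else 0) + (if l \<in> A then (- y j) * c l else 0)) = 0"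
      unfolding lcomb_add[OF A(1) A(1)] by simp
    from triangular_independent[OF triangular_E A(1,2) this that(1)] show ?thesis using that by (simp add: algebra_simps)
  qed
  have "\<exists>l\<in>A. c l \<noteq> 0"
  proof (rule ccontr)
    assume "\<not> ?thesis"
    then have "lcomb E A c = 0" unfolding lcomb_def by (intro sum.neutral) auto
    then show False using nz A(3) by simp
  qed
  then obtain l where l: "l \<in> A" "c l \<noteq> 0" by blast
  have uni: "c m = 0" if "m \<in> A" "m \<noteq> l" for m
  proof (rule ccontr)
    assume "c m \<noteq> 0"
    then have "yv m j = yv l j" if "j \<in> {1..n}" for j using c[OF l(1) that] c[OF \<open>m \<in> A\<close> that] l(2) by simp
    then show False using yv_inject[of m l] that A(2) l(1) by blast
  qed
  have "f = lcomb E {l} c" unfolding A(3) by (rule lcomb_superset) (use A l uni in auto)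
  then have "f = Cst (c l) * E l" by (simp add: lcomb_def)
  then show ?thesis using c[OF l(1)] l A(2) by (metis subsetD)
qed

lemma isE_unique:
  assumes l: "l \<in> weights n" and E: "isE l f"
  shows "f = E l"
proof -
  have one: "Poly_Mapping.lookup f l = 1" using E by (simp add: isE_def)
  have "Poly_Mapping.keys f \<subseteq> weights n" using E low_weights[OF _ l] by (auto simp: isE_def)
  moreover have "f \<noteq> 0" using one by auto
  moreover have "eig (yv l) f" using E by (simp add: isE_def)
  ultimately obtain m c where m: "m \<in> weights n" "f = Cst c * E m" "\<forall>j\<in>{1..n}. yv l j = yv m j"
    using eigenvector_E by blast
  then have "l = m" using yv_inject l by blast
  then show ?thesis using m one isE_E[OF l] by (simp add: isE_def)
qed

text \<open>Applying \<open>Y_j - y(m)_j\<close> removes the component of \<open>m\<close> and keeps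
  that of \<open>l\<close> if \<open>j\<close> separates the two; this is repeated until one term is
  left.\<close>

lemma eigen_component:
  assumes W: "\<And>f g. f \<in> W \<Longrightarrow> g \<in> W \<Longrightarrow> f + g \<in> W" "\<And>c f. f \<in> W \<Longrightarrow> Cst c * f \<in> W"
      "\<And>j f. j \<in> {1..n} \<Longrightarrow> f \<in> W \<Longrightarrow> Y j f \<in> W"
    and A: "finite A" "A \<subseteq> weights n" and f: "lcomb E A c \<in> W" and l: "l \<in> A" "c l \<noteq> 0"
  shows "E l \<in> W"
  using A f l
proof (induction "card A" arbitrary: A c rule: less_induct)
  case less
  show ?case
  proof (cases "A = {l}")
    case True
    then have "Cst (inverse (c l)) * (Cst (c l) * E l) \<in> W" using less.prems W(2) by (simp add: lcomb_def)
    then show ?thesis using less.prems(5) by (simp add: Cst_Cst)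
  next
    case False
    then obtain m where m: "m \<in> A" "m \<noteq> l" using less.prems(4) by blast
    then obtain j where j: "j \<in> {1..n}" "yv m j \<noteq> yv l j" using yv_inject[of m l] less.prems(2,4) by blast
    let ?f = "lcomb E A c"
    have "Y j ?f + Cst (- yv m j) * ?f \<in> W" using W less.prems(3) j by blast
    then have "lcomb E A (\<lambda>k. (if k \<in> A then yv k j * c k else 0) + (if k \<in> A then (- yv m j) * c k else 0)) \<in> W"
      unfolding Y_lcomb_E[OF less.prems(2) j(1)] lcomb_cmul lcomb_add[OF less.prems(1) less.prems(1)] by simp
    also have "lcomb E A (\<lambda>k. (if k \<in> A then yv k j * c k else 0) + (if k \<in> A then (- yv m j) * c k else 0))
      = lcomb E A (\<lambda>k. (yv k j - yv m j) * c k)"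
      unfolding lcomb_def by (rule sum.cong) (auto simp: algebra_simps)
    also have "\<dots> = lcomb E (A - {m}) (\<lambda>k. (yv k j - yv m j) * c k)"
      by (rule lcomb_superset) (use less.prems in auto)
    finally have w: "lcomb E (A - {m}) (\<lambda>k. (yv k j - yv m j) * c k) \<in> W" .
    have "card (A - {m}) < card A" using m less.prems(1) by (intro psubset_card_mono) auto
    then show ?thesis
      by (rule less.hyps[OF _ _ _ w]) (use less.prems m j in auto)
  qed
qed

lemma keys_sop_weights:
  assumes "Poly_Mapping.keys f \<subseteq> weights n" "i \<le> n"
  shows "Poly_Mapping.keys (sop i y f) \<subseteq> weights n"
proof
  fix u assume "u \<in> Poly_Mapping.keys (sop i y f)"
  then obtain m where m: "m \<in> Poly_Mapping.keys f" "u \<in> Poly_Mapping.keys (sop i y (xmon m))"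
    using linear_keys[OF linear_sop] by blast
  have "m \<in> weights n" using m assms by blast
  moreover have "u \<in> seg n i m" by (rule keys_sop_seg[OF assms(2) m(2)])
  ultimately show "u \<in> weights n"
    using seg_cases[of m n i u] wact_weights[of m n i] assms(2) n2 low1_weights by auto
qed

lemma keys_E: "l \<in> weights n \<Longrightarrow> Poly_Mapping.keys (E l) \<subseteq> weights n"
  using isE_E[of l] low_weights[of n _ l] unfolding isE_def by blast

lemma keys_step: "Poly_Mapping.keys f \<subseteq> weights n \<Longrightarrow> i \<le> n \<Longrightarrow> Poly_Mapping.keys (step i y f) \<subseteq> weights n"
  unfolding step_def using keys_add keys_sop_weights keys_cmul_sub by (meson Un_least subset_trans)

lemma step_E:
  assumes l: "l \<in> weights n" and i: "i \<le> n"
    and nt: "if i = 0 then True else if i < n then lk l i \<noteq> lk l (Suc i) else lk l n \<noteq> 0"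
  shows "\<exists>c. step i (yv l) (E l) = Cst c * E (wact n i l)"
proof (cases "step i (yv l) (E l) = 0")
  case True
  then show ?thesis by (intro exI[of _ 0]) simp
next
  case False
  have W: "wact n i l \<in> weights n" using wact_weights l i n2 by simp
  have "eig (yact i (yv l)) (step i (yv l) (E l))"
    by (rule eig_step[OF eig_E[OF l] kden_nz[OF i] _ i]) simp
  then obtain m c where m: "m \<in> weights n" "step i (yv l) (E l) = Cst c * E m" "\<forall>j\<in>{1..n}. yact i (yv l) j = yv m j"
    using eigenvector_E[OF keys_step[OF keys_E[OF l] i]] False by blast
  then have "yv m j = yv (wact n i l) j" if "j \<in> {1..n}" for j
    using yact_yv[OF i nt that] that by simp
  then have "m = wact n i l" using yv_inject[OF m(1) W] by blast
  then show ?thesis using m(2) by blast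
qed

lemma step_E_asc:
  assumes l: "l \<in> weights n" and i: "i \<le> n" and a: "asc n i l"
  shows "step i (yv l) (E l) = Cst (lead i l) * E (wact n i l)"
proof -
  have W: "wact n i l \<in> weights n" using wact_weights l i n2 by simp
  have "estep i l (E l) = E (wact n i l)"
    by (rule isE_unique[OF W isE_step[OF isE_E[OF l] l i a kden_nz[OF i]]])
  then show ?thesis using lead_nz[of i l] unfolding estep_def by (metis Cst_Cst right_inverse mult.left_neutral single_one)
qed

text \<open>A nonzero image would be an eigenvector for the reflected eigenvalues, which belong to
  no weight: the relevant entries would have to be those of \<open>l\<close>, and then the rank or
  the sign is wrong.\<close>

lemma step_E_tie:
  assumes l: "l \<in> weights n" and i: "0 < i" "i \<le> n"
    and tie: "if i < n then lk l i = lk l (Suc i) else lk l n = 0"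
  shows "step i (yv l) (E l) = 0"
proof (rule ccontr)
  assume nz: "\<not> ?thesis"
  have "eig (yact i (yv l)) (step i (yv l) (E l))"
    by (rule eig_step[OF eig_E[OF l] kden_nz[OF i(2)] _ i(2)]) simp
  then obtain m c where m: "m \<in> weights n" "\<And>j. j \<in> {1..n} \<Longrightarrow> yact i (yv l) j = yv m j"
    using eigenvector_E[OF keys_step[OF keys_E[OF l] i(2)]] nz by blast
  show False
  proof (cases "i < n")
    case True
    let ?p = "Transposition.transpose i (Suc i)"
    have y: "yact i (yv l) j = yv l (?p j)" for j using i True by (auto simp: yact_def transpose_def)
    have "l = m"
    proof (rule weights_eqI[OF l m(1)])
      fix j assume j: "j \<in> {1..n}"
      then have "lk m j = lk l (?p j)" using m(2)[OF j] unfolding y yv_mon3 mon3_eq_iff by simp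
      then show "lk l j = lk m j" using tie True by (auto simp: transpose_def split: if_splits)
    qed
    then have "yv l (Suc i) = yv l i" using m(2)[of i] y[of i] i True by (simp add: transpose_def)
    then show ?thesis using kden_nz[OF i(2), of l] i True by (simp add: kden_def)
  next
    case False
    then have i: "i = n" "n > 0" using i by auto
    have "yv m n = inverse (yv l n)" using m(2)[of n] i by (simp add: yact_def)
    then have "lk m n = - lk l n" "sgn_vec m n = - sgn_vec l n" unfolding yv_mon3 mon3_inverse mon3_eq_iff by auto
    then show ?thesis using tie False by (simp add: sgn_vec_def)
  qed
qed

end

section \<open>The vanishing ideal at special parameters\<close>

text \<open>Exchanging \<open>h0\<close> and \<open>un\<close> turns the spectral points into the evaluation points.\<close>

locale koornwinder_special =
  koornwinder_sep n hq ht hn h0 un u0 + dual: koornwinder_sep n hq ht hn un h0 u0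
  for n :: nat and hq ht hn h0 un u0 :: "'a::field" +
  fixes ii kk :: nat
  assumes ii: "1 \<le> ii" "ii \<le> n" and kk: "1 \<le> kk"
    \<comment> \<open>This is \<open>t^(n-ii) q^kk a^* b^* = 1\<close>, because
      \<open>a^* b^* = - t_n\<close>.\<close>
    and special: "hn\<^sup>2 * ht powi (2 * int (n - ii)) * hq powi (2 * int kk) = - 1"
    \<comment> \<open>Keeps the scalars attached to the affine reflection nonzero: the first two
      conditions concern \<open>kap 0\<close>, the last two \<open>al 0\<close>.\<close>
    and free: "hq * mon3 A B C * un \<noteq> - u0" "hq * mon3 A B C * un * u0 \<noteq> 1"
      "dual.mon3 A B C \<noteq> hq * h0 * u0" "dual.mon3 A B C * u0 \<noteq> - (hq * h0)"
begin

section \<open>The set S and its boundary\<close>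

definition cB :: "(nat \<Rightarrow>\<^sub>0 int) \<Rightarrow> nat" where
  "cB l = card {j\<in>{1..n}. gval (lk l j) \<ge> 2 * int kk}"

definition inS :: "(nat \<Rightarrow>\<^sub>0 int) \<Rightarrow> bool" where
  "inS l \<longleftrightarrow> ii \<le> cB l"

text \<open>Here \<open>s_n\<close> moves \<open>l\<close> from the complement into
  \<open>S\<close>: \<open>cB\<close> rises from \<open>ii - 1\<close> to \<open>ii\<close>
  (\<open>crossing_cB\<close>, \<open>cB_wact_n\<close>).\<close>

definition crossing :: "(nat \<Rightarrow>\<^sub>0 int) \<Rightarrow> bool" where
  "crossing l \<longleftrightarrow> lk l n = - int kk \<and> rk n l n = n - ii"

definition tied :: "nat \<Rightarrow> (nat \<Rightarrow>\<^sub>0 int) \<Rightarrow> bool" where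
  "tied i l \<longleftrightarrow> (if i = 0 then False else if i < n then lk l i = lk l (Suc i) else lk l n = 0)"

lemma special': "hn\<^sup>2 * (ht powi (2 * int (n - ii)) * hq powi (2 * int kk)) = - 1"
  using special by (simp add: mult.assoc)

lemma hn_square: "- (hn\<^sup>2) = inverse (ht powi (2 * int (n - ii)) * hq powi (2 * int kk))"
proof -
  have "- (hn\<^sup>2) * (ht powi (2 * int (n - ii)) * hq powi (2 * int kk)) = 1" using special' by simp
  then show ?thesis by (metis inverse_unique inverse_inverse_eq mult.commute)
qed

text \<open>At the special parameters \<open>b^* = - hn / h0\<close> turns into a possible
  eigenvalue of \<open>Y_n\<close>. This resonance is what singles out
  \<open>crossing\<close>.\<close>

lemma special_mon3: "- hn * inverse h0 = mon3 (- int kk) (- int (n - ii)) (- 1)"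
proof -
  have "- hn * inverse h0 = - (hn\<^sup>2) * inverse (hn * h0)" by (simp add: power2_eq_square)
  also have "\<dots> = mon3 (- int kk) (- int (n - ii)) (- 1)"
    unfolding hn_square by (simp add: mon3_def power_int_minus)
  finally show ?thesis .
qed

lemma special_dual_mon3: "- hn * inverse un = dual.mon3 (- int kk) (- int (n - ii)) (- 1)"
proof -
  have "- hn * inverse un = - (hn\<^sup>2) * inverse (hn * un)" by (simp add: power2_eq_square)
  also have "\<dots> = dual.mon3 (- int kk) (- int (n - ii)) (- 1)"
    unfolding hn_square by (simp add: dual.mon3_def power_int_minus)
  finally show ?thesis .
qed

lemma crossing_iff_yv: "yv l n = - hn * inverse h0 \<longleftrightarrow> crossing l"
  unfolding special_mon3 yv_mon3 mon3_eq_iff crossing_def using kk by (auto simp: sgn_vec_def)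

lemma crossing_iff_dual_yv: "dual.yv l n = - hn * inverse un \<longleftrightarrow> crossing l"
  unfolding special_dual_mon3 dual.yv_mon3 dual.mon3_eq_iff crossing_def using kk by (auto simp: sgn_vec_def)

lemma crossing_cB: "lk l n = - int kk \<Longrightarrow> crossing l \<longleftrightarrow> cB l = ii - 1"
proof -
  assume "lk l n = - int kk"
  then have "rk n l n + cB l = n - 1"
    unfolding cB_def using rk_cross[of n l "int kk"] n2 kk by simp
  then show ?thesis using ii \<open>lk l n = - int kk\<close> unfolding crossing_def by auto
qed

lemma cB_wact:
  assumes i: "i \<le> n" and nc: "\<not> (i = n \<and> \<bar>lk l n\<bar> = int kk)"
  shows "cB (wact n i l) = cB l"
proof -
  consider "i = 0" | "0 < i" "i < n" | "i = n" "0 < i" using i by linarith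
  then show ?thesis
  proof cases
    case 1
    have "gval (lk (wact n i l) j) \<ge> 2 * int kk \<longleftrightarrow> gval (lk l j) \<ge> 2 * int kk" for j
      using 1 by (auto simp: lookup_wact gval_def)
    then show ?thesis by (simp add: cB_def)
  next
    case 2
    let ?p = "Transposition.transpose i (Suc i)"
    have L: "lk (wact n i l) c = lk l (?p c)" for c
      using 2 by (auto simp: lookup_wact transpose_def)
    have b: "bij_betw ?p {1..n} {1..n}"
      by (rule bij_betw_byWitness[of _ ?p]) (use 2 in \<open>auto simp: transpose_def\<close>)
    show ?thesis unfolding cB_def L by (rule card_bij_Collect[OF b, symmetric])
  next
    case 3
    have "gval (lk (wact n i l) j) \<ge> 2 * int kk \<longleftrightarrow> gval (lk l j) \<ge> 2 * int kk" for j
      using 3 nc by (auto simp: lookup_wact gval_def)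
    then show ?thesis by (simp add: cB_def)
  qed
qed

lemma cB_wact_n:
  assumes c: "lk l n = - int kk"
  shows "cB (wact n n l) = Suc (cB l)"
proof -
  have "{j\<in>{1..n}. gval (lk (wact n n l) j) \<ge> 2 * int kk} = insert n {j\<in>{1..n}. gval (lk l j) \<ge> 2 * int kk}"
    using c n2 kk by (auto simp: lookup_wact gval_def)
  moreover have "n \<notin> {j\<in>{1..n}. gval (lk l j) \<ge> 2 * int kk}" using c kk by (simp add: gval_def)
  ultimately show ?thesis by (simp add: cB_def)
qed

lemma inS_asc:
  assumes "i \<le> n" "asc n i l"
  shows "inS (wact n i l) \<longleftrightarrow> inS l \<or> i = n \<and> crossing l"
proof (cases "i = n \<and> \<bar>lk l n\<bar> = int kk")
  case True
  then have "lk l n = - int kk" using assms n2 by (auto simp: asc_def)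
  then show ?thesis using cB_wact_n[of l] crossing_cB[of l] True ii by (auto simp: inS_def)
next
  case False
  then have "\<not> (i = n \<and> crossing l)" by (auto simp: crossing_def)
  then show ?thesis using cB_wact[OF assms(1) False] by (auto simp: inS_def)
qed

lemma inS_change:
  assumes i: "i \<le> n" and "inS (wact n i l)" "\<not> inS l"
  shows "i = n \<and> crossing l"
proof -
  have a: "i = n" "\<bar>lk l n\<bar> = int kk" using cB_wact[OF i, of l] assms by (auto simp: inS_def)
  show ?thesis
  proof (cases "lk l n = - int kk")
    case True
    then show ?thesis using cB_wact_n[OF True] crossing_cB[OF True] a assms by (auto simp: inS_def)
  next
    case False
    then have c: "lk (wact n n l) n = - int kk" using a n2 by (simp add: lookup_wact)
    show ?thesis using cB_wact_n[OF c] a assms by (simp add: inS_def)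
  qed
qed

lemma inS_zero: "\<not> inS 0"
  using ii kk by (simp add: inS_def cB_def gval_def)

lemma ht_square: "ht\<^sup>2 \<noteq> 1"
  using sep[of 0 1 0] by (auto simp: mon3_def)

lemma a_square: "(hn * un)\<^sup>2 \<noteq> 1"
  using dual.sep[of 0 0 2] by (auto simp: dual.mon3_def)

text \<open>The numerators factor. For \<open>i = 0\<close> both factors are excluded by
  \<open>free\<close>; in the middle the zero is the ratio \<open>t\<close> of a tie; for
  \<open>i = n\<close> one factor vanishes at \<open>y_n = a^*\<close>, that is at
  \<open>l_n = 0\<close>, the other at \<open>y_n = b^*\<close>, the crossing.\<close>

lemma kap_zero_iff:
  assumes i: "i \<le> n"
  shows "(if i = 0 then un else tau i) + kap i (yv l) = 0 \<longleftrightarrow> tied i l \<or> i = n \<and> crossing l"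
proof -
  have kd: "kden i (yv l) \<noteq> 0" by (rule kden_nz[OF i])
  have eq0: "x + a / kden i (yv l) = 0 \<longleftrightarrow> x * kden i (yv l) + a = 0" for x a
    using kd by (simp add: field_simps)
  consider "i = 0" | "0 < i" "i < n" | "i = n" "0 < i" using i by linarith
  then show ?thesis
  proof cases
    case 1
    define y where "y = yv l 1"
    have "un * (hq\<^sup>2 * y\<^sup>2 - 1) + (hq * (u0 - inverse u0) * y + (un - inverse un)) = (un * hq * y + u0) * (hq * y - inverse (un * u0))"
      by (simp add: field_simps power2_eq_square)
    moreover have "un * hq * y + u0 \<noteq> 0"
      using free(1) unfolding y_def yv_mon3 by (metis add.commute add_eq_0_iff mult.assoc mult.commute)
    moreover have "hq * y - inverse (un * u0) \<noteq> 0"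
    proof
      assume "hq * y - inverse (un * u0) = 0"
      then have "hq * y * un * u0 = 1" by (simp add: field_simps)
      then show False using free(2) unfolding y_def yv_mon3 by blast
    qed
    ultimately have num: "un * (hq\<^sup>2 * y\<^sup>2 - 1) + (hq * (u0 - inverse u0) * y + (un - inverse un)) \<noteq> 0"
      by simp
    have kd0: "kden 0 (yv l) = hq\<^sup>2 * y\<^sup>2 - 1" unfolding kden_def y_def by simp
    have kap0: "kap 0 (yv l) = (hq * (u0 - inverse u0) * y + (un - inverse un)) / kden 0 (yv l)"
      unfolding kap_def kden_def y_def by simp
    have "un + kap 0 (yv l) \<noteq> 0"
      unfolding kap0 eq0[unfolded 1] unfolding kd0 by (rule num)
    then show ?thesis using 1 n2 by (simp add: tied_def)
  next
    case 2
    have t: "tau i = ht" using 2 by (simp add: tau_def)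
    have "tau i * (yv l (Suc i) - yv l i) + del i * yv l i = inverse ht * (ht\<^sup>2 * yv l (Suc i) - yv l i)"
      by (simp add: del_def t field_simps power2_eq_square)
    then have "tau i + kap i (yv l) = 0 \<longleftrightarrow> yv l i = ht\<^sup>2 * yv l (Suc i)"
      using 2 eq0[of "tau i" "del i * yv l i"] by (auto simp: kap_def kden_def)
    also have "\<dots> \<longleftrightarrow> tied i l" using yv_ratio[OF 2] yv_tie[OF 2] 2 by (auto simp: tied_def)
    finally show ?thesis using 2 by simp
  next
    case 3
    define y where "y = yv l n"
    have t: "tau n = hn" "tau 0 = h0" using 3 by (simp_all add: tau_def)
    have "tau n * (1 - y\<^sup>2) + y * (y * del n + del 0) = (hn + y * h0) * (1 - y * inverse (hn * h0))"
      by (simp add: del_def t field_simps power2_eq_square)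
    then have "tau n + kap n (yv l) = 0 \<longleftrightarrow> hn + y * h0 = 0 \<or> 1 - y * inverse (hn * h0) = 0"
      using 3 eq0[of "tau n" "y * (y * del n + del 0)"] by (simp add: kap_def kden_def flip: y_def)
    also have "hn + y * h0 = 0 \<longleftrightarrow> y = - hn * inverse h0"
      by (metis (no_types, opaque_lifting) add.commute add_eq_0_iff mult.assoc mult_cancel_right2 mult_minus_left nz(4) right_inverse mult.right_neutral left_inverse)
    also have "\<dots> \<longleftrightarrow> crossing l" unfolding y_def by (rule crossing_iff_yv)
    also have "1 - y * inverse (hn * h0) = 0 \<longleftrightarrow> y = mon3 0 0 1" by (auto simp: mon3_def field_simps)
    also have "\<dots> \<longleftrightarrow> lk l n = 0"
      unfolding y_def yv_mon3 mon3_eq_iff using rk_n0[of l n] by (auto simp: sgn_vec_def)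
    finally show ?thesis using 3 by (auto simp: tied_def)
  qed
qed

section \<open>Evaluation points and the value at the base point\<close>

definition pt :: "(nat \<Rightarrow>\<^sub>0 int) \<Rightarrow> nat \<Rightarrow> 'a" where
  "pt l i = (if i \<in> {1..n} then inverse (dual.yv l i) else 1)"

lemma pt_nz: "pt l i \<noteq> 0"
  by (simp add: pt_def)

lemma pt_zero: "pt 0 = base_pt"
proof
  fix i
  show "pt 0 i = base_pt i"
  proof (cases "i \<in> {1..n}")
    case True
    have "2 * int (n - i) = int (2 * (n - i))" by simp
    then have "ht powi (2 * int (n - i)) = ht ^ (2 * (n - i))" by (metis power_int_of_nat)
    then show ?thesis using True by (simp add: pt_def base_pt_def dual.yv_def sgn_vec_def rk_zero)
  qed (auto simp: pt_def base_pt_def)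
qed

lemma pact_pt:
  assumes i: "i \<le> n" and nt: "\<not> tied i l"
  shows "pact i (pt l) = pt (wact n i l)"
proof
  fix j
  have Y: "dual.yact i (dual.yv l) j = dual.yv (wact n i l) j" if "j \<in> {1..n}"
    by (rule dual.yact_yv[OF i _ that]) (use nt in \<open>auto simp: tied_def split: if_splits\<close>)
  show "pact i (pt l) j = pt (wact n i l) j"
  proof (cases "j \<in> {1..n}")
    case True
    then show ?thesis
      using Y i n2 by (auto simp: pact_def dual.yact_def pt_def field_simps split: if_splits)
  next
    case False
    then show ?thesis using i n2 by (auto simp: pact_def pt_def)
  qed
qed

text \<open>Dual counterpart of \<open>kap_zero_iff\<close>: \<open>tau i - al i\<close> factors in
  the same way with \<open>h0\<close> and \<open>un\<close> exchanged, and at evaluation points it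
  vanishes on the same walls, with \<open>b\<close> in place of \<open>b^*\<close>.\<close>

lemma pt_coeff:
  assumes i: "i \<le> n"
  shows "gd i (pt l)" "tau i = al i (pt l) \<longleftrightarrow> tied i l \<or> i = n \<and> crossing l"
proof -
  have kd: "dual.kden i (dual.yv l) \<noteq> 0" by (rule dual.kden_nz[OF i])
  have "gd i (pt l) \<and> (tau i = al i (pt l) \<longleftrightarrow> tied i l \<or> i = n \<and> crossing l)"
  proof -
    consider "i = 0" | "0 < i" "i < n" | "i = n" "0 < i" using i by linarith
    then show ?thesis
    proof cases
      case 1
      define y where "y = dual.yv l 1"
      have y0: "y \<noteq> 0" by (simp add: y_def)
      define x where "x = pt l 1"
      have x: "x = inverse y" "x \<noteq> 0" using n2 by (simp_all add: x_def pt_def y_def)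
      have d: "hq\<^sup>2 * y\<^sup>2 \<noteq> 1" using kd 1 by (simp add: dual.kden_def y_def)
      have xq: "x\<^sup>2 \<noteq> hq\<^sup>2"
      proof
        assume "x\<^sup>2 = hq\<^sup>2"
        then have "hq\<^sup>2 * y\<^sup>2 = (x * y)\<^sup>2" by (simp add: power_mult_distrib)
        then show False using d x y0 by simp
      qed
      have "(tau 0 - al 0 (pt l)) * (x\<^sup>2 - hq\<^sup>2) = tau 0 * (x\<^sup>2 - hq\<^sup>2) - (del 0 * x\<^sup>2 + (u0 - inverse u0) * hq * x)"
      proof -
        have "al 0 (pt l) = (del 0 * x\<^sup>2 + (u0 - inverse u0) * hq * x) / (x\<^sup>2 - hq\<^sup>2)"
          unfolding al_def x_def by simp
        then show ?thesis using xq by (simp add: left_diff_distrib)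
      qed
      also have "\<dots> = (x - hq * h0 * u0) * (x * inverse h0 + hq * inverse u0)"
        by (simp add: del_def tau_def field_simps power2_eq_square)
      finally have f: "(tau 0 - al 0 (pt l)) * (x\<^sup>2 - hq\<^sup>2) = (x - hq * h0 * u0) * (x * inverse h0 + hq * inverse u0)" .
      have xm: "x = dual.mon3 (- lk l 1) (- (sgn_vec l 1 * int (rk n l 1))) (- sgn_vec l 1)"
        unfolding x(1) y_def dual.yv_mon3 dual.mon3_inverse ..
      have "x - hq * h0 * u0 \<noteq> 0" using free(3) unfolding xm by simp
      moreover have "x * inverse h0 + hq * inverse u0 \<noteq> 0"
      proof
        assume "x * inverse h0 + hq * inverse u0 = 0"
        then have "x * inverse h0 = - (hq * inverse u0)" by (simp add: add_eq_0_iff2)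
        then have "x * inverse h0 * (h0 * u0) = - (hq * inverse u0) * (h0 * u0)" by simp
        then have "x * u0 = - (hq * h0)" by (simp add: field_simps)
        then show False using free(4) unfolding xm by blast
      qed
      ultimately have "tau 0 \<noteq> al 0 (pt l)" using f by auto
      then show ?thesis using 1 xq n2 by (simp add: gd_def tied_def x_def)
    next
      case 2
      define y y' where yy: "y = dual.yv l i" "y' = dual.yv l (Suc i)"
      have y0: "y \<noteq> 0" "y' \<noteq> 0" by (simp_all add: yy)
      have d: "y' - y \<noteq> 0" using kd 2 by (simp add: dual.kden_def yy)
      have x: "pt l i = inverse y" "pt l (Suc i) = inverse y'" using 2 by (simp_all add: pt_def yy)
      have e: "inverse y' - inverse y = (y - y') / (y * y')" using y0 by (simp add: field_simps)
      have t: "tau i = ht" using 2 by (simp add: tau_def)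
      have "al i (pt l) = del i * y / (y - y')"
        using 2 y0 d by (simp add: al_def x e)
      then have "(tau i - al i (pt l)) * (y - y') = inverse ht * (y - ht\<^sup>2 * y')"
        using d by (simp add: left_diff_distrib del_def t field_simps power2_eq_square)
      then have "tau i = al i (pt l) \<longleftrightarrow> y = ht\<^sup>2 * y'" using d by auto
      also have "\<dots> \<longleftrightarrow> tied i l" using dual.yv_ratio[OF 2] dual.yv_tie[OF 2] 2 by (auto simp: tied_def yy)
      finally show ?thesis using 2 d by (auto simp: gd_def x)
    next
      case 3
      define y where "y = dual.yv l n"
      have y0: "y \<noteq> 0" by (simp add: y_def)
      have d: "y\<^sup>2 - 1 \<noteq> 0" using kd 3 by (simp add: dual.kden_def y_def)
      have x: "pt l n = inverse y" using 3 by (simp add: pt_def y_def)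
      have t: "tau n = hn" using 3 by (simp add: tau_def)
      have e: "1 - (inverse y)\<^sup>2 = (y\<^sup>2 - 1) / y\<^sup>2" using y0 by (simp add: field_simps)
      have g: "gd n (pt l)" using d 3 y0 by (auto simp: gd_def x power_inverse field_simps)
      have "al n (pt l) = (del n * y\<^sup>2 + (un - inverse un) * y) / (y\<^sup>2 - 1)"
        using 3 y0 d unfolding al_def x e by (simp add: field_simps power2_eq_square)
      then have "(tau n - al n (pt l)) * (y\<^sup>2 - 1) = tau n * (y\<^sup>2 - 1) - (del n * y\<^sup>2 + (un - inverse un) * y)"
        using d by (simp add: left_diff_distrib)
      also have "\<dots> = (y - hn * un) * (y * inverse hn + inverse un)"
        by (simp add: del_def t field_simps power2_eq_square)
      finally have "tau n = al n (pt l) \<longleftrightarrow> y = hn * un \<or> y * inverse hn + inverse un = 0" using d by auto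
      also have "y * inverse hn + inverse un = 0 \<longleftrightarrow> y = - hn * inverse un"
        by (simp add: field_simps add_eq_0_iff2) (auto simp: field_simps add_eq_0_iff)
      also have "\<dots> \<longleftrightarrow> crossing l" unfolding y_def by (rule crossing_iff_dual_yv)
      also have "y = hn * un \<longleftrightarrow> y = dual.mon3 0 0 1" by (simp add: dual.mon3_def)
      also have "\<dots> \<longleftrightarrow> lk l n = 0"
        unfolding y_def dual.yv_mon3 dual.mon3_eq_iff using rk_n0[of l n] by (auto simp: sgn_vec_def)
      finally show ?thesis using 3 g by (auto simp: tied_def)
    qed
  qed
  then show "gd i (pt l)" "tau i = al i (pt l) \<longleftrightarrow> tied i l \<or> i = n \<and> crossing l" by auto
qed

lemma ev_pt_T:
  assumes "i \<le> n"
  shows "ev (pt l) (T i f) = al i (pt l) * ev (pt l) f + (tau i - al i (pt l)) * ev (pact i (pt l)) f"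
  by (rule ev_T[OF pt_nz pt_coeff(1)[OF assms]])

lemma asc_not_tied: "asc n i l \<Longrightarrow> \<not> tied i l"
  by (auto simp: asc_def tied_def)

text \<open>An ascending step multiplies the value by a scalar that vanishes only at a crossing.
  Ascending steps do not leave \<open>S\<close> (\<open>inS_asc\<close>), so a value once zero stays
  zero exactly as membership persists.\<close>

lemma ev_base_E:
  assumes "l \<in> weights n"
  shows "ev base_pt (E l) = 0 \<longleftrightarrow> inS l"
  using assms n2
proof (induction rule: weight_induct)
  case zero
  have "E 0 = 1" using isE_unique[OF weights_zero isE_zero] by simp
  then show ?case using inS_zero by simp
next
  case (step i v)
  have e: "ev base_pt (Cst (lead i v) * E (wact n i v)) = ((if i = 0 then un else tau i) + kap i (yv v)) * ev base_pt (E v)"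
    unfolding step_E_asc[OF step(1-3), symmetric]
    by (rule ev_step_base[OF eig_E[OF step(1)] _ step(2) ht_square a_square]) simp
  have "ev base_pt (E (wact n i v)) = 0 \<longleftrightarrow> (if i = 0 then un else tau i) + kap i (yv v) = 0 \<or> ev base_pt (E v) = 0"
  proof -
    have "ev base_pt (Cst (lead i v) * E (wact n i v)) = lead i v * ev base_pt (E (wact n i v))"
      using base_pt_nz by simp
    then have "lead i v * ev base_pt (E (wact n i v)) = ((if i = 0 then un else tau i) + kap i (yv v)) * ev base_pt (E v)"
      using e by simp
    then show ?thesis using lead_nz[of i v] mult_eq_0_iff by metis
  qed
  also have "\<dots> \<longleftrightarrow> inS (wact n i v)"
    unfolding kap_zero_iff[OF step(2)] inS_asc[OF step(2,3)] step.IH using asc_not_tied[OF step(3)] by blast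
  finally show ?case .
qed

section \<open>Stability of both sides of the theorem\<close>

definition Vset :: "'a lpoly set" where
  "Vset = {f. \<exists>A c. finite A \<and> A \<subseteq> weights n \<and> (\<forall>l\<in>A. inS l) \<and> f = lcomb E A c}"

definition Iset :: "'a lpoly set" where
  "Iset = {f. \<forall>m\<in>weights n. \<not> inS m \<longrightarrow> ev (pt m) f = 0}"

lemma Vset_add: "f \<in> Vset \<Longrightarrow> g \<in> Vset \<Longrightarrow> f + g \<in> Vset"
proof -
  assume "f \<in> Vset" "g \<in> Vset"
  then obtain A c B d where 1: "finite A" "A \<subseteq> weights n" "\<forall>l\<in>A. inS l" "f = lcomb E A c"
    and 2: "finite B" "B \<subseteq> weights n" "\<forall>l\<in>B. inS l" "g = lcomb E B d"
    unfolding Vset_def by blast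
  show ?thesis
    unfolding Vset_def 1(4) 2(4) lcomb_add[OF 1(1) 2(1)]
    by (rule CollectI, rule exI[of _ "A \<union> B"], rule exI) (use 1 2 in auto)
qed

lemma Vset_cmul: "f \<in> Vset \<Longrightarrow> Cst k * f \<in> Vset"
proof -
  assume "f \<in> Vset"
  then obtain A c where 1: "finite A" "A \<subseteq> weights n" "\<forall>l\<in>A. inS l" "f = lcomb E A c"
    unfolding Vset_def by blast
  show ?thesis
    unfolding Vset_def 1(4) lcomb_cmul
    by (rule CollectI, rule exI[of _ A], rule exI) (use 1 in auto)
qed

lemma Vset_zero: "0 \<in> Vset"
  unfolding Vset_def by (rule CollectI, rule exI[of _ "{}"]) (simp add: lcomb_def)

lemma Vset_E: "l \<in> weights n \<Longrightarrow> inS l \<Longrightarrow> E l \<in> Vset"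
  unfolding Vset_def by (rule CollectI, rule exI[of _ "{l}"], rule exI[of _ "\<lambda>_. 1"]) (simp add: lcomb_def)

lemma Vset_closed:
  assumes "linear_op D" "\<And>l. l \<in> weights n \<Longrightarrow> inS l \<Longrightarrow> D (E l) \<in> Vset" "f \<in> Vset"
  shows "D f \<in> Vset"
proof -
  obtain A c where 1: "finite A" "A \<subseteq> weights n" "\<forall>l\<in>A. inS l" "f = lcomb E A c"
    using assms(3) unfolding Vset_def by blast
  have "(\<Sum>l\<in>A. Cst (c l) * D (E l)) \<in> Vset"
    using 1(1,2,3) by induction (auto intro!: Vset_zero Vset_add Vset_cmul assms(2))
  then show ?thesis unfolding 1(4) lcomb_linear[OF assms(1)] unfolding lcomb_def .
qed

lemma Vset_T:
  assumes i: "0 < i" "i \<le> n" and f: "f \<in> Vset"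
  shows "T i f \<in> Vset"
proof (rule Vset_closed[OF linear_T _ f])
  fix l assume l: "l \<in> weights n" "inS l"
  have T: "T i (E l) = step i (yv l) (E l) + Cst (- kap i (yv l)) * E l"
    using i by (simp add: step_def sop_def single_uminus)
  have "step i (yv l) (E l) \<in> Vset"
  proof (cases "tied i l")
    case True
    then show ?thesis using step_E_tie[OF l(1) i] i Vset_zero by (simp add: tied_def split: if_splits)
  next
    case False
    then have "if i = 0 then True else if i < n then lk l i \<noteq> lk l (Suc i) else lk l n \<noteq> 0"
      by (auto simp: tied_def split: if_splits)
    then obtain c where c: "step i (yv l) (E l) = Cst c * E (wact n i l)" using step_E[OF l(1) i(2)] by blast
    have W: "wact n i l \<in> weights n" using wact_weights[OF l(1) i(2)] n2 by simp
    show ?thesis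
    proof (cases "inS (wact n i l)")
      case True
      then show ?thesis unfolding c using Vset_cmul Vset_E W by blast
    next
      case False
      \<comment> \<open>If the step leaves \<open>S\<close>, the right-hand side is 0 while
        \<open>E\<close> outside \<open>S\<close> has a nonzero base value; so the constant itself
        vanishes.\<close>
      have "c * ev base_pt (E (wact n i l)) = ((if i = 0 then un else tau i) + kap i (yv l)) * ev base_pt (E l)"
        using ev_step_base[OF eig_E[OF l(1)] _ i(2) ht_square a_square] unfolding c by (simp add: base_pt_nz)
      then have "c = 0" using ev_base_E[OF W] ev_base_E[OF l(1)] False l(2) by simp
      then show ?thesis unfolding c using Vset_zero by simp
    qed
  qed
  then show "T i (E l) \<in> Vset" unfolding T using Vset_add Vset_cmul Vset_E l by blast
qed

lemma Vset_Ti: "0 < i \<Longrightarrow> i \<le> n \<Longrightarrow> f \<in> Vset \<Longrightarrow> Ti i f \<in> Vset"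
proof -
  assume a: "0 < i" "i \<le> n" "f \<in> Vset"
  have "Ti i f = T i f + Cst (- del i) * f" by (simp add: Ti_def single_uminus)
  then show ?thesis using Vset_T[OF a] Vset_cmul[OF a(3)] Vset_add by simp
qed

lemma Vset_zi: "k < n \<Longrightarrow> f \<in> Vset \<Longrightarrow> zi k f \<in> Vset"
proof (induction k arbitrary: f)
  case 0
  then show ?case using Vset_Ti[of n] n2 by simp
next
  case (Suc k)
  then show ?case using Vset_Ti[of "n - Suc k"] by simp
qed

text \<open>\<open>T_0\<close> is the inverse of \<open>Zd 1\<close> after \<open>Y_1\<close>:
  \<open>Y_1\<close> acts diagonally on the \<open>E\<close>, and the inverse is a word in
  generators under which \<open>Vset\<close> is already stable.\<close>

lemma Vset_T0:
  assumes f: "f \<in> Vset"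
  shows "T 0 f \<in> Vset"
proof -
  have "Y 1 f \<in> Vset"
  proof (rule Vset_closed[OF linear_Y _ f])
    fix l assume l: "l \<in> weights n" "inS l"
    have "Y 1 (E l) = Cst (yv l 1) * E l" using eigD[OF eig_E[OF l(1)], of 1] n2 by simp
    then show "Y 1 (E l) \<in> Vset" using Vset_cmul Vset_E l by simp
  qed
  moreover have "T 0 f = Zi 1 (Y 1 f)" by (simp add: Y_def G_1 Zi_Zd)
  ultimately show ?thesis using Vset_zi[of "n - 1"] n2 by (simp add: Zi_def)
qed

text \<open>Induction on the evaluated weight. If all of \<open>Vset\<close> vanishes at
  \<open>pt v\<close>, this applies to \<open>f\<close> and to \<open>T i f\<close>; the two-point
  formula then gives the reflected value, whose coefficient is nonzero off the crossing.\<close>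

lemma Vset_Iset: "Vset \<subseteq> Iset"
proof -
  have "\<not> inS m \<longrightarrow> (\<forall>f\<in>Vset. ev (pt m) f = 0)" if "m \<in> weights n" for m
    using that n2
  proof (induction rule: weight_induct)
    case zero
    show ?case
    proof (intro impI ballI)
      fix f assume "f \<in> Vset"
      then obtain A c where 1: "finite A" "A \<subseteq> weights n" "\<forall>l\<in>A. inS l" "f = lcomb E A c"
        unfolding Vset_def by blast
      have "ev (pt 0) f = (\<Sum>l\<in>A. c l * ev base_pt (E l))"
        unfolding 1(4) lcomb_def ev_sum pt_zero by (simp add: base_pt_nz)
      also have "\<dots> = 0" using 1 ev_base_E by (intro sum.neutral) auto
      finally show "ev (pt 0) f = 0" .
    qed
  next
    case (step i v)
    show ?case
    proof (intro impI ballI)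
      fix f assume nS: "\<not> inS (wact n i v)" and f: "f \<in> Vset"
      have c: "\<not> inS v" "\<not> (i = n \<and> crossing v)" using nS inS_asc[OF step(2,3)] by auto
      have nt: "\<not> tied i v" by (rule asc_not_tied[OF step(3)])
      have "T i f \<in> Vset" using Vset_T Vset_T0 f step(2) by (cases "i = 0") auto
      then have "ev (pt v) (T i f) = 0" "ev (pt v) f = 0" using step.IH c f by auto
      then have "(tau i - al i (pt v)) * ev (pt (wact n i v)) f = 0"
        using ev_pt_T[OF step(2), of v f] pact_pt[OF step(2) nt] by simp
      then show "ev (pt (wact n i v)) f = 0" using pt_coeff(2)[OF step(2), of v] nt c by simp
    qed
  qed
  then show ?thesis unfolding Iset_def by blast
qed

lemma Iset_add: "f \<in> Iset \<Longrightarrow> g \<in> Iset \<Longrightarrow> f + g \<in> Iset"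
  by (simp add: Iset_def)

lemma Iset_cmul: "f \<in> Iset \<Longrightarrow> Cst k * f \<in> Iset"
  by (simp add: Iset_def pt_nz)

text \<open>The reflected weight either lies outside \<open>S\<close> again or its value enters with
  coefficient 0, by \<open>inS_change\<close> and \<open>pt_coeff\<close>.\<close>

lemma Iset_T:
  assumes i: "i \<le> n" and f: "f \<in> Iset"
  shows "T i f \<in> Iset"
  unfolding Iset_def
proof (intro CollectI ballI impI)
  fix m assume m: "m \<in> weights n" "\<not> inS m"
  have W: "wact n i m \<in> weights n" using wact_weights[OF m(1) i] n2 by simp
  have 0: "ev (pt m) f = 0" using f m by (simp add: Iset_def)
  show "ev (pt m) (T i f) = 0"
  proof (cases "tied i m \<or> i = n \<and> crossing m")
    case True
    then show ?thesis using pt_coeff(2)[OF i, of m] ev_pt_T[OF i, of m f] 0 by simp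
  next
    case False
    then have "\<not> inS (wact n i m)" using inS_change[OF i _ m(2)] by blast
    then have "ev (pt (wact n i m)) f = 0" using f W by (simp add: Iset_def)
    then show ?thesis using ev_pt_T[OF i, of m f] pact_pt[OF i, of m] False 0 by simp
  qed
qed

lemma Iset_Ti: "i \<le> n \<Longrightarrow> f \<in> Iset \<Longrightarrow> Ti i f \<in> Iset"
proof -
  assume a: "i \<le> n" "f \<in> Iset"
  have "Ti i f = T i f + Cst (- del i) * f" by (simp add: Ti_def single_uminus)
  then show ?thesis using Iset_T[OF a] Iset_cmul[OF a(2)] Iset_add by simp
qed

lemma Iset_Y: "j \<in> {1..n} \<Longrightarrow> f \<in> Iset \<Longrightarrow> Y j f \<in> Iset"
proof -
  have zz: "k < n \<Longrightarrow> f \<in> Iset \<Longrightarrow> zz k f \<in> Iset" for k f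
    by (induction k arbitrary: f) (simp_all add: Iset_T)
  have gg: "k < n \<Longrightarrow> f \<in> Iset \<Longrightarrow> gg k f \<in> Iset" for k f
    by (induction k arbitrary: f) (simp_all add: Iset_T Iset_Ti)
  assume "j \<in> {1..n}" "f \<in> Iset"
  then show ?thesis unfolding Y_def Zd_def G_def by (intro zz gg) auto
qed

text \<open>Phrased through coefficients, because these are what is pulled back to the residue field
  afterwards.\<close>

theorem lcomb_vanishes_iff:
  assumes A: "finite A" "A \<subseteq> weights n"
  shows "(\<forall>m\<in>weights n. \<not> inS m \<longrightarrow> ev (pt m) (lcomb E A c) = 0) \<longleftrightarrow> (\<forall>l\<in>A. \<not> inS l \<longrightarrow> c l = 0)"
proof
  assume "\<forall>m\<in>weights n. \<not> inS m \<longrightarrow> ev (pt m) (lcomb E A c) = 0"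
  then have I: "lcomb E A c \<in> Iset" by (simp add: Iset_def)
  show "\<forall>l\<in>A. \<not> inS l \<longrightarrow> c l = 0"
  proof (intro ballI impI, rule ccontr)
    fix l assume l: "l \<in> A" "\<not> inS l" "c l \<noteq> 0"
    have "E l \<in> Iset"
      by (rule eigen_component[OF Iset_add Iset_cmul Iset_Y A I l(1,3)])
    then have "ev base_pt (E l) = 0" using weights_zero inS_zero by (auto simp: Iset_def simp flip: pt_zero)
    then show False using ev_base_E l A by blast
  qed
next
  assume c: "\<forall>l\<in>A. \<not> inS l \<longrightarrow> c l = 0"
  have "lcomb E A c = lcomb E {l\<in>A. inS l} c" by (rule lcomb_superset) (use A c in auto)
  also have "\<dots> \<in> Vset" unfolding Vset_def
    by (rule CollectI, rule exI[of _ "{l\<in>A. inS l}"], rule exI[of _ c]) (use A in auto)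
  finally show "\<forall>m\<in>weights n. \<not> inS m \<longrightarrow> ev (pt m) (lcomb E A c) = 0"
    using Vset_Iset by (auto simp: Iset_def)
qed

end

section \<open>Specialization of the eigenbasis\<close>

text \<open>Presents a product as an iterated linear extension, so that compatibility with
  specialization follows from \<open>plp_lext\<close> without convolution sums.\<close>

lemma lext_mult_left: "f * g = lext (\<lambda>m. Poly_Mapping.single m 1 * g) (f :: 'a::field lpoly)"
proof (induction f rule: lpoly_induct)
  case (single m c)
  show ?case by (simp add: mult_single flip: mult.assoc)
next
  case (add f h)
  then show ?case by (simp add: lext_add ring_distribs)
qed

lemma lext_mult_right: "Poly_Mapping.single m 1 * g = lext (\<lambda>k. Poly_Mapping.single (m + k) 1) (g :: 'a::field lpoly)"
proof (induction g rule: lpoly_induct)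
  case (single k c)
  show ?case by (simp add: mult_single)
next
  case (add f h)
  then show ?case by (simp add: lext_add ring_distribs)
qed

text \<open>\<open>pl x x'\<close>: the element \<open>x\<close> is finite at a place of the first field and specializes to \<open>x'\<close>.\<close>

locale koornwinder_place =
  src: koornwinder_field n hq ht hn h0 un u0 + tgt: koornwinder_sep n hq' ht' hn' h0' un' u0'
  for n :: nat and hq ht hn h0 un u0 :: "'a::field" and hq' ht' hn' h0' un' u0' :: "'b::field" +
  fixes pl :: "'a \<Rightarrow> 'b \<Rightarrow> bool"
  assumes pl_one: "pl 1 1" and pl_add: "pl x x' \<Longrightarrow> pl y y' \<Longrightarrow> pl (x + y) (x' + y')"
    and pl_mult: "pl x x' \<Longrightarrow> pl y y' \<Longrightarrow> pl (x * y) (x' * y')"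
    and pl_uminus: "pl x x' \<Longrightarrow> pl (- x) (- x')"
    and pl_inverse: "pl x x' \<Longrightarrow> x' \<noteq> 0 \<Longrightarrow> pl (inverse x) (inverse x')"
    and pl_zero_unique: "pl 0 z \<Longrightarrow> z = 0"
    and pl_params: "pl hq hq'" "pl ht ht'" "pl hn hn'" "pl h0 h0'" "pl un un'" "pl u0 u0'"
begin

lemma pl_diff: "pl x x' \<Longrightarrow> pl y y' \<Longrightarrow> pl (x - y) (x' - y')"
  using pl_add[OF _ pl_uminus, of x x' y y'] by simp

lemma pl_zero: "pl 0 0"
  using pl_diff[OF pl_one pl_one] by simp

lemma pl_unique: "pl x y \<Longrightarrow> pl x z \<Longrightarrow> y = z"
  using pl_zero_unique[of "y - z"] pl_diff[of x y x z] by simp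

lemma pl_sum: "(\<And>x. x \<in> A \<Longrightarrow> pl (g x) (g' x)) \<Longrightarrow> pl (\<Sum>x\<in>A. g x) (\<Sum>x\<in>A. g' x)"
  by (induction A rule: infinite_finite_induct) (auto intro: pl_zero pl_add)

lemma pl_power: "pl x x' \<Longrightarrow> pl (x ^ k) (x' ^ k)"
  by (induction k) (auto intro: pl_one pl_mult)

lemma pl_powi:
  assumes "pl x x'" "x' \<noteq> 0"
  shows "pl (x powi k) (x' powi k)"
proof (cases "0 \<le> k")
  case True
  then show ?thesis using pl_power[OF assms(1)] by (simp add: power_int_def)
next
  case False
  then show ?thesis using pl_power[OF pl_inverse[OF assms]] by (simp add: power_int_def)
qed

lemma pl_divide: "pl x x' \<Longrightarrow> pl y y' \<Longrightarrow> y' \<noteq> 0 \<Longrightarrow> pl (x / y) (x' / y')"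
  unfolding divide_inverse by (intro pl_mult pl_inverse)

definition plp :: "'a lpoly \<Rightarrow> 'b lpoly \<Rightarrow> bool" where
  "plp f f' \<longleftrightarrow> (\<forall>m. pl (Poly_Mapping.lookup f m) (Poly_Mapping.lookup f' m))"

lemma plp_zero: "plp 0 0"
  by (simp add: plp_def pl_zero)

lemma plp_single: "pl c c' \<Longrightarrow> plp (Poly_Mapping.single m c) (Poly_Mapping.single m c')"
  by (simp add: plp_def lookup_single when_def pl_zero)

lemma plp_one: "plp 1 1"
  using plp_single[OF pl_one, of 0] by simp

lemma plp_add: "plp f f' \<Longrightarrow> plp g g' \<Longrightarrow> plp (f + g) (f' + g')"
  by (simp add: plp_def lookup_add pl_add)

lemma plp_diff: "plp f f' \<Longrightarrow> plp g g' \<Longrightarrow> plp (f - g) (f' - g')"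
  by (simp add: plp_def lookup_minus pl_diff)

lemma plp_cmul: "pl c c' \<Longrightarrow> plp f f' \<Longrightarrow> plp (Cst c * f) (Cst c' * f')"
  by (simp add: plp_def pl_mult)

lemma plp_sum: "(\<And>x. x \<in> A \<Longrightarrow> plp (g x) (g' x)) \<Longrightarrow> plp (\<Sum>x\<in>A. g x) (\<Sum>x\<in>A. g' x)"
  by (simp add: plp_def lookup_sum pl_sum)

lemma plp_lext:
  assumes "\<And>m. plp (F m) (F' m)" "plp f f'"
  shows "plp (lext F f) (lext F' f')"
proof -
  let ?K = "Poly_Mapping.keys f \<union> Poly_Mapping.keys f'"
  have 1: "lext F f = (\<Sum>m\<in>?K. Cst (Poly_Mapping.lookup f m) * F m)"
    "lext F' f' = (\<Sum>m\<in>?K. Cst (Poly_Mapping.lookup f' m) * F' m)"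
    by (rule lext_superset; simp)+
  show ?thesis unfolding 1
    by (intro plp_sum plp_cmul assms(1)) (use assms(2) in \<open>simp add: plp_def\<close>)
qed

lemma plp_mult: "plp f f' \<Longrightarrow> plp g g' \<Longrightarrow> plp (f * g) (f' * g')"
  unfolding lext_mult_left[of f] lext_mult_left[of f'] lext_mult_right[of _ g] lext_mult_right[of _ g']
  by (intro plp_lext plp_single pl_one)

lemma plp_dd:
  assumes "pl c c'" "c' \<noteq> 0" "plp f f'"
  shows "plp (dd c b e f) (dd c' b e f')"
proof -
  have "plp (of_int (sgn k)) (of_int (sgn k))" for k :: int
    using plp_diff[OF plp_zero plp_one] by (auto simp: sgn_if plp_zero plp_one)
  then show ?thesis unfolding dd_def zmon_def
    by (intro plp_lext plp_mult plp_sum plp_single pl_one pl_powi assms)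
qed

lemma pl_tau: "pl (src.tau i) (tgt.tau i)"
  by (simp add: src.tau_def tgt.tau_def pl_params)

lemma pl_del: "pl (src.del i) (tgt.del i)"
  unfolding src.del_def tgt.del_def by (intro pl_diff pl_inverse pl_tau tgt.tau_nz)

lemma plp_T: "plp f f' \<Longrightarrow> plp (src.T i f) (tgt.T i f')"
proof -
  assume f: "plp f f'"
  have N: "plp (src.Num i) (tgt.Num i)"
    by (cases "i = 0"; cases "i < n") (simp_all only: src.Num_def tgt.Num_def if_True if_False,
      auto intro!: plp_mult plp_diff plp_one plp_single pl_one pl_mult pl_uminus pl_inverse pl_power pl_params)
  have "pl (src.zc i) (tgt.zc i)" "tgt.zc i \<noteq> 0"
    by (simp_all add: src.zc_def tgt.zc_def pl_power pl_params pl_one)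
  note dd = plp_dd[OF this f]
  show ?thesis unfolding src.T_def tgt.T_def dl_def
    by (intro plp_add plp_mult plp_single pl_inverse pl_tau tgt.tau_nz N dd f)
qed

lemma pl_mon3: "pl (src.mon3 A B C) (tgt.mon3 A B C)"
  unfolding src.mon3_def tgt.mon3_def by (intro pl_mult pl_powi pl_params tgt.nz) simp

text \<open>A multiplicative relation between the source parameters would specialize to one in the
  target, so separation is inherited from the special parameters.\<close>

lemma src_sep: "koornwinder_sep n hq ht hn h0 un u0"
proof
  fix A B C assume "src.mon3 A B C = 1"
  then have "tgt.mon3 A B C = 1" using pl_unique[OF pl_mon3[of A B C]] pl_one by metis
  then show "A = 0 \<and> B = 0 \<and> C = 0" by (rule tgt.sep)
qed

sublocale src: koornwinder_sep n hq ht hn h0 un u0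
  by (rule src_sep)

lemma pl_yv: "pl (src.yv l i) (tgt.yv l i)"
  unfolding src.yv_mon3 tgt.yv_mon3 by (rule pl_mon3)

lemma pl_kap:
  assumes "i \<le> n"
  shows "pl (src.kap i (src.yv l)) (tgt.kap i (tgt.yv l))"
proof -
  have "pl (src.kden i (src.yv l)) (tgt.kden i (tgt.yv l))"
    unfolding src.kden_def tgt.kden_def by (simp add: pl_diff pl_mult pl_power pl_one pl_yv pl_params)
  then show ?thesis unfolding src.kap_def tgt.kap_def
    by (intro pl_divide tgt.kden_nz assms)
      (simp add: pl_add pl_diff pl_mult pl_inverse pl_yv pl_params pl_del)
qed

lemma plp_estep:
  assumes "i \<le> n" "plp f f'"
  shows "plp (src.estep i l f) (tgt.estep i l f')"
proof -
  have "pl (src.lead i l) (tgt.lead i l)"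
    unfolding src.lead_def tgt.lead_def
    by (simp add: pl_mult pl_inverse pl_yv pl_powi pl_params pl_tau)
  moreover have "plp (src.sop i (src.yv l) f) (tgt.sop i (tgt.yv l) f')"
    unfolding src.sop_def tgt.sop_def src.R_def tgt.R_def
    by (simp add: plp_mult plp_single pl_inverse pl_yv plp_T pl_one assms)
  ultimately show ?thesis
    unfolding src.estep_def tgt.estep_def src.step_def tgt.step_def
    by (intro plp_cmul plp_add pl_inverse tgt.lead_nz pl_kap assms)
qed

text \<open>Both families obey the same recursion, whose denominators stay nonzero in the target;
  hence all coefficients are finite at the place and reduce to the expected ones.\<close>

theorem plp_E:
  assumes "l \<in> weights n"
  shows "plp (src.E l) (tgt.E l)"
  using assms src.n2
proof (induction rule: weight_induct)
  case zero
  have "src.E 0 = 1" "tgt.E 0 = 1"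
    using src.isE_unique[OF weights_zero src.isE_zero] tgt.isE_unique[OF weights_zero tgt.isE_zero] by simp_all
  then show ?case using plp_one by simp
next
  case (step i v)
  have W: "wact n i v \<in> weights n" using wact_weights[OF step(1,2)] src.n2 by simp
  have "src.estep i v (src.E v) = src.E (wact n i v)"
    by (rule src.isE_unique[OF W src.isE_step[OF src.isE_E[OF step(1)] step(1-3) src.kden_nz[OF step(2)]]])
  moreover have "tgt.estep i v (tgt.E v) = tgt.E (wact n i v)"
    by (rule tgt.isE_unique[OF W tgt.isE_step[OF tgt.isE_E[OF step(1)] step(1-3) tgt.kden_nz[OF step(2)]]])
  ultimately show ?case using plp_estep[OF step(2) step.IH, of v] by simp
qed

end

section \<open>The operators and polynomials of the statement\<close>

lemma emb_simps [simp]: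
  "emb 0 = 0" "emb 1 = 1" "emb (x + y) = emb x + emb y" "emb (x * y) = emb x * emb y" "emb (- x) = - emb x"
  "emb x = 0 \<longleftrightarrow> x = 0" "emb x = emb y \<longleftrightarrow> x = y"
  by (simp_all add: emb_def Zero_fract_def One_fract_def eq_fract)

lemma gen_mult: "gen p j * gen p k = gen p (j + k)"
  by (simp add: gen_def mult_single single_add)

lemma gen_zero: "gen p 0 = 1"
  by (simp add: gen_def)

lemma gen_nonzero [simp]: "gen p k \<noteq> 0"
proof
  assume "gen p k = 0"
  then have "Poly_Mapping.lookup (gen p k) (Poly_Mapping.single p k) = 0" by simp
  then show False by (simp add: gen_def)
qed

lemma emb_gen_minus_one: "emb (gen p (- 1)) = inverse (emb (gen p 1))"
proof -
  have "emb (gen p (- 1)) * emb (gen p 1) = 1" unfolding emb_simps(4)[symmetric] gen_mult by (simp add: gen_zero)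
  then show ?thesis by (metis inverse_unique mult.commute)
qed

lemma emb_gen_two: "emb (gen p 2) = (emb (gen p 1))\<^sup>2"
proof -
  have "gen p 2 = gen p 1 * gen p 1" by (simp only: gen_mult) simp
  then show ?thesis by (simp add: power2_eq_square)
qed

lemma foldr_comp_map: "foldr (\<circ>) (map F xs) id f = foldr F xs f"
  by (induction xs) simp_all

lemma refl_op_eq:
  assumes n: "2 \<le> n" and i: "i \<le> n"
    and b: "b = (if i = 0 then Poly_Mapping.single 1 (-2)
      else if i < n then Poly_Mapping.single i 1 + Poly_Mapping.single (Suc i) (-1)
      else Poly_Mapping.single n 2)"
    and e: "\<And>m. e m = (if i = 0 then - Poly_Mapping.lookup m 1
      else if i < n then Poly_Mapping.lookup m i - Poly_Mapping.lookup m (Suc i)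
      else Poly_Mapping.lookup m n)"
  shows "refl_op n i f = rf (if i = 0 then emb par_q else 1) b e f"
proof -
  have r: "m + frag_cmul (- e m) b = refl_exp n i m" for m
  proof (rule poly_mapping_eqI)
    fix j
    show "Poly_Mapping.lookup (m + frag_cmul (- e m) b) j = Poly_Mapping.lookup (refl_exp n i m) j"
      using i by (auto simp: b e refl_exp_def lookup_add lookup_minus lookup_single when_def map_key.rep_eq
        transpose_def)
  qed
  have "Poly_Mapping.single m 1 * zmon c b (- e m) = Poly_Mapping.single (refl_exp n i m) (c powi (- e m))" for m :: "nat \<Rightarrow>\<^sub>0 int" and c :: kfield
    by (simp add: zmon_def mult_single r)
  then show ?thesis
    unfolding rf_def lext_def refl_op_def const_def mon_def
    by (intro sum.cong) (auto simp: mult_single e)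
qed

locale koornwinder_poly =
  koornwinder_sep n "emb (gen Root_q 1)" "emb (gen Root_t 1)" "emb (gen Root_tn 1)" "emb (gen Root_t0 1)"
    "emb (gen Root_un 1)" "emb (gen Root_u0 1)" for n
begin

lemma exact_div_eq: "h * g = f \<Longrightarrow> g \<noteq> 0 \<Longrightarrow> exact_div f g = h"
  unfolding exact_div_def by (rule the_equality) auto

lemma one_minus_zmon_nonzero:
  assumes "b \<noteq> 0"
  shows "1 - zmon c b 1 \<noteq> (0 :: laurent)"
proof
  assume "1 - zmon c b 1 = (0 :: laurent)"
  then have "Poly_Mapping.lookup (1 - zmon c b 1) 0 = (0 :: kfield)" by simp
  then show False using assms by (simp add: zmon_def lookup_minus lookup_single lookup_one)
qed

lemma That_eq:
  assumes i: "i \<le> n"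
  shows "That n i f = T i f"
proof -
  have c: "(if i = 0 then emb par_q else 1) = zc i" by (simp add: zc_def par_q_def emb_gen_two)
  have z: "zc i \<noteq> 0" by (simp add: zc_def)
  have r: "refl_op n i f = rf (zc i) (beta i) (lf i) f"
    unfolding c[symmetric] by (rule refl_op_eq[OF n2 i beta_def lf_def])
  have "Poly_Mapping.lookup (beta i) (if i = 0 then 1 else i) \<noteq> 0"
    using i by (auto simp: beta_def lookup_add lookup_single)
  then have b: "beta i \<noteq> 0" by auto
  \<comment> \<open>\<open>exact_div\<close> is defined through unique existence: this product is
    the witness, and uniqueness holds because \<open>1 - z\<close> is nonzero in a domain.\<close>
  have "(Num i * dd (zc i) (beta i) (lf i) f) * (1 - zmon (zc i) (beta i) 1) = Num i * (refl_op n i f - f)"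
    unfolding r dd_times[OF z, symmetric] by (simp only: mult.assoc)
  from exact_div_eq[OF this one_minus_zmon_nonzero[OF b]]
  have ex: "exact_div (Num i * (refl_op n i f - f)) (1 - zmon (zc i) (beta i) 1) = Num i * dd (zc i) (beta i) (lf i) f" .
  have zm: "zmon (zc i) (beta i) 1 = (if i = 0 then const (emb par_q) * var 1 (-2)
    else if i < n then var i 1 * var (Suc i) (-1) else var n 2)"
    by (simp add: zmon_def zc_def beta_def const_def var_def mon_def mult_single par_q_def emb_gen_two)
  consider "i = 0" | "0 < i" "i < n" | "i = n" "0 < i" using i by linarith
  then show ?thesis
  proof cases
    case 1
    have N: "(1 - const (emb par_c) * var 1 (-1)) * (1 - const (emb par_d) * var 1 (-1)) = Num i"
      using 1 by (simp add: Num_def const_def var_def mon_def par_c_def par_d_def emb_gen_minus_one)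
    show ?thesis
      using 1 ex unfolding That_def N zm by (simp add: T_def dl_def const_def tau_def emb_gen_minus_one)
  next
    case 2
    have N: "1 - const (emb par_t) * var i 1 * var (Suc i) (-1) = Num i"
      using 2 by (simp add: Num_def const_def var_def mon_def par_t_def emb_gen_two)
    show ?thesis
      using 2 ex unfolding That_def N zm by (simp add: T_def dl_def const_def tau_def emb_gen_minus_one)
  next
    case 3
    have N: "(1 - const (emb par_a) * var n 1) * (1 - const (emb par_b) * var n 1) = Num i"
      using 3 by (simp add: Num_def const_def var_def mon_def par_a_def par_b_def emb_gen_minus_one)
    show ?thesis
      using 3 ex unfolding That_def N zm by (simp add: T_def dl_def const_def tau_def emb_gen_minus_one)
  qed
qed

lemma T_laurent_polys:
  assumes "f \<in> laurent_polys n" "0 < i" "i \<le> n"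
  shows "T i f \<in> laurent_polys n"
  using keys_sop_weights[of f i] assms by (simp add: laurent_polys_def sop_def)

lemma Ti_laurent_polys:
  assumes "f \<in> laurent_polys n" "0 < i" "i \<le> n"
  shows "Ti i f \<in> laurent_polys n"
proof -
  have "Poly_Mapping.keys (Ti i f) \<subseteq> Poly_Mapping.keys (T i f) \<union> Poly_Mapping.keys f"
    unfolding Ti_def by (auto simp: in_keys_iff lookup_minus)
  then show ?thesis using T_laurent_polys[OF assms] assms(1) by (auto simp: laurent_polys_def)
qed

text \<open>The inverse is taken within \<open>laurent_polys n\<close>, so it has to be shown that
  \<open>Ti\<close> maps this set to itself.\<close>

lemma inv_into_That:
  assumes "f \<in> laurent_polys n" "0 < i" "i \<le> n"
  shows "inv_into (laurent_polys n) (That n i) f = Ti i f"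
proof (rule inv_into_f_eq)
  show "inj_on (That n i) (laurent_polys n)"
    by (rule inj_on_inverseI[of _ "Ti i"]) (simp add: That_eq Ti_T assms)
  show "Ti i f \<in> laurent_polys n" by (rule Ti_laurent_polys[OF assms])
  show "That n i (Ti i f) = f" by (simp add: That_eq T_Ti assms)
qed

lemma foldr_inv_into_That:
  assumes "set xs \<subseteq> {1..n}" "f \<in> laurent_polys n"
  shows "foldr (\<lambda>j. inv_into (laurent_polys n) (That n j)) xs f = foldr Ti xs f \<and> foldr Ti xs f \<in> laurent_polys n"
  using assms by (induction xs) (auto simp: inv_into_That Ti_laurent_polys)

lemma foldr_That: "set xs \<subseteq> {0..n} \<Longrightarrow> foldr (That n) xs f = foldr T xs f"
  by (induction xs) (auto simp: That_eq)

lemma zz_foldr: "k < n \<Longrightarrow> zz k f = foldr T ([n - k..<n] @ [n] @ rev [n - k..<n]) f"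
proof (induction k arbitrary: f)
  case (Suc k)
  have "[n - Suc k..<n] = (n - Suc k) # [n - k..<n]"
    using Suc.prems by (simp add: upt_conv_Cons Suc_diff_Suc)
  then show ?case using Suc by simp
qed simp

lemma gg_foldr: "gg k f = foldr T (rev [1..<Suc k] @ [0]) (foldr Ti [1..<Suc k] f)"
  by (induction k arbitrary: f) simp_all

lemma Yhat_eq:
  assumes f: "f \<in> laurent_polys n" and i: "i \<in> {1..n}"
  shows "Yhat n i f = Y i f"
proof -
  \<comment> \<open>Splits the descending part of the word at \<open>i\<close>, which groups it into
    the words of \<open>Zd i\<close> and \<open>G i\<close>.\<close>
  have "[1..<n] = [1..<i] @ [i..<n]" using i upt_add_eq_append[of 1 i "n - i"] by simp
  then have l: "[i..<n] @ [n] @ rev [1..<n] @ [0] = ([i..<n] @ [n] @ rev [i..<n]) @ (rev [1..<i] @ [0])" by simp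
  have "Yhat n i f = foldr (That n) ([i..<n] @ [n] @ rev [1..<n] @ [0])
      (foldr (\<lambda>j. inv_into (laurent_polys n) (That n j)) [1..<i] f)"
  proof -
    have "foldr (\<circ>) (xs @ ys) id f = foldr (\<circ>) xs id (foldr (\<circ>) ys id f)" for xs ys :: "(laurent \<Rightarrow> laurent) list"
      by (induction xs) simp_all
    then show ?thesis unfolding Yhat_def by (simp only: foldr_comp_map)
  qed
  also have "\<dots> = foldr T ([i..<n] @ [n] @ rev [1..<n] @ [0]) (foldr Ti [1..<i] f)"
  proof -
    have "foldr (\<lambda>j. inv_into (laurent_polys n) (That n j)) [1..<i] f = foldr Ti [1..<i] f"
    proof -
      have "set [1..<i] \<subseteq> {1..n}" using i by auto
      then show ?thesis using foldr_inv_into_That f by blast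
    qed
    then show ?thesis using i by (subst foldr_That) auto
  qed
  also have "\<dots> = Y i f"
    unfolding l foldr_append Y_def Zd_def G_def using i by (simp add: zz_foldr gg_foldr del: One_nat_def)
  finally show ?thesis .
qed

lemma y_val_eq: "l \<in> weights n \<Longrightarrow> i \<in> {1..n} \<Longrightarrow> y_val n l i = yv l i"
  using n2 by (simp add: y_val_def yv_def rho_eq par_q_def par_t_def par_a_star_def emb_gen_two power_int_mult)

text \<open>For uniqueness, the difference of a candidate and \<open>E l\<close> is a joint
  eigenvector for \<open>y(l)\<close> or zero, hence a multiple of \<open>E l\<close>; but its
  coefficient at \<open>l\<close> is 0.\<close>

theorem koornwinder_eq:
  assumes l: "l \<in> weights n"
  shows "koornwinder n l = E l"
  unfolding koornwinder_def
proof (rule the_equality)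
  have k: "E l \<in> laurent_polys n" using keys_E[OF l] by (simp add: laurent_polys_def)
  have "Yhat n i (E l) = const (y_val n l i) * E l" if "i \<in> {1..n}" for i
    using eig_E[OF l] that by (simp add: Yhat_eq[OF k that] y_val_eq[OF l that] eig_def const_def)
  moreover have "Poly_Mapping.keys (E l - mon l) \<subseteq> {m \<in> weights n. weight_ge n l m \<and> m \<noteq> l}"
  proof
    fix v assume v: "v \<in> Poly_Mapping.keys (E l - mon l)"
    have one: "Poly_Mapping.lookup (E l) l = 1" using isE_E[OF l] by (simp add: isE_def)
    then have "v \<noteq> l" using v by (auto simp: in_keys_iff lookup_minus mon_def)
    then have "v \<in> Poly_Mapping.keys (E l)" using v by (simp add: in_keys_iff lookup_minus mon_def lookup_single)
    then have "low n v l" using isE_E[OF l] by (simp add: isE_def)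
    then show "v \<in> {m \<in> weights n. weight_ge n l m \<and> m \<noteq> l}"
      using \<open>v \<noteq> l\<close> low_weight_ge[of n v l] low_weights[of n v l] l n2 by auto
  qed
  ultimately show "E l \<in> laurent_polys n \<and> (\<forall>i\<in>{1..n}. Yhat n i (E l) = const (y_val n l i) * E l) \<and>
    Poly_Mapping.keys (E l - mon l) \<subseteq> {m \<in> weights n. weight_ge n l m \<and> m \<noteq> l}"
    using k by blast
next
  fix f
  assume f: "f \<in> laurent_polys n \<and> (\<forall>i\<in>{1..n}. Yhat n i f = const (y_val n l i) * f) \<and>
    Poly_Mapping.keys (f - mon l) \<subseteq> {m \<in> weights n. weight_ge n l m \<and> m \<noteq> l}"
  then have fl: "f \<in> laurent_polys n" by blast
  have ef: "eig (yv l) f"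
    using f by (auto simp: eig_def const_def y_val_eq[OF l] simp flip: Yhat_eq[OF fl])
  have "l \<notin> Poly_Mapping.keys (f - mon l)" using f by blast
  then have one: "Poly_Mapping.lookup f l = 1" by (simp add: in_keys_iff lookup_minus mon_def)
  define g where "g = f - E l"
  have g: "Poly_Mapping.keys g \<subseteq> weights n"
  proof -
    have "Poly_Mapping.keys g \<subseteq> Poly_Mapping.keys f \<union> Poly_Mapping.keys (E l)"
      unfolding g_def by (auto simp: in_keys_iff lookup_minus)
    then show ?thesis using keys_E[OF l] fl by (auto simp: laurent_polys_def)
  qed
  have eg: "eig (yv l) g"
    using ef eig_E[OF l] unfolding g_def eig_def by (simp add: linear_opD[OF linear_Y] right_diff_distrib)
  have "g = 0"
  proof (rule ccontr)
    assume "g \<noteq> 0"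
    then obtain m c where m: "m \<in> weights n" "g = Cst c * E m" "\<forall>j\<in>{1..n}. yv l j = yv m j"
      using eigenvector_E[OF g eg] by blast
    have "l = m" by (rule yv_inject[OF l m(1)]) (use m(3) in blast)
    moreover have "Poly_Mapping.lookup g l = 0" "Poly_Mapping.lookup (E l) l = 1"
      using one isE_E[OF l] by (simp_all add: g_def lookup_minus isE_def)
    ultimately show False using m(2) \<open>g \<noteq> 0\<close> by simp
  qed
  then show "f = E l" by (simp add: g_def)
qed

end

section \<open>Places given by ring endomorphisms\<close>

lemma alg_ring_simps [simp]:
  "carrier alg_ring = UNIV" "x \<otimes>\<^bsub>alg_ring\<^esub> y = x * y" "x \<oplus>\<^bsub>alg_ring\<^esub> y = x + y"
  "\<zero>\<^bsub>alg_ring\<^esub> = 0" "\<one>\<^bsub>alg_ring\<^esub> = 1"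
  by (simp_all add: alg_ring_def ring_of_type_algebra_def)

lemma residue_eq: "residue s x = {y. s dvd y - x}"
proof -
  have "PIdl\<^bsub>alg_ring\<^esub> s = {z. s dvd z}" by (auto simp: cgenideal_def dvd_def mult.commute)
  then have "residue s x = (\<Union>h\<in>{z. s dvd z}. {h + x})" by (simp add: residue_def a_r_coset_def r_coset_def)
  also have "\<dots> = {y. s dvd y - x}"
  proof (intro equalityI subsetI)
    fix y assume "y \<in> {y. s dvd y - x}"
    then show "y \<in> (\<Union>h\<in>{z. s dvd z}. {h + x})" by (intro UN_I[of "y - x"]) auto
  qed auto
  finally show ?thesis .
qed

lemma residue_eq_iff: "residue s x = residue s y \<longleftrightarrow> s dvd x - y"
proof
  assume "residue s x = residue s y"
  moreover have "x \<in> residue s x" by (simp add: residue_eq)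
  ultimately show "s dvd x - y" by (simp add: residue_eq)
next
  assume a: "s dvd x - y"
  have "s dvd z - x \<longleftrightarrow> s dvd z - y" for z
    using dvd_add_left_iff[OF a, of "z - x"] by simp
  then show "residue s x = residue s y" by (simp add: residue_eq)
qed

text \<open>An endomorphism with kernel generated by \<open>s\<close> identifies the quotient ring
  with a subring of \<open>alg\<close>, and the fraction field of the quotient with a subfield of
  \<open>kfield\<close>.\<close>

locale place_hom =
  fixes s :: alg and \<phi> :: "alg \<Rightarrow> alg"
  assumes hom_add: "\<phi> (x + y) = \<phi> x + \<phi> y" and hom_mult: "\<phi> (x * y) = \<phi> x * \<phi> y"
    and hom_one: "\<phi> 1 = 1" and hom_zero_iff: "\<phi> x = 0 \<longleftrightarrow> s dvd x"
begin

lemma hom_zero: "\<phi> 0 = 0"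
  by (simp add: hom_zero_iff)

lemma hom_uminus: "\<phi> (- x) = - \<phi> x"
  using hom_add[of x "- x"] by (simp add: hom_zero add_eq_0_iff)

lemma hom_diff: "\<phi> (x - y) = \<phi> x - \<phi> y"
  using hom_add[of x "- y"] by (simp add: hom_uminus)

lemma hom_eq_iff: "\<phi> x = \<phi> y \<longleftrightarrow> s dvd x - y"
  by (simp add: hom_diff flip: hom_zero_iff)

text \<open>A denominator with nonzero image is one not divisible by \<open>s\<close>; so this is
  finiteness at the \<open>s\<close>-adic place together with the reduced value.\<close>

definition pl :: "kfield \<Rightarrow> kfield \<Rightarrow> bool" where
  "pl x x' \<longleftrightarrow> (\<exists>a b. \<phi> b \<noteq> 0 \<and> x = Fraction_Field.Fract a b \<and> x' = Fraction_Field.Fract (\<phi> a) (\<phi> b))"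

lemma plI: "\<phi> b \<noteq> 0 \<Longrightarrow> pl (Fraction_Field.Fract a b) (Fraction_Field.Fract (\<phi> a) (\<phi> b))"
  unfolding pl_def by blast

lemma denominator_nonzero: "\<phi> b \<noteq> 0 \<Longrightarrow> b \<noteq> 0"
  using hom_zero by blast

lemma pl_emb: "pl (emb x) (emb (\<phi> x))"
  using plI[of 1 x] by (simp add: emb_def hom_one)

lemma pl_add:
  assumes "pl x x'" "pl y y'"
  shows "pl (x + y) (x' + y')"
proof -
  obtain a b c d where "\<phi> b \<noteq> 0" "\<phi> d \<noteq> 0" and x: "x = Fraction_Field.Fract a b" "x' = Fraction_Field.Fract (\<phi> a) (\<phi> b)"
    and y: "y = Fraction_Field.Fract c d" "y' = Fraction_Field.Fract (\<phi> c) (\<phi> d)"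
    using assms unfolding pl_def by blast
  then show ?thesis using plI[of "b * d" "a * d + c * b"] denominator_nonzero
    by (simp add: hom_add hom_mult)
qed

lemma pl_mult:
  assumes "pl x x'" "pl y y'"
  shows "pl (x * y) (x' * y')"
proof -
  obtain a b c d where "\<phi> b \<noteq> 0" "\<phi> d \<noteq> 0" and x: "x = Fraction_Field.Fract a b" "x' = Fraction_Field.Fract (\<phi> a) (\<phi> b)"
    and y: "y = Fraction_Field.Fract c d" "y' = Fraction_Field.Fract (\<phi> c) (\<phi> d)"
    using assms unfolding pl_def by blast
  then show ?thesis using plI[of "b * d" "a * c"] by (simp add: hom_mult)
qed

lemma pl_uminus: "pl x x' \<Longrightarrow> pl (- x) (- x')"
  unfolding pl_def by (metis hom_uminus minus_fract)

lemma pl_inverse: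
  assumes "pl x x'" "x' \<noteq> 0"
  shows "pl (inverse x) (inverse x')"
proof -
  obtain a b where b: "\<phi> b \<noteq> 0" and x: "x = Fraction_Field.Fract a b" "x' = Fraction_Field.Fract (\<phi> a) (\<phi> b)"
    using assms unfolding pl_def by blast
  have "\<phi> a \<noteq> 0"
  proof
    assume "\<phi> a = 0"
    then show False using assms(2) b x by (simp add: eq_fract Zero_fract_def)
  qed
  then show ?thesis using plI[of a b] x by simp
qed

lemma pl_zero_unique:
  assumes "pl 0 z"
  shows "z = 0"
proof -
  obtain a b where b: "\<phi> b \<noteq> 0" and x: "0 = Fraction_Field.Fract a b" "z = Fraction_Field.Fract (\<phi> a) (\<phi> b)"
    using assms unfolding pl_def by blast
  then have "a = 0" using denominator_nonzero[OF b] by (simp add: eq_fract Zero_fract_def)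
  then show ?thesis using x b by (simp add: hom_zero eq_fract Zero_fract_def)
qed

lemma ideal_PIdl: "ideal (PIdl\<^bsub>alg_ring\<^esub> s) alg_ring"
proof -
  interpret cring alg_ring unfolding alg_ring_def by (rule cring_from_type_algebra)
  show ?thesis by (rule cgenideal_ideal) simp
qed

lemma quot_ring_simps:
  "carrier (quot_ring s) = range (residue s)"
  "residue s x \<otimes>\<^bsub>quot_ring s\<^esub> residue s y = residue s (x * y)"
  "residue s x \<oplus>\<^bsub>quot_ring s\<^esub> residue s y = residue s (x + y)"
  "\<zero>\<^bsub>quot_ring s\<^esub> = residue s 0" "\<one>\<^bsub>quot_ring s\<^esub> = residue s 1"
proof -
  interpret ideal "PIdl\<^bsub>alg_ring\<^esub> s" alg_ring by (rule ideal_PIdl)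
  show "carrier (quot_ring s) = range (residue s)"
    by (auto simp: quot_ring_def FactRing_def A_RCOSETS_def RCOSETS_def residue_def a_r_coset_def r_coset_def)
  show "residue s x \<otimes>\<^bsub>quot_ring s\<^esub> residue s y = residue s (x * y)"
    using rcoset_mult_add[of x y] by (simp add: quot_ring_def FactRing_def residue_def)
  show "residue s x \<oplus>\<^bsub>quot_ring s\<^esub> residue s y = residue s (x + y)"
    using a_rcos_sum[of x y] by (simp add: quot_ring_def FactRing_def residue_def)
  show "\<zero>\<^bsub>quot_ring s\<^esub> = residue s 0"
    by (auto simp: quot_ring_def FactRing_def residue_eq cgenideal_def dvd_def mult.commute)
  show "\<one>\<^bsub>quot_ring s\<^esub> = residue s 1"
    by (simp add: quot_ring_def FactRing_def residue_def)
qed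

lemma residue_zero_iff: "residue s x = residue s 0 \<longleftrightarrow> \<phi> x = 0"
  by (simp add: residue_eq_iff hom_zero_iff)

lemma domain_quot_ring: "domain (quot_ring s)"
proof -
  interpret ideal "PIdl\<^bsub>alg_ring\<^esub> s" alg_ring by (rule ideal_PIdl)
  have "cring alg_ring" unfolding alg_ring_def by (rule cring_from_type_algebra)
  then have "cring (quot_ring s)" unfolding quot_ring_def by (rule quotient_is_cring)
  then show ?thesis
  proof (rule domain.intro)
    show "domain_axioms (quot_ring s)"
    proof
      show "\<one>\<^bsub>quot_ring s\<^esub> \<noteq> \<zero>\<^bsub>quot_ring s\<^esub>"
        unfolding quot_ring_simps residue_zero_iff by (simp add: hom_one)
    next
      fix a b
      assume ab: "a \<otimes>\<^bsub>quot_ring s\<^esub> b = \<zero>\<^bsub>quot_ring s\<^esub>" "a \<in> carrier (quot_ring s)" "b \<in> carrier (quot_ring s)"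
      then obtain x y where "a = residue s x" "b = residue s y" unfolding quot_ring_simps by blast
      then show "a = \<zero>\<^bsub>quot_ring s\<^esub> \<or> b = \<zero>\<^bsub>quot_ring s\<^esub>"
        using ab(1) by (simp add: quot_ring_simps residue_zero_iff hom_mult)
    qed
  qed
qed

sublocale domain "quot_ring s"
  by (rule domain_quot_ring)

definition fc :: "alg \<Rightarrow> alg \<Rightarrow> sfield" where
  "fc a b = frac_class (quot_ring s) (residue s a) (residue s b)"

lemma residue_carrier: "residue s a \<in> carrier (quot_ring s)"
  by (simp add: quot_ring_simps)

lemma residue_nonzero: "\<phi> b \<noteq> 0 \<Longrightarrow> residue s b \<in> carrier (quot_ring s) - {\<zero>\<^bsub>quot_ring s\<^esub>}"
  using residue_carrier by (simp add: quot_ring_simps(4) residue_zero_iff)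

lemma fc_eq_iff:
  assumes "\<phi> b \<noteq> 0" "\<phi> d \<noteq> 0"
  shows "fc a b = fc c d \<longleftrightarrow> Fraction_Field.Fract (\<phi> a) (\<phi> b) = Fraction_Field.Fract (\<phi> c) (\<phi> d)"
proof -
  have "fc a b = fc c d \<longleftrightarrow> residue s (a * d) = residue s (c * b)"
    unfolding fc_def quot_ring_simps(2)[symmetric]
    by (rule frac_class_eq_iff) (intro residue_carrier residue_nonzero assms)+
  also have "\<dots> \<longleftrightarrow> \<phi> (a * d) = \<phi> (c * b)" by (simp only: residue_eq_iff hom_eq_iff)
  finally show ?thesis using assms by (simp add: eq_fract hom_mult)
qed

lemma fc_cases:
  assumes "z \<in> carrier (spec_field s)"
  obtains a b where "\<phi> b \<noteq> 0" "z = fc a b"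
proof -
  obtain x y where "x \<in> carrier (quot_ring s)" "y \<in> carrier (quot_ring s)" "y \<noteq> \<zero>\<^bsub>quot_ring s\<^esub>"
    "z = frac_class (quot_ring s) x y"
    using frac_field_cases assms unfolding spec_field_def by blast
  then show ?thesis using that unfolding fc_def quot_ring_simps(1,4) using residue_zero_iff by blast
qed

lemma fc_carrier: "\<phi> b \<noteq> 0 \<Longrightarrow> fc a b \<in> carrier (spec_field s)"
  unfolding fc_def spec_field_def by (intro frac_class_closed residue_carrier residue_nonzero)

text \<open>The residue field embeds into the field of fractions through \<open>\<phi>\<close>.\<close>

definition \<iota> :: "sfield \<Rightarrow> kfield" where
  "\<iota> z = (THE w. \<exists>a b. \<phi> b \<noteq> 0 \<and> z = fc a b \<and> w = Fraction_Field.Fract (\<phi> a) (\<phi> b))"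

lemma \<iota>_fc: "\<phi> b \<noteq> 0 \<Longrightarrow> \<iota> (fc a b) = Fraction_Field.Fract (\<phi> a) (\<phi> b)"
  unfolding \<iota>_def by (rule the_equality) (use fc_eq_iff in blast)+

lemma \<iota>_inject:
  assumes "x \<in> carrier (spec_field s)" "y \<in> carrier (spec_field s)"
  shows "\<iota> x = \<iota> y \<longleftrightarrow> x = y"
proof -
  obtain a b c d where "\<phi> b \<noteq> 0" "x = fc a b" "\<phi> d \<noteq> 0" "y = fc c d"
    using fc_cases assms by metis
  then show ?thesis using \<iota>_fc fc_eq_iff by simp
qed

lemma field_spec_field: "field (spec_field s)"
  unfolding spec_field_def by (rule frac_field_is_field)

lemma \<iota>_zero: "\<iota> \<zero>\<^bsub>spec_field s\<^esub> = 0" and \<iota>_one: "\<iota> \<one>\<^bsub>spec_field s\<^esub> = 1"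
proof -
  have "\<zero>\<^bsub>spec_field s\<^esub> = fc 0 1" "\<one>\<^bsub>spec_field s\<^esub> = fc 1 1"
    by (simp_all add: spec_field_def frac_field_def fc_def quot_ring_simps)
  then show "\<iota> \<zero>\<^bsub>spec_field s\<^esub> = 0" "\<iota> \<one>\<^bsub>spec_field s\<^esub> = 1"
    by (simp_all add: \<iota>_fc hom_one hom_zero Zero_fract_def One_fract_def)
qed

lemma \<iota>_mult:
  assumes "x \<in> carrier (spec_field s)" "y \<in> carrier (spec_field s)"
  shows "\<iota> (x \<otimes>\<^bsub>spec_field s\<^esub> y) = \<iota> x * \<iota> y"
proof -
  obtain a b c d where *: "\<phi> b \<noteq> 0" "x = fc a b" "\<phi> d \<noteq> 0" "y = fc c d"
    using fc_cases assms by metis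
  then have "x \<otimes>\<^bsub>spec_field s\<^esub> y = fc (a * c) (b * d)"
    unfolding fc_def spec_field_def quot_ring_simps(2)[symmetric]
    by (simp only: frac_field_mult residue_carrier residue_nonzero not_False_eq_True)
  then show ?thesis using * by (simp add: \<iota>_fc hom_mult)
qed

lemma \<iota>_add:
  assumes "x \<in> carrier (spec_field s)" "y \<in> carrier (spec_field s)"
  shows "\<iota> (x \<oplus>\<^bsub>spec_field s\<^esub> y) = \<iota> x + \<iota> y"
proof -
  obtain a b c d where *: "\<phi> b \<noteq> 0" "x = fc a b" "\<phi> d \<noteq> 0" "y = fc c d"
    using fc_cases assms by metis
  then have "x \<oplus>\<^bsub>spec_field s\<^esub> y = fc (a * d + c * b) (b * d)"
    unfolding fc_def spec_field_def quot_ring_simps(2,3)[symmetric]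
    by (simp only: frac_field_add residue_carrier residue_nonzero not_False_eq_True)
  then show ?thesis using * by (simp add: \<iota>_fc hom_mult hom_add)
qed

text \<open>Equal fractions have equal cross products, which \<open>\<phi>\<close> preserves; hence
  the description defining \<open>spec\<close> has exactly one solution.\<close>

lemma pl_spec:
  assumes "pl x x'"
  shows "spec s x \<in> carrier (spec_field s)" "\<iota> (spec s x) = x'"
proof -
  obtain a b where b: "\<phi> b \<noteq> 0" and x: "x = Fraction_Field.Fract a b" "x' = Fraction_Field.Fract (\<phi> a) (\<phi> b)"
    using assms unfolding pl_def by blast
  have "spec s x = fc a b"
    unfolding spec_def fc_def[symmetric]
  proof (rule the_equality)
    show "\<exists>a' b'. \<not> s dvd b' \<and> x = Fraction_Field.Fract a' b' \<and> fc a b = fc a' b'"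
      using b x hom_zero_iff by blast
  next
    fix z assume "\<exists>a' b'. \<not> s dvd b' \<and> x = Fraction_Field.Fract a' b' \<and> z = fc a' b'"
    then obtain a' b' where z: "\<phi> b' \<noteq> 0" "x = Fraction_Field.Fract a' b'" "z = fc a' b'"
      using hom_zero_iff by blast
    then have "a * b' = a' * b"
      using x(1) b by (simp add: eq_fract denominator_nonzero)
    then have "\<phi> a * \<phi> b' = \<phi> a' * \<phi> b" by (simp flip: hom_mult)
    then show "z = fc a b" using z b by (simp add: fc_eq_iff eq_fract)
  qed
  then show "spec s x \<in> carrier (spec_field s)" "\<iota> (spec s x) = x'"
    using fc_carrier \<iota>_fc b x by simp_all
qed

sublocale F: field "spec_field s"
  by (rule field_spec_field)

lemma \<iota>_zero_iff: "x \<in> carrier (spec_field s) \<Longrightarrow> \<iota> x = 0 \<longleftrightarrow> x = \<zero>\<^bsub>spec_field s\<^esub>"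
  using \<iota>_inject[of x "\<zero>\<^bsub>spec_field s\<^esub>"] by (simp add: \<iota>_zero)

lemma \<iota>_finsum:
  assumes "finite A" "\<And>x. x \<in> A \<Longrightarrow> g x \<in> carrier (spec_field s)"
  shows "\<iota> (\<Oplus>\<^bsub>spec_field s\<^esub>x\<in>A. g x) = (\<Sum>x\<in>A. \<iota> (g x))"
  using assms by (induction A) (auto simp: \<iota>_zero \<iota>_add F.finsum_insert)

lemma \<iota>_finprod:
  assumes "finite A" "\<And>x. x \<in> A \<Longrightarrow> g x \<in> carrier (spec_field s)"
  shows "\<iota> (\<Otimes>\<^bsub>spec_field s\<^esub>x\<in>A. g x) = (\<Prod>x\<in>A. \<iota> (g x))"
  using assms by (induction A) (auto simp: \<iota>_one \<iota>_mult F.finprod_insert)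

lemma \<iota>_power: "x \<in> carrier (spec_field s) \<Longrightarrow> \<iota> (x [^]\<^bsub>spec_field s\<^esub> (k::nat)) = \<iota> x ^ k"
  by (induction k) (simp_all add: \<iota>_one \<iota>_mult)

lemma int_pow:
  assumes x: "x \<in> carrier (spec_field s)" "\<iota> x \<noteq> 0"
  shows "x [^]\<^bsub>spec_field s\<^esub> (k::int) \<in> carrier (spec_field s)" "\<iota> (x [^]\<^bsub>spec_field s\<^esub> k) = \<iota> x powi k"
proof -
  have nz: "x [^]\<^bsub>spec_field s\<^esub> j \<noteq> \<zero>\<^bsub>spec_field s\<^esub>" for j :: nat
    using \<iota>_zero_iff[of "x [^]\<^bsub>spec_field s\<^esub> j"] \<iota>_power[OF x(1), of j] x by simp
  have U: "x [^]\<^bsub>spec_field s\<^esub> j \<in> Units (spec_field s)" for j :: nat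
    using nz x(1) by (simp add: F.field_Units)
  have i: "\<iota> (inv\<^bsub>spec_field s\<^esub> y) = inverse (\<iota> y)" if "y \<in> Units (spec_field s)" for y
  proof -
    have "\<iota> (inv\<^bsub>spec_field s\<^esub> y) * \<iota> y = 1"
      using \<iota>_mult[of "inv\<^bsub>spec_field s\<^esub> y" y] that \<iota>_one
      by (simp add: F.Units_closed F.Units_inv_closed F.Units_l_inv)
    then show ?thesis by (metis inverse_unique mult.commute)
  qed
  show "x [^]\<^bsub>spec_field s\<^esub> k \<in> carrier (spec_field s)"
    unfolding int_pow_def2 by (cases "k < 0") (simp_all only: if_True if_False F.Units_inv_closed[OF U] F.nat_pow_closed[OF x(1)])
  show "\<iota> (x [^]\<^bsub>spec_field s\<^esub> k) = \<iota> x powi k"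
    unfolding int_pow_def2 by (cases "k < 0") (simp_all only: if_True if_False i[OF U] \<iota>_power[OF x(1)], simp_all add: power_int_def power_inverse)
qed

end

section \<open>The place attached to the irreducible factor\<close>

definition spec_exp :: "int \<Rightarrow> int \<Rightarrow> (param \<Rightarrow>\<^sub>0 int) \<Rightarrow> (param \<Rightarrow>\<^sub>0 int)" where
  "spec_exp k m e = e + frag_cmul (Poly_Mapping.lookup e Root_tn)
     (Poly_Mapping.single Root_tn (- 1) + Poly_Mapping.single Root_q (- k) + Poly_Mapping.single Root_t (- m))"

text \<open>The substitution \<open>t\<^sub>n\<^bsup>1/2\<^esup> \<mapsto> c q\<^bsup>-k/2\<^esup> t\<^bsup>-m/2\<^esup>\<close>.\<close>

definition spec_hom :: "complex \<Rightarrow> int \<Rightarrow> int \<Rightarrow> alg \<Rightarrow> alg" where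
  "spec_hom c k m f = (\<Sum>e\<in>Poly_Mapping.keys f. Poly_Mapping.single (spec_exp k m e)
     (Poly_Mapping.lookup f e * c powi Poly_Mapping.lookup e Root_tn))"

lemma spec_exp_add: "spec_exp k m (e + e') = spec_exp k m e + spec_exp k m e'"
  by (simp add: spec_exp_def lookup_add frag_cmul_distrib add_ac)

lemma spec_exp_zero: "spec_exp k m 0 = 0"
  by (simp add: spec_exp_def)

lemma spec_hom_superset:
  assumes "finite A" "Poly_Mapping.keys f \<subseteq> A"
  shows "spec_hom c k m f = (\<Sum>e\<in>A. Poly_Mapping.single (spec_exp k m e)
     (Poly_Mapping.lookup f e * c powi Poly_Mapping.lookup e Root_tn))"
  unfolding spec_hom_def using assms by (intro sum.mono_neutral_left) (auto simp: in_keys_iff)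

lemma spec_hom_add: "spec_hom c k m (f + g) = spec_hom c k m f + spec_hom c k m g"
proof -
  let ?A = "Poly_Mapping.keys f \<union> Poly_Mapping.keys g"
  have fin: "finite ?A" and sub: "Poly_Mapping.keys (f + g) \<subseteq> ?A" "Poly_Mapping.keys f \<subseteq> ?A" "Poly_Mapping.keys g \<subseteq> ?A"
    using keys_add[of f g] by auto
  show ?thesis
    unfolding spec_hom_superset[OF fin sub(1)] spec_hom_superset[OF fin sub(2)] spec_hom_superset[OF fin sub(3)]
    by (simp add: lookup_add ring_distribs single_add sum.distrib)
qed

lemma spec_hom_single:
  "spec_hom c k m (Poly_Mapping.single e d) = Poly_Mapping.single (spec_exp k m e) (d * c powi Poly_Mapping.lookup e Root_tn)"
  by (cases "d = 0") (simp_all add: spec_hom_def)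

lemma spec_hom_mult:
  assumes c: "c \<noteq> 0"
  shows "spec_hom c k m (f * g) = spec_hom c k m f * spec_hom c k m g"
proof (induction f rule: lpoly_induct)
  case (single e d)
  show ?case
  proof (induction g rule: lpoly_induct)
    case (single e' d')
    show ?case using c by (simp add: mult_single spec_hom_single spec_exp_add lookup_add power_int_add mult_ac)
  next
    case (add g h)
    then show ?case by (simp add: spec_hom_add ring_distribs)
  qed
next
  case (add f h)
  then show ?case by (simp add: spec_hom_add ring_distribs)
qed

lemma spec_hom_one: "spec_hom c k m 1 = 1"
  using spec_hom_single[of c k m 0 1] by (simp add: spec_exp_zero)

lemma spec_hom_diff: "spec_hom c k m (f - g) = spec_hom c k m f - spec_hom c k m g"
  using spec_hom_add[of c k m "f - g" g] by simp

lemma spec_hom_gen: "p \<noteq> Root_tn \<Longrightarrow> spec_hom c k m (gen p j) = gen p j"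
  by (simp add: gen_def spec_hom_single spec_exp_def lookup_single)

lemma spec_hom_gen_tn:
  "spec_hom c k m (gen Root_tn 1) = Poly_Mapping.single 0 c * (gen Root_q (- k) * gen Root_t (- m))"
proof -
  have "spec_exp k m (Poly_Mapping.single Root_tn 1) = Poly_Mapping.single Root_q (- k) + Poly_Mapping.single Root_t (- m)"
    by (rule poly_mapping_eqI) (simp add: spec_exp_def lookup_add lookup_single when_def)
  then show ?thesis by (simp add: gen_def spec_hom_single mult_single)
qed

lemma gen_power: "gen p j ^ k = gen p (int k * j)"
  by (induction k) (simp_all add: gen_zero gen_mult ring_distribs)

text \<open>The variable \<open>t_n^(1/2)\<close> minus its substitute; for nonzero \<open>c\<close>
  it generates the kernel of \<open>spec_hom\<close> (\<open>spec_hom_zero_iff\<close>).\<close>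

definition spec_prime :: "complex \<Rightarrow> int \<Rightarrow> int \<Rightarrow> alg" where
  "spec_prime c k m = gen Root_tn 1 - Poly_Mapping.single 0 c * (gen Root_q (- k) * gen Root_t (- m))"

lemma spec_hom_prime: "c \<noteq> 0 \<Longrightarrow> spec_hom c k m (spec_prime c k m) = 0"
  by (simp add: spec_prime_def spec_hom_diff spec_hom_gen_tn spec_hom_mult spec_hom_gen)
    (simp add: spec_hom_single spec_exp_zero)

text \<open>For nonnegative powers \<open>x - y\<close> divides \<open>x^a - y^a\<close>; negative
  powers are reduced to these through the inverse monomials.\<close>

lemma spec_prime_dvd_gen_diff:
  assumes c: "c \<noteq> 0"
  shows "spec_prime c k m dvd gen Root_tn j - spec_hom c k m (gen Root_tn j)"
proof -
  let ?h = "spec_hom c k m"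
  have pos: "spec_prime c k m dvd gen Root_tn (int a) - ?h (gen Root_tn (int a))" for a
  proof -
    have "?h (x ^ a) = ?h x ^ a" for x
      by (induction a) (simp_all add: spec_hom_one spec_hom_mult[OF c])
    then have "gen Root_tn (int a) - ?h (gen Root_tn (int a)) = gen Root_tn 1 ^ a - ?h (gen Root_tn 1) ^ a"
      using gen_power[of Root_tn 1 a] by (metis mult.right_neutral)
    also have "\<dots> = spec_prime c k m * (\<Sum>i<a. ?h (gen Root_tn 1) ^ (a - Suc i) * gen Root_tn 1 ^ i)"
      unfolding spec_prime_def spec_hom_gen_tn[symmetric] by (rule power_diff_sumr2)
    finally show ?thesis by simp
  qed
  show ?thesis
  proof (cases "j \<ge> 0")
    case True
    then show ?thesis using pos[of "nat j"] by simp
  next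
    case False
    define a where "a = nat (- j)"
    have j: "j = - int a" using False by (simp add: a_def)
    let ?N = "gen Root_tn (int a)" and ?M = "gen Root_tn j"
    have NM: "?N * ?M = 1" by (simp add: gen_mult gen_zero j)
    have "?h ?N * ?h ?M = 1" unfolding spec_hom_mult[OF c, symmetric] NM by (rule spec_hom_one)
    then have "?M - ?h ?M = ?M * (?h ?N * ?h ?M) - (?N * ?M) * ?h ?M" using NM by simp
    also have "\<dots> = (?N - ?h ?N) * (- (?M * ?h ?M))" by (simp add: algebra_simps)
    finally show ?thesis using pos[of a] by (metis dvd_mult2)
  qed
qed

lemma spec_prime_dvd_diff:
  assumes c: "c \<noteq> 0"
  shows "spec_prime c k m dvd f - spec_hom c k m f"
proof (induction f rule: lpoly_induct)
  case (single e d)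
  define j where "j = Poly_Mapping.lookup e Root_tn"
  define e' where "e' = e - Poly_Mapping.single Root_tn j"
  have "Poly_Mapping.single e d = Poly_Mapping.single e' d * gen Root_tn j"
    by (simp add: gen_def mult_single e'_def)
  moreover have "spec_hom c k m (Poly_Mapping.single e' d) = Poly_Mapping.single e' d"
    by (simp add: spec_hom_single e'_def spec_exp_def lookup_minus j_def)
  ultimately have "Poly_Mapping.single e d - spec_hom c k m (Poly_Mapping.single e d) =
      Poly_Mapping.single e' d * (gen Root_tn j - spec_hom c k m (gen Root_tn j))"
    by (simp add: spec_hom_mult[OF c] right_diff_distrib)
  then show ?case using spec_prime_dvd_gen_diff[OF c] by (metis dvd_mult)
next
  case (add f g)
  have "f + g - spec_hom c k m (f + g) = (f - spec_hom c k m f) + (g - spec_hom c k m g)"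
    by (simp add: spec_hom_add)
  then show ?case using add dvd_add by metis
qed

lemma spec_hom_zero_iff:
  assumes c: "c \<noteq> 0"
  shows "spec_hom c k m f = 0 \<longleftrightarrow> spec_prime c k m dvd f"
proof
  assume "spec_hom c k m f = 0"
  then show "spec_prime c k m dvd f" using spec_prime_dvd_diff[OF c, of k m f] by simp
next
  assume "spec_prime c k m dvd f"
  then show "spec_hom c k m f = 0" by (auto simp: dvd_def spec_hom_mult[OF c] spec_hom_prime[OF c])
qed

text \<open>The kernel of a homomorphism into a domain is a prime ideal.\<close>

lemma spec_prime_prime:
  assumes c: "c \<noteq> 0"
  shows "spec_prime c k m dvd f * g \<Longrightarrow> spec_prime c k m dvd f \<or> spec_prime c k m dvd g"
    and "\<not> spec_prime c k m dvd 1"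
  unfolding spec_hom_zero_iff[OF c, symmetric] by (simp_all add: spec_hom_mult[OF c] spec_hom_one)

lemma spec_prime_nonzero: "spec_prime c k m \<noteq> 0"
proof
  assume "spec_prime c k m = 0"
  then have "Poly_Mapping.lookup (gen Root_tn 1) (Poly_Mapping.single Root_tn 1) =
      Poly_Mapping.lookup (Poly_Mapping.single 0 c * (gen Root_q (- k) * gen Root_t (- m))) (Poly_Mapping.single Root_tn 1)"
    by (simp add: spec_prime_def)
  moreover have "Poly_Mapping.single Root_q (- k) + Poly_Mapping.single Root_t (- m) \<noteq> Poly_Mapping.single Root_tn 1"
    by (auto dest!: arg_cong[of _ _ "\<lambda>e. Poly_Mapping.lookup e Root_tn"] simp: lookup_add lookup_single)
  ultimately show False by (simp add: gen_def mult_single lookup_single)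
qed

text \<open>As \<open>a^* b^* = - t_n\<close>, the expression is a unit monomial times the sum of
  squares \<open>N^2 + V^2\<close>, which splits into linear factors over the complex
  numbers.\<close>

lemma special_factorization:
  "par_t ^ m * par_q ^ k * par_a_star * par_b_star - 1 =
     - (gen Root_q (2 * int k) * gen Root_t (2 * int m)) * (spec_prime \<i> (int k) (int m) * spec_prime (- \<i>) (int k) (int m))"
proof -
  define N U V where "N = gen Root_tn 1" and "U = gen Root_q (2 * int k) * gen Root_t (2 * int m)"
    and "V = gen Root_q (- int k) * gen Root_t (- int m)"
  let ?I = "Poly_Mapping.single 0 \<i> :: alg"
  have "U * (V * V) = (gen Root_q (2 * int k) * (gen Root_q (- int k) * gen Root_q (- int k))) *
      (gen Root_t (2 * int m) * (gen Root_t (- int m) * gen Root_t (- int m)))"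
    unfolding U_def V_def by (simp only: mult_ac)
  then have UV: "U * (V * V) = 1" by (simp add: gen_mult gen_zero)
  have I: "?I * ?I = - 1" by (simp add: mult_single single_uminus)
  have "par_a_star * par_b_star = - (N * N) * (gen Root_t0 1 * gen Root_t0 (- 1))"
    by (simp add: par_a_star_def par_b_star_def N_def)
  then have ab: "par_a_star * par_b_star = - (N * N)" by (simp add: gen_mult gen_zero)
  have tq: "par_t ^ m * par_q ^ k = U"
    by (simp add: par_t_def par_q_def gen_power U_def mult.commute)
  have "spec_prime \<i> (int k) (int m) * spec_prime (- \<i>) (int k) (int m) = (N - ?I * V) * (N + ?I * V)"
    by (simp add: spec_prime_def N_def V_def single_uminus)
  also have "\<dots> = N * N - (?I * ?I) * (V * V)" by (simp add: algebra_simps)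
  finally have P: "spec_prime \<i> (int k) (int m) * spec_prime (- \<i>) (int k) (int m) = N * N + V * V"
    unfolding I by simp
  have "par_t ^ m * par_q ^ k * par_a_star * par_b_star - 1 = U * (- (N * N)) - U * (V * V)"
    unfolding tq unfolding mult.assoc ab UV ..
  also have "\<dots> = - U * (N * N + V * V)" by (simp add: algebra_simps)
  finally show ?thesis unfolding P U_def .
qed

lemma irreducible_factor_associated:
  assumes s: "Factorial_Ring.irreducible s" and d: "s dvd par_t ^ m * par_q ^ k * par_a_star * par_b_star - 1"
  shows "\<exists>c. c\<^sup>2 = - 1 \<and> (\<forall>x. s dvd x \<longleftrightarrow> spec_prime c (int k) (int m) dvd x)"
proof -
  let ?p = "spec_prime \<i> (int k) (int m)" and ?q = "spec_prime (- \<i>) (int k) (int m)"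
  let ?U = "- (gen Root_q (2 * int k) * gen Root_t (2 * int m))"
  have nz: "\<i> \<noteq> 0" "- \<i> \<noteq> 0" by simp_all
  have assoc: "s dvd x \<longleftrightarrow> spec_prime c (int k) (int m) dvd x"
    if c: "c \<noteq> 0" and ps: "spec_prime c (int k) (int m) dvd s" for c x
  proof -
    obtain u where u: "s = spec_prime c (int k) (int m) * u" using ps by (auto simp: dvd_def)
    have "u dvd 1" using irreducibleD[OF s u] spec_prime_prime(2)[OF c] by blast
    then obtain w where w: "1 = u * w" by (auto simp: dvd_def)
    show ?thesis
    proof
      assume "s dvd x"
      then show "spec_prime c (int k) (int m) dvd x" using ps dvd_trans by blast
    next
      assume "spec_prime c (int k) (int m) dvd x"
      then obtain y where "x = spec_prime c (int k) (int m) * y" by (auto simp: dvd_def)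
      then have "x = spec_prime c (int k) (int m) * y * (u * w)" unfolding w[symmetric] by simp
      then have "x = s * (w * y)" unfolding u by (simp only: mult_ac)
      then show "s dvd x" by simp
    qed
  qed
  obtain a where a: "?U * (?p * ?q) = s * a" using d unfolding special_factorization by (auto simp: dvd_def)
  have "?p dvd s * a" unfolding a[symmetric] by simp
  then consider "?p dvd s" | "?p dvd a" using spec_prime_prime(1)[OF nz(1)] by blast
  then show ?thesis
  proof cases
    case 1
    then show ?thesis using assoc[OF nz(1)] by (intro exI[of _ \<i>]) simp
  next
    case 2
    then obtain b where b: "a = ?p * b" by (auto simp: dvd_def)
    note p0 = spec_prime_nonzero[of \<i> "int k" "int m"]
    have "?p * (?U * ?q) = ?p * (s * b)" using a unfolding b by (simp only: mult_ac)
    then have e: "?U * ?q = s * b" using mult_left_cancel[OF p0] by blast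
    have "?q dvd s * b" unfolding e[symmetric] by simp
    then consider "?q dvd s" | "?q dvd b" using spec_prime_prime(1)[OF nz(2)] by blast
    then show ?thesis
    proof cases
      case 1
      then show ?thesis using assoc[OF nz(2)] by (intro exI[of _ "- \<i>"]) simp
    next
      case 2
      \<comment> \<open>If both primes divide the cofactor of \<open>s\<close>, then
        \<open>s\<close> divides a unit monomial, which an irreducible element cannot do.\<close>
      then obtain g where g: "b = ?q * g" by (auto simp: dvd_def)
      note q0 = spec_prime_nonzero[of "- \<i>" "int k" "int m"]
      have "?q * ?U = ?q * (s * g)" using e unfolding g by (simp only: mult_ac)
      then have "?U = s * g" using mult_left_cancel[OF q0] by blast
      moreover have "?U dvd 1"
      proof -
        have "(gen Root_q (2 * int k) * gen Root_q (- 2 * int k)) * (gen Root_t (2 * int m) * gen Root_t (- 2 * int m)) = 1"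
          by (simp add: gen_mult gen_zero)
        then have "?U * (- (gen Root_q (- 2 * int k) * gen Root_t (- 2 * int m))) = 1" by (simp add: mult_ac)
        then show ?thesis by (metis dvd_triv_left)
      qed
      ultimately have "s dvd 1" by (metis dvd_mult_left)
      then show ?thesis using irreducible_not_unit[OF s] by blast
    qed
  qed
qed

lemma place_hom_spec_hom:
  assumes "c \<noteq> 0" "\<And>x. s dvd x \<longleftrightarrow> spec_prime c k m dvd x"
  shows "place_hom s (spec_hom c k m)"
  by unfold_locales (simp_all add: spec_hom_add spec_hom_mult spec_hom_one spec_hom_zero_iff assms)

text \<open>Every parameter is still a single term after the substitution, so the required
  inequations reduce to comparing exponents (\<open>kmon_eq_imp\<close>).\<close>

definition kmon :: "(param \<Rightarrow>\<^sub>0 int) \<Rightarrow> complex \<Rightarrow> kfield" where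
  "kmon e c = emb (Poly_Mapping.single e c)"

lemma kmon_mult: "kmon e c * kmon e' c' = kmon (e + e') (c * c')"
  by (simp add: kmon_def mult_single flip: emb_simps(4))

lemma kmon_one: "kmon 0 1 = 1"
  by (simp add: kmon_def)

lemma kmon_uminus: "- kmon e c = kmon e (- c)"
  by (simp add: kmon_def single_uminus)

lemma kmon_eq_imp: "kmon e c = kmon e' c' \<Longrightarrow> c \<noteq> 0 \<Longrightarrow> e = e'"
proof -
  assume "kmon e c = kmon e' c'" "c \<noteq> 0"
  then have "Poly_Mapping.single e c = Poly_Mapping.single e' c'" by (simp add: kmon_def)
  then have "Poly_Mapping.lookup (Poly_Mapping.single e' c') e = c" by (metis lookup_single_eq)
  then show "e = e'" using \<open>c \<noteq> 0\<close> by (auto simp: lookup_single when_def split: if_splits)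
qed

lemma kmon_power: "kmon e c ^ j = kmon (frag_cmul (int j) e) (c ^ j)"
  by (induction j) (simp_all add: kmon_one kmon_mult frag_cmul_distrib)

lemma kmon_inverse: "c \<noteq> 0 \<Longrightarrow> inverse (kmon e c) = kmon (- e) (inverse c)"
proof -
  assume "c \<noteq> 0"
  then have "kmon e c * kmon (- e) (inverse c) = 1" by (simp add: kmon_mult kmon_one)
  then show ?thesis by (rule inverse_unique)
qed

lemma kmon_powi:
  assumes "c \<noteq> 0"
  shows "kmon e c powi j = kmon (frag_cmul j e) (c powi j)"
proof -
  have "frag_cmul (- j) (- e) = frag_cmul j e" by (rule poly_mapping_eqI) simp
  then show ?thesis using assms
    by (cases "j \<ge> 0") (simp_all add: power_int_def kmon_power kmon_inverse)
qed

lemma emb_gen: "emb (gen p j) = kmon (Poly_Mapping.single p j) 1"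
  by (simp add: gen_def kmon_def)

lemma kmon_nonzero [simp]: "c \<noteq> 0 \<Longrightarrow> kmon e c \<noteq> 0"
  by (metis kmon_def emb_simps(6) lookup_single_eq lookup_zero)

lemma infinite_kfield: "infinite (UNIV :: kfield set)"
proof -
  have "inj (\<lambda>j::nat. emb (gen Root_q (int j)))"
  proof (rule injI)
    fix j l :: nat assume "emb (gen Root_q (int j)) = emb (gen Root_q (int l))"
    then have "Poly_Mapping.single Root_q (int j) = Poly_Mapping.single Root_q (int l)"
      unfolding emb_gen by (rule kmon_eq_imp) simp
    then have "Poly_Mapping.lookup (Poly_Mapping.single Root_q (int j)) Root_q = Poly_Mapping.lookup (Poly_Mapping.single Root_q (int l)) Root_q"
      by simp
    then show "j = l" by simp
  qed
  then show ?thesis using range_inj_infinite infinite_super subset_UNIV by metis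
qed

text \<open>The substitution does not touch \<open>t_0^(1/2)\<close> and \<open>u_n^(1/2)\<close>.
  Their exponents detect the power of \<open>a^*\<close>, respectively \<open>a\<close>, after which
  those of \<open>q\<close> and \<open>t\<close> can be read off; the conditions \<open>free\<close>
  are settled by the exponent of one of the two as well.\<close>

lemma koornwinder_special_spec_hom:
  assumes n: "2 \<le> n" and i: "1 \<le> i" "i \<le> n" and k: "1 \<le> k" and c: "c\<^sup>2 = - 1"
  defines "\<phi> \<equiv> spec_hom c (int k) (int (n - i))"
  shows "koornwinder_special n (emb (\<phi> (gen Root_q 1))) (emb (\<phi> (gen Root_t 1))) (emb (\<phi> (gen Root_tn 1)))
    (emb (\<phi> (gen Root_t0 1))) (emb (\<phi> (gen Root_un 1))) (emb (\<phi> (gen Root_u0 1))) i k"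
proof -
  have c0: "c \<noteq> 0" using c by auto
  define x where "x = Poly_Mapping.single Root_q (- int k) + Poly_Mapping.single Root_t (- int (n - i))"
  have p: "emb (\<phi> (gen p 1)) = kmon (Poly_Mapping.single p 1) 1" if "p \<noteq> Root_tn" for p
    unfolding \<phi>_def spec_hom_gen[OF that] by (rule emb_gen)
  have t: "emb (\<phi> (gen Root_tn 1)) = kmon x c"
    unfolding \<phi>_def spec_hom_gen_tn x_def by (simp add: kmon_def gen_def mult_single flip: emb_simps(4))
  have ne: "u \<noteq> v" if "u = kmon e d" "v = kmon e' d'" "d \<noteq> 0" "Poly_Mapping.lookup e b \<noteq> Poly_Mapping.lookup e' b" for u v e d e' d' b
    using kmon_eq_imp that by metis
  have P: "emb (\<phi> (gen Root_q 1)) = kmon (Poly_Mapping.single Root_q 1) 1" "emb (\<phi> (gen Root_t 1)) = kmon (Poly_Mapping.single Root_t 1) 1"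
    "emb (\<phi> (gen Root_t0 1)) = kmon (Poly_Mapping.single Root_t0 1) 1" "emb (\<phi> (gen Root_un 1)) = kmon (Poly_Mapping.single Root_un 1) 1"
    "emb (\<phi> (gen Root_u0 1)) = kmon (Poly_Mapping.single Root_u0 1) 1"
    by (rule p, simp)+
  interpret A: koornwinder_field n "kmon (Poly_Mapping.single Root_q 1) 1" "kmon (Poly_Mapping.single Root_t 1) 1" "kmon x c"
    "kmon (Poly_Mapping.single Root_t0 1) 1" "kmon (Poly_Mapping.single Root_un 1) 1" "kmon (Poly_Mapping.single Root_u0 1) 1"
    by unfold_locales (use n infinite_kfield c0 in auto)
  interpret B: koornwinder_field n "kmon (Poly_Mapping.single Root_q 1) 1" "kmon (Poly_Mapping.single Root_t 1) 1" "kmon x c"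
    "kmon (Poly_Mapping.single Root_un 1) 1" "kmon (Poly_Mapping.single Root_t0 1) 1" "kmon (Poly_Mapping.single Root_u0 1) 1"
    by unfold_locales (use n infinite_kfield c0 in auto)
  have A3: "A.mon3 a b d = kmon (frag_cmul (2 * a) (Poly_Mapping.single Root_q 1) + frag_cmul (2 * b) (Poly_Mapping.single Root_t 1)
      + frag_cmul d (x + Poly_Mapping.single Root_t0 1)) (c powi d)" for a b d
    unfolding A.mon3_def kmon_mult using c0 by (simp add: kmon_powi kmon_mult)
  have B3: "B.mon3 a b d = kmon (frag_cmul (2 * a) (Poly_Mapping.single Root_q 1) + frag_cmul (2 * b) (Poly_Mapping.single Root_t 1)
      + frag_cmul d (x + Poly_Mapping.single Root_un 1)) (c powi d)" for a b d
    unfolding B.mon3_def kmon_mult using c0 by (simp add: kmon_powi kmon_mult)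
  have sep: "a = 0 \<and> b = 0 \<and> d = 0"
    if e: "kmon (frag_cmul (2 * a) (Poly_Mapping.single Root_q 1) + frag_cmul (2 * b) (Poly_Mapping.single Root_t 1)
      + frag_cmul d (x + Poly_Mapping.single p 1)) (c powi d) = 1" and p: "p = Root_t0 \<or> p = Root_un" for a b d p
  proof -
    let ?e = "frag_cmul (2 * a) (Poly_Mapping.single Root_q 1) + frag_cmul (2 * b) (Poly_Mapping.single Root_t 1)
      + frag_cmul d (x + Poly_Mapping.single p 1)"
    have "kmon ?e (c powi d) = kmon 0 1" using e by (simp only: kmon_one)
    then have "?e = 0" by (rule kmon_eq_imp) (use c0 in simp)
    then have z: "Poly_Mapping.lookup ?e y = 0" for y by simp
    from z[of p] have "d = 0" using p by (auto simp: x_def lookup_add lookup_single)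
    then show ?thesis using z[of Root_q] z[of Root_t] by (simp add: lookup_add lookup_single)
  qed
  show ?thesis
    unfolding t P
  proof (intro_locales)
    show "koornwinder_sep_axioms (kmon (Poly_Mapping.single Root_q 1) 1) (kmon (Poly_Mapping.single Root_t 1) 1) (kmon x c)
        (kmon (Poly_Mapping.single Root_t0 1) 1)"
      by unfold_locales (use sep in \<open>unfold A3, blast\<close>)
    show "koornwinder_sep_axioms (kmon (Poly_Mapping.single Root_q 1) 1) (kmon (Poly_Mapping.single Root_t 1) 1) (kmon x c)
        (kmon (Poly_Mapping.single Root_un 1) 1)"
      by unfold_locales (use sep in \<open>unfold B3, blast\<close>)
    have eq: "(kmon x c)\<^sup>2 * kmon (Poly_Mapping.single Root_t 1) 1 powi (2 * int (n - i)) * kmon (Poly_Mapping.single Root_q 1) 1 powi (2 * int k) = - 1"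
    proof -
      have "frag_cmul 2 x + frag_cmul (2 * int (n - i)) (Poly_Mapping.single Root_t 1) + frag_cmul (2 * int k) (Poly_Mapping.single Root_q 1) = 0"
        by (rule poly_mapping_eqI) (simp add: x_def lookup_add lookup_single when_def)
      then show ?thesis using c by (simp add: kmon_power kmon_powi kmon_mult) (simp add: kmon_one flip: kmon_uminus)
    qed
    show "koornwinder_special_axioms n (kmon (Poly_Mapping.single Root_q 1) 1) (kmon (Poly_Mapping.single Root_t 1) 1) (kmon x c)
        (kmon (Poly_Mapping.single Root_t0 1) 1) (kmon (Poly_Mapping.single Root_un 1) 1) (kmon (Poly_Mapping.single Root_u0 1) 1) i k"
    proof
      show "1 \<le> i" "i \<le> n" "1 \<le> k" by fact+
      show "(kmon x c)\<^sup>2 * kmon (Poly_Mapping.single Root_t 1) 1 powi (2 * int (n - i)) * kmon (Poly_Mapping.single Root_q 1) 1 powi (2 * int k) = - 1"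
        by (rule eq)
      fix a b d
      have one: "1 = kmon 0 1" by (simp add: kmon_one)
      show "kmon (Poly_Mapping.single Root_q 1) 1 * A.mon3 a b d * kmon (Poly_Mapping.single Root_un 1) 1 \<noteq> - kmon (Poly_Mapping.single Root_u0 1) 1"
        unfolding A3 kmon_mult kmon_uminus by (rule ne[OF refl refl, of _ _ Root_un]) (use c0 in \<open>simp_all add: lookup_add lookup_single x_def\<close>)
      show "kmon (Poly_Mapping.single Root_q 1) 1 * A.mon3 a b d * kmon (Poly_Mapping.single Root_un 1) 1 * kmon (Poly_Mapping.single Root_u0 1) 1 \<noteq> 1"
        unfolding A3 kmon_mult one by (rule ne[OF refl refl, of _ _ Root_un]) (use c0 in \<open>simp_all add: lookup_add lookup_single x_def\<close>)
      show "B.mon3 a b d \<noteq> kmon (Poly_Mapping.single Root_q 1) 1 * kmon (Poly_Mapping.single Root_t0 1) 1 * kmon (Poly_Mapping.single Root_u0 1) 1"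
        unfolding B3 kmon_mult by (rule ne[OF refl refl, of _ _ Root_t0]) (use c0 in \<open>simp_all add: lookup_add lookup_single x_def\<close>)
      show "B.mon3 a b d * kmon (Poly_Mapping.single Root_u0 1) 1 \<noteq> - (kmon (Poly_Mapping.single Root_q 1) 1 * kmon (Poly_Mapping.single Root_t0 1) 1)"
        unfolding B3 kmon_mult kmon_uminus by (rule ne[OF refl refl, of _ _ Root_t0]) (use c0 in \<open>simp_all add: lookup_add lookup_single x_def\<close>)
    qed
  qed
qed

section \<open>The span of the specialized polynomials\<close>

lemma (in koornwinder_sep) E_inject:
  assumes "l \<in> weights n" "l' \<in> weights n" "E l = E l'"
  shows "l = l'"
proof -
  have "l' \<in> Poly_Mapping.keys (E l)" "l \<in> Poly_Mapping.keys (E l')"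
    using isE_E[OF assms(1)] isE_E[OF assms(2)] assms(3) by (simp_all add: isE_def in_keys_iff)
  then have "low n l' l" "low n l l'"
    using isE_E[OF assms(1)] isE_E[OF assms(2)] by (auto simp: isE_def)
  then show ?thesis by (rule low_antisym[symmetric])
qed

locale koornwinder_reduction =
  place_hom s \<phi> +
  kw: koornwinder_special n "emb (\<phi> (gen Root_q 1))" "emb (\<phi> (gen Root_t 1))" "emb (\<phi> (gen Root_tn 1))"
    "emb (\<phi> (gen Root_t0 1))" "emb (\<phi> (gen Root_un 1))" "emb (\<phi> (gen Root_u0 1))" ii kk
  for s \<phi> n ii kk
begin

sublocale place: koornwinder_place n "emb (gen Root_q 1)" "emb (gen Root_t 1)" "emb (gen Root_tn 1)"
    "emb (gen Root_t0 1)" "emb (gen Root_un 1)" "emb (gen Root_u0 1)"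
    "emb (\<phi> (gen Root_q 1))" "emb (\<phi> (gen Root_t 1))" "emb (\<phi> (gen Root_tn 1))"
    "emb (\<phi> (gen Root_t0 1))" "emb (\<phi> (gen Root_un 1))" "emb (\<phi> (gen Root_u0 1))" pl
proof
  show "pl 1 1" using pl_emb[of 1] by (simp add: hom_one)
qed (use kw.n2 kw.inf in \<open>simp_all add: pl_add pl_mult pl_uminus pl_inverse pl_zero_unique pl_emb\<close>)

sublocale poly: koornwinder_poly n
  by (rule koornwinder_poly.intro) (rule place.src_sep)

lemma spec_koornwinder:
  assumes "l \<in> weights n"
  shows "spec_poly s (koornwinder n l) m \<in> carrier (spec_field s)"
    "\<iota> (spec_poly s (koornwinder n l) m) = Poly_Mapping.lookup (kw.E l) m"
proof -
  have "pl (Poly_Mapping.lookup (koornwinder n l) m) (Poly_Mapping.lookup (kw.E l) m)"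
    using place.plp_E[OF assms] poly.koornwinder_eq[OF assms] by (simp add: place.plp_def)
  from pl_spec[OF this] show "spec_poly s (koornwinder n l) m \<in> carrier (spec_field s)"
    "\<iota> (spec_poly s (koornwinder n l) m) = Poly_Mapping.lookup (kw.E l) m"
    by (simp_all add: spec_poly_def)
qed

lemma spec_point:
  assumes m: "m \<in> weights n" and i: "i \<in> {1..n}"
  shows "spec s (inverse (y_star n m i)) \<in> carrier (spec_field s)"
    "\<iota> (spec s (inverse (y_star n m i))) = kw.pt m i"
proof -
  have y: "y_star n m i = emb (gen Root_q 1) powi (2 * Poly_Mapping.lookup m i) *
      emb (gen Root_t 1) powi (2 * (sgn_vec m i * int (rk n m i))) * (emb (gen Root_tn 1) * emb (gen Root_un 1)) powi sgn_vec m i"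
    using m i kw.n2 by (simp add: y_star_def rho_eq par_q_def par_t_def par_a_def emb_gen_two power_int_mult)
  have "pl (y_star n m i) (kw.dual.yv m i)"
    unfolding y kw.dual.yv_def by (intro pl_mult place.pl_powi pl_emb) (use kw.nz in simp_all)
  then have "pl (inverse (y_star n m i)) (kw.pt m i)"
    using pl_inverse[of "y_star n m i" "kw.dual.yv m i"] i by (simp add: kw.pt_def)
  from pl_spec[OF this] show "spec s (inverse (y_star n m i)) \<in> carrier (spec_field s)"
    "\<iota> (spec s (inverse (y_star n m i))) = kw.pt m i" .
qed

text \<open>Transports evaluation through the embedding \<open>\<iota>\<close>, under which
  coefficients, points and integer powers correspond.\<close>

lemma chi_star_zero_iff:
  assumes f: "\<And>m. f m \<in> carrier (spec_field s)" and h: "\<And>m. \<iota> (f m) = Poly_Mapping.lookup h m"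
    and k: "Poly_Mapping.keys h \<subseteq> weights n" and m: "m \<in> weights n"
  shows "chi_star s n m f = \<zero>\<^bsub>spec_field s\<^esub> \<longleftrightarrow> ev (kw.pt m) h = 0"
proof -
  let ?v = "\<lambda>i. spec s (inverse (y_star n m i))"
  let ?g = "\<lambda>(u :: nat \<Rightarrow>\<^sub>0 int) i. ?v i [^]\<^bsub>spec_field s\<^esub> Poly_Mapping.lookup u i"
  have g: "?g u i \<in> carrier (spec_field s)" "\<iota> (?g u i) = kw.pt m i powi Poly_Mapping.lookup u i" if "i \<in> {1..n}" for u i
    using int_pow[of "?v i" "Poly_Mapping.lookup u i"] spec_point[OF m that] kw.pt_nz[of m i] by simp_all
  have G: "(\<Otimes>\<^bsub>spec_field s\<^esub>i\<in>{1..n}. ?g u i) \<in> carrier (spec_field s)" for u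
    by (rule F.finprod_closed, rule Pi_I, rule g(1))
  have pw: "\<iota> (\<Otimes>\<^bsub>spec_field s\<^esub>i\<in>{1..n}. ?g u i) = pw (kw.pt m) u" if u: "u \<in> weights n" for u
  proof -
    have "\<iota> (\<Otimes>\<^bsub>spec_field s\<^esub>i\<in>{1..n}. ?g u i) = (\<Prod>i\<in>{1..n}. kw.pt m i powi Poly_Mapping.lookup u i)"
    proof -
      have "\<iota> (\<Otimes>\<^bsub>spec_field s\<^esub>i\<in>{1..n}. ?g u i) = (\<Prod>i\<in>{1..n}. \<iota> (?g u i))"
        by (rule \<iota>_finprod[OF finite_atLeastAtMost g(1)])
      also have "\<dots> = (\<Prod>i\<in>{1..n}. kw.pt m i powi Poly_Mapping.lookup u i)"
        by (rule prod.cong[OF refl g(2)])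
      finally show ?thesis .
    qed
    also have "\<dots> = pw (kw.pt m) u" by (rule pw_superset[symmetric]) (use u in \<open>auto simp: weights_def\<close>)
    finally show ?thesis .
  qed
  have supp: "{u. f u \<noteq> \<zero>\<^bsub>spec_field s\<^esub>} = Poly_Mapping.keys h"
    using \<iota>_zero_iff[OF f] h by (auto simp: in_keys_iff)
  have c: "f u \<otimes>\<^bsub>spec_field s\<^esub> (\<Otimes>\<^bsub>spec_field s\<^esub>i\<in>{1..n}. ?g u i) \<in> carrier (spec_field s)" for u
    by (rule F.m_closed[OF f G])
  have C: "chi_star s n m f \<in> carrier (spec_field s)"
    unfolding chi_star_def spec_eval_def by (rule F.finsum_closed) (use c in auto)
  have "\<iota> (chi_star s n m f) = (\<Sum>u\<in>Poly_Mapping.keys h. \<iota> (f u \<otimes>\<^bsub>spec_field s\<^esub> (\<Otimes>\<^bsub>spec_field s\<^esub>i\<in>{1..n}. ?g u i)))"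
    unfolding chi_star_def spec_eval_def supp by (rule \<iota>_finsum[OF finite_keys c])
  also have "\<dots> = ev (kw.pt m) h"
    unfolding ev_def
  proof (rule sum.cong)
    fix u assume "u \<in> Poly_Mapping.keys h"
    then have "u \<in> weights n" using k by blast
    then show "\<iota> (f u \<otimes>\<^bsub>spec_field s\<^esub> (\<Otimes>\<^bsub>spec_field s\<^esub>i\<in>{1..n}. ?g u i)) = Poly_Mapping.lookup h u * pw (kw.pt m) u"
      using \<iota>_mult[OF f G] pw h by simp
  qed simp
  finally show ?thesis using \<iota>_zero_iff[OF C] by simp
qed

lemma keys_lcomb: "A \<subseteq> weights n \<Longrightarrow> Poly_Mapping.keys (kw.lcomb kw.E A c) \<subseteq> weights n"
proof
  fix u assume A: "A \<subseteq> weights n" and "u \<in> Poly_Mapping.keys (kw.lcomb kw.E A c)"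
  then have "(\<Sum>l\<in>A. c l * Poly_Mapping.lookup (kw.E l) u) \<noteq> 0"
    by (simp add: kw.lcomb_def in_keys_iff lookup_sum)
  then obtain l where "l \<in> A" "c l * Poly_Mapping.lookup (kw.E l) u \<noteq> 0"
    by (rule sum.not_neutral_contains_not_neutral)
  then have "l \<in> A" "u \<in> Poly_Mapping.keys (kw.E l)" by (auto simp: in_keys_iff)
  then show "u \<in> weights n" using kw.keys_E A by blast
qed

text \<open>The closure conditions that \<open>triangular_expand\<close> demands of
  \<open>L\<close>.\<close>

lemma \<iota>_image_ring:
  "0 \<in> \<iota> ` carrier (spec_field s)" "1 \<in> \<iota> ` carrier (spec_field s)"
  "a \<in> \<iota> ` carrier (spec_field s) \<Longrightarrow> b \<in> \<iota> ` carrier (spec_field s) \<Longrightarrow> a + b \<in> \<iota> ` carrier (spec_field s)"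
  "a \<in> \<iota> ` carrier (spec_field s) \<Longrightarrow> b \<in> \<iota> ` carrier (spec_field s) \<Longrightarrow> a * b \<in> \<iota> ` carrier (spec_field s)"
  "a \<in> \<iota> ` carrier (spec_field s) \<Longrightarrow> - a \<in> \<iota> ` carrier (spec_field s)"
proof -
  show "0 \<in> \<iota> ` carrier (spec_field s)" using \<iota>_zero F.zero_closed by (metis imageI)
  show "1 \<in> \<iota> ` carrier (spec_field s)" using \<iota>_one F.one_closed by (metis imageI)
  show "a \<in> \<iota> ` carrier (spec_field s) \<Longrightarrow> b \<in> \<iota> ` carrier (spec_field s) \<Longrightarrow> a + b \<in> \<iota> ` carrier (spec_field s)"
    using \<iota>_add F.a_closed by (elim imageE) (metis imageI)
  show "a \<in> \<iota> ` carrier (spec_field s) \<Longrightarrow> b \<in> \<iota> ` carrier (spec_field s) \<Longrightarrow> a * b \<in> \<iota> ` carrier (spec_field s)"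
    using \<iota>_mult F.m_closed by (elim imageE) (metis imageI)
  show "a \<in> \<iota> ` carrier (spec_field s) \<Longrightarrow> - a \<in> \<iota> ` carrier (spec_field s)"
  proof (elim imageE)
    fix x assume a: "a = \<iota> x" and x: "x \<in> carrier (spec_field s)"
    have "\<iota> x + \<iota> (\<ominus>\<^bsub>spec_field s\<^esub> x) = 0"
      using \<iota>_add[of x "\<ominus>\<^bsub>spec_field s\<^esub> x"] x \<iota>_zero by (simp add: F.r_neg)
    then have "- a = \<iota> (\<ominus>\<^bsub>spec_field s\<^esub> x)" unfolding a by (simp add: add_eq_0_iff)
    then show "- a \<in> \<iota> ` carrier (spec_field s)" using x by (auto intro!: imageI)
  qed
qed

definition Ls :: "(nat \<Rightarrow>\<^sub>0 int) \<Rightarrow> (nat \<Rightarrow>\<^sub>0 int) \<Rightarrow> sfield" where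
  "Ls l = spec_poly s (koornwinder n l)"

lemma Ls_inject: "inj_on Ls (weights n)"
proof (rule inj_onI)
  fix l l' assume l: "l \<in> weights n" "l' \<in> weights n" and e: "Ls l = Ls l'"
  have "kw.E l = kw.E l'"
    by (rule poly_mapping_eqI) (metis e Ls_def spec_koornwinder(2) l)
  then show "l = l'" by (rule kw.E_inject[OF l])
qed

lemma \<iota>_combination:
  assumes A: "finite A" "A \<subseteq> weights n" and c: "\<And>l. l \<in> A \<Longrightarrow> c (Ls l) \<in> carrier (spec_field s)"
  shows "(\<Oplus>\<^bsub>spec_field s\<^esub>b\<in>Ls ` A. c b \<otimes>\<^bsub>spec_field s\<^esub> b m) \<in> carrier (spec_field s)"
    "\<iota> (\<Oplus>\<^bsub>spec_field s\<^esub>b\<in>Ls ` A. c b \<otimes>\<^bsub>spec_field s\<^esub> b m) =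
      Poly_Mapping.lookup (kw.lcomb kw.E A (\<lambda>l. \<iota> (c (Ls l)))) m"
proof -
  have K: "Ls l m \<in> carrier (spec_field s)" "\<iota> (Ls l m) = Poly_Mapping.lookup (kw.E l) m" if "l \<in> A" for l
    unfolding Ls_def using spec_koornwinder A(2) that by blast+
  have t: "c b \<otimes>\<^bsub>spec_field s\<^esub> b m \<in> carrier (spec_field s)" if "b \<in> Ls ` A" for b
    using that K c by auto
  show "(\<Oplus>\<^bsub>spec_field s\<^esub>b\<in>Ls ` A. c b \<otimes>\<^bsub>spec_field s\<^esub> b m) \<in> carrier (spec_field s)"
    by (rule F.finsum_closed) (use t in auto)
  have "\<iota> (\<Oplus>\<^bsub>spec_field s\<^esub>b\<in>Ls ` A. c b \<otimes>\<^bsub>spec_field s\<^esub> b m) = (\<Sum>b\<in>Ls ` A. \<iota> (c b \<otimes>\<^bsub>spec_field s\<^esub> b m))"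
    by (rule \<iota>_finsum) (use A(1) t in auto)
  also have "\<dots> = (\<Sum>l\<in>A. \<iota> (c (Ls l) \<otimes>\<^bsub>spec_field s\<^esub> Ls l m))"
    by (subst sum.reindex[OF inj_on_subset[OF Ls_inject A(2)]]) simp
  also have "\<dots> = (\<Sum>l\<in>A. \<iota> (c (Ls l)) * Poly_Mapping.lookup (kw.E l) m)"
    by (rule sum.cong) (simp_all add: \<iota>_mult c K)
  finally show "\<iota> (\<Oplus>\<^bsub>spec_field s\<^esub>b\<in>Ls ` A. c b \<otimes>\<^bsub>spec_field s\<^esub> b m) =
      Poly_Mapping.lookup (kw.lcomb kw.E A (\<lambda>l. \<iota> (c (Ls l)))) m"
    by (simp add: kw.lcomb_def lookup_sum)
qed

theorem spec_span_eq:
  assumes S: "S \<subseteq> weights n" "\<And>l. l \<in> weights n \<Longrightarrow> l \<in> S \<longleftrightarrow> kw.inS l"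
  shows "spec_span s {spec_poly s (koornwinder n l) | l. l \<in> S} =
    {f \<in> spec_laurent_polys s n. \<forall>m \<in> weights n - S. chi_star s n m f = \<zero>\<^bsub>spec_field s\<^esub>}"
proof (intro equalityI subsetI)
  fix f assume "f \<in> spec_span s {spec_poly s (koornwinder n l) | l. l \<in> S}"
  then obtain B c where B: "finite B" "B \<subseteq> Ls ` S" "c \<in> B \<rightarrow> carrier (spec_field s)"
    and f: "f = (\<lambda>m. \<Oplus>\<^bsub>spec_field s\<^esub>b\<in>B. c b \<otimes>\<^bsub>spec_field s\<^esub> b m)"
    unfolding spec_span_def Ls_def by blast
  obtain A where A: "finite A" "A \<subseteq> S" "B = Ls ` A"
    using finite_subset_image[OF B(1,2)] by blast
  have AW: "A \<subseteq> weights n" using A(2) S(1) by blast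
  have c: "c (Ls l) \<in> carrier (spec_field s)" if "l \<in> A" for l using B(3) A(3) that by blast
  let ?h = "kw.lcomb kw.E A (\<lambda>l. \<iota> (c (Ls l)))"
  have fm: "f m \<in> carrier (spec_field s)" "\<iota> (f m) = Poly_Mapping.lookup ?h m" for m
    unfolding f A(3) using \<iota>_combination[where c = c, OF A(1) AW c, of m] by blast+
  have supp: "{m. f m \<noteq> \<zero>\<^bsub>spec_field s\<^esub>} = Poly_Mapping.keys ?h"
    using \<iota>_zero_iff[OF fm(1)] fm(2) by (auto simp: in_keys_iff)
  have kh: "Poly_Mapping.keys ?h \<subseteq> weights n" by (rule keys_lcomb[OF AW])
  have "\<forall>l\<in>A. \<not> kw.inS l \<longrightarrow> \<iota> (c (Ls l)) = 0" using A(2) S(2) AW by blast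
  then have "\<forall>m\<in>weights n. \<not> kw.inS m \<longrightarrow> ev (kw.pt m) ?h = 0"
    unfolding kw.lcomb_vanishes_iff[OF A(1) AW] .
  then have "chi_star s n m f = \<zero>\<^bsub>spec_field s\<^esub>" if "m \<in> weights n - S" for m
    using chi_star_zero_iff[OF fm kh, of m] that S(2) by blast
  moreover have "f \<in> spec_laurent_polys s n"
    using fm(1) kh by (simp add: spec_laurent_polys_def supp)
  ultimately show "f \<in> {f \<in> spec_laurent_polys s n. \<forall>m \<in> weights n - S. chi_star s n m f = \<zero>\<^bsub>spec_field s\<^esub>}"
    by blast
next
  fix f assume "f \<in> {f \<in> spec_laurent_polys s n. \<forall>m \<in> weights n - S. chi_star s n m f = \<zero>\<^bsub>spec_field s\<^esub>}"
  then have f: "\<And>m. f m \<in> carrier (spec_field s)" "finite {m. f m \<noteq> \<zero>\<^bsub>spec_field s\<^esub>}"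
      "{m. f m \<noteq> \<zero>\<^bsub>spec_field s\<^esub>} \<subseteq> weights n"
    and z: "\<And>m. m \<in> weights n - S \<Longrightarrow> chi_star s n m f = \<zero>\<^bsub>spec_field s\<^esub>"
    by (auto simp: spec_laurent_polys_def)
  have supp: "{m. \<iota> (f m) \<noteq> 0} = {m. f m \<noteq> \<zero>\<^bsub>spec_field s\<^esub>}" using \<iota>_zero_iff[OF f(1)] by auto
  define h where "h = Abs_poly_mapping (\<lambda>m. \<iota> (f m))"
  have h: "Poly_Mapping.lookup h m = \<iota> (f m)" for m
    unfolding h_def using f(2) supp by (subst lookup_Abs_poly_mapping) simp_all
  have kh: "Poly_Mapping.keys h \<subseteq> weights n" 
  proof
    fix m assume "m \<in> Poly_Mapping.keys h"
    then have "f m \<noteq> \<zero>\<^bsub>spec_field s\<^esub>" using \<iota>_zero_iff[OF f(1)] by (simp add: in_keys_iff h)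
    then show "m \<in> weights n" using f(3) by blast
  qed
  \<comment> \<open>Keeping the coefficients of the expansion in the image of the residue field is
    what allows them to be pulled back to it.\<close>
  let ?L = "\<iota> ` carrier (spec_field s)"
  have "\<exists>A c. finite A \<and> A \<subseteq> weights n \<and> (\<forall>l. c l \<in> ?L) \<and> h = kw.lcomb kw.E A c"
    by (rule kw.triangular_expand[OF kw.triangular_E kh \<iota>_image_ring(1) \<iota>_image_ring(3,4,5,2)])
      (use f(1) in \<open>auto simp: h simp flip: spec_koornwinder(2) intro!: imageI spec_koornwinder(1)\<close>)
  then obtain A c where A: "finite A" "A \<subseteq> weights n" "\<And>l. c l \<in> ?L" "h = kw.lcomb kw.E A c" by metis
  have "ev (kw.pt m) h = 0" if "m \<in> weights n" "\<not> kw.inS m" for m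
    using chi_star_zero_iff[OF f(1) h[symmetric] kh that(1)] z[of m] that S(2) by blast
  then have c0: "\<forall>l\<in>A. \<not> kw.inS l \<longrightarrow> c l = 0"
    unfolding A(4) using kw.lcomb_vanishes_iff[OF A(1,2)] by blast
  define B where "B = A \<inter> S"
  have B: "finite B" "B \<subseteq> weights n" "B \<subseteq> S" "B \<subseteq> A" using A by (auto simp: B_def)
  have hB: "h = kw.lcomb kw.E B c"
    unfolding A(4) by (rule kw.lcomb_superset[OF A(1) B(4)]) (use c0 S(2) A(2) in \<open>auto simp: B_def\<close>)
  \<comment> \<open>\<open>spec_span\<close> indexes coefficients by basis functions rather than by
    weights, so \<open>Ls\<close> is inverted first, and then the coefficient is pulled back along
    \<open>\<iota>\<close>.\<close>
  define d where "d b = inv_into (carrier (spec_field s)) \<iota> (c (inv_into B Ls b))" for b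
  have inj: "inj_on Ls B" by (rule inj_on_subset[OF Ls_inject B(2)])
  have d: "d (Ls l) \<in> carrier (spec_field s)" "\<iota> (d (Ls l)) = c l" if "l \<in> B" for l
    unfolding d_def inv_into_f_f[OF inj that] using inv_into_into[OF A(3)] f_inv_into_f[OF A(3)] by blast+
  have hd: "kw.lcomb kw.E B (\<lambda>l. \<iota> (d (Ls l))) = h"
    unfolding hB kw.lcomb_def by (rule sum.cong) (simp_all add: d)
  have "f = (\<lambda>m. \<Oplus>\<^bsub>spec_field s\<^esub>b\<in>Ls ` B. d b \<otimes>\<^bsub>spec_field s\<^esub> b m)"
  proof
    fix m
    have "(\<Oplus>\<^bsub>spec_field s\<^esub>b\<in>Ls ` B. d b \<otimes>\<^bsub>spec_field s\<^esub> b m) \<in> carrier (spec_field s)"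
      "\<iota> (\<Oplus>\<^bsub>spec_field s\<^esub>b\<in>Ls ` B. d b \<otimes>\<^bsub>spec_field s\<^esub> b m) = \<iota> (f m)"
      using \<iota>_combination[OF B(1,2), of d m] d(1) hd h by simp_all
    then show "f m = (\<Oplus>\<^bsub>spec_field s\<^esub>b\<in>Ls ` B. d b \<otimes>\<^bsub>spec_field s\<^esub> b m)"
      using \<iota>_inject[OF f(1), of "\<Oplus>\<^bsub>spec_field s\<^esub>b\<in>Ls ` B. d b \<otimes>\<^bsub>spec_field s\<^esub> b m" m] by simp
  qed
  moreover have "Ls ` B \<subseteq> {spec_poly s (koornwinder n l) | l. l \<in> S}"
    using B(3) unfolding Ls_def[abs_def] by blast
  moreover have "d \<in> Ls ` B \<rightarrow> carrier (spec_field s)"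
    using d(1) by (intro Pi_I) (elim imageE, simp)
  ultimately show "f \<in> spec_span s {spec_poly s (koornwinder n l) | l. l \<in> S}"
    unfolding spec_span_def
    by (intro CollectI exI[of _ "Ls ` B"] exI[of _ d] conjI) (simp_all add: B(1))
qed

end

theorem proposition4p38:
  fixes n i r :: nat and s :: alg
  assumes "n \<ge> 2" and "n \<ge> i" and "i \<ge> 1" and "r - 1 \<ge> 1"
    and "Factorial_Ring.irreducible s"
    and "s dvd par_t ^ (n - i) * par_q ^ (r - 1) * par_a_star * par_b_star - 1"
  shows "spec_span s {spec_poly s (koornwinder n l) | l. l \<in> index_set n i r} =
    {f \<in> spec_laurent_polys s n.
       \<forall>m \<in> weights n - index_set n i r. chi_star s n m f = \<zero>\<^bsub>spec_field s\<^esub>}"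
proof -
  obtain c where c: "c\<^sup>2 = - 1" "\<And>x. s dvd x \<longleftrightarrow> spec_prime c (int (r - 1)) (int (n - i)) dvd x"
    using irreducible_factor_associated[OF assms(5,6)] by blast
  have "c \<noteq> 0" using c(1) by auto
  interpret koornwinder_reduction s "spec_hom c (int (r - 1)) (int (n - i))" n i "r - 1"
    using place_hom_spec_hom[OF \<open>c \<noteq> 0\<close> c(2)] koornwinder_special_spec_hom[OF assms(1,3,2,4) c(1)]
    by (rule koornwinder_reduction.intro)
  show ?thesis
  proof (rule spec_span_eq)
    show "index_set n i r \<subseteq> weights n" by (auto simp: index_set_def)
    show "l \<in> index_set n i r \<longleftrightarrow> kw.inS l" if "l \<in> weights n" for l
      unfolding kw.inS_def kw.cB_def using index_set_iff[of n i l r] that assms(1-3) by simp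
  qed
qed

end
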